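(* Let $\Sigma$ be a fan in $N_{\mathbb R}\times\mathbb R_{\ge0}$ and let $\mathcal E$ be a toric vector bundle over the toric scheme $\mathfrak X_\Sigma$, with $E=\mathcal E_{x_0}$ and corresponding graded piecewise linear map $\Phi_{\mathcal E}:|\Sigma|\to\widetilde{\mathfrak B}(E)$. Then $\mathcal E$ splits equivariantly (i.e. is equivariantly isomorphic to a direct sum of toric line bundles) if and only if the image of $\Phi_{\mathcal E}$ lies in one extended apartment of $\widetilde{\mathfrak B}(E)$. Moreover, if $\Sigma$ is complete (and hence $\mathfrak X_\Sigma$ is proper over $\operatorname{Spec}(\mathcal O)$), this is equivalent to the image of the piecewise affine map $\Phi_{\mathcal E,1}:|\Sigma_1|\to\widetilde{\mathfrak B}_{\rm aff}(E)$ lying in one extended apartment of $\widetilde{\mathfrak B}_{\rm aff}(E)$.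
   Context: **Toric schemes.** $K$ is a field with a discrete valuation $\operatorname{val}:K\to\mathbb Z\cup\{\infty\}$, valuation ring $\mathcal O$, and uniformizer $\varpi$ with $\operatorname{val}(\varpi)=1$. $T\cong\mathbb G_m^n$ is a split torus over $\mathcal O$ with character lattice $M$ and cocharacter lattice $N$; $\chi^u$ is the character of $u\in M$; $T_\eta$ is the generic fiber of $T$, so $K[T_\eta]=K[M]$. A fan $\Sigma$ in $N_{\mathbb R}\times\mathbb R_{\ge0}$ is a finite fan of strictly convex polyhedral cones, rational with respect to $N\times\mathbb Z$, contained in $N_{\mathbb R}\times\mathbb R_{\ge0}$; $|\Sigma|$ is its support, and $\Sigma$ is complete if $|\Sigma|=N_{\mathbb R}\times\mathbb R_{\ge0}$. For $\sigma\in\Sigma$ put $R_\sigma=\mathcal O[\chi^u\varpi^k\mid (u,k)\in\sigma^\vee\cap(M\times\mathbb Z)]\subset K[T_\eta]$ and $\mathfrak U_\sigma=\operatorname{Spec}R_\sigma$. The toric scheme $\mathfrak X_\Sigma$ is obtained by gluing the $\mathfrak U_\sigma$; $T$ acts on it, $\mathfrak U_{\{0\}}=T_\eta$ is open in it, and $x_0$ denotes the identity point of $T_\eta$. $\Sigma_1$ is the polyhedral complex of all nonempty $\sigma\cap(N_{\mathbb R}\times\{1\})$, $\sigma\in\Sigma$, with support $|\Sigma_1|$. **Toric vector bundles.** A toric vector bundle on $\mathfrak X_\Sigma$ is a $T$-linearized vector bundle of constant finite rank; a toric line bundle is one of rank $1$. **Additive norms and the total building.** Let $E$ be a finite dimensional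 $K$-vector space. For real $m\ge0$, a level $m$ additive norm on $E$ is a function $v:E\to\mathbb R\cup\{\infty\}$ with $v(\lambda e)=m\operatorname{val}(\lambda)+v(e)$ for $0\ne\lambda\in K$, $v(e_1+e_2)\ge\min\{v(e_1),v(e_2)\}$, and $v(e)=\infty$ iff $e=0$. $\widetilde{\mathfrak B}_m(E)$ is the set of these, $\widetilde{\mathfrak B}_{\rm aff}(E)=\widetilde{\mathfrak B}_1(E)$ and $\widetilde{\mathfrak B}(E)=\bigsqcup_{m\ge0}\widetilde{\mathfrak B}_m(E)$. For a basis $B=\{b_1,\dots,b_r\}$ of $E$, $\widetilde A_m(B)$ is the set of level $m$ additive norms $v$ with $v(\sum\lambda_ib_i)=\min_i v(\lambda_ib_i)$. The extended apartments of $\widetilde{\mathfrak B}(E)$ are the sets $\widetilde A(B)=\bigsqcup_{m\ge0}\widetilde A_m(B)$, and those of $\widetilde{\mathfrak B}_{\rm aff}(E)$ are the sets $\widetilde A_{\rm aff}(B)=\widetilde A_1(B)$, for bases $B$ of $E$. **The maps $\Phi_{\mathcal E}$ and $\Phi_{\mathcal E,1}$.** Let $E=\mathcal E_{x_0}$. Identify $H^0(T_\eta,\mathcal E)$ with $K[M]\otimes_KE$, where $e\in E$ corresponds to the $T_\eta$-invariant section with value $e$ at $x_0$. For $\sigma\in\Sigma$, restriction embeds $H^0(\mathfrak U_\sigma,\mathcal E)$ into $K[M]\otimes_KE$ as an $M$-graded $R_\sigma$-submodule, and it has the form $\bigoplus_{i=1}^rR_\sigma\,\chi^{-u_{\sigma,i}}b_{\sigma,i}$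 for some $u_{\sigma,i}\in M$ and a $K$-basis $\{b_{\sigma,i}\}$ of $E$. For $(x,m)\in\sigma$, $\Phi_{\mathcal E}(x,m)$ is the level $m$ additive norm with $\Phi_{\mathcal E}(x,m)(\sum_i\lambda_ib_{\sigma,i})=\min\{m\operatorname{val}(\lambda_i)+\langle u_{\sigma,i},x\rangle\mid\lambda_i\ne0\}$ (this does not depend on the choices). $\Phi_{\mathcal E,1}$ is the restriction of $\Phi_{\mathcal E}$ to $|\Sigma_1|$. *)

theory Defs
  imports
    "HOL-Analysis.Analysis"
    "HOL-Library.Poly_Mapping"
    "HOL-Library.FuncSet"
    "HOL-Algebra.Module"
    "HOL-Algebra.Ideal"
begin

section \<open>Total ring of fractions\<close>

text \<open>
  The library type \<open>fract\<close> needs an \<^class>\<open>idom\<close> instance, which is not available for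
  \<open>(int ^ 'n) \<Rightarrow>\<^sub>0 'k\<close> because \<open>int ^ 'n\<close> carries no linear order. For an integral domain such
  as \<open>K[M]\<close> the total ring of fractions below is the field of fractions.
\<close>

definition nonzerodivisor :: "'a::comm_ring_1 \<Rightarrow> bool" where
  "nonzerodivisor b \<longleftrightarrow> (\<forall>c. b * c = 0 \<longrightarrow> c = 0)"

lemma nonzerodivisor_one: "nonzerodivisor 1"
  by (simp add: nonzerodivisor_def)

lemma nonzerodivisor_mult: "nonzerodivisor a \<Longrightarrow> nonzerodivisor b \<Longrightarrow> nonzerodivisor (a * b)"
  unfolding nonzerodivisor_def mult.assoc by blast

lemma nonzerodivisor_cancel:
  assumes "nonzerodivisor b" "b * x = b * y"
  shows "x = y"
proof -
  have "b * (x - y) = 0" using assms(2) by (simp add: right_diff_distrib)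
  then have "x - y = 0" using assms(1) unfolding nonzerodivisor_def by blast
  then show ?thesis by simp
qed

definition frac_rel :: "'a::comm_ring_1 \<times> 'a \<Rightarrow> 'a \<times> 'a \<Rightarrow> bool" where
  "frac_rel p q \<longleftrightarrow> nonzerodivisor (snd p) \<and> nonzerodivisor (snd q) \<and> fst p * snd q = fst q * snd p"

lemma frac_relI:
  "nonzerodivisor b \<Longrightarrow> nonzerodivisor d \<Longrightarrow> a * d = c * b \<Longrightarrow> frac_rel (a, b) (c, d)"
  by (simp add: frac_rel_def)

lemma frac_rel_trans:
  assumes "frac_rel p q" "frac_rel q s"
  shows "frac_rel p s"
proof -
  have 1: "fst p * snd q = fst q * snd p" "fst q * snd s = fst s * snd q"
    using assms unfolding frac_rel_def by blast+
  have "snd q * (fst p * snd s) = fst p * snd q * snd s" by (simp add: ac_simps)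
  also have "\<dots> = fst q * snd s * snd p" unfolding 1(1) by (simp add: ac_simps)
  also have "\<dots> = snd q * (fst s * snd p)" unfolding 1(2) by (simp add: ac_simps)
  finally show ?thesis
    using assms nonzerodivisor_cancel unfolding frac_rel_def by blast
qed

quotient_type (overloaded) 'a total_frac = "'a::comm_ring_1 \<times> 'a" / partial: frac_rel
proof (rule part_equivpI)
  show "\<exists>x::'a \<times> 'a. frac_rel x x"
    by (rule exI[of _ "(0, 1)"]) (simp add: frac_rel_def nonzerodivisor_one)
  show "symp (frac_rel :: 'a \<times> 'a \<Rightarrow> _)"
    by (auto simp: symp_def frac_rel_def)
  show "transp (frac_rel :: 'a \<times> 'a \<Rightarrow> _)"
    using frac_rel_trans by (auto simp: transp_def)
qed

text \<open>\<open>Frac a b\<close> is the fraction \<open>a / b\<close>; it is meaningful only if \<open>b\<close> is not a zero divisor.\<close>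

lift_definition Frac :: "'a::comm_ring_1 \<Rightarrow> 'a \<Rightarrow> 'a total_frac" is
  "\<lambda>a b. if nonzerodivisor b then (a, b) else (0, 1)"
  by (simp add: frac_rel_def nonzerodivisor_one)

instantiation total_frac :: (comm_ring_1) comm_ring_1
begin

lift_definition zero_total_frac :: "'a total_frac" is "(0, 1)"
  by (simp add: frac_rel_def nonzerodivisor_one)

lift_definition one_total_frac :: "'a total_frac" is "(1, 1)"
  by (simp add: frac_rel_def nonzerodivisor_one)

lift_definition plus_total_frac :: "'a total_frac \<Rightarrow> 'a total_frac \<Rightarrow> 'a total_frac" is
  "\<lambda>p q. (fst p * snd q + fst q * snd p, snd p * snd q)"
proof -
  fix p p' q q' :: "'a \<times> 'a"
  assume a: "frac_rel p p'" "frac_rel q q'"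
  have 1: "fst p * snd p' = fst p' * snd p" "fst q * snd q' = fst q' * snd q"
    using a unfolding frac_rel_def by blast+
  have n: "nonzerodivisor (snd p)" "nonzerodivisor (snd p')" "nonzerodivisor (snd q)" "nonzerodivisor (snd q')"
    using a unfolding frac_rel_def by blast+
  have "(fst p * snd q + fst q * snd p) * (snd p' * snd q')
      = (fst p * snd p') * (snd q * snd q') + (fst q * snd q') * (snd p * snd p')"
    by (simp add: algebra_simps)
  also have "\<dots> = (fst p' * snd q' + fst q' * snd p') * (snd p * snd q)"
    unfolding 1 by (simp add: algebra_simps)
  finally show "frac_rel (fst p * snd q + fst q * snd p, snd p * snd q)
       (fst p' * snd q' + fst q' * snd p', snd p' * snd q')"
    by (rule frac_relI[OF nonzerodivisor_mult[OF n(1,3)] nonzerodivisor_mult[OF n(2,4)]])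
qed

lift_definition uminus_total_frac :: "'a total_frac \<Rightarrow> 'a total_frac" is
  "\<lambda>p. (- fst p, snd p)"
  unfolding frac_rel_def fst_conv snd_conv mult_minus_left by simp

lift_definition times_total_frac :: "'a total_frac \<Rightarrow> 'a total_frac \<Rightarrow> 'a total_frac" is
  "\<lambda>p q. (fst p * fst q, snd p * snd q)"
proof -
  fix p p' q q' :: "'a \<times> 'a"
  assume a: "frac_rel p p'" "frac_rel q q'"
  have 1: "fst p * snd p' = fst p' * snd p" "fst q * snd q' = fst q' * snd q"
    using a unfolding frac_rel_def by blast+
  have n: "nonzerodivisor (snd p)" "nonzerodivisor (snd p')" "nonzerodivisor (snd q)" "nonzerodivisor (snd q')"
    using a unfolding frac_rel_def by blast+
  have "fst p * fst q * (snd p' * snd q') = (fst p * snd p') * (fst q * snd q')"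
    by (simp add: ac_simps)
  also have "\<dots> = fst p' * fst q' * (snd p * snd q)"
    unfolding 1 by (simp add: ac_simps)
  finally show "frac_rel (fst p * fst q, snd p * snd q) (fst p' * fst q', snd p' * snd q')"
    by (rule frac_relI[OF nonzerodivisor_mult[OF n(1,3)] nonzerodivisor_mult[OF n(2,4)]])
qed

definition minus_total_frac :: "'a total_frac \<Rightarrow> 'a total_frac \<Rightarrow> 'a total_frac" where
  "minus_total_frac x y = x + - y"

instance
proof
  fix a b c :: "'a total_frac"
  show "a * b * c = a * (b * c)"
    by transfer (simp add: frac_rel_def nonzerodivisor_mult algebra_simps)
  show "a * b = b * a"
    by transfer (simp add: frac_rel_def nonzerodivisor_mult algebra_simps)
  show "1 * a = a"
    by transfer (simp add: frac_rel_def nonzerodivisor_mult algebra_simps)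
  show "a + b + c = a + (b + c)"
    by transfer (simp add: frac_rel_def nonzerodivisor_mult algebra_simps)
  show "a + b = b + a"
    by transfer (simp add: frac_rel_def nonzerodivisor_mult algebra_simps)
  show "0 + a = a"
    by transfer (simp add: frac_rel_def nonzerodivisor_mult algebra_simps)
  show "- a + a = 0"
    by transfer (simp add: frac_rel_def nonzerodivisor_mult nonzerodivisor_one algebra_simps)
  show "a - b = a + - b"
    by (simp add: minus_total_frac_def)
  show "(a + b) * c = a * c + b * c"
    by transfer (simp add: frac_rel_def nonzerodivisor_mult algebra_simps)
  show "(0::'a total_frac) \<noteq> 1"
    by transfer (simp add: frac_rel_def)
qed

end

section \<open>Valuations and fans\<close>

definition discrete_valuation :: "('k::field \<Rightarrow> ereal) \<Rightarrow> bool" where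
  "discrete_valuation val \<longleftrightarrow>
     (\<forall>a. val a = \<infinity> \<longleftrightarrow> a = 0) \<and>
     (\<forall>a. a \<noteq> 0 \<longrightarrow> (\<exists>k::int. val a = ereal (of_int k))) \<and>
     (\<forall>a b. val (a * b) = val a + val b) \<and>
     (\<forall>a b. min (val a) (val b) \<le> val (a + b))"

text \<open>
  \<open>M\<close> is the type \<open>int ^ 'n\<close>, \<open>N\<^sub>\<real>\<close> is \<open>real ^ 'n\<close>, and \<open>N\<close> is the lattice of integral vectors in it.
\<close>

type_synonym 'n cone = "((real ^ 'n) \<times> real) set"
type_synonym ('n, 'k) laurent = "(int ^ 'n) \<Rightarrow>\<^sub>0 'k"

definition pairing :: "int ^ 'n::finite \<Rightarrow> real ^ 'n \<Rightarrow> real" where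
  "pairing u x = (\<Sum>i\<in>UNIV. of_int (u $ i) * x $ i)"

definition integral_points :: "((real ^ 'n::finite) \<times> real) set" where
  "integral_points = {(x, m). (\<forall>i. x $ i \<in> \<int>) \<and> m \<in> \<int>}"

definition rational_polyhedral_cone :: "'n::finite cone \<Rightarrow> bool" where
  "rational_polyhedral_cone \<sigma> \<longleftrightarrow>
     (\<exists>G. finite G \<and> G \<subseteq> integral_points \<and> \<sigma> = convex_cone hull G)"

definition strictly_convex :: "'n::finite cone \<Rightarrow> bool" where
  "strictly_convex \<sigma> \<longleftrightarrow> (\<forall>z. z \<in> \<sigma> \<and> - z \<in> \<sigma> \<longrightarrow> z = 0)"

definition half_space :: "((real ^ 'n::finite) \<times> real) set" where
  "half_space = {(x, m). 0 \<le> m}"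

text \<open>
  For a polyhedral cone, the nonempty faces in the sense of \<^const>\<open>face_of\<close> are exactly the
  subsets cut out by the supporting hyperplanes through the origin.
\<close>

definition fan :: "'n::finite cone set \<Rightarrow> bool" where
  "fan \<Sigma> \<longleftrightarrow> finite \<Sigma> \<and> \<Sigma> \<noteq> {} \<and>
     (\<forall>\<sigma>\<in>\<Sigma>. rational_polyhedral_cone \<sigma> \<and> strictly_convex \<sigma> \<and> \<sigma> \<subseteq> half_space) \<and>
     (\<forall>\<sigma>\<in>\<Sigma>. \<forall>\<tau>. \<tau> face_of \<sigma> \<and> \<tau> \<noteq> {} \<longrightarrow> \<tau> \<in> \<Sigma>) \<and>
     (\<forall>\<sigma>\<in>\<Sigma>. \<forall>\<tau>\<in>\<Sigma>. (\<sigma> \<inter> \<tau>) face_of \<sigma> \<and> (\<sigma> \<inter> \<tau>) face_of \<tau>)"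

definition support :: "'n::finite cone set \<Rightarrow> ((real ^ 'n) \<times> real) set" where
  "support \<Sigma> = \<Union>\<Sigma>"

definition complete_fan :: "'n::finite cone set \<Rightarrow> bool" where
  "complete_fan \<Sigma> \<longleftrightarrow> support \<Sigma> = half_space"

text \<open>The polyhedral complex \<open>\<Sigma>\<^sub>1\<close>, whose cells are kept inside \<open>N\<^sub>\<real> \<times> {1}\<close>.\<close>

definition height_one_complex :: "'n::finite cone set \<Rightarrow> 'n cone set" where
  "height_one_complex \<Sigma> = {\<sigma> \<inter> {z. snd z = 1} |\<sigma>. \<sigma> \<in> \<Sigma>} - {{}}"

definition dual_lattice_points :: "'n::finite cone \<Rightarrow> ((int ^ 'n) \<times> int) set" where
  "dual_lattice_points \<sigma> = {(u, k). \<forall>(x, m)\<in>\<sigma>. 0 \<le> pairing u x + of_int k * m}"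

definition subring_struct :: "'a::comm_ring_1 set \<Rightarrow> 'a ring" where
  "subring_struct S = \<lparr>carrier = S, monoid.mult = (*), one = 1, zero = 0, add = (+)\<rparr>"

section \<open>Direct sums of modules\<close>

definition module_direct_sum :: "nat \<Rightarrow> (nat \<Rightarrow> ('r, 'e) module) \<Rightarrow> ('r, nat \<Rightarrow> 'e) module" where
  "module_direct_sum l P =
     \<lparr>carrier = (\<Pi>\<^sub>E i\<in>{..<l}. carrier (P i)), monoid.mult = undefined, one = undefined,
      zero = (\<lambda>i\<in>{..<l}. \<zero>\<^bsub>P i\<^esub>),
      add = (\<lambda>s t. \<lambda>i\<in>{..<l}. s i \<oplus>\<^bsub>P i\<^esub> t i),
      smult = (\<lambda>a s. \<lambda>i\<in>{..<l}. a \<odot>\<^bsub>P i\<^esub> s i)\<rparr>"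

section \<open>The toric scheme\<close>

text \<open>
  A point of the toric scheme is an equivalence class of pairs \<open>(\<sigma>, p)\<close> with \<open>p\<close> a prime ideal of
  \<open>R\<^sub>\<sigma>\<close>. A regular function is a map from points to fractions of \<open>K[M]\<close>, extended by \<open>0\<close> outside
  its domain of definition.
\<close>

type_synonym ('n, 'k) point = "('n cone \<times> ('n, 'k) laurent set) set"
type_synonym ('n, 'k) func = "('n, 'k) point \<Rightarrow> ('n, 'k) laurent total_frac"

text \<open>
  The data of a sheaf of modules with a linearization. On the chart of \<open>\<sigma>\<close> the value
  \<open>coaction F \<sigma> s u\<close> is the \<open>u\<close>-component of \<open>s\<close>, that is, the coaction
  \<open>H\<^sup>0(U\<^sub>\<sigma>, F) \<rightarrow> H\<^sup>0(U\<^sub>\<sigma>, F) \<otimes> O[M]\<close> sends \<open>s\<close> to the sum of all \<open>coaction F \<sigma> s u \<otimes> u\<close>.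
\<close>

record (overloaded) ('n, 'k, 'e) linearized_sheaf =
  sections :: "('n::finite, 'k::field) point set \<Rightarrow> (('n, 'k) func, 'e) module"
  restriction :: "('n, 'k) point set \<Rightarrow> ('n, 'k) point set \<Rightarrow> 'e \<Rightarrow> 'e"
  coaction :: "'n cone \<Rightarrow> 'e \<Rightarrow> int ^ 'n \<Rightarrow> 'e"

locale toric_data =
  fixes val :: "'k::field \<Rightarrow> ereal" and \<pi> :: 'k and \<Sigma> :: "'n::finite cone set"
begin

inductive_set chart_ring :: "'n cone \<Rightarrow> ('n, 'k) laurent set" for \<sigma> where
  scalar: "0 \<le> val a \<Longrightarrow> Poly_Mapping.single 0 a \<in> chart_ring \<sigma>"
| monomial: "(u, k) \<in> dual_lattice_points \<sigma> \<Longrightarrow>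
    Poly_Mapping.single u (\<pi> powi k) \<in> chart_ring \<sigma>"
| add: "f \<in> chart_ring \<sigma> \<Longrightarrow> g \<in> chart_ring \<sigma> \<Longrightarrow> f + g \<in> chart_ring \<sigma>"
| mult: "f \<in> chart_ring \<sigma> \<Longrightarrow> g \<in> chart_ring \<sigma> \<Longrightarrow> f * g \<in> chart_ring \<sigma>"

definition spec :: "'n cone \<Rightarrow> ('n, 'k) laurent set set" where
  "spec \<sigma> = {p. primeideal p (subring_struct (chart_ring \<sigma>))}"

text \<open>The charts of \<open>\<sigma>\<close> and \<open>\<tau>\<close> are glued along the chart of \<open>\<sigma> \<inter> \<tau>\<close>.\<close>

definition glue_rel ::
  "(('n cone \<times> ('n, 'k) laurent set) \<times> ('n cone \<times> ('n, 'k) laurent set)) set" where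
  "glue_rel = {((\<sigma>, p), (\<tau>, q)). \<sigma> \<in> \<Sigma> \<and> \<tau> \<in> \<Sigma> \<and> p \<in> spec \<sigma> \<and> q \<in> spec \<tau> \<and>
     (\<exists>P\<in>spec (\<sigma> \<inter> \<tau>). P \<inter> chart_ring \<sigma> = p \<and> P \<inter> chart_ring \<tau> = q)}"

definition points :: "('n, 'k) point set" where
  "points = (SIGMA \<sigma>:\<Sigma>. spec \<sigma>) // glue_rel"

definition chart_point :: "'n cone \<Rightarrow> ('n, 'k) laurent set \<Rightarrow> ('n, 'k) point" where
  "chart_point \<sigma> p = glue_rel `` {(\<sigma>, p)}"

definition chart :: "'n cone \<Rightarrow> ('n, 'k) point set" where
  "chart \<sigma> = chart_point \<sigma> ` spec \<sigma>"

definition distinguished_open :: "'n cone \<Rightarrow> ('n, 'k) laurent \<Rightarrow> ('n, 'k) point set" where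
  "distinguished_open \<sigma> f = chart_point \<sigma> ` {p \<in> spec \<sigma>. f \<notin> p}"

definition zariski_open :: "('n, 'k) point set \<Rightarrow> bool" where
  "zariski_open W \<longleftrightarrow> W \<subseteq> points \<and>
     (\<forall>\<sigma>\<in>\<Sigma>. \<exists>S \<subseteq> chart_ring \<sigma>. {p \<in> spec \<sigma>. chart_point \<sigma> p \<in> W} = {p \<in> spec \<sigma>. \<not> S \<subseteq> p})"

definition regular_functions :: "('n, 'k) point set \<Rightarrow> ('n, 'k) func set" where
  "regular_functions W = {s. (\<forall>x. x \<notin> W \<longrightarrow> s x = 0) \<and>
     (\<forall>x\<in>W. \<exists>\<sigma>\<in>\<Sigma>. \<exists>a\<in>chart_ring \<sigma>. \<exists>b\<in>chart_ring \<sigma>. \<exists>V. zariski_open V \<and> x \<in> V \<and>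
        V \<subseteq> W \<inter> distinguished_open \<sigma> b \<and> (\<forall>y\<in>V. s y = Frac a b))}"

definition restrict_func :: "('n, 'k) point set \<Rightarrow> ('n, 'k) func \<Rightarrow> ('n, 'k) func" where
  "restrict_func V s = (\<lambda>x. if x \<in> V then s x else 0)"

definition structure_sheaf :: "('n, 'k) point set \<Rightarrow> ('n, 'k) func ring" where
  "structure_sheaf W =
     \<lparr>carrier = regular_functions W, monoid.mult = (\<lambda>s t x. s x * t x),
      one = restrict_func W (\<lambda>x. 1), zero = (\<lambda>x. 0), add = (\<lambda>s t x. s x + t x)\<rparr>"

definition regular_of :: "('n, 'k) point set \<Rightarrow> ('n, 'k) laurent \<Rightarrow> ('n, 'k) func" where
  "regular_of W f = restrict_func W (\<lambda>x. Frac f 1)"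

section \<open>Toric vector bundles\<close>

definition sheaf_of_modules :: "('n, 'k, 'e) linearized_sheaf \<Rightarrow> bool" where
  "sheaf_of_modules F \<longleftrightarrow>
     (\<forall>W. zariski_open W \<longrightarrow> module (structure_sheaf W) (sections F W)) \<and>
     (\<forall>W V. zariski_open W \<and> zariski_open V \<and> V \<subseteq> W \<longrightarrow>
        (\<forall>s\<in>carrier (sections F W). restriction F W V s \<in> carrier (sections F V)) \<and>
        (\<forall>s\<in>carrier (sections F W). \<forall>t\<in>carrier (sections F W).
           restriction F W V (s \<oplus>\<^bsub>sections F W\<^esub> t)
             = restriction F W V s \<oplus>\<^bsub>sections F V\<^esub> restriction F W V t) \<and>
        (\<forall>a\<in>regular_functions W. \<forall>s\<in>carrier (sections F W).
           restriction F W V (a \<odot>\<^bsub>sections F W\<^esub> s)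
             = restrict_func V a \<odot>\<^bsub>sections F V\<^esub> restriction F W V s)) \<and>
     (\<forall>W. zariski_open W \<longrightarrow> (\<forall>s\<in>carrier (sections F W). restriction F W W s = s)) \<and>
     (\<forall>W V V'. zariski_open W \<and> zariski_open V \<and> zariski_open V' \<and> V' \<subseteq> V \<and> V \<subseteq> W \<longrightarrow>
        (\<forall>s\<in>carrier (sections F W).
           restriction F V V' (restriction F W V s) = restriction F W V' s)) \<and>
     (\<forall>\<W> s. (\<forall>V\<in>\<W>. zariski_open V \<and> s V \<in> carrier (sections F V)) \<and>
        (\<forall>V\<in>\<W>. \<forall>V'\<in>\<W>. restriction F V (V \<inter> V') (s V) = restriction F V' (V \<inter> V') (s V')) \<longrightarrow>
        (\<exists>!t. t \<in> carrier (sections F (\<Union>\<W>)) \<and> (\<forall>V\<in>\<W>. restriction F (\<Union>\<W>) V t = s V)))"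

text \<open>Every point has an open neighbourhood \<open>W\<close> with a frame \<open>b\<close>, i.e. \<open>F|\<^sub>W \<cong> O\<^sup>r|\<^sub>W\<close>.\<close>

definition locally_free :: "nat \<Rightarrow> ('n, 'k, 'e) linearized_sheaf \<Rightarrow> bool" where
  "locally_free r F \<longleftrightarrow>
     (\<forall>x\<in>points. \<exists>W b. zariski_open W \<and> x \<in> W \<and> (\<forall>i<r. b i \<in> carrier (sections F W)) \<and>
        (\<forall>V. zariski_open V \<and> V \<subseteq> W \<longrightarrow>
           (\<forall>s\<in>carrier (sections F V). \<exists>!a. a \<in> {..<r} \<rightarrow>\<^sub>E regular_functions V \<and>
              s = (\<Oplus>\<^bsub>sections F V\<^esub>i\<in>{..<r}. a i \<odot>\<^bsub>sections F V\<^esub> restriction F W V (b i)))))"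

definition vector_bundle :: "nat \<Rightarrow> ('n, 'k, 'e) linearized_sheaf \<Rightarrow> bool" where
  "vector_bundle r F \<longleftrightarrow> sheaf_of_modules F \<and> locally_free r F"

text \<open>
  A \<open>T\<close>-linearization is an isomorphism \<open>a\<^sup>*F \<cong> pr\<^sub>2\<^sup>*F\<close> on \<open>T \<times> X\<close> (\<open>a\<close> the action) satisfying the
  cocycle condition. As \<open>T\<close> is affine and the charts are affine, \<open>T\<close>-stable and cover \<open>X\<close>, the
  adjoint \<open>F \<rightarrow> a\<^sub>*pr\<^sub>2\<^sup>*F\<close> of this isomorphism is a family of maps
  \<open>H\<^sup>0(U\<^sub>\<sigma>, F) \<rightarrow> H\<^sup>0(T \<times> U\<^sub>\<sigma>, pr\<^sub>2\<^sup>*F) = H\<^sup>0(U\<^sub>\<sigma>, F) \<otimes> O[M]\<close>, compatible with restriction and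
  semilinear over the coaction of \<open>R\<^sub>\<sigma>\<close>, which maps a monomial \<open>a\<cdot>u\<close> to \<open>a\<cdot>u \<otimes> u\<close>; the cocycle
  condition says that they are counital and coassociative. Elements of \<open>H\<^sup>0(U\<^sub>\<sigma>, F) \<otimes> O[M]\<close>
  are the finitely supported functions on \<open>M\<close> with values in \<open>H\<^sup>0(U\<^sub>\<sigma>, F)\<close>.
\<close>

definition torus_linearized :: "('n, 'k, 'e) linearized_sheaf \<Rightarrow> bool" where
  "torus_linearized F \<longleftrightarrow>
     (\<forall>\<sigma>\<in>\<Sigma>. let H = sections F (chart \<sigma>); \<rho> = coaction F \<sigma> in
        (\<forall>s\<in>carrier H.
           (\<forall>u. \<rho> s u \<in> carrier H) \<and> finite {u. \<rho> s u \<noteq> \<zero>\<^bsub>H\<^esub>} \<and>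
           (\<Oplus>\<^bsub>H\<^esub>u\<in>{u. \<rho> s u \<noteq> \<zero>\<^bsub>H\<^esub>}. \<rho> s u) = s \<and>
           (\<forall>u w. \<rho> (\<rho> s u) w = (if w = u then \<rho> s u else \<zero>\<^bsub>H\<^esub>))) \<and>
        (\<forall>s\<in>carrier H. \<forall>t\<in>carrier H. \<forall>u. \<rho> (s \<oplus>\<^bsub>H\<^esub> t) u = \<rho> s u \<oplus>\<^bsub>H\<^esub> \<rho> t u) \<and>
        (\<forall>u a. Poly_Mapping.single u a \<in> chart_ring \<sigma> \<longrightarrow> (\<forall>s\<in>carrier H. \<forall>w.
           \<rho> (regular_of (chart \<sigma>) (Poly_Mapping.single u a) \<odot>\<^bsub>H\<^esub> s) w
             = regular_of (chart \<sigma>) (Poly_Mapping.single u a) \<odot>\<^bsub>H\<^esub> \<rho> s (w - u)))) \<and>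
     (\<forall>\<sigma>\<in>\<Sigma>. \<forall>\<tau>\<in>\<Sigma>. \<tau> \<subseteq> \<sigma> \<longrightarrow> (\<forall>s\<in>carrier (sections F (chart \<sigma>)). \<forall>u.
        restriction F (chart \<sigma>) (chart \<tau>) (coaction F \<sigma> s u)
          = coaction F \<tau> (restriction F (chart \<sigma>) (chart \<tau>) s) u))"

definition toric_vector_bundle :: "nat \<Rightarrow> ('n, 'k, 'e) linearized_sheaf \<Rightarrow> bool" where
  "toric_vector_bundle r F \<longleftrightarrow> vector_bundle r F \<and> torus_linearized F"

abbreviation toric_line_bundle :: "('n, 'k, 'e) linearized_sheaf \<Rightarrow> bool" where
  "toric_line_bundle \<equiv> toric_vector_bundle 1"

definition equivariant_isomorphism ::
  "('n, 'k, 'e) linearized_sheaf \<Rightarrow> ('n, 'k, 'f) linearized_sheaf \<Rightarrow>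
   (('n, 'k) point set \<Rightarrow> 'e \<Rightarrow> 'f) \<Rightarrow> bool" where
  "equivariant_isomorphism F G \<phi> \<longleftrightarrow>
     (\<forall>W. zariski_open W \<longrightarrow>
        bij_betw (\<phi> W) (carrier (sections F W)) (carrier (sections G W)) \<and>
        (\<forall>s\<in>carrier (sections F W). \<forall>t\<in>carrier (sections F W).
           \<phi> W (s \<oplus>\<^bsub>sections F W\<^esub> t) = \<phi> W s \<oplus>\<^bsub>sections G W\<^esub> \<phi> W t) \<and>
        (\<forall>a\<in>regular_functions W. \<forall>s\<in>carrier (sections F W).
           \<phi> W (a \<odot>\<^bsub>sections F W\<^esub> s) = a \<odot>\<^bsub>sections G W\<^esub> \<phi> W s)) \<and>
     (\<forall>W V. zariski_open W \<and> zariski_open V \<and> V \<subseteq> W \<longrightarrow>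
        (\<forall>s\<in>carrier (sections F W). \<phi> V (restriction F W V s) = restriction G W V (\<phi> W s))) \<and>
     (\<forall>\<sigma>\<in>\<Sigma>. \<forall>s\<in>carrier (sections F (chart \<sigma>)). \<forall>u.
        \<phi> (chart \<sigma>) (coaction F \<sigma> s u) = coaction G \<sigma> (\<phi> (chart \<sigma>) s) u)"

definition direct_sum ::
  "nat \<Rightarrow> (nat \<Rightarrow> ('n, 'k, 'e) linearized_sheaf) \<Rightarrow> ('n, 'k, nat \<Rightarrow> 'e) linearized_sheaf" where
  "direct_sum l L =
     \<lparr>sections = (\<lambda>W. module_direct_sum l (\<lambda>i. sections (L i) W)),
      restriction = (\<lambda>W V s. \<lambda>i\<in>{..<l}. restriction (L i) W V (s i)),
      coaction = (\<lambda>\<sigma> s u. \<lambda>i\<in>{..<l}. coaction (L i) \<sigma> (s i) u)\<rparr>"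

text \<open>
  That the line bundles have sections in the same type as \<open>F\<close> is no restriction: each of them is
  equivariantly isomorphic to a subsheaf of \<open>F\<close>.
\<close>

definition splits_equivariantly :: "('n, 'k, 'e) linearized_sheaf \<Rightarrow> bool" where
  "splits_equivariantly F \<longleftrightarrow>
     (\<exists>l. \<exists>L :: nat \<Rightarrow> ('n, 'k, 'e) linearized_sheaf.
        (\<forall>i<l. toric_line_bundle (L i)) \<and> (\<exists>\<phi>. equivariant_isomorphism F (direct_sum l L) \<phi>))"

section \<open>The fiber at the identity point\<close>

abbreviation generic_torus :: "('n, 'k) point set" where
  "generic_torus \<equiv> chart {0}"

text \<open>
  The fiber at \<open>x\<^sub>0\<close> is \<open>H\<^sup>0(T\<^sub>\<eta>, F) / I H\<^sup>0(T\<^sub>\<eta>, F)\<close>, where the maximal ideal \<open>I\<close> of \<open>x\<^sub>0\<close> is the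
  augmentation ideal of \<open>K[M]\<close>.
\<close>

definition identity_ideal :: "('n, 'k) laurent set" where
  "identity_ideal = {f. (\<Sum>u\<in>Poly_Mapping.keys f. Poly_Mapping.lookup f u) = 0}"

definition vanishing_sections :: "('n, 'k, 'e) linearized_sheaf \<Rightarrow> 'e set" where
  "vanishing_sections F = (let H = sections F generic_torus in
     {\<Oplus>\<^bsub>H\<^esub>j\<in>{..<l}. regular_of generic_torus (f j) \<odot>\<^bsub>H\<^esub> s j |(l::nat) f s.
        (\<forall>j<l. f j \<in> identity_ideal \<and> s j \<in> carrier H)})"

definition value_at_identity :: "('n, 'k, 'e) linearized_sheaf \<Rightarrow> 'e \<Rightarrow> 'e set" where
  "value_at_identity F s = vanishing_sections F +>\<^bsub>sections F generic_torus\<^esub> s"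

definition fiber :: "('n, 'k, 'e) linearized_sheaf \<Rightarrow> ('k, 'e set) module" where
  "fiber F = (let H = sections F generic_torus in
     \<lparr>carrier = value_at_identity F ` carrier H, monoid.mult = undefined, one = undefined,
      zero = vanishing_sections F, add = set_add H,
      smult = (\<lambda>c e. \<Union>s\<in>e. value_at_identity F
        (regular_of generic_torus (Poly_Mapping.single 0 c) \<odot>\<^bsub>H\<^esub> s))\<rparr>)"

definition invariant_section :: "('n, 'k, 'e) linearized_sheaf \<Rightarrow> 'e set \<Rightarrow> 'e" where
  "invariant_section F e = (let H = sections F generic_torus in
     (THE s. s \<in> carrier H \<and> (\<forall>u. coaction F {0} s u = (if u = 0 then s else \<zero>\<^bsub>H\<^esub>)) \<and>
        value_at_identity F s = e))"

text \<open>The section of \<open>F\<close> over \<open>T\<^sub>\<eta>\<close> that corresponds to \<open>f \<otimes> e\<close> in \<open>K[M] \<otimes> E\<close>.\<close>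

definition tensor_section ::
  "('n, 'k, 'e) linearized_sheaf \<Rightarrow> ('n, 'k) laurent \<Rightarrow> 'e set \<Rightarrow> 'e" where
  "tensor_section F f e =
     regular_of generic_torus f \<odot>\<^bsub>sections F generic_torus\<^esub> invariant_section F e"

end

section \<open>Additive norms and extended apartments\<close>

text \<open>Vector spaces over \<open>K\<close> are represented by the carrier, addition and scalar action of a module record.\<close>

definition lin_comb :: "('k::field, 'v) module \<Rightarrow> nat \<Rightarrow> (nat \<Rightarrow> 'k) \<Rightarrow> (nat \<Rightarrow> 'v) \<Rightarrow> 'v" where
  "lin_comb E r c b = (\<Oplus>\<^bsub>E\<^esub>i\<in>{..<r}. c i \<odot>\<^bsub>E\<^esub> b i)"

definition is_basis :: "('k::field, 'v) module \<Rightarrow> nat \<Rightarrow> (nat \<Rightarrow> 'v) \<Rightarrow> bool" where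
  "is_basis E r b \<longleftrightarrow> (\<forall>i<r. b i \<in> carrier E) \<and>
     (\<forall>e\<in>carrier E. \<exists>!c. c \<in> extensional {..<r} \<and> e = lin_comb E r c b)"

definition additive_norms ::
  "('k::field \<Rightarrow> ereal) \<Rightarrow> ('k, 'v) module \<Rightarrow> real \<Rightarrow> ('v \<Rightarrow> ereal) set" where
  "additive_norms val E m = {v \<in> extensional (carrier E).
     (\<forall>e\<in>carrier E. v e \<noteq> -\<infinity>) \<and>
     (\<forall>c. \<forall>e\<in>carrier E. c \<noteq> 0 \<longrightarrow> v (c \<odot>\<^bsub>E\<^esub> e) = ereal m * val c + v e) \<and>
     (\<forall>e\<in>carrier E. \<forall>e'\<in>carrier E. min (v e) (v e') \<le> v (e \<oplus>\<^bsub>E\<^esub> e')) \<and>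
     (\<forall>e\<in>carrier E. v e = \<infinity> \<longleftrightarrow> e = \<zero>\<^bsub>E\<^esub>)}"

definition level_apartment ::
  "('k::field \<Rightarrow> ereal) \<Rightarrow> ('k, 'v) module \<Rightarrow> nat \<Rightarrow> (nat \<Rightarrow> 'v) \<Rightarrow> real \<Rightarrow> ('v \<Rightarrow> ereal) set" where
  "level_apartment val E r b m = {v \<in> additive_norms val E m.
     \<forall>c. v (lin_comb E r c b) = (INF i\<in>{..<r}. v (c i \<odot>\<^bsub>E\<^esub> b i))}"

text \<open>A point of the disjoint union over all levels is a pair of the level and the norm.\<close>

definition extended_apartment ::
  "('k::field \<Rightarrow> ereal) \<Rightarrow> ('k, 'v) module \<Rightarrow> nat \<Rightarrow> (nat \<Rightarrow> 'v) \<Rightarrow> (real \<times> ('v \<Rightarrow> ereal)) set" where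
  "extended_apartment val E r b = (SIGMA m:{0..}. level_apartment val E r b m)"

definition affine_extended_apartment ::
  "('k::field \<Rightarrow> ereal) \<Rightarrow> ('k, 'v) module \<Rightarrow> nat \<Rightarrow> (nat \<Rightarrow> 'v) \<Rightarrow> ('v \<Rightarrow> ereal) set" where
  "affine_extended_apartment val E r b = level_apartment val E r b 1"

definition in_one_extended_apartment ::
  "('k::field \<Rightarrow> ereal) \<Rightarrow> ('k, 'v) module \<Rightarrow> (real \<times> ('v \<Rightarrow> ereal)) set \<Rightarrow> bool" where
  "in_one_extended_apartment val E S \<longleftrightarrow>
     (\<exists>r b. is_basis E r b \<and> S \<subseteq> extended_apartment val E r b)"

definition in_one_affine_extended_apartment ::
  "('k::field \<Rightarrow> ereal) \<Rightarrow> ('k, 'v) module \<Rightarrow> ('v \<Rightarrow> ereal) set \<Rightarrow> bool" where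
  "in_one_affine_extended_apartment val E S \<longleftrightarrow>
     (\<exists>r b. is_basis E r b \<and> S \<subseteq> affine_extended_apartment val E r b)"

section \<open>The piecewise linear map of a toric vector bundle\<close>

context toric_data
begin

text \<open>
  \<open>H\<^sup>0(U\<^sub>\<sigma>, F)\<close>, restricted to \<open>T\<^sub>\<eta>\<close>, is the direct sum of the \<open>R\<^sub>\<sigma> \<cdot> (-u i) \<otimes> b i\<close>.
\<close>

definition chart_frame ::
  "('n, 'k, 'e) linearized_sheaf \<Rightarrow> 'n cone \<Rightarrow> nat \<Rightarrow> (nat \<Rightarrow> int ^ 'n) \<Rightarrow> (nat \<Rightarrow> 'e set) \<Rightarrow> bool" where
  "chart_frame F \<sigma> r u b \<longleftrightarrow> is_basis (fiber F) r b \<and>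
     restriction F (chart \<sigma>) generic_torus ` carrier (sections F (chart \<sigma>)) =
       {\<Oplus>\<^bsub>sections F generic_torus\<^esub>i\<in>{..<r}.
          tensor_section F (f i * Poly_Mapping.single (- u i) 1) (b i) |f.
          \<forall>i<r. f i \<in> chart_ring \<sigma>}"

definition Phi_norm ::
  "('n, 'k, 'e) linearized_sheaf \<Rightarrow> real ^ 'n \<Rightarrow> real \<Rightarrow> 'e set \<Rightarrow> ereal" where
  "Phi_norm F x m = (THE v. v \<in> additive_norms val (fiber F) m \<and>
     (\<exists>\<sigma>\<in>\<Sigma>. (x, m) \<in> \<sigma> \<and> (\<exists>r u b. chart_frame F \<sigma> r u b \<and>
        (\<forall>c. v (lin_comb (fiber F) r c b) =
           (INF i\<in>{i. i < r \<and> c i \<noteq> 0}. ereal m * val (c i) + ereal (pairing (u i) x))))))"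

definition Phi ::
  "('n, 'k, 'e) linearized_sheaf \<Rightarrow> (real ^ 'n) \<times> real \<Rightarrow> real \<times> ('e set \<Rightarrow> ereal)" where
  "Phi F = (\<lambda>(x, m). (m, Phi_norm F x m))"

definition Phi_affine ::
  "('n, 'k, 'e) linearized_sheaf \<Rightarrow> (real ^ 'n) \<times> real \<Rightarrow> 'e set \<Rightarrow> ereal" where
  "Phi_affine F z = snd (Phi F z)"

end

end

theory Submission
  imports Defs
begin

text \<open>
  Regular functions are Laurent fractions and sections are vectors of fractions in the coordinates of a
  frame. On an affine chart \<open>U\<^sub>\<sigma>\<close>, quasi-coherence turns a frame at a prime
  that contains all monomials that are not units into a homogeneous frame of the whole chart; on the
  generic torus this gives an invariant frame, hence an identification of the fiber \<open>E\<close> with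
  \<open>K\<^sup>r\<close> and of \<open>H\<^sup>0(U\<^sub>\<sigma>, F)\<close> with a graded submodule
  of \<open>K[M]\<^sup>r\<close> that has a basis \<open>\<chi>\<^sup>-\<^sup>u e\<close>. The bundle
  splits iff one \<open>K\<close>-basis of \<open>E\<close> provides, up to scalars, such bases on all
  charts: its lines generate line subbundles, and conversely invariant generators of the summands on the
  torus form such a basis. The norms at the points of \<open>\<sigma>\<close> determine
  \<open>H\<^sup>0(U\<^sub>\<sigma>, F)\<close>, as \<open>\<chi>\<^sup>-\<^sup>w e\<close> is a section
  iff the norm of \<open>e\<close> dominates \<open>w\<close> on \<open>\<sigma>\<close>; if they all lie
  in the apartment of a basis, then the norm of each basis vector is a single integral functional on
  \<open>\<sigma>\<close>, so that the basis is, up to scalars, a frame of the chart. In a complete fan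
  every cone is a face of one that meets height one, and nonnegativity of an integral functional on such
  a cone can be tested at height one.
\<close>

text \<open>Local freeness yields frames that are neither homogeneous nor global on a chart, and a
  chart ring is graded but not local. The special prime contains every term that is not a unit. An
  element \<open>f\<close> outside it therefore has a unit term, and comparing a single weight in an
  identity \<open>f p = sum of g i h i\<close> replaces \<open>f\<close> by that term, so that the
  division takes place in the chart ring. This is a graded form of Nakayama's lemma. One function,
  \<open>functional u k\<close>, carries the combinatorics. For a coefficient of valuation
  \<open>k\<close> at the exponent \<open>u\<close>, its nonnegativity on a cone is membership in
  the chart ring, and its value at \<open>(x, m)\<close> is a term that the level \<open>m\<close>
  norm minimises. Inclusions of graded modules and inequalities of norms thus become the same linear
  inequalities. The obstacle on the way from an apartment to a splitting is that the norm of a basis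
  vector is a priori a minimum of several functionals, which need not be linear on a cone. The
  constant part of the single functional that is found is absorbed into a scalar; hence common
  frames allow scalars that vary with the cone.\<close>

abbreviation coef :: "('a \<Rightarrow>\<^sub>0 'b::zero) \<Rightarrow> 'a \<Rightarrow> 'b" where "coef \<equiv> Poly_Mapping.lookup"
abbreviation mterm :: "'a \<Rightarrow> 'b \<Rightarrow> ('a \<Rightarrow>\<^sub>0 'b::zero)" where "mterm \<equiv> Poly_Mapping.single"
abbreviation supp :: "('a \<Rightarrow>\<^sub>0 'b::zero) \<Rightarrow> 'a set" where "supp \<equiv> Poly_Mapping.keys"

section \<open>Laurent polynomials\<close>

lemma coef_mterm_mult:
  fixes f :: "'a::ab_group_add \<Rightarrow>\<^sub>0 'b::semiring_0"
  shows "coef (mterm u a * f) k = a * coef f (k - u)"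
proof -
  have *: "(k = l + q) = (q = k - l)" for l q :: 'a by (auto simp: algebra_simps)
  show ?thesis
    by (simp add: lookup_mult lookup_single when_mult *)
qed

lemma coef_mult:
  fixes f :: "'a::ab_group_add \<Rightarrow>\<^sub>0 'b::semiring_0"
  shows "coef (f * g) k = (\<Sum>l\<in>supp f. coef f l * coef g (k - l))"
proof -
  have *: "(k = l + q) = (q = k - l)" for l q :: 'a by (auto simp: algebra_simps)
  have "coef (f * g) k = Sum_any (\<lambda>l. coef f l * coef g (k - l))"
    by (simp add: lookup_mult *)
  also have "\<dots> = (\<Sum>l\<in>supp f. coef f l * coef g (k - l))"
    by (rule Sum_any.expand_superset) (auto simp: in_keys_iff)
  finally show ?thesis .
qed

lemma sum_mterms: "(\<Sum>u\<in>supp f. mterm u (coef f u)) = f"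
proof (rule poly_mapping_eqI)
  fix k
  have "coef (\<Sum>u\<in>supp f. mterm u (coef f u)) k = (\<Sum>u\<in>supp f. if u = k then coef f u else 0)"
    by (simp add: lookup_sum lookup_single when_def)
  also have "\<dots> = coef f k" by (simp add: in_keys_iff)
  finally show "coef (\<Sum>u\<in>supp f. mterm u (coef f u)) k = coef f k" .
qed

lemma pairing_add_left: "pairing (u + w) x = pairing u x + pairing w x"
  by (simp add: pairing_def sum.distrib algebra_simps)

lemma pairing_uminus_left: "pairing (- u) x = - pairing u x"
  by (simp add: pairing_def sum_negf)

lemma pairing_zero_left [simp]: "pairing 0 x = 0"
  by (simp add: pairing_def)

lemma pairing_diff_left: "pairing (u - w) x = pairing u x - pairing w x"
  using pairing_add_left[of "u - w" w x] by simp

lemma pairing_inner: "pairing u x = (\<chi> i. of_int (u $ i)) \<bullet> x"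
  by (simp add: pairing_def inner_vec_def)

text \<open>Countably many hyperplanes form a negligible set. Pairing with the resulting vector is
  injective on exponents, so it serves as a monomial order.\<close>

lemma ex_generic_vector: "\<exists>c. \<forall>u :: int ^ 'n::finite. pairing u c = 0 \<longrightarrow> u = 0"
proof -
  let ?U = "{u :: int ^ 'n. u \<noteq> 0}"
  have "negligible (\<Union>u\<in>?U. {x. pairing u x = 0})"
  proof (rule negligible_countable_Union)
    show "countable ((\<lambda>u. {x. pairing u x = 0}) ` ?U)" by simp
    fix S assume "S \<in> (\<lambda>u. {x. pairing u x = 0}) ` ?U"
    then obtain u :: "int ^ 'n" where u: "u \<noteq> 0" "S = {x. pairing u x = 0}" by blast
    have "(\<chi> i. real_of_int (u $ i)) \<noteq> 0"
      using u(1) by (simp add: vec_eq_iff)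
    then show "negligible S" unfolding u(2) pairing_inner by (intro negligible_hyperplane) simp
  qed
  then have "(\<Union>u\<in>?U. {x. pairing u x = 0}) \<noteq> UNIV" by (metis non_negligible_UNIV)
  then show ?thesis by auto
qed

text \<open>The terms of \<open>f\<close> and \<open>g\<close> at which the generic vector is
  largest multiply to a term that no other pair of terms can cancel.\<close>

lemma laurent_no_zero_divisors:
  fixes f g :: "('n::finite, 'k::field) laurent"
  assumes "f \<noteq> 0" "g \<noteq> 0"
  shows "f * g \<noteq> 0"
proof -
  obtain c where c: "\<And>u :: int ^ 'n. pairing u c = 0 \<Longrightarrow> u = 0" using ex_generic_vector by blast
  have max: "\<exists>u\<in>supp h. \<forall>w\<in>supp h. pairing w c \<le> pairing u c" if h: "h \<noteq> 0" for h :: "('n, 'k) laurent"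
  proof -
    have ne: "supp h \<noteq> {}" using h by simp
    have "Max ((\<lambda>w. pairing w c) ` supp h) \<in> (\<lambda>w. pairing w c) ` supp h"
      by (rule Max_in) (use ne in auto)
    then obtain u where "u \<in> supp h" "pairing u c = Max ((\<lambda>w. pairing w c) ` supp h)" by force
    then show ?thesis by (metis Max_ge finite_imageI finite_keys image_eqI)
  qed
  obtain u where u: "u \<in> supp f" "\<And>w. w \<in> supp f \<Longrightarrow> pairing w c \<le> pairing u c"
    using max[OF assms(1)] by blast
  obtain v where v: "v \<in> supp g" "\<And>w. w \<in> supp g \<Longrightarrow> pairing w c \<le> pairing v c"
    using max[OF assms(2)] by blast
  have "coef f l * coef g (u + v - l) = 0" if "l \<in> supp f" "l \<noteq> u" for l
  proof (rule ccontr)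
    assume "coef f l * coef g (u + v - l) \<noteq> 0"
    then have "u + v - l \<in> supp g" by (auto simp: in_keys_iff)
    then have "pairing u c \<le> pairing l c"
      using v(2)[of "u + v - l"] by (simp add: pairing_add_left pairing_diff_left)
    then have "pairing (u - l) c = 0" using u(2)[OF that(1)] by (simp add: pairing_diff_left)
    then show False using c that(2) by force
  qed
  then have "coef (f * g) (u + v) = (\<Sum>l\<in>{u}. coef f l * coef g (u + v - l))"
    unfolding coef_mult using u(1) by (intro sum.mono_neutral_right) auto
  then have "coef (f * g) (u + v) = coef f u * coef g v" by simp
  then have "coef (f * g) (u + v) \<noteq> 0" using u(1) v(1) by (simp add: in_keys_iff)
  then show ?thesis by auto
qed

lemma laurent_mult_eq_0_iff [simp]:
  fixes f g :: "('n::finite, 'k::field) laurent"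
  shows "f * g = 0 \<longleftrightarrow> f = 0 \<or> g = 0"
  using laurent_no_zero_divisors by auto

lemma laurent_power_eq_0_iff [simp]:
  fixes f :: "('n::finite, 'k::field) laurent"
  shows "f ^ n = 0 \<longleftrightarrow> f = 0 \<and> n > 0"
  by (induction n) auto

section \<open>Prime ideals of subrings\<close>

text \<open>Subrings, ideals and primes are taken as plain subsets of a ring type. The record-based
  notions behind \<open>spec\<close> are translated into them once, in
  \<open>primeideal_subring_struct\<close>.\<close>

definition subring_of :: "'a::comm_ring_1 set \<Rightarrow> bool" where
  "subring_of S \<longleftrightarrow> 1 \<in> S \<and> (\<forall>a\<in>S. - a \<in> S) \<and> (\<forall>a\<in>S. \<forall>b\<in>S. a + b \<in> S \<and> a * b \<in> S)"

definition ideal_in :: "'a::comm_ring_1 set \<Rightarrow> 'a set \<Rightarrow> bool" where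
  "ideal_in I S \<longleftrightarrow> I \<subseteq> S \<and> 0 \<in> I \<and> (\<forall>a\<in>I. \<forall>b\<in>I. a + b \<in> I) \<and> (\<forall>a\<in>S. \<forall>b\<in>I. a * b \<in> I)"

definition prime_in :: "'a::comm_ring_1 set \<Rightarrow> 'a set \<Rightarrow> bool" where
  "prime_in p S \<longleftrightarrow> ideal_in p S \<and> 1 \<notin> p \<and> (\<forall>a\<in>S. \<forall>b\<in>S. a * b \<in> p \<longrightarrow> a \<in> p \<or> b \<in> p)"

lemma subring_zero: "subring_of S \<Longrightarrow> 0 \<in> S"
  unfolding subring_of_def by (metis add.right_inverse)

lemma subring_power: "subring_of S \<Longrightarrow> a \<in> S \<Longrightarrow> a ^ n \<in> S"
  by (induction n) (auto simp: subring_of_def)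

lemma subring_sum: "subring_of S \<Longrightarrow> (\<And>i. i \<in> A \<Longrightarrow> f i \<in> S) \<Longrightarrow> sum f A \<in> S"
  by (induction A rule: infinite_finite_induct) (auto simp: subring_zero, auto simp: subring_of_def)

lemma cring_subring_struct:
  assumes "subring_of S" shows "cring (subring_struct S)"
proof (rule cringI)
  show "abelian_group (subring_struct S)"
  proof (rule abelian_groupI)
    fix x assume "x \<in> carrier (subring_struct S)"
    then show "\<exists>y\<in>carrier (subring_struct S). y \<oplus>\<^bsub>subring_struct S\<^esub> x = \<zero>\<^bsub>subring_struct S\<^esub>"
      using assms by (intro bexI[of _ "- x"]) (auto simp: subring_struct_def subring_of_def)
  qed (use assms subring_zero[OF assms] in \<open>auto simp: subring_struct_def subring_of_def algebra_simps\<close>)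
  show "Group.comm_monoid (subring_struct S)"
    by (rule comm_monoidI) (use assms in \<open>auto simp: subring_struct_def subring_of_def algebra_simps\<close>)
qed (auto simp: subring_struct_def algebra_simps)

lemma ideal_subring_struct:
  assumes S: "subring_of S"
  shows "ideal I (subring_struct S) \<longleftrightarrow> ideal_in I S"
proof
  interpret cring "subring_struct S" by (rule cring_subring_struct[OF S])
  assume "ideal I (subring_struct S)"
  then interpret ideal I "subring_struct S" .
  have "I \<subseteq> S" using a_subset by (simp add: subring_struct_def)
  moreover have "0 \<in> I" using zero_closed by (simp add: subring_struct_def)
  moreover have "a + b \<in> I" if "a \<in> I" "b \<in> I" for a b
    using a_closed[OF that] by (simp add: subring_struct_def)
  moreover have "a * b \<in> I" if "a \<in> S" "b \<in> I" for a b
    using I_l_closed[of b a] that by (simp add: subring_struct_def)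
  ultimately show "ideal_in I S" by (simp add: ideal_in_def)
next
  interpret cring "subring_struct S" by (rule cring_subring_struct[OF S])
  assume I: "ideal_in I S"
  have inv: "\<ominus>\<^bsub>subring_struct S\<^esub> a = - a" if "a \<in> S" for a
    by (rule minus_equality) (use that S in \<open>auto simp: subring_struct_def subring_of_def\<close>)
  have neg: "- a \<in> I" if "a \<in> I" for a
  proof -
    have "- 1 \<in> S" using S by (auto simp: subring_of_def)
    then have "(- 1) * a \<in> I" using I that unfolding ideal_in_def by blast
    then show ?thesis by simp
  qed
  have IS: "a \<in> I \<Longrightarrow> a \<in> S" for a using I unfolding ideal_in_def by blast
  show "ideal I (subring_struct S)"
  proof (rule idealI)
    show "ring (subring_struct S)" by (rule ring_axioms)
    show "subgroup I (add_monoid (subring_struct S))"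
    proof (rule add.subgroupI)
      show "I \<subseteq> carrier (subring_struct S)" using IS by (auto simp: subring_struct_def)
      show "I \<noteq> {}" using I by (auto simp: ideal_in_def)
      show "\<ominus>\<^bsub>subring_struct S\<^esub> a \<in> I" if "a \<in> I" for a using inv neg IS that by simp
      show "a \<oplus>\<^bsub>subring_struct S\<^esub> b \<in> I" if "a \<in> I" "b \<in> I" for a b
        using I that by (simp add: subring_struct_def ideal_in_def)
    qed
    show "x \<otimes>\<^bsub>subring_struct S\<^esub> a \<in> I" if "a \<in> I" "x \<in> carrier (subring_struct S)" for a x
      using I that by (simp add: subring_struct_def ideal_in_def)
    then show "a \<otimes>\<^bsub>subring_struct S\<^esub> x \<in> I" if "a \<in> I" "x \<in> carrier (subring_struct S)" for a x
      using that by (metis (no_types, lifting) mult.commute partial_object.select_convs(1) monoid.simps(1) subring_struct_def)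
  qed
qed

lemma primeideal_subring_struct:
  assumes S: "subring_of S"
  shows "primeideal p (subring_struct S) \<longleftrightarrow> prime_in p S"
proof
  interpret cring "subring_struct S" by (rule cring_subring_struct[OF S])
  assume "primeideal p (subring_struct S)"
  then interpret primeideal p "subring_struct S" .
  have i: "ideal_in p S" using is_ideal ideal_subring_struct[OF S] by blast
  have "1 \<notin> p" using one_imp_carrier I_notcarr by (auto simp: subring_struct_def)
  moreover have "a \<in> p \<or> b \<in> p" if "a \<in> S" "b \<in> S" "a * b \<in> p" for a b
    using I_prime[of a b] that by (simp add: subring_struct_def)
  ultimately show "prime_in p S" using i by (simp add: prime_in_def)
next
  assume p: "prime_in p S"
  show "primeideal p (subring_struct S)"
  proof (rule primeidealI)
    show "ideal p (subring_struct S)" using p ideal_subring_struct[OF S] by (simp add: prime_in_def)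
    show "cring (subring_struct S)" by (rule cring_subring_struct[OF S])
    have "1 \<in> S" "1 \<notin> p" using S p by (auto simp: subring_of_def prime_in_def)
    then show "carrier (subring_struct S) \<noteq> p" by (auto simp: subring_struct_def)
  qed (use p in \<open>auto simp: subring_struct_def prime_in_def\<close>)
qed

text \<open>Krull's argument: an ideal that is maximal among those containing \<open>I\<close> and
  avoiding the powers of \<open>f\<close> is prime.\<close>

lemma ex_prime_avoiding:
  assumes S: "subring_of S" and I: "ideal_in I S" and f: "f \<in> S" "\<And>n. f ^ n \<notin> I"
  shows "\<exists>p. prime_in p S \<and> I \<subseteq> p \<and> f \<notin> p"
proof -
  let ?A = "{J. ideal_in J S \<and> I \<subseteq> J \<and> (\<forall>n. f ^ n \<notin> J)}"
  have "\<exists>M\<in>?A. \<forall>X\<in>?A. M \<subseteq> X \<longrightarrow> X = M"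
  proof (rule subset_Zorn_nonempty)
    show "?A \<noteq> {}" using I f(2) by blast
    fix C assume C: "C \<noteq> {}" "subset.chain ?A C"
    have CA: "J \<in> ?A" if "J \<in> C" for J using C(2) that by (auto simp: subset.chain_def)
    have ch: "J \<subseteq> J' \<or> J' \<subseteq> J" if "J \<in> C" "J' \<in> C" for J J'
      using C(2) that by (auto simp: subset_chain_def)
    have "ideal_in (\<Union>C) S" unfolding ideal_in_def
    proof (intro conjI ballI)
      show "\<Union>C \<subseteq> S" using CA unfolding ideal_in_def by blast
      show "0 \<in> \<Union>C" using CA C(1) unfolding ideal_in_def by blast
      fix a b assume "a \<in> \<Union>C" "b \<in> \<Union>C"
      then obtain J where "J \<in> C" "a \<in> J" "b \<in> J" using ch by blast
      then show "a + b \<in> \<Union>C" using CA[of J] unfolding ideal_in_def by blast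
    next
      fix a b assume "a \<in> S" "b \<in> \<Union>C"
      then show "a * b \<in> \<Union>C" using CA unfolding ideal_in_def by blast
    qed
    moreover have "I \<subseteq> \<Union>C" using C(1) CA by blast
    ultimately show "\<Union>C \<in> ?A" using CA by blast
  qed
  then obtain M where M0: "M \<in> ?A" "\<forall>X\<in>?A. M \<subseteq> X \<longrightarrow> X = M" by (rule bexE)
  then have M: "ideal_in M S" "I \<subseteq> M" "\<And>n. f ^ n \<notin> M" by auto
  have max: "X = M" if "ideal_in X S" "M \<subseteq> X" "\<And>n. f ^ n \<notin> X" for X
    using M0(2) M(2) that by blast
  have M1: "m + m' \<in> M" "s * m \<in> M" if "m \<in> M" "m' \<in> M" "s \<in> S" for m m' s
    using M(1) that unfolding ideal_in_def by blast+
  have MS: "m \<in> S" if "m \<in> M" for m using M(1) that unfolding ideal_in_def by blast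
  have S1: "s + t \<in> S" "s * t \<in> S" if "s \<in> S" "t \<in> S" for s t
    using S that unfolding subring_of_def by blast+
  have M0: "0 \<in> M" and S0: "0 \<in> S" "1 \<in> S"
    using M(1) S subring_zero[OF S] unfolding ideal_in_def subring_of_def by blast+
  \<comment> \<open>By maximality, the ideal generated by \<open>M\<close> and an element outside
    \<open>M\<close> must contain a power of \<open>f\<close>.\<close>
  have big: "\<exists>n s m. s \<in> S \<and> m \<in> M \<and> f ^ n = m + s * a" if a: "a \<in> S" "a \<notin> M" for a
  proof -
    let ?X = "{m + s * a | m s. m \<in> M \<and> s \<in> S}"
    have "ideal_in ?X S" unfolding ideal_in_def
    proof (intro conjI ballI)
      show "?X \<subseteq> S" using MS S1 a by blast
      show "0 \<in> ?X" using M0 S0 by force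
      fix x y assume "x \<in> ?X" "y \<in> ?X"
      then obtain m s m' s' where x: "x = m + s * a" "y = m' + s' * a" "m \<in> M" "s \<in> S" "m' \<in> M" "s' \<in> S"
        by blast
      have "x + y = (m + m') + (s + s') * a" unfolding x by (simp add: algebra_simps)
      moreover have "m + m' \<in> M" "s + s' \<in> S" using x(3-6) M1(1) S1(1) S0(2) by blast+
      ultimately show "x + y \<in> ?X" by blast
    next
      fix x y assume "x \<in> S" "y \<in> ?X"
      then obtain m s where y: "y = m + s * a" "m \<in> M" "s \<in> S" by blast
      have "x * y = x * m + (x * s) * a" unfolding y by (simp add: algebra_simps)
      moreover have "x * m \<in> M" "x * s \<in> S" using y(2,3) M1(2) S1(2) \<open>x \<in> S\<close> by blast+
      ultimately show "x * y \<in> ?X" by blast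
    qed
    moreover have "M \<subseteq> ?X" using subring_zero[OF S] by (force)
    moreover have "?X \<noteq> M"
    proof -
      have "0 + 1 * a \<in> ?X" using M0 S0 by blast
      then show ?thesis using a(2) by auto
    qed
    ultimately obtain n where "f ^ n \<in> ?X" using max[of ?X] by blast
    then show ?thesis by blast
  qed
  have "prime_in M S" unfolding prime_in_def
  proof (intro conjI ballI impI)
    show "ideal_in M S" by (rule M(1))
    show "1 \<notin> M" using M(3)[of 0] by simp
    fix a b assume ab: "a \<in> S" "b \<in> S" "a * b \<in> M"
    show "a \<in> M \<or> b \<in> M"
    proof (rule ccontr)
      assume "\<not> (a \<in> M \<or> b \<in> M)"
      then obtain n s m n' s' m' where h: "s \<in> S" "m \<in> M" "f ^ n = m + s * a"
        "s' \<in> S" "m' \<in> M" "f ^ n' = m' + s' * b"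
        using big[OF ab(1)] big[OF ab(2)] by blast
      have "f ^ (n + n') = (m' + s' * b) * m + ((s * a) * m' + (s * s') * (a * b))"
        unfolding power_add h(3,6) by (simp add: algebra_simps)
      moreover have "m' + s' * b \<in> S" "s * a \<in> S" "s * s' \<in> S"
        by (intro S1 MS h ab)+
      then have "(m' + s' * b) * m \<in> M" "s * a * m' \<in> M" "s * s' * (a * b) \<in> M"
        using M1(2) h(2,5) ab(3) by blast+
      ultimately have "f ^ (n + n') \<in> M" using M1(1)[OF _ _ S0(2)] by presburger
      then show False using M(3) by blast
    qed
  qed
  then show ?thesis using M(2) M(3)[of 1] by auto
qed

text \<open>The case \<open>f = 1\<close> of the preceding lemma. It is the passage from local to
  global on a chart: the elements for which a statement holds form an ideal, and it suffices to find
  one outside each prime.\<close>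

lemma ideal_in_no_prime:
  assumes S: "subring_of S" and I: "ideal_in I S" and np: "\<And>p. prime_in p S \<Longrightarrow> \<not> I \<subseteq> p"
  shows "1 \<in> I"
proof (rule ccontr)
  assume "1 \<notin> I"
  then have "\<exists>p. prime_in p S \<and> I \<subseteq> p \<and> 1 \<notin> p"
    using S by (intro ex_prime_avoiding[OF S I]) (auto simp: subring_of_def)
  then show False using np by blast
qed

section \<open>Cones and integral functionals\<close>

text \<open>The linear form given by the lattice point \<open>(u, k)\<close>. Later \<open>k\<close>
  is mostly the valuation of a coefficient that stands at the exponent \<open>u\<close>.\<close>

definition functional :: "int ^ 'n::finite \<Rightarrow> int \<Rightarrow> (real ^ 'n) \<times> real \<Rightarrow> real" where
  "functional u k z = pairing u (fst z) + of_int k * snd z"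

lemma dual_lattice_points_iff:
  "(u, k) \<in> dual_lattice_points \<sigma> \<longleftrightarrow> (\<forall>z\<in>\<sigma>. 0 \<le> functional u k z)"
  by (auto simp: dual_lattice_points_def functional_def split: prod.splits)

lemma functional_add_left: "functional (u + w) (k + l) z = functional u k z + functional w l z"
  by (simp add: functional_def pairing_add_left algebra_simps)

lemma functional_uminus_left: "functional (- u) (- k) z = - functional u k z"
  by (simp add: functional_def pairing_uminus_left)

lemma functional_zero_left [simp]: "functional 0 0 z = 0"
  by (simp add: functional_def)

lemma functional_inner: "functional u k z = ((\<chi> i. of_int (u $ i)), of_int k) \<bullet> z"
  by (cases z) (simp add: functional_def pairing_inner)

lemma functional_sum_right: "functional u k (sum f A) = (\<Sum>i\<in>A. functional u k (f i))"
  by (simp add: functional_inner inner_sum_right)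

lemma functional_nonneg_convex_cone_hull:
  assumes "\<And>g. g \<in> G \<Longrightarrow> 0 \<le> a \<bullet> g" "z \<in> convex_cone hull G"
  shows "0 \<le> (a :: 'a::euclidean_space) \<bullet> z"
proof -
  have "convex_cone hull G \<subseteq> {x. a \<bullet> x \<ge> 0}"
    by (rule hull_minimal) (use assms(1) convex_cone_halfspace_ge in auto)
  then show ?thesis using assms(2) by blast
qed

lemma integral_point_functional:
  assumes "g \<in> integral_points"
  shows "functional u k g \<in> \<int>"
  using assms by (auto simp: integral_points_def functional_def pairing_def split: prod.splits intro!: Ints_add Ints_sum Ints_mult)

text \<open>
  Simultaneous Diophantine approximation: an integral vector close enough to a large multiple of \<open>a\<close>
  takes integral values at the points of \<open>G\<close>, so that it vanishes wherever \<open>a\<close> does.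
\<close>

lemma ex_integral_functional:
  fixes a :: "(real ^ 'n::finite) \<times> real"
  assumes G: "finite G" "G \<subseteq> integral_points" and a: "\<And>g. g \<in> G \<Longrightarrow> 0 \<le> a \<bullet> g"
  shows "\<exists>u k. \<forall>g\<in>G. (if a \<bullet> g = 0 then functional u k g = 0 else functional u k g > 0)"
proof -
  obtain e where e: "bij_betw e {..<CARD('n)} (UNIV :: 'n set)"
    by (metis ex_bij_betw_nat_finite finite lessThan_atLeast0)
  define N0 where "N0 = CARD('n)"
  define \<theta> where "\<theta> i = (if i < N0 then fst a $ e i else snd a)" for i
  \<comment> \<open>\<open>S\<close> bounds the sum of the absolute coordinates of every generator,
    and \<open>m\<close> bounds the positive values of \<open>a\<close> from below. With a
    coordinate error below \<open>1 / N\<close> and \<open>N > S / m\<close>, the value at a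
    generator is off by less than \<open>m\<close>. As \<open>m \<le> 1\<close>, an integral value
    that approximates 0 is then 0; as \<open>m\<close> is at most each positive value, positive
    values stay positive.\<close>
  define S where "S = Max (insert 1 ((\<lambda>g. (\<Sum>i\<in>UNIV. \<bar>fst g $ i\<bar>) + \<bar>snd g\<bar>) ` G))"
  define m where "m = Min (insert 1 ((\<lambda>g. a \<bullet> g) ` {g\<in>G. a \<bullet> g > 0}))"
  have fin: "finite {g\<in>G. a \<bullet> g > 0}" using G(1) by simp
  have m: "m > 0" unfolding m_def using fin by (subst Min_gr_iff) auto
  have m1: "m \<le> 1" unfolding m_def using fin by simp
  have ml: "m \<le> a \<bullet> g" if "g \<in> G" "a \<bullet> g > 0" for g
    unfolding m_def using fin that by (intro Min_le) auto
  have S1: "1 \<le> S" unfolding S_def using G(1) by simp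
  have Sg: "(\<Sum>i\<in>UNIV. \<bar>fst g $ i\<bar>) + \<bar>snd g\<bar> \<le> S" if "g \<in> G" for g
    unfolding S_def using G(1) that by (intro Max_ge) auto
  obtain N :: nat where N: "N > S / m" using reals_Archimedean2 by blast
  have "S / m > 0" using S1 m by simp
  then have N0: "N > 0" using N by linarith
  obtain q p where q: "0 < q" and p: "\<And>i. i < Suc N0 \<Longrightarrow> \<bar>of_int q * \<theta> i - of_int (p i)\<bar> < 1 / N"
    using Dirichlet_approx_simult[OF N0, of "Suc N0" \<theta>] by metis
  define ix where "ix i = the_inv_into {..<CARD('n)} e i" for i
  have ix: "ix i < N0" "e (ix i) = i" for i
    using e the_inv_into_into[of e "{..<CARD('n)}" i "{..<CARD('n)}"] f_the_inv_into_f[of e "{..<CARD('n)}" i]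
    unfolding ix_def N0_def bij_betw_def by auto
  define u where "u = (\<chi> i. p (ix i))"
  define k where "k = p N0"
  have du: "\<bar>of_int q * fst a $ i - of_int (u $ i)\<bar> < 1 / N" for i
    using p[of "ix i"] ix[of i] by (simp add: \<theta>_def u_def)
  have dk: "\<bar>of_int q * snd a - of_int k\<bar> < 1 / N"
    using p[of N0] by (simp add: \<theta>_def k_def)
  have err: "\<bar>of_int q * (a \<bullet> g) - functional u k g\<bar> < m" if g: "g \<in> G" for g
  proof -
    have "a \<bullet> g = (\<Sum>i\<in>UNIV. fst a $ i * fst g $ i) + snd a * snd g"
      by (cases a; cases g) (simp add: inner_vec_def)
    then have "of_int q * (a \<bullet> g) - functional u k g
        = (\<Sum>i\<in>UNIV. (of_int q * fst a $ i - of_int (u $ i)) * fst g $ i) + (of_int q * snd a - of_int k) * snd g"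
      by (simp add: functional_def pairing_def algebra_simps sum_subtractf sum_distrib_left)
    also have "\<bar>\<dots>\<bar> \<le> (\<Sum>i\<in>UNIV. \<bar>(of_int q * fst a $ i - of_int (u $ i)) * fst g $ i\<bar>) + \<bar>(of_int q * snd a - of_int k) * snd g\<bar>"
      by (intro order.trans[OF abs_triangle_ineq] add_mono sum_abs order_refl)
    also have "\<dots> \<le> (\<Sum>i\<in>UNIV. 1 / N * \<bar>fst g $ i\<bar>) + 1 / N * \<bar>snd g\<bar>"
      unfolding abs_mult using du dk by (intro add_mono sum_mono mult_right_mono) (auto intro: less_imp_le)
    also have "\<dots> = 1 / N * ((\<Sum>i\<in>UNIV. \<bar>fst g $ i\<bar>) + \<bar>snd g\<bar>)"
      by (simp add: sum_distrib_left distrib_left)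
    also have "\<dots> \<le> 1 / N * S" using Sg[OF g] by (intro mult_left_mono) auto
    also have "\<dots> < m" using N N0 m by (simp add: field_simps)
    finally show ?thesis .
  qed
  show ?thesis
  proof (intro exI ballI)
    fix g assume g: "g \<in> G"
    show "if a \<bullet> g = 0 then functional u k g = 0 else functional u k g > 0"
    proof (cases "a \<bullet> g = 0")
      case True
      have "functional u k g \<in> \<int>" using integral_point_functional G(2) g by blast
      moreover have "\<bar>functional u k g\<bar> < 1" using err[OF g] True m1 by simp
      ultimately have "functional u k g = 0" by (metis Ints_nonzero_abs_less1)
      then show ?thesis using True by simp
    next
      case False
      then have pos: "a \<bullet> g > 0" using a[OF g] by simp
      have "m \<le> of_int q * (a \<bullet> g)"
      proof -
        have "1 \<le> real_of_int q" using q by simp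
        then have "1 * (a \<bullet> g) \<le> of_int q * (a \<bullet> g)" using pos by (intro mult_right_mono) auto
        then show ?thesis using ml[OF g pos] by simp
      qed
      then show ?thesis using err[OF g] False by auto
    qed
  qed
qed

text \<open>Faces of polyhedra are exposed, but only by a real functional. An integral one with the
  same zeros among the generators replaces it; each of the two is bounded by a multiple of the other
  on the cone, so they have the same zeros on the whole cone.\<close>

lemma rational_cone_face_functional:
  fixes \<sigma> \<tau> :: "'n::finite cone"
  assumes \<sigma>: "rational_polyhedral_cone \<sigma>" and \<tau>: "\<tau> face_of \<sigma>" "0 \<in> \<tau>"
  shows "\<exists>u k. (\<forall>z\<in>\<sigma>. 0 \<le> functional u k z) \<and> \<tau> = {z \<in> \<sigma>. functional u k z = 0}"
proof -
  obtain G where G: "finite G" "G \<subseteq> integral_points" "\<sigma> = convex_cone hull G"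
    using \<sigma> unfolding rational_polyhedral_cone_def by blast
  have G\<sigma>: "g \<in> \<sigma>" if "g \<in> G" for g using that G(3) by (simp add: hull_inc)
  have "polyhedron \<sigma>" unfolding G(3) by (rule polyhedron_convex_cone_hull[OF G(1)])
  then have "\<tau> exposed_face_of \<sigma>" using \<tau>(1) exposed_face_of_polyhedron by blast
  then obtain a0 b where ab: "\<sigma> \<subseteq> {x. a0 \<bullet> x \<le> b}" "\<tau> = \<sigma> \<inter> {x. a0 \<bullet> x = b}"
    unfolding exposed_face_of_def by blast
  \<comment> \<open>The supporting hyperplane passes through the origin because the face contains
    it.\<close>
  have b: "b = 0" using ab(2) \<tau>(2) by auto
  define a where "a = - a0"
  have a: "\<And>z. z \<in> \<sigma> \<Longrightarrow> 0 \<le> a \<bullet> z" "\<tau> = {z \<in> \<sigma>. a \<bullet> z = 0}" using ab b by (auto simp: a_def)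
  obtain u k where uk: "\<And>g. g \<in> G \<Longrightarrow> if a \<bullet> g = 0 then functional u k g = 0 else functional u k g > 0"
    using ex_integral_functional[OF G(1,2), of a] a(1) G\<sigma> by blast
  define F where "F = (((\<chi> i. real_of_int (u $ i)), real_of_int k) :: (real ^ 'n) \<times> real)"
  have F: "functional u k z = F \<bullet> z" for z by (simp add: F_def functional_inner)
  have pos: "0 < F \<bullet> g" if "g \<in> G" "a \<bullet> g \<noteq> 0" for g using uk[OF that(1)] that(2) F by simp
  have zero: "F \<bullet> g = 0" if "g \<in> G" "a \<bullet> g = 0" for g using uk[OF that(1)] that(2) F by simp
  \<comment> \<open>\<open>C\<close> is the largest ratio of \<open>x\<close> and \<open>y\<close>
    on the generators where \<open>y\<close> is positive; at the other generators both sides vanish,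
    and the inequality extends from generators to the cone.\<close>
  have dom: "\<exists>C. \<forall>z\<in>\<sigma>. x \<bullet> z \<le> C * (y \<bullet> z)"
    if xy: "\<And>g. g \<in> G \<Longrightarrow> (x \<bullet> g = 0 \<and> y \<bullet> g = 0) \<or> 0 < y \<bullet> g" for x y :: "(real ^ 'n) \<times> real"
  proof -
    define C where "C = Max (insert 0 ((\<lambda>g. (x \<bullet> g) / (y \<bullet> g)) ` G))"
    have C: "x \<bullet> g \<le> C * (y \<bullet> g)" if g: "g \<in> G" for g
    proof (cases "0 < y \<bullet> g")
      case True
      moreover have "(x \<bullet> g) / (y \<bullet> g) \<le> C"
        unfolding C_def using G(1) g by (intro Max_ge) auto
      ultimately show ?thesis by (simp add: field_simps)
    next
      case False
      then show ?thesis using xy[OF g] by simp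
    qed
    have "0 \<le> (C *\<^sub>R y - x) \<bullet> z" if "z \<in> \<sigma>" for z
      by (rule functional_nonneg_convex_cone_hull[of G]) (use C that G(3) in \<open>simp_all add: inner_diff_left\<close>)
    then show ?thesis by (intro exI[of _ C]) (simp add: inner_diff_left)
  qed
  obtain C where C: "\<And>z. z \<in> \<sigma> \<Longrightarrow> F \<bullet> z \<le> C * (a \<bullet> z)"
    using dom[of F a] pos zero a(1)[OF G\<sigma>] by (metis order_le_less)
  obtain D where D: "\<And>z. z \<in> \<sigma> \<Longrightarrow> a \<bullet> z \<le> D * (F \<bullet> z)"
    using dom[of a F] pos zero by metis
  have nn: "0 \<le> F \<bullet> z" if "z \<in> \<sigma>" for z
    by (rule functional_nonneg_convex_cone_hull[of G]) (use pos zero that G(3) in \<open>force+\<close>)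
  have "a \<bullet> z = 0 \<longleftrightarrow> F \<bullet> z = 0" if "z \<in> \<sigma>" for z
    using C[OF that] D[OF that] nn[OF that] a(1)[OF that] by auto
  then have "\<tau> = {z \<in> \<sigma>. functional u k z = 0}" unfolding a(2) F by blast
  moreover have "\<forall>z\<in>\<sigma>. 0 \<le> functional u k z" using nn F by simp
  ultimately show ?thesis by blast
qed

text \<open>The multiple \<open>of_nat n * u\<close> is formed in the componentwise ring structure
  of \<open>int ^ 'n\<close>.\<close>

lemma functional_mult_add:
  "functional (w + of_nat n * u) (l + of_nat n * k) z = functional w l z + of_nat n * functional u k z"
  by (induction n)
    (simp_all add: distrib_right functional_add_left add.assoc add.left_commute[of w u] add.left_commute[of l k] algebra_simps)

text \<open>At the finitely many generators off the face the supporting functional is positive, so a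
  large multiple of it outweighs every negative value of the other one. This is the combinatorial
  content of localizing at a monomial.\<close>

lemma functional_nonneg_on_face:
  fixes \<sigma> :: "'n::finite cone"
  assumes \<sigma>: "rational_polyhedral_cone \<sigma>" and uk: "\<And>z. z \<in> \<sigma> \<Longrightarrow> 0 \<le> functional u k z"
    and w: "\<And>z. z \<in> \<sigma> \<Longrightarrow> functional u k z = 0 \<Longrightarrow> 0 \<le> functional w l z"
  shows "\<exists>n::nat. \<forall>z\<in>\<sigma>. 0 \<le> functional (w + of_nat n * u) (l + of_nat n * k) z"
proof -
  obtain G where G: "finite G" "\<sigma> = convex_cone hull G"
    using \<sigma> unfolding rational_polyhedral_cone_def by blast
  have G\<sigma>: "g \<in> \<sigma>" if "g \<in> G" for g using that G(2) by (simp add: hull_inc)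
  define n where "n = nat \<lceil>Max (insert 0 ((\<lambda>g. - functional w l g / functional u k g) ` G))\<rceil>"
  define F where "F = (((\<chi> i. real_of_int ((w + of_nat n * u) $ i)), real_of_int (l + of_nat n * k)) :: (real ^ 'n) \<times> real)"
  have F: "functional w l z + of_nat n * functional u k z = F \<bullet> z" for z
    unfolding functional_mult_add[symmetric] F_def by (rule functional_inner)
  have "0 \<le> F \<bullet> g" if g: "g \<in> G" for g
  proof (cases "functional u k g = 0")
    case True
    then show ?thesis using w[OF G\<sigma>[OF g]] F[of g] by simp
  next
    case False
    then have p: "functional u k g > 0" using uk[OF G\<sigma>[OF g]] by simp
    have "- functional w l g / functional u k g \<le> Max (insert 0 ((\<lambda>g. - functional w l g / functional u k g) ` G))"
      using G(1) g by (intro Max_ge) auto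
    then have "- functional w l g / functional u k g \<le> of_nat n"
      unfolding n_def by linarith
    then show ?thesis using p unfolding F[symmetric] by (simp add: field_simps)
  qed
  then have "0 \<le> F \<bullet> z" if "z \<in> \<sigma>" for z
    using that functional_nonneg_convex_cone_hull[of G F z] unfolding G(2) by blast
  then show ?thesis unfolding F[symmetric] functional_mult_add by blast
qed

text \<open>The sum of the generators lies in the relative interior of the cone.\<close>

lemma rational_cone_interior_point:
  assumes "rational_polyhedral_cone \<sigma>"
  shows "\<exists>z0\<in>\<sigma>. \<forall>u k. (\<forall>z\<in>\<sigma>. 0 \<le> functional u k z) \<and> functional u k z0 = 0 \<longrightarrow>
    (\<forall>z\<in>\<sigma>. functional u k z = 0)"
proof -
  obtain G where G: "finite G" "\<sigma> = convex_cone hull G"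
    using assms unfolding rational_polyhedral_cone_def by blast
  have cc: "convex_cone \<sigma>" unfolding G(2) by (rule convex_cone_convex_cone_hull)
  have "sum (\<lambda>g. g) H \<in> \<sigma>" if "finite H" "H \<subseteq> G" for H
    using that
  proof (induction H)
    case empty then show ?case using cc convex_cone_contains_0 by simp
  next
    case (insert x F)
    then show ?case using convex_cone_add[OF cc] by (simp add: G(2) hull_inc)
  qed
  then have z0: "sum (\<lambda>g. g) G \<in> \<sigma>" using G(1) by blast
  show ?thesis
  proof (intro bexI[OF _ z0] allI impI ballI)
    fix u k z
    assume uk: "(\<forall>z\<in>\<sigma>. 0 \<le> functional u k z) \<and> functional u k (sum (\<lambda>g. g) G) = 0" and z: "z \<in> \<sigma>"
    have "(\<Sum>g\<in>G. functional u k g) = 0" using uk functional_sum_right[of u k "\<lambda>g. g" G] by simp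
    moreover have "0 \<le> functional u k g" if "g \<in> G" for g using uk that G(2) by (simp add: hull_inc)
    ultimately have "\<forall>g\<in>G. functional u k g = 0" using sum_nonneg_eq_0_iff[OF G(1)] by blast
    then have "0 \<le> functional (- u) (- k) z"
      using functional_nonneg_convex_cone_hull[of G "((\<chi> i. real_of_int ((- u) $ i)), real_of_int (- k))" z] z
      unfolding G(2) functional_inner[symmetric] functional_uminus_left by auto
    then show "functional u k z = 0" using uk z unfolding functional_uminus_left by force
  qed
qed

section \<open>Chart rings\<close>

locale toric_setup = toric_data val \<pi> \<Sigma>
  for val :: "'k::field \<Rightarrow> ereal" and \<pi> :: 'k and \<Sigma> :: "'n::finite cone set" +
  assumes dv: "discrete_valuation val" and val_pi: "val \<pi> = 1" and fan_Sigma: "fan \<Sigma>"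
begin

text \<open>The valuation as an integer, which keeps extended reals out of the combinatorics. Its
  value at 0 is unspecified, so conditions on \<open>vl a\<close> are guarded by
  \<open>a = 0\<close>.\<close>

definition vl :: "'k \<Rightarrow> int" where
  "vl a = (THE k. val a = ereal (of_int k))"

lemma val_infinity_iff: "val a = \<infinity> \<longleftrightarrow> a = 0"
  and val_ex_int: "a \<noteq> 0 \<Longrightarrow> \<exists>k::int. val a = ereal (of_int k)"
  and val_mult: "val (a * b) = val a + val b"
  and val_add: "min (val a) (val b) \<le> val (a + b)"
  using dv by (simp_all add: discrete_valuation_def)

lemma val_vl: "a \<noteq> 0 \<Longrightarrow> val a = ereal (of_int (vl a))"
  using val_ex_int[of a] unfolding vl_def by (auto intro: theI)

lemma val_zero [simp]: "val 0 = \<infinity>"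
  using val_infinity_iff by blast

lemma vl_unique: "val a = ereal (of_int k) \<Longrightarrow> vl a = k"
  unfolding vl_def by auto

lemma vl_mult: "a \<noteq> 0 \<Longrightarrow> b \<noteq> 0 \<Longrightarrow> vl (a * b) = vl a + vl b"
  by (intro vl_unique) (simp add: val_mult val_vl)

lemma vl_one [simp]: "vl 1 = 0"
  using vl_mult[of 1 1] by simp

lemma vl_inverse: "a \<noteq> 0 \<Longrightarrow> vl (inverse a) = - vl a"
  using vl_mult[of a "inverse a"] by simp

lemma vl_uminus [simp]: "vl (- a) = vl a"
proof (cases "a = 0")
  case False
  have "vl (- 1) + vl (- 1) = vl ((- 1) * (- 1))" by (rule vl_mult[symmetric]) auto
  then have "vl (- 1) = 0" by simp
  then show ?thesis using vl_mult[of "- 1" a] False by simp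
qed simp

lemma vl_add: "a \<noteq> 0 \<Longrightarrow> b \<noteq> 0 \<Longrightarrow> a + b \<noteq> 0 \<Longrightarrow> min (vl a) (vl b) \<le> vl (a + b)"
  using val_add[of a b] by (simp add: val_vl min_def split: if_splits)

lemma pi_nonzero: "\<pi> \<noteq> 0"
  using val_pi val_infinity_iff[of \<pi>] by auto

lemma vl_pi [simp]: "vl \<pi> = 1"
  by (rule vl_unique) (simp add: val_pi one_ereal_def)

lemma vl_power: "a \<noteq> 0 \<Longrightarrow> vl (a ^ n) = int n * vl a"
  by (induction n) (simp_all add: vl_mult algebra_simps)

lemma vl_pi_powi [simp]: "vl (\<pi> powi k) = k"
  using pi_nonzero by (cases "k \<ge> 0") (auto simp: power_int_def vl_power vl_inverse)

section \<open>Elementary properties of the cones of a fan\<close>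

lemma cone_facts:
  assumes "\<sigma> \<in> \<Sigma>"
  shows cone_rational: "rational_polyhedral_cone \<sigma>" and cone_strictly_convex: "strictly_convex \<sigma>"
    and cone_half_space: "z \<in> \<sigma> \<Longrightarrow> 0 \<le> snd z" and cone_convex_cone: "convex_cone \<sigma>"
    and zero_in_cone: "0 \<in> \<sigma>"
proof -
  have "\<forall>\<sigma>\<in>\<Sigma>. rational_polyhedral_cone \<sigma> \<and> strictly_convex \<sigma> \<and> \<sigma> \<subseteq> half_space"
    using fan_Sigma by (simp add: fan_def)
  then have r: "rational_polyhedral_cone \<sigma>" "strictly_convex \<sigma>" "\<sigma> \<subseteq> half_space"
    using assms by simp_all
  show "rational_polyhedral_cone \<sigma>" "strictly_convex \<sigma>" by fact+
  show "0 \<le> snd z" if "z \<in> \<sigma>"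
    using subsetD[OF r(3) that] by (auto simp: half_space_def)
  show "convex_cone \<sigma>" using r(1) convex_cone_convex_cone_hull unfolding rational_polyhedral_cone_def by blast
  then show "0 \<in> \<sigma>" by (rule convex_cone_contains_0)
qed

lemma fan_face: "\<sigma> \<in> \<Sigma> \<Longrightarrow> \<tau> face_of \<sigma> \<Longrightarrow> \<tau> \<noteq> {} \<Longrightarrow> \<tau> \<in> \<Sigma>"
  using fan_Sigma by (simp add: fan_def)

lemma cone_Int_face: "\<sigma> \<in> \<Sigma> \<Longrightarrow> \<tau> \<in> \<Sigma> \<Longrightarrow> (\<sigma> \<inter> \<tau>) face_of \<sigma>"
  using fan_Sigma by (simp add: fan_def)

lemma cone_Int_in_Sigma:
  assumes "\<sigma> \<in> \<Sigma>" "\<tau> \<in> \<Sigma>" shows "\<sigma> \<inter> \<tau> \<in> \<Sigma>"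
proof -
  have "\<sigma> \<inter> \<tau> \<noteq> {}" using zero_in_cone assms by blast
  then show ?thesis using fan_face[OF assms(1) cone_Int_face[OF assms]] by blast
qed

text \<open>By strict convexity the origin is an extreme point of any cone of the fan, hence a face:
  two points of the cone with the origin strictly between them have multiples that are negatives of
  each other.\<close>

lemma zero_cone_in_Sigma: "{0} \<in> \<Sigma>"
proof -
  obtain \<sigma> where s: "\<sigma> \<in> \<Sigma>" using fan_Sigma by (auto simp: fan_def)
  have cc: "convex_cone \<sigma>" by (rule cone_convex_cone[OF s])
  have "{0} face_of \<sigma>"
    unfolding face_of_def
  proof (intro conjI ballI impI)
    show "{0} \<subseteq> \<sigma>" using zero_in_cone[OF s] by blast
    show "convex {0 :: (real ^ 'n) \<times> real}" by simp
    fix a b x assume ab: "a \<in> \<sigma>" "b \<in> \<sigma>" "x \<in> {0}" "x \<in> open_segment a b"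
    then obtain u where u: "0 < u" "u < 1" "0 = (1 - u) *\<^sub>R a + u *\<^sub>R b"
      by (auto simp: in_segment)
    have A: "(1 - u) *\<^sub>R a \<in> \<sigma>" and B: "u *\<^sub>R b \<in> \<sigma>"
      using convex_cone_scaleR[OF cc] ab u by auto
    have "- ((1 - u) *\<^sub>R a) = u *\<^sub>R b" using u(3) by (simp add: add_eq_0_iff)
    then have "(1 - u) *\<^sub>R a = 0" "u *\<^sub>R b = 0"
      using cone_strictly_convex[OF s] A B unfolding strictly_convex_def by (metis neg_equal_0_iff_equal)+
    then show "a \<in> {0}" "b \<in> {0}" using u by auto
  qed
  then show ?thesis by (rule fan_face[OF s]) simp
qed

section \<open>Chart rings in terms of admissible monomials\<close>

definition monomial_ok :: "'n cone \<Rightarrow> int ^ 'n \<Rightarrow> 'k \<Rightarrow> bool" where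
  "monomial_ok \<sigma> u a \<longleftrightarrow> a = 0 \<or> (\<forall>z\<in>\<sigma>. 0 \<le> functional u (vl a) z)"

text \<open>Cones lie in nonnegative height, so raising a valuation raises the functional. This is
  what lets the ultrametric inequality pass to conditions on terms and to the norms.\<close>

lemma functional_mono:
  assumes "k \<le> l" "0 \<le> snd z" shows "functional u k z \<le> functional u l z"
  using assms by (simp add: functional_def mult_right_mono)

lemma monomial_ok_add:
  assumes "\<sigma> \<in> \<Sigma>" "monomial_ok \<sigma> u a" "monomial_ok \<sigma> u b"
  shows "monomial_ok \<sigma> u (a + b)"
proof (cases "a = 0 \<or> b = 0 \<or> a + b = 0")
  case True
  then show ?thesis using assms by (auto simp: monomial_ok_def)
next
  case False
  then have "min (vl a) (vl b) \<le> vl (a + b)" using vl_add by blast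
  then have "vl a \<le> vl (a + b) \<or> vl b \<le> vl (a + b)" by linarith
  then show ?thesis unfolding monomial_ok_def
    using assms(2,3) False functional_mono cone_half_space[OF assms(1)] unfolding monomial_ok_def
    by (meson order_trans)
qed

lemma monomial_ok_mult:
  assumes "monomial_ok \<sigma> u a" "monomial_ok \<sigma> w b"
  shows "monomial_ok \<sigma> (u + w) (a * b)"
  using assms unfolding monomial_ok_def by (auto simp: vl_mult functional_add_left add_nonneg_nonneg)

lemma monomial_ok_sum:
  assumes "\<sigma> \<in> \<Sigma>" "\<And>i. i \<in> A \<Longrightarrow> monomial_ok \<sigma> u (f i)"
  shows "monomial_ok \<sigma> u (sum f A)"
  using assms(2) by (induction A rule: infinite_finite_induct)
    (auto simp: monomial_ok_add[OF assms(1)], auto simp: monomial_ok_def)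

lemma mterm_in_chart_ring:
  assumes "monomial_ok \<sigma> u a"
  shows "mterm u a \<in> chart_ring \<sigma>"
proof (cases "a = 0")
  case True
  have "mterm 0 0 \<in> chart_ring \<sigma>" by (rule chart_ring.scalar) simp
  then show ?thesis using True by simp
next
  case False
  \<comment> \<open>The coefficient is a unit of the valuation ring times a power of the
    uniformizer; the unit is a scalar generator of the chart ring and the power belongs to a
    monomial generator.\<close>
  define b where "b = a * \<pi> powi (- vl a)"
  have "vl b = 0" unfolding b_def using False pi_nonzero by (subst vl_mult) (auto simp: power_int_eq_0_iff)
  then have "val b = 0" using False pi_nonzero val_vl[of b] by (simp add: b_def power_int_eq_0_iff)
  then have 1: "mterm 0 b \<in> chart_ring \<sigma>" by (intro chart_ring.scalar) simp
  have 2: "mterm u (\<pi> powi vl a) \<in> chart_ring \<sigma>"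
    using assms False by (intro chart_ring.monomial) (simp add: dual_lattice_points_iff monomial_ok_def)
  have "b * \<pi> powi vl a = a" unfolding b_def using pi_nonzero by (simp add: power_int_minus)
  then have "mterm 0 b * mterm u (\<pi> powi vl a) = mterm u a" by (simp add: mult_single)
  then show ?thesis using chart_ring.mult[OF 1 2] by simp
qed

text \<open>The condition on terms is stable under sums and products and holds for the generators,
  and every admissible term is a product of generators. In particular the chart ring contains each
  term of its elements.\<close>

lemma chart_ring_iff:
  assumes s: "\<sigma> \<in> \<Sigma>"
  shows "f \<in> chart_ring \<sigma> \<longleftrightarrow> (\<forall>u. monomial_ok \<sigma> u (coef f u))"
proof
  assume "f \<in> chart_ring \<sigma>"
  then show "\<forall>u. monomial_ok \<sigma> u (coef f u)"
  proof induction
    case (scalar a)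
    show ?case
    proof
      fix u
      show "monomial_ok \<sigma> u (coef (mterm 0 a) u)"
        using scalar val_vl[of a] cone_half_space[OF s]
        by (cases "u = 0") (auto simp: monomial_ok_def lookup_single when_def functional_def)
    qed
  next
    case (monomial u k)
    then show ?case
      by (auto simp: monomial_ok_def lookup_single when_def dual_lattice_points_iff)
  next
    case (add f g)
    then show ?case using monomial_ok_add[OF s] by (simp add: lookup_add)
  next
    case (mult f g)
    show ?case
    proof
      fix k
      have "monomial_ok \<sigma> k (coef f l * coef g (k - l))" for l
        using monomial_ok_mult[of \<sigma> l "coef f l" "k - l" "coef g (k - l)"] mult.IH by simp
      then show "monomial_ok \<sigma> k (coef (f * g) k)"
        unfolding coef_mult by (intro monomial_ok_sum[OF s])
    qed
  qed
next
  assume ok: "\<forall>u. monomial_ok \<sigma> u (coef f u)"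
  have z: "0 \<in> chart_ring \<sigma>" using mterm_in_chart_ring[of \<sigma> 0 0] by (simp add: monomial_ok_def)
  have "(\<Sum>u\<in>A. mterm u (coef f u)) \<in> chart_ring \<sigma>" if "finite A" for A
    using that by (induction A) (auto simp: z intro!: chart_ring.add mterm_in_chart_ring ok[rule_format])
  then show "f \<in> chart_ring \<sigma>" using sum_mterms[of f] by (metis finite_keys)
qed

lemma subring_chart_ring: "\<sigma> \<in> \<Sigma> \<Longrightarrow> subring_of (chart_ring \<sigma>)"
  unfolding subring_of_def
proof (intro conjI ballI)
  assume s: "\<sigma> \<in> \<Sigma>"
  show "1 \<in> chart_ring \<sigma>" using mterm_in_chart_ring[of \<sigma> 0 1] by (simp add: monomial_ok_def)
  fix a assume "a \<in> chart_ring \<sigma>"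
  then show "- a \<in> chart_ring \<sigma>" unfolding chart_ring_iff[OF s] by (simp add: monomial_ok_def)
qed (auto intro: chart_ring.add chart_ring.mult)

lemma chart_ring_zero_cone: "chart_ring {0} = UNIV"
proof -
  have "f \<in> chart_ring {0}" for f
    unfolding chart_ring_iff[OF zero_cone_in_Sigma] monomial_ok_def by (simp add: functional_inner)
  then show ?thesis by blast
qed

lemma chart_ring_antimono:
  assumes "\<sigma> \<in> \<Sigma>" "\<tau> \<in> \<Sigma>" "\<tau> \<subseteq> \<sigma>" shows "chart_ring \<sigma> \<subseteq> chart_ring \<tau>"
  using assms unfolding subset_iff chart_ring_iff[OF assms(1)] chart_ring_iff[OF assms(2)] monomial_ok_def by blast

text \<open>The chart ring of a face is the localization of the chart ring at a monomial.\<close>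

definition cuts_face :: "'n cone \<Rightarrow> int ^ 'n \<Rightarrow> 'k \<Rightarrow> 'n cone \<Rightarrow> bool" where
  "cuts_face \<sigma> u a \<tau> \<longleftrightarrow> a \<noteq> 0 \<and> (\<forall>z\<in>\<sigma>. 0 \<le> functional u (vl a) z) \<and>
     \<tau> = {z \<in> \<sigma>. functional u (vl a) z = 0}"

lemma ex_cuts_face:
  assumes s: "\<sigma> \<in> \<Sigma>" "\<tau> \<in> \<Sigma>" "\<tau> \<subseteq> \<sigma>"
  shows "\<exists>u a. cuts_face \<sigma> u a \<tau>"
proof -
  have "\<tau> face_of \<sigma>" using cone_Int_face[OF s(1,2)] s(3) by (simp add: Int_absorb1)
  then obtain u k where uk: "\<forall>z\<in>\<sigma>. 0 \<le> functional u k z" "\<tau> = {z \<in> \<sigma>. functional u k z = 0}"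
    using rational_cone_face_functional[OF cone_rational[OF s(1)] _ zero_in_cone[OF s(2)]] by blast
  \<comment> \<open>The power of the uniformizer realises the integer \<open>k\<close> of the
    supporting functional as a valuation.\<close>
  have "\<pi> powi k \<noteq> 0" using pi_nonzero by (simp add: power_int_eq_0_iff)
  then have "cuts_face \<sigma> u (\<pi> powi k) \<tau>" using uk by (simp add: cuts_face_def)
  then show ?thesis by blast
qed

text \<open>A sum of two nonnegative functionals vanishes exactly where both vanish. The product
  monomial is what allows a prime to be extended to a triple overlap.\<close>

lemma cuts_face_mult:
  assumes "cuts_face \<sigma> u a \<tau>" "cuts_face \<sigma> w b \<rho>"
  shows "cuts_face \<sigma> (u + w) (a * b) (\<tau> \<inter> \<rho>)"
proof -
  have nz: "a \<noteq> 0" "b \<noteq> 0" using assms by (auto simp: cuts_face_def)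
  have A: "0 \<le> functional u (vl a) z" "0 \<le> functional w (vl b) z" if "z \<in> \<sigma>" for z
    using assms that by (auto simp: cuts_face_def)
  have t: "\<tau> = {z \<in> \<sigma>. functional u (vl a) z = 0}" "\<rho> = {z \<in> \<sigma>. functional w (vl b) z = 0}"
    using assms by (auto simp: cuts_face_def)
  show ?thesis unfolding cuts_face_def
    using nz A add_nonneg_eq_0_iff[OF A]
    by (auto simp: vl_mult functional_add_left add_nonneg_nonneg t)
qed

lemma cuts_face_mterm: "cuts_face \<sigma> u a \<tau> \<Longrightarrow> mterm u a \<in> chart_ring \<sigma>"
  by (rule mterm_in_chart_ring) (simp add: cuts_face_def monomial_ok_def)

lemma cuts_face_inverse:
  "cuts_face \<sigma> u a \<tau> \<Longrightarrow> mterm (- u) (inverse a) \<in> chart_ring \<tau>"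
  by (rule mterm_in_chart_ring) (auto simp: cuts_face_def monomial_ok_def vl_inverse functional_uminus_left)

text \<open>For one term, \<open>functional_nonneg_on_face\<close> gives an exponent, and all larger
  ones work too; the maximum over the finite support serves for \<open>f\<close>.\<close>

lemma cuts_face_localization:
  assumes s: "\<sigma> \<in> \<Sigma>" "\<tau> \<in> \<Sigma>" and c: "cuts_face \<sigma> u a \<tau>" and f: "f \<in> chart_ring \<tau>"
  shows "\<exists>n. mterm u a ^ n * f \<in> chart_ring \<sigma>"
proof -
  have a: "a \<noteq> 0" and uk: "\<And>z. z \<in> \<sigma> \<Longrightarrow> 0 \<le> functional u (vl a) z"
    and t: "\<tau> = {z \<in> \<sigma>. functional u (vl a) z = 0}"
    using c by (auto simp: cuts_face_def)
  note 1 = cuts_face_mterm[OF c]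
  have pow: "mterm u a ^ n = mterm (of_nat n * u) (a ^ n)" for n
    by (induction n) (simp_all add: mult_single algebra_simps)
  have R: "subring_of (chart_ring \<sigma>)" by (rule subring_chart_ring[OF s(1)])
  have ex: "\<exists>N. \<forall>n\<ge>N. mterm u a ^ n * mterm w b \<in> chart_ring \<sigma>" if ok: "monomial_ok \<tau> w b" for w b
  proof (cases "b = 0")
    case True then show ?thesis by (simp add: subring_zero[OF R])
  next
    case False
    then have "0 \<le> functional w (vl b) z" if "z \<in> \<sigma>" "functional u (vl a) z = 0" for z
      using ok that unfolding monomial_ok_def t by blast
    then obtain N :: nat where N: "\<forall>z\<in>\<sigma>. 0 \<le> functional (w + of_nat N * u) (vl b + of_nat N * vl a) z"
      using functional_nonneg_on_face[OF cone_rational[OF s(1)] uk] by blast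
    have "mterm u a ^ N * mterm w b \<in> chart_ring \<sigma>"
      unfolding pow mult_single
      by (intro mterm_in_chart_ring) (use N False a in \<open>simp add: monomial_ok_def vl_mult vl_power add.commute\<close>)
    then have "mterm u a ^ (m + N) * mterm w b \<in> chart_ring \<sigma>" for m
      using 1 by (induction m) (auto simp: mult.assoc intro: chart_ring.mult)
    then show ?thesis by (metis le_Suc_ex add.commute)
  qed
  have "\<forall>w. \<exists>N. \<forall>n\<ge>N. mterm u a ^ n * mterm w (coef f w) \<in> chart_ring \<sigma>"
    using f ex unfolding chart_ring_iff[OF s(2)] by blast
  then obtain N where N: "\<And>w n. n \<ge> N w \<Longrightarrow> mterm u a ^ n * mterm w (coef f w) \<in> chart_ring \<sigma>" by metis
  define n where "n = Max (N ` supp f)"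
  have "mterm u a ^ n * (\<Sum>w\<in>supp f. mterm w (coef f w)) \<in> chart_ring \<sigma>"
    unfolding sum_distrib_left by (rule subring_sum[OF R], rule N) (simp add: n_def)
  then show ?thesis unfolding sum_mterms by blast
qed

text \<open>
  The prime ideal contains the ideal generated by all monomials of the chart ring that are not units.
\<close>

lemma ex_prime_unit_terms:
  assumes s: "\<sigma> \<in> \<Sigma>"
  shows "\<exists>q. prime_in q (chart_ring \<sigma>) \<and>
    (\<forall>f\<in>chart_ring \<sigma> - q. \<exists>w. coef f w \<noteq> 0 \<and> mterm (- w) (inverse (coef f w)) \<in> chart_ring \<sigma>)"
proof -
  obtain z0 where z0: "z0 \<in> \<sigma>"
    "\<forall>u k. (\<forall>z\<in>\<sigma>. 0 \<le> functional u k z) \<and> functional u k z0 = 0 \<longrightarrow> (\<forall>z\<in>\<sigma>. functional u k z = 0)"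
    using rational_cone_interior_point[OF cone_rational[OF s]] by (elim bexE)
  \<comment> \<open>The terms with \<open>pos\<close> are those that are not units: an admissible
    functional that vanishes at the interior point \<open>z0\<close> vanishes on all of
    \<open>\<sigma>\<close>, and then the inverse monomial is admissible as well.\<close>
  define pos where "pos u a \<longleftrightarrow> a = 0 \<or> functional u (vl a) z0 > 0" for u a
  define I where "I = {f \<in> chart_ring \<sigma>. \<forall>u. pos u (coef f u)}"
  have R: "subring_of (chart_ring \<sigma>)" by (rule subring_chart_ring[OF s])
  have pos_add: "pos u (a + b)" if "pos u a" "pos u b" for u a b
  proof (cases "a = 0 \<or> b = 0 \<or> a + b = 0")
    case True
    then show ?thesis using that by (auto simp: pos_def)
  next
    case False
    then have "min (vl a) (vl b) \<le> vl (a + b)" using vl_add by blast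
    then have "vl a \<le> vl (a + b) \<or> vl b \<le> vl (a + b)" by linarith
    then show ?thesis
      using that False functional_mono cone_half_space[OF s z0(1)] unfolding pos_def
      by (meson less_le_trans)
  qed
  have pos_sum: "pos u (sum f A)" if "\<And>i. i \<in> A \<Longrightarrow> pos u (f i)" for u A and f :: "int ^ 'n \<Rightarrow> 'k"
    using that by (induction A rule: infinite_finite_induct) (auto simp: pos_add, auto simp: pos_def)
  have I: "ideal_in I (chart_ring \<sigma>)" unfolding ideal_in_def
  proof (intro conjI ballI)
    show "0 \<in> I" by (simp add: I_def pos_def subring_zero[OF R])
    fix f g assume "f \<in> I" "g \<in> I"
    then show "f + g \<in> I" by (simp add: I_def lookup_add pos_add chart_ring.add)
  next
    fix f g assume f: "f \<in> chart_ring \<sigma>" and g: "g \<in> I"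
    have "pos k (coef f l * coef g (k - l))" for k l
    proof (cases "coef f l = 0 \<or> coef g (k - l) = 0")
      case True then show ?thesis by (auto simp: pos_def)
    next
      case False
      have "0 \<le> functional l (vl (coef f l)) z0"
        using f False z0(1) unfolding chart_ring_iff[OF s] monomial_ok_def by blast
      moreover have "0 < functional (k - l) (vl (coef g (k - l))) z0"
        using g False unfolding I_def pos_def by blast
      ultimately have "0 < functional (l + (k - l)) (vl (coef f l) + vl (coef g (k - l))) z0"
        unfolding functional_add_left by simp
      then show ?thesis using False by (simp add: pos_def vl_mult)
    qed
    then have "\<forall>k. pos k (coef (f * g) k)" unfolding coef_mult by (blast intro: pos_sum)
    then show "f * g \<in> I" using f g by (auto simp: I_def intro: chart_ring.mult)
  qed (auto simp: I_def)
  have "1 \<notin> I" by (auto simp: I_def pos_def lookup_one when_def intro!: exI[of _ 0])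
  then obtain q where q: "prime_in q (chart_ring \<sigma>)" "I \<subseteq> q"
    using ideal_in_no_prime[OF R I] by blast
  have "\<exists>w. coef f w \<noteq> 0 \<and> mterm (- w) (inverse (coef f w)) \<in> chart_ring \<sigma>" if f: "f \<in> chart_ring \<sigma> - q" for f
  proof -
    have "f \<notin> I" using f q(2) by blast
    then obtain w where w: "coef f w \<noteq> 0" "\<not> 0 < functional w (vl (coef f w)) z0"
      using f by (auto simp: I_def pos_def)
    have ok: "\<forall>z\<in>\<sigma>. 0 \<le> functional w (vl (coef f w)) z"
      using f w unfolding chart_ring_iff[OF s] Diff_iff monomial_ok_def by blast
    then have "functional w (vl (coef f w)) z0 = 0" using w(2) z0(1) by force
    then have "\<forall>z\<in>\<sigma>. functional w (vl (coef f w)) z = 0" using z0(2) ok by blast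
    then have "monomial_ok \<sigma> (- w) (inverse (coef f w))"
      using w(1) by (simp add: monomial_ok_def vl_inverse functional_uminus_left)
    then show ?thesis using w(1) mterm_in_chart_ring by blast
  qed
  then show ?thesis using q(1) by blast
qed

end

section \<open>Fractions of Laurent polynomials\<close>

type_synonym ('n, 'k) lfrac = "('n, 'k) laurent total_frac"

lemma nonzerodivisor_laurent_iff [simp]:
  fixes b :: "('n::finite, 'k::field) laurent"
  shows "nonzerodivisor b \<longleftrightarrow> b \<noteq> 0"
proof
  assume "nonzerodivisor b"
  then have "b * 1 = 0 \<longrightarrow> (1 :: ('n, 'k) laurent) = 0" unfolding nonzerodivisor_def by blast
  then show "b \<noteq> 0" by auto
qed (auto simp: nonzerodivisor_def)

lemma Frac_eq_iff_nonzerodivisor: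
  "nonzerodivisor b \<Longrightarrow> nonzerodivisor d \<Longrightarrow> Frac a b = Frac c d \<longleftrightarrow> a * d = c * b"
  by transfer (simp add: frac_rel_def)

lemma Frac_add_nonzerodivisor:
  "nonzerodivisor b \<Longrightarrow> nonzerodivisor d \<Longrightarrow> Frac a b + Frac c d = Frac (a * d + c * b) (b * d)"
  by transfer (simp add: frac_rel_def nonzerodivisor_mult)

lemma Frac_mult_nonzerodivisor:
  "nonzerodivisor b \<Longrightarrow> nonzerodivisor d \<Longrightarrow> Frac a b * Frac c d = Frac (a * c) (b * d)"
  by transfer (simp add: frac_rel_def nonzerodivisor_mult)

lemma Frac_0_1: "Frac 0 1 = 0"
  by transfer (simp add: frac_rel_def nonzerodivisor_one)

lemma Frac_1_1: "Frac 1 1 = 1"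
  by transfer (simp add: frac_rel_def nonzerodivisor_one)

lemma Frac_cases_nonzerodivisor:
  obtains a b where "nonzerodivisor b" "q = Frac a b"
proof -
  obtain a b where ab: "rep_total_frac q = (a, b)" by force
  have "frac_rel (rep_total_frac q) (rep_total_frac q)" by (rule Quotient_rep_reflp[OF Quotient_total_frac])
  then have b: "nonzerodivisor b" by (simp add: ab frac_rel_def)
  have "q = abs_total_frac (a, b)" using Quotient_abs_rep[OF Quotient_total_frac, of q] ab by simp
  then have "q = Frac a b" using b by (simp add: Frac_def)
  then show ?thesis using b that by blast
qed

context
  fixes a b c d :: "('n::finite, 'k::field) laurent"
  assumes bd: "b \<noteq> 0" "d \<noteq> 0"
begin

lemma Frac_eq_iff: "Frac a b = Frac c d \<longleftrightarrow> a * d = c * b"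
  using bd by (simp add: Frac_eq_iff_nonzerodivisor)

lemma Frac_add: "Frac a b + Frac c d = Frac (a * d + c * b) (b * d)"
  using bd by (simp add: Frac_add_nonzerodivisor)

lemma Frac_mult: "Frac a b * Frac c d = Frac (a * c) (b * d)"
  using bd by (simp add: Frac_mult_nonzerodivisor)

end

lemma Frac_cases:
  fixes q :: "('n::finite, 'k::field) lfrac"
  obtains a b where "b \<noteq> 0" "q = Frac a b"
  by (rule Frac_cases_nonzerodivisor[of q]) (use that in simp)

definition of_laurent :: "('n::finite, 'k::field) laurent \<Rightarrow> ('n, 'k) lfrac" where
  "of_laurent f = Frac f 1"

lemma of_laurent_0 [simp]: "of_laurent 0 = 0"
  unfolding of_laurent_def by (rule Frac_0_1)

lemma of_laurent_1 [simp]: "of_laurent 1 = 1"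
  unfolding of_laurent_def by (rule Frac_1_1)

lemma of_laurent_add [simp]: "of_laurent (f + g) = of_laurent f + of_laurent g"
  by (simp add: of_laurent_def Frac_add)

lemma of_laurent_mult [simp]: "of_laurent (f * g) = of_laurent f * of_laurent g"
  by (simp add: of_laurent_def Frac_mult)

lemma of_laurent_power [simp]: "of_laurent (f ^ n) = of_laurent f ^ n"
  by (induction n) simp_all

lemma of_laurent_sum [simp]: "of_laurent (sum f A) = (\<Sum>i\<in>A. of_laurent (f i))"
  by (induction A rule: infinite_finite_induct) simp_all

lemma of_laurent_eq_iff [simp]: "of_laurent f = of_laurent g \<longleftrightarrow> f = g"
  by (simp add: of_laurent_def Frac_eq_iff)

lemma of_laurent_eq_0_iff [simp]: "of_laurent f = 0 \<longleftrightarrow> f = 0"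
  using of_laurent_eq_iff[of f 0] by simp

lemma of_laurent_uminus [simp]: "of_laurent (- f) = - of_laurent f"
  using of_laurent_add[of f "- f"] by (simp add: eq_neg_iff_add_eq_0 add.commute)

lemma of_laurent_mult_Frac:
  "b \<noteq> 0 \<Longrightarrow> of_laurent f * Frac a b = Frac (f * a) b"
  by (simp add: of_laurent_def Frac_mult)

lemma of_laurent_denominator: "b \<noteq> 0 \<Longrightarrow> of_laurent b * Frac a b = of_laurent a"
  by (simp add: of_laurent_mult_Frac) (simp add: of_laurent_def Frac_eq_iff mult.commute)

lemma lfrac_inverse:
  fixes q :: "('n::finite, 'k::field) lfrac"
  assumes "q \<noteq> 0" shows "\<exists>q'. q * q' = 1"
proof -
  obtain a b where ab: "b \<noteq> 0" "q = Frac a b" by (rule Frac_cases)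
  have "a \<noteq> 0"
  proof
    assume "a = 0"
    then have "q = Frac 0 1" using ab by (simp add: Frac_eq_iff)
    then show False using assms of_laurent_0 unfolding of_laurent_def by metis
  qed
  then have "q * Frac b a = of_laurent 1" using ab
    by (simp add: Frac_mult of_laurent_def Frac_eq_iff del: of_laurent_1)
  then show ?thesis by auto
qed

lemma lfrac_mult_eq_0_iff [simp]:
  fixes p q :: "('n::finite, 'k::field) lfrac"
  shows "p * q = 0 \<longleftrightarrow> p = 0 \<or> q = 0"
proof
  assume "p * q = 0"
  show "p = 0 \<or> q = 0"
  proof (rule ccontr)
    assume "\<not> (p = 0 \<or> q = 0)"
    then obtain p' q' where "p * p' = 1" "q * q' = 1" using lfrac_inverse by blast
    then have "(p * q) * (p' * q') = 1" by (simp add: mult.assoc mult.left_commute[of q])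
    then show False using \<open>p * q = 0\<close> by simp
  qed
qed auto

lemma lfrac_mult_left_cancel:
  fixes a p q :: "('n::finite, 'k::field) lfrac"
  assumes "a \<noteq> 0" "a * p = a * q" shows "p = q"
proof -
  have "a * (p - q) = 0" using assms(2) by (simp add: right_diff_distrib)
  then show ?thesis using assms(1) by simp
qed

section \<open>Points of the toric scheme\<close>

context toric_setup
begin

lemma spec_iff: "\<sigma> \<in> \<Sigma> \<Longrightarrow> p \<in> spec \<sigma> \<longleftrightarrow> prime_in p (chart_ring \<sigma>)"
  unfolding spec_def using primeideal_subring_struct[OF subring_chart_ring] by simp

lemma one_in_chart_ring: "\<sigma> \<in> \<Sigma> \<Longrightarrow> 1 \<in> chart_ring \<sigma>"
  using subring_chart_ring by (auto simp: subring_of_def)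

lemma chart_ring_power: "\<sigma> \<in> \<Sigma> \<Longrightarrow> f \<in> chart_ring \<sigma> \<Longrightarrow> f ^ n \<in> chart_ring \<sigma>"
  using subring_power[OF subring_chart_ring] by blast

context
  fixes \<sigma> p assumes s: "\<sigma> \<in> \<Sigma>" and p: "p \<in> spec \<sigma>"
begin

lemma spec_subset: "p \<subseteq> chart_ring \<sigma>"
  and spec_zero: "0 \<in> p"
  and spec_one: "1 \<notin> p"
  and spec_add: "f \<in> p \<Longrightarrow> g \<in> p \<Longrightarrow> f + g \<in> p"
  and spec_mult_left: "f \<in> chart_ring \<sigma> \<Longrightarrow> g \<in> p \<Longrightarrow> f * g \<in> p"
  and spec_mult_right: "f \<in> p \<Longrightarrow> g \<in> chart_ring \<sigma> \<Longrightarrow> f * g \<in> p"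
  and spec_prime: "f \<in> chart_ring \<sigma> \<Longrightarrow> g \<in> chart_ring \<sigma> \<Longrightarrow> f * g \<in> p \<Longrightarrow> f \<in> p \<or> g \<in> p"
proof -
  have P: "prime_in p (chart_ring \<sigma>)" using spec_iff s p by blast
  show "p \<subseteq> chart_ring \<sigma>" "0 \<in> p" "1 \<notin> p"
    using P by (simp_all add: prime_in_def ideal_in_def)
  show "f \<in> p \<Longrightarrow> g \<in> p \<Longrightarrow> f + g \<in> p"
    using P by (simp add: prime_in_def ideal_in_def)
  show m: "f \<in> chart_ring \<sigma> \<Longrightarrow> g \<in> p \<Longrightarrow> f * g \<in> p" for f g
    using P by (simp add: prime_in_def ideal_in_def)
  show "f \<in> p \<Longrightarrow> g \<in> chart_ring \<sigma> \<Longrightarrow> f * g \<in> p" using m[of g f] by (simp add: mult.commute)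
  show "f \<in> chart_ring \<sigma> \<Longrightarrow> g \<in> chart_ring \<sigma> \<Longrightarrow> f * g \<in> p \<Longrightarrow> f \<in> p \<or> g \<in> p"
    using P by (simp add: prime_in_def)
qed

lemma spec_mult_iff: "f \<in> chart_ring \<sigma> \<Longrightarrow> g \<in> chart_ring \<sigma> \<Longrightarrow> f * g \<in> p \<longleftrightarrow> f \<in> p \<or> g \<in> p"
  using spec_prime spec_mult_left spec_mult_right by blast

lemma spec_power: "f \<in> chart_ring \<sigma> \<Longrightarrow> f \<notin> p \<Longrightarrow> f ^ n \<notin> p"
proof (induction n)
  case 0 show ?case using spec_one by simp
next
  case (Suc n)
  then show ?case using spec_mult_iff[of f "f ^ n"] chart_ring_power[OF s] by simp
qed

lemma spec_unit: "f * g = 1 \<Longrightarrow> g \<in> chart_ring \<sigma> \<Longrightarrow> f \<notin> p"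
  using spec_mult_right spec_one by force

lemma spec_nonzero: "f \<notin> p \<Longrightarrow> f \<noteq> 0"
  using spec_zero by auto

end

section \<open>Primes of a chart and of the charts of its faces\<close>

lemma mterm_inverse: "a \<noteq> (0 :: 'k) \<Longrightarrow> mterm (u :: int ^ 'n) a * mterm (- u) (inverse a) = 1"
  by (simp add: mult_single)

context
  fixes \<sigma> \<tau> u a assumes s: "\<sigma> \<in> \<Sigma>" "\<tau> \<in> \<Sigma>" and c: "cuts_face \<sigma> u a \<tau>"
begin

lemma cuts_face_subset: "\<tau> \<subseteq> \<sigma>"
  using c by (auto simp: cuts_face_def)

lemma cuts_face_ring_subset: "f \<in> chart_ring \<sigma> \<Longrightarrow> f \<in> chart_ring \<tau>"
  using chart_ring_antimono[OF s cuts_face_subset] by blast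

lemma cuts_face_unit: "P \<in> spec \<tau> \<Longrightarrow> mterm u a \<notin> P"
  using spec_unit[OF s(2) _ mterm_inverse cuts_face_inverse[OF c]] c by (simp add: cuts_face_def)

text \<open>Primes of a localization correspond to primes that avoid the denominators. The extension
  of \<open>p\<close> consists of the elements that some power of the monomial moves into
  \<open>p\<close>.\<close>

lemma spec_extend:
  assumes p: "p \<in> spec \<sigma>" and u: "mterm u a \<notin> p"
  shows "\<exists>P\<in>spec \<tau>. P \<inter> chart_ring \<sigma> = p"
proof -
  let ?m = "mterm u a"
  note m = cuts_face_mterm[OF c]
  let ?P = "{f \<in> chart_ring \<tau>. \<exists>n. ?m ^ n * f \<in> p}"
  have mn: "?m ^ n \<in> chart_ring \<sigma>" for n using chart_ring_power[OF s(1) m] .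
  have mult: "?m ^ (k + n) * f \<in> p" if "?m ^ n * f \<in> p" for k n f
    using spec_mult_left[OF s(1) p mn that, of k] by (simp add: power_add mult.assoc)
  have "prime_in ?P (chart_ring \<tau>)" unfolding prime_in_def ideal_in_def
  proof (intro conjI ballI impI)
    show "0 \<in> ?P" using subring_zero[OF subring_chart_ring[OF s(2)]] spec_zero[OF s(1) p] by simp
    show "1 \<notin> ?P" using spec_power[OF s(1) p m u] by simp
    fix f g assume "f \<in> ?P" "g \<in> ?P"
    then obtain n n' where n: "?m ^ n * f \<in> p" "?m ^ n' * g \<in> p" "f \<in> chart_ring \<tau>" "g \<in> chart_ring \<tau>" by blast
    have "?m ^ (n' + n) * (f + g) \<in> p"
      unfolding distrib_left using mult[OF n(1), of n'] mult[OF n(2), of n]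
      by (intro spec_add[OF s(1) p]) (simp_all add: add.commute)
    then show "f + g \<in> ?P" using n chart_ring.add by blast
  next
    fix f g assume f: "f \<in> chart_ring \<tau>" and "g \<in> ?P"
    then obtain n where n: "?m ^ n * g \<in> p" "g \<in> chart_ring \<tau>" by blast
    obtain k where k: "?m ^ k * f \<in> chart_ring \<sigma>" using cuts_face_localization[OF s c f] by blast
    have "(?m ^ k * f) * (?m ^ n * g) \<in> p" by (rule spec_mult_left[OF s(1) p k n(1)])
    then have "?m ^ (k + n) * (f * g) \<in> p" by (simp add: power_add ac_simps)
    then show "f * g \<in> ?P" using f n chart_ring.mult by blast
  next
    fix f g assume f: "f \<in> chart_ring \<tau>" "g \<in> chart_ring \<tau>" and "f * g \<in> ?P"
    then obtain n where n: "?m ^ n * (f * g) \<in> p" by blast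
    obtain k where k: "?m ^ k * f \<in> chart_ring \<sigma>" using cuts_face_localization[OF s c f(1)] by blast
    obtain l where l: "?m ^ l * g \<in> chart_ring \<sigma>" using cuts_face_localization[OF s c f(2)] by blast
    have "?m ^ ((k + l) + n) * (f * g) \<in> p" by (rule mult[OF n])
    then have "?m ^ n * ((?m ^ k * f) * (?m ^ l * g)) \<in> p" by (simp add: power_add ac_simps)
    then have "(?m ^ k * f) * (?m ^ l * g) \<in> p"
      using spec_power[OF s(1) p m u, of n] k l mn spec_mult_iff[OF s(1) p] chart_ring.mult by blast
    then show "f \<in> ?P \<or> g \<in> ?P" using spec_prime[OF s(1) p k l] f by blast
  qed blast
  then have "?P \<in> spec \<tau>" using spec_iff[OF s(2)] by blast
  moreover have "?P \<inter> chart_ring \<sigma> = p"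
  proof
    show "?P \<inter> chart_ring \<sigma> \<subseteq> p"
    proof
      fix f assume f: "f \<in> ?P \<inter> chart_ring \<sigma>"
      then obtain n where "?m ^ n * f \<in> p" by blast
      then show "f \<in> p" using spec_power[OF s(1) p m u, of n] spec_prime[OF s(1) p mn] f by blast
    qed
    show "p \<subseteq> ?P \<inter> chart_ring \<sigma>"
    proof
      fix f assume f: "f \<in> p"
      then have f': "f \<in> chart_ring \<sigma>" using spec_subset[OF s(1) p] by blast
      moreover have "?m ^ 0 * f \<in> p" using f by simp
      ultimately show "f \<in> ?P \<inter> chart_ring \<sigma>" using cuts_face_ring_subset by blast
    qed
  qed
  ultimately show ?thesis by blast
qed

text \<open>Up to a power of a monomial that is a unit on the face, every element of the larger ring
  already lies in the smaller one.\<close>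

lemma spec_contract_inj:
  assumes P: "P \<in> spec \<tau>" "Q \<in> spec \<tau>" and eq: "P \<inter> chart_ring \<sigma> = Q \<inter> chart_ring \<sigma>"
  shows "P = Q"
proof -
  have "f \<in> Q" if P: "P \<in> spec \<tau>" "Q \<in> spec \<tau>" and eq: "P \<inter> chart_ring \<sigma> = Q \<inter> chart_ring \<sigma>"
    and f: "f \<in> P" for P Q f
  proof -
    have ft: "f \<in> chart_ring \<tau>" using f spec_subset[OF s(2) P(1)] by blast
    then obtain n where n: "mterm u a ^ n * f \<in> chart_ring \<sigma>" using cuts_face_localization[OF s c] by blast
    have m: "mterm u a \<in> chart_ring \<tau>" using cuts_face_mterm[OF c] cuts_face_ring_subset by blast
    have "mterm u a ^ n * f \<in> P" using spec_mult_left[OF s(2) P(1) chart_ring_power[OF s(2) m] f] .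
    then have "mterm u a ^ n * f \<in> Q" using n eq by blast
    then show "f \<in> Q"
      using spec_prime[OF s(2) P(2) chart_ring_power[OF s(2) m] ft] spec_power[OF s(2) P(2) m cuts_face_unit[OF P(2)]] by blast
  qed
  from this[OF P eq] this[OF P(2,1) eq[symmetric]] show ?thesis by blast
qed

end

lemma spec_contract:
  assumes s: "\<sigma> \<in> \<Sigma>" "\<tau> \<in> \<Sigma>" "\<tau> \<subseteq> \<sigma>" and P: "P \<in> spec \<tau>"
  shows "P \<inter> chart_ring \<sigma> \<in> spec \<sigma>"
proof -
  note sub = subsetD[OF chart_ring_antimono[OF s]]
  have "prime_in (P \<inter> chart_ring \<sigma>) (chart_ring \<sigma>)" unfolding prime_in_def ideal_in_def
    using spec_zero[OF s(2) P] spec_one[OF s(2) P] spec_add[OF s(2) P] spec_mult_left[OF s(2) P] spec_prime[OF s(2) P] sub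
      subring_zero[OF subring_chart_ring[OF s(1)]]
    by (auto intro: chart_ring.add chart_ring.mult)
  then show ?thesis using spec_iff[OF s(1)] by blast
qed

section \<open>Gluing of the charts\<close>

lemma glue_rel_iff:
  "((\<sigma>, p), (\<tau>, q)) \<in> glue_rel \<longleftrightarrow> \<sigma> \<in> \<Sigma> \<and> \<tau> \<in> \<Sigma> \<and> p \<in> spec \<sigma> \<and> q \<in> spec \<tau> \<and>
     (\<exists>P\<in>spec (\<sigma> \<inter> \<tau>). P \<inter> chart_ring \<sigma> = p \<and> P \<inter> chart_ring \<tau> = q)"
  by (simp add: glue_rel_def)

text \<open>Only transitivity needs an argument. The middle prime avoids the monomials of
  \<open>\<tau>\<close> that cut out the two overlaps, so it extends to the triple overlap. By
  uniqueness of extensions this prime restricts to the two given ones, and its restriction to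
  \<open>\<sigma> \<inter> \<rho>\<close> glues the outer primes.\<close>

lemma equiv_glue_rel: "equiv (SIGMA \<sigma>:\<Sigma>. spec \<sigma>) glue_rel"
proof (rule equivI)
  show "glue_rel \<subseteq> (SIGMA \<sigma>:\<Sigma>. spec \<sigma>) \<times> (SIGMA \<sigma>:\<Sigma>. spec \<sigma>)" by (auto simp: glue_rel_def)
  show "refl_on (SIGMA \<sigma>:\<Sigma>. spec \<sigma>) glue_rel"
    unfolding refl_on_def
  proof (clarify)
    fix \<sigma> p assume s: "\<sigma> \<in> \<Sigma>" "p \<in> spec \<sigma>"
    then show "((\<sigma>, p), (\<sigma>, p)) \<in> glue_rel"
      unfolding glue_rel_iff using spec_subset[OF s] by (auto intro!: bexI[of _ p])
  qed
  show "sym glue_rel"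
    unfolding sym_def
  proof (clarify)
    fix \<sigma> p \<tau> q assume "((\<sigma>, p), (\<tau>, q)) \<in> glue_rel"
    then show "((\<tau>, q), (\<sigma>, p)) \<in> glue_rel" unfolding glue_rel_iff Int_commute[of \<tau> \<sigma>] by blast
  qed
  show "trans glue_rel"
    unfolding trans_def
  proof (clarify)
    fix \<sigma> p \<tau> q \<rho> r
    assume "((\<sigma>, p), (\<tau>, q)) \<in> glue_rel" "((\<tau>, q), (\<rho>, r)) \<in> glue_rel"
    then obtain P Q where s: "\<sigma> \<in> \<Sigma>" "\<tau> \<in> \<Sigma>" "\<rho> \<in> \<Sigma>"
      and sp: "p \<in> spec \<sigma>" "q \<in> spec \<tau>" "r \<in> spec \<rho>"
      and P: "P \<in> spec (\<sigma> \<inter> \<tau>)" "P \<inter> chart_ring \<sigma> = p" "P \<inter> chart_ring \<tau> = q"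
      and Q: "Q \<in> spec (\<tau> \<inter> \<rho>)" "Q \<inter> chart_ring \<tau> = q" "Q \<inter> chart_ring \<rho> = r"
      unfolding glue_rel_iff by blast
    have i: "\<sigma> \<inter> \<tau> \<in> \<Sigma>" "\<tau> \<inter> \<rho> \<in> \<Sigma>" "\<sigma> \<inter> \<rho> \<in> \<Sigma>" "(\<sigma> \<inter> \<tau>) \<inter> (\<tau> \<inter> \<rho>) \<in> \<Sigma>"
      using s cone_Int_in_Sigma by blast+
    obtain u a where c1: "cuts_face \<tau> u a (\<sigma> \<inter> \<tau>)" using ex_cuts_face[OF s(2) i(1)] by blast
    obtain w b where c2: "cuts_face \<tau> w b (\<tau> \<inter> \<rho>)" using ex_cuts_face[OF s(2) i(2)] by blast
    note c = cuts_face_mult[OF c1 c2]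
    have "mterm u a \<notin> q" using cuts_face_unit[OF s(2) i(1) c1 P(1)] P(3) by blast
    moreover have "mterm w b \<notin> q" using cuts_face_unit[OF s(2) i(2) c2 Q(1)] Q(2) by blast
    ultimately have "mterm (u + w) (a * b) \<notin> q"
      using spec_mult_iff[OF s(2) sp(2) cuts_face_mterm[OF c1] cuts_face_mterm[OF c2]] by (simp add: mult_single)
    then obtain Y where Y: "Y \<in> spec ((\<sigma> \<inter> \<tau>) \<inter> (\<tau> \<inter> \<rho>))" "Y \<inter> chart_ring \<tau> = q"
      using spec_extend[OF s(2) i(4) c sp(2)] by blast
    have sub: "chart_ring \<sigma> \<subseteq> chart_ring (\<sigma> \<inter> \<tau>)" "chart_ring \<tau> \<subseteq> chart_ring (\<sigma> \<inter> \<tau>)"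
      "chart_ring \<tau> \<subseteq> chart_ring (\<tau> \<inter> \<rho>)" "chart_ring \<rho> \<subseteq> chart_ring (\<tau> \<inter> \<rho>)"
      "chart_ring \<sigma> \<subseteq> chart_ring (\<sigma> \<inter> \<rho>)" "chart_ring \<rho> \<subseteq> chart_ring (\<sigma> \<inter> \<rho>)"
      by (rule chart_ring_antimono[OF s(1) i(1)] chart_ring_antimono[OF s(2) i(1)]
          chart_ring_antimono[OF s(2) i(2)] chart_ring_antimono[OF s(3) i(2)]
          chart_ring_antimono[OF s(1) i(3)] chart_ring_antimono[OF s(3) i(3)]; blast)+
    have "Y \<inter> chart_ring (\<sigma> \<inter> \<tau>) = P"
      by (rule spec_contract_inj[OF s(2) i(1) c1]) (use spec_contract[OF i(1,4) _ Y(1)] P Y sub in auto)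
    then have p: "Y \<inter> chart_ring \<sigma> = p" using P(2) sub(1) by blast
    have "Y \<inter> chart_ring (\<tau> \<inter> \<rho>) = Q"
      by (rule spec_contract_inj[OF s(2) i(2) c2]) (use spec_contract[OF i(2,4) _ Y(1)] Q Y sub in auto)
    then have r: "Y \<inter> chart_ring \<rho> = r" using Q(3) sub(4) by blast
    have "Y \<inter> chart_ring (\<sigma> \<inter> \<rho>) \<in> spec (\<sigma> \<inter> \<rho>)"
      using spec_contract[OF i(3,4) _ Y(1)] by blast
    then show "((\<sigma>, p), (\<rho>, r)) \<in> glue_rel"
      unfolding glue_rel_iff using s sp p r sub(5,6) by (auto intro!: bexI[of _ "Y \<inter> chart_ring (\<sigma> \<inter> \<rho>)"])
  qed
qed

lemma chart_point_eq_iff: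
  assumes "\<sigma> \<in> \<Sigma>" "p \<in> spec \<sigma>" "\<tau> \<in> \<Sigma>" "q \<in> spec \<tau>"
  shows "chart_point \<sigma> p = chart_point \<tau> q \<longleftrightarrow>
    (\<exists>P\<in>spec (\<sigma> \<inter> \<tau>). P \<inter> chart_ring \<sigma> = p \<and> P \<inter> chart_ring \<tau> = q)"
  unfolding chart_point_def using eq_equiv_class_iff[OF equiv_glue_rel] assms
  by (simp add: glue_rel_iff)

lemma points_eq: "points = {chart_point \<sigma> p | \<sigma> p. \<sigma> \<in> \<Sigma> \<and> p \<in> spec \<sigma>}"
  unfolding points_def quotient_def chart_point_def by blast

lemma chart_point_face:
  assumes s: "\<sigma> \<in> \<Sigma>" "\<tau> \<in> \<Sigma>" "\<tau> \<subseteq> \<sigma>" and P: "P \<in> spec \<tau>"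
  shows "chart_point \<tau> P = chart_point \<sigma> (P \<inter> chart_ring \<sigma>)"
  using chart_point_eq_iff[OF s(2) P s(1) spec_contract[OF s P]] spec_subset[OF s(2) P] P s(3)
  by (metis inf.absorb1)

section \<open>Local rings\<close>

text \<open>The local ring at \<open>x\<close>, as a subring of the fractions of
  \<open>K[M]\<close>. Taking all charts that contain \<open>x\<close> makes it depend on the point
  only; \<open>loc_chart_point\<close> shows that a single chart gives the same ring.\<close>

definition loc :: "('n, 'k) point \<Rightarrow> ('n, 'k) lfrac set" where
  "loc x = {Frac a b | \<sigma> p a b. \<sigma> \<in> \<Sigma> \<and> p \<in> spec \<sigma> \<and> x = chart_point \<sigma> p \<and>
     a \<in> chart_ring \<sigma> \<and> b \<in> chart_ring \<sigma> \<and> b \<notin> p}"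

text \<open>On the overlap of the two charts a monomial is a unit, and its powers move numerator and
  denominator of a fraction from the second chart ring into the first.\<close>

lemma loc_chart_point:
  assumes s: "\<sigma> \<in> \<Sigma>" "p \<in> spec \<sigma>"
  shows "loc (chart_point \<sigma> p) = {Frac a b | a b. a \<in> chart_ring \<sigma> \<and> b \<in> chart_ring \<sigma> \<and> b \<notin> p}"
proof
  show "loc (chart_point \<sigma> p) \<subseteq> {Frac a b | a b. a \<in> chart_ring \<sigma> \<and> b \<in> chart_ring \<sigma> \<and> b \<notin> p}"
  proof
    fix f assume "f \<in> loc (chart_point \<sigma> p)"
    then obtain \<tau> q a b where t: "\<tau> \<in> \<Sigma>" "q \<in> spec \<tau>" "chart_point \<sigma> p = chart_point \<tau> q"
      and ab: "a \<in> chart_ring \<tau>" "b \<in> chart_ring \<tau>" "b \<notin> q" and f: "f = Frac a b"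
      unfolding loc_def by blast
    obtain P where P: "P \<in> spec (\<sigma> \<inter> \<tau>)" "P \<inter> chart_ring \<sigma> = p" "P \<inter> chart_ring \<tau> = q"
      using t(3) chart_point_eq_iff[OF s t(1,2)] by blast
    have i: "\<sigma> \<inter> \<tau> \<in> \<Sigma>" using s t cone_Int_in_Sigma by blast
    obtain u c where c: "cuts_face \<sigma> u c (\<sigma> \<inter> \<tau>)" using ex_cuts_face[OF s(1) i] by blast
    let ?m = "mterm u c"
    have sub: "chart_ring \<tau> \<subseteq> chart_ring (\<sigma> \<inter> \<tau>)" using chart_ring_antimono[OF t(1) i] by blast
    obtain k where k: "?m ^ k * a \<in> chart_ring \<sigma>" using cuts_face_localization[OF s(1) i c] ab(1) sub by blast
    obtain l where l: "?m ^ l * b \<in> chart_ring \<sigma>" using cuts_face_localization[OF s(1) i c] ab(2) sub by blast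
    have m: "?m \<in> chart_ring \<sigma>" "?m \<in> chart_ring (\<sigma> \<inter> \<tau>)" "?m \<notin> P" "?m \<noteq> 0"
      using cuts_face_mterm[OF c] cuts_face_ring_subset[OF s(1) i c] cuts_face_unit[OF s(1) i c P(1)]
        spec_zero[OF i P(1)] by auto
    have b: "b \<notin> P" using P(3) ab by blast
    have mp: "?m ^ n \<in> chart_ring \<sigma>" for n using chart_ring_power[OF s(1) m(1)] .
    have "?m ^ n * b \<notin> P" for n
      using spec_prime[OF i P(1) chart_ring_power[OF i m(2), of n]] ab(2) sub b
        spec_power[OF i P(1) m(2,3), of n] by blast
    then have "?m ^ n * b \<notin> p" for n using P(2) by blast
    moreover have "f = Frac (?m ^ l * (?m ^ k * a)) (?m ^ k * (?m ^ l * b))"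
      using m(4) spec_nonzero[OF i P(1) b] unfolding f by (subst Frac_eq_iff) (auto simp: ac_simps)
    ultimately show "f \<in> {Frac a b | a b. a \<in> chart_ring \<sigma> \<and> b \<in> chart_ring \<sigma> \<and> b \<notin> p}"
      using chart_ring.mult[OF mp k] chart_ring.mult[OF mp l] by (metis (mono_tags, lifting) CollectI mult.assoc power_add)
  qed
qed (use s in \<open>auto simp: loc_def\<close>)

context
  fixes \<sigma> p assumes s: "\<sigma> \<in> \<Sigma>" and p: "p \<in> spec \<sigma>"
begin

lemma loc_chart_pointE:
  assumes "q \<in> loc (chart_point \<sigma> p)"
  obtains a b where "a \<in> chart_ring \<sigma>" "b \<in> chart_ring \<sigma>" "b \<notin> p" "b \<noteq> 0" "q = Frac a b"
  using assms unfolding loc_chart_point[OF s p] using spec_nonzero[OF s p] by blast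

lemma loc_chart_pointI:
  "a \<in> chart_ring \<sigma> \<Longrightarrow> b \<in> chart_ring \<sigma> \<Longrightarrow> b \<notin> p \<Longrightarrow> Frac a b \<in> loc (chart_point \<sigma> p)"
  unfolding loc_chart_point[OF s p] by blast

lemma of_laurent_in_loc: "f \<in> chart_ring \<sigma> \<Longrightarrow> of_laurent f \<in> loc (chart_point \<sigma> p)"
  unfolding of_laurent_def by (rule loc_chart_pointI[OF _ one_in_chart_ring[OF s] spec_one[OF s p]])

lemma loc_inverse_power:
  assumes h: "h \<in> chart_ring \<sigma>" "h \<notin> p" and q: "of_laurent (h ^ n) * q \<in> loc (chart_point \<sigma> p)"
  shows "q \<in> loc (chart_point \<sigma> p)"
proof -
  obtain a b where ab: "a \<in> chart_ring \<sigma>" "b \<in> chart_ring \<sigma>" "b \<notin> p" "b \<noteq> 0" "of_laurent (h ^ n) * q = Frac a b"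
    using loc_chart_pointE[OF q] .
  have hn: "h ^ n \<in> chart_ring \<sigma>" "h ^ n \<notin> p" "h ^ n \<noteq> 0"
    using h spec_power[OF s p] chart_ring_power[OF s] spec_nonzero[OF s p] by blast+
  have "of_laurent (h ^ n) * q = of_laurent (h ^ n) * Frac a (h ^ n * b)"
    unfolding ab(5) using hn(3) ab(4) by (simp add: of_laurent_mult_Frac Frac_eq_iff ac_simps del: of_laurent_power)
  then have "q = Frac a (h ^ n * b)" using lfrac_mult_left_cancel hn(3) by (metis of_laurent_eq_0_iff)
  moreover have "h ^ n * b \<notin> p" using spec_mult_iff[OF s p hn(1) ab(2)] hn ab by blast
  ultimately show ?thesis using loc_chart_pointI ab hn chart_ring.mult by blast
qed

text \<open>The fractions with numerator in \<open>p\<close> are closed under addition and contain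
  every element without inverse in the local ring, but not a unit such as \<open>h\<close>.\<close>

lemma loc_sum_unit:
  assumes A: "finite A" "\<And>i. i \<in> A \<Longrightarrow> c i \<in> loc (chart_point \<sigma> p)"
    and h: "h \<in> chart_ring \<sigma>" "h \<notin> p" "(\<Sum>i\<in>A. c i) = of_laurent h"
  shows "\<exists>i\<in>A. \<exists>d\<in>loc (chart_point \<sigma> p). c i * d = 1"
proof (rule ccontr)
  assume no: "\<not> ?thesis"
  let ?N = "{Frac a b | a b. a \<in> p \<and> b \<in> chart_ring \<sigma> \<and> b \<notin> p}"
  have nu: "c i \<in> ?N" if i: "i \<in> A" for i
  proof -
    obtain a b where ab: "a \<in> chart_ring \<sigma>" "b \<in> chart_ring \<sigma>" "b \<notin> p" "b \<noteq> 0" "c i = Frac a b"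
      using loc_chart_pointE[OF A(2)[OF i]] .
    have "a \<in> p"
    proof (rule ccontr)
      assume a: "a \<notin> p"
      then have "Frac a b * Frac b a = 1"
        using ab(4) spec_nonzero[OF s p] by (subst of_laurent_1[symmetric]) (simp add: Frac_mult of_laurent_def Frac_eq_iff mult.commute del: of_laurent_1)
      then show False using no i ab loc_chart_pointI[OF ab(2,1) a] by metis
    qed
    then show ?thesis using ab by blast
  qed
  have "(\<Sum>i\<in>B. c i) \<in> ?N" if "B \<subseteq> A" for B
    using finite_subset[OF that A(1)] that
  proof (induction B)
    case empty
    have "Frac 0 1 \<in> ?N" using spec_zero[OF s p] one_in_chart_ring[OF s] spec_one[OF s p] by blast
    then show ?case by (simp only: sum.empty Frac_0_1)
  next
    case (insert x F)
    then have "c x \<in> ?N" "(\<Sum>i\<in>F. c i) \<in> ?N" using nu by auto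
    then obtain a b a' b' where ab: "c x = Frac a b" "(\<Sum>i\<in>F. c i) = Frac a' b'" "a \<in> p" "a' \<in> p"
      "b \<in> chart_ring \<sigma>" "b' \<in> chart_ring \<sigma>" "b \<notin> p" "b' \<notin> p" by blast
    have nz: "b \<noteq> 0" "b' \<noteq> 0" using ab spec_nonzero[OF s p] by blast+
    have "c x + (\<Sum>i\<in>F. c i) = Frac (a * b' + a' * b) (b * b')" using ab nz by (simp add: Frac_add)
    moreover have "a * b' + a' * b \<in> p" using ab spec_add[OF s p] spec_mult_right[OF s p] by blast
    moreover have "b * b' \<notin> p" using ab spec_mult_iff[OF s p] by blast
    moreover have "b * b' \<in> chart_ring \<sigma>" using ab chart_ring.mult by blast
    ultimately have "c x + (\<Sum>i\<in>F. c i) \<in> ?N" by blast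
    then show ?case by (simp only: sum.insert[OF insert(1,2)])
  qed
  from this[OF order_refl] have "Frac h 1 \<in> ?N" unfolding h(3) of_laurent_def .
  then obtain a b where ab: "Frac h 1 = Frac a b" "a \<in> p" "b \<in> chart_ring \<sigma>" "b \<notin> p" by blast
  then have "h * b = a" using spec_nonzero[OF s p] by (simp add: Frac_eq_iff)
  then show False using spec_mult_iff[OF s p h(1) ab(3)] ab h(2) by blast
qed

end

lemma loc_closed:
  assumes x: "x \<in> points"
  shows loc_add: "f \<in> loc x \<Longrightarrow> g \<in> loc x \<Longrightarrow> f + g \<in> loc x"
    and loc_mult: "f \<in> loc x \<Longrightarrow> g \<in> loc x \<Longrightarrow> f * g \<in> loc x"
    and loc_0: "0 \<in> loc x" and loc_1: "1 \<in> loc x" and loc_uminus: "f \<in> loc x \<Longrightarrow> - f \<in> loc x"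
proof -
  obtain \<sigma> p where s: "\<sigma> \<in> \<Sigma>" "p \<in> spec \<sigma>" and xp: "x = chart_point \<sigma> p" using x unfolding points_eq by blast
  note E = loc_chart_pointE[OF s] and I = loc_chart_pointI[OF s]
  show "0 \<in> loc x" "1 \<in> loc x"
    using of_laurent_in_loc[OF s, of 0] of_laurent_in_loc[OF s, of 1] one_in_chart_ring[OF s(1)]
      subring_zero[OF subring_chart_ring[OF s(1)]] unfolding xp by auto
  show "f + g \<in> loc x" if f: "f \<in> loc x" and g: "g \<in> loc x"
  proof -
    obtain a b where 1: "a \<in> chart_ring \<sigma>" "b \<in> chart_ring \<sigma>" "b \<notin> p" "b \<noteq> 0" "f = Frac a b" using f xp E by metis
    obtain c d where 2: "c \<in> chart_ring \<sigma>" "d \<in> chart_ring \<sigma>" "d \<notin> p" "d \<noteq> 0" "g = Frac c d" using g xp E by metis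
    have "b * d \<notin> p" using 1 2 spec_mult_iff[OF s] by blast
    then show ?thesis unfolding xp using 1 2 by (auto simp: Frac_add intro!: I chart_ring.add chart_ring.mult)
  qed
  show m: "f * g \<in> loc x" if f: "f \<in> loc x" and g: "g \<in> loc x" for f g
  proof -
    obtain a b where 1: "a \<in> chart_ring \<sigma>" "b \<in> chart_ring \<sigma>" "b \<notin> p" "b \<noteq> 0" "f = Frac a b" using f xp E by metis
    obtain c d where 2: "c \<in> chart_ring \<sigma>" "d \<in> chart_ring \<sigma>" "d \<notin> p" "d \<noteq> 0" "g = Frac c d" using g xp E by metis
    have "b * d \<notin> p" using 1 2 spec_mult_iff[OF s] by blast
    then show ?thesis unfolding xp using 1 2 by (auto simp: Frac_mult intro!: I chart_ring.mult)
  qed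
  show "- f \<in> loc x" if f: "f \<in> loc x"
  proof -
    have "- 1 \<in> chart_ring \<sigma>" using subring_chart_ring[OF s(1)] by (auto simp: subring_of_def)
    then have "of_laurent (- 1) \<in> loc x" unfolding xp by (rule of_laurent_in_loc[OF s])
    from m[OF this f] show ?thesis by simp
  qed
qed

end

section \<open>Open sets and regular functions\<close>

context toric_setup
begin

definition chart_preimage :: "'n cone \<Rightarrow> ('n, 'k) point set \<Rightarrow> ('n, 'k) laurent set set" where
  "chart_preimage \<sigma> W = {p \<in> spec \<sigma>. chart_point \<sigma> p \<in> W}"

lemma zariski_open_iff:
  "zariski_open W \<longleftrightarrow> W \<subseteq> points \<and>
     (\<forall>\<sigma>\<in>\<Sigma>. \<exists>S \<subseteq> chart_ring \<sigma>. chart_preimage \<sigma> W = {p \<in> spec \<sigma>. \<not> S \<subseteq> p})"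
  by (simp add: zariski_open_def chart_preimage_def)

lemma zariski_open_points: "zariski_open W \<Longrightarrow> W \<subseteq> points"
  by (simp add: zariski_open_def)

lemma zariski_open_empty: "zariski_open {}"
  unfolding zariski_open_iff chart_preimage_def by (auto intro!: exI[of _ "{}"])

lemma zariski_open_Int:
  assumes W: "zariski_open W" and V: "zariski_open V"
  shows "zariski_open (W \<inter> V)"
  unfolding zariski_open_iff
proof (intro conjI ballI)
  show "W \<inter> V \<subseteq> points" using zariski_open_points[OF W] by blast
  fix \<sigma> assume s: "\<sigma> \<in> \<Sigma>"
  obtain S where S: "S \<subseteq> chart_ring \<sigma>" "chart_preimage \<sigma> W = {p \<in> spec \<sigma>. \<not> S \<subseteq> p}"
    using W s unfolding zariski_open_iff by blast
  obtain T where T: "T \<subseteq> chart_ring \<sigma>" "chart_preimage \<sigma> V = {p \<in> spec \<sigma>. \<not> T \<subseteq> p}"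
    using V s unfolding zariski_open_iff by blast
  let ?U = "{f * g | f g. f \<in> S \<and> g \<in> T}"
  have eq: "(\<not> ?U \<subseteq> p) = (\<not> S \<subseteq> p \<and> \<not> T \<subseteq> p)" if p: "p \<in> spec \<sigma>" for p
  proof
    assume "\<not> ?U \<subseteq> p"
    then obtain f g where fg: "f \<in> S" "g \<in> T" "f * g \<notin> p" by blast
    then have "f \<notin> p" "g \<notin> p"
      using spec_mult_left[OF s p, of f g] spec_mult_right[OF s p, of f g] S(1) T(1) by blast+
    then show "\<not> S \<subseteq> p \<and> \<not> T \<subseteq> p" using fg by blast
  next
    assume "\<not> S \<subseteq> p \<and> \<not> T \<subseteq> p"
    then obtain f g where fg: "f \<in> S" "g \<in> T" "f \<notin> p" "g \<notin> p" by blast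
    then have "f * g \<notin> p" using spec_prime[OF s p, of f g] S(1) T(1) by blast
    then show "\<not> ?U \<subseteq> p" using fg by blast
  qed
  have mem: "p \<in> chart_preimage \<sigma> (W \<inter> V) \<longleftrightarrow> p \<in> chart_preimage \<sigma> W \<and> p \<in> chart_preimage \<sigma> V" for p
    by (auto simp: chart_preimage_def)
  have eqv: "p \<in> chart_preimage \<sigma> (W \<inter> V) \<longleftrightarrow> p \<in> {p \<in> spec \<sigma>. \<not> ?U \<subseteq> p}" for p
    using eq[of p] unfolding mem S(2) T(2) mem_Collect_eq by argo
  have "chart_preimage \<sigma> (W \<inter> V) = {p \<in> spec \<sigma>. \<not> ?U \<subseteq> p}" by (rule Set.set_eqI) (rule eqv)
  moreover have "?U \<subseteq> chart_ring \<sigma>" using S(1) T(1) by (blast intro: chart_ring.mult)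
  ultimately show "\<exists>S \<subseteq> chart_ring \<sigma>. chart_preimage \<sigma> (W \<inter> V) = {p \<in> spec \<sigma>. \<not> S \<subseteq> p}" by blast
qed

lemma zariski_open_Union:
  assumes W: "\<And>W. W \<in> \<W> \<Longrightarrow> zariski_open W"
  shows "zariski_open (\<Union>\<W>)"
  unfolding zariski_open_iff
proof (intro conjI ballI)
  show "\<Union>\<W> \<subseteq> points" using W zariski_open_points by blast
  fix \<sigma> assume s: "\<sigma> \<in> \<Sigma>"
  have "\<forall>W\<in>\<W>. \<exists>S. S \<subseteq> chart_ring \<sigma> \<and> chart_preimage \<sigma> W = {p \<in> spec \<sigma>. \<not> S \<subseteq> p}"
    using W s unfolding zariski_open_iff by blast
  from bchoice[OF this] obtain S
    where "\<forall>W\<in>\<W>. S W \<subseteq> chart_ring \<sigma> \<and> chart_preimage \<sigma> W = {p \<in> spec \<sigma>. \<not> S W \<subseteq> p}"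
    by (elim exE)
  then have S: "\<And>W. W \<in> \<W> \<Longrightarrow> S W \<subseteq> chart_ring \<sigma>"
    "\<And>W. W \<in> \<W> \<Longrightarrow> chart_preimage \<sigma> W = {p \<in> spec \<sigma>. \<not> S W \<subseteq> p}" by simp_all
  have "chart_preimage \<sigma> (\<Union>\<W>) = (\<Union>W\<in>\<W>. chart_preimage \<sigma> W)"
    unfolding chart_preimage_def by blast
  also have "\<dots> = (\<Union>W\<in>\<W>. {p \<in> spec \<sigma>. \<not> S W \<subseteq> p})" using S(2) by (rule SUP_cong[OF refl])
  also have "\<dots> = {p \<in> spec \<sigma>. \<not> (\<Union>W\<in>\<W>. S W) \<subseteq> p}"
  proof (rule Set.set_eqI)
    fix p
    show "p \<in> (\<Union>W\<in>\<W>. {p \<in> spec \<sigma>. \<not> S W \<subseteq> p}) \<longleftrightarrow> p \<in> {p \<in> spec \<sigma>. \<not> (\<Union>W\<in>\<W>. S W) \<subseteq> p}"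
      by (cases "p \<in> spec \<sigma>") (simp_all add: UN_subset_iff)
  qed
  finally show "\<exists>S \<subseteq> chart_ring \<sigma>. chart_preimage \<sigma> (\<Union>\<W>) = {p \<in> spec \<sigma>. \<not> S \<subseteq> p}"
    using S(1) by (intro exI[of _ "\<Union>W\<in>\<W>. S W"]) blast
qed

lemma distinguished_open_iff:
  "x \<in> distinguished_open \<sigma> f \<longleftrightarrow> (\<exists>p\<in>spec \<sigma>. x = chart_point \<sigma> p \<and> f \<notin> p)"
  unfolding distinguished_open_def by blast

text \<open>Seen from another chart \<open>\<tau>\<close>, the set is the nonvanishing locus of one
  element: the monomial cutting out the overlap times a multiple of \<open>b\<close> that lies in
  the ring of \<open>\<tau>\<close>.\<close>

lemma zariski_open_distinguished:
  assumes s: "\<sigma> \<in> \<Sigma>" and b: "b \<in> chart_ring \<sigma>"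
  shows "zariski_open (distinguished_open \<sigma> b)"
  unfolding zariski_open_iff
proof (intro conjI ballI)
  show "distinguished_open \<sigma> b \<subseteq> points" using s unfolding distinguished_open_def points_eq by blast
  fix \<tau> assume t: "\<tau> \<in> \<Sigma>"
  have i: "\<sigma> \<inter> \<tau> \<in> \<Sigma>" using s t cone_Int_in_Sigma by blast
  obtain u a where c: "cuts_face \<tau> u a (\<sigma> \<inter> \<tau>)" using ex_cuts_face[OF t i] by blast
  let ?m = "mterm u a"
  have b': "b \<in> chart_ring (\<sigma> \<inter> \<tau>)" using chart_ring_antimono[OF s i] b by blast
  obtain n where n: "?m ^ n * b \<in> chart_ring \<tau>" using cuts_face_localization[OF t i c b'] by blast
  have m: "?m \<in> chart_ring \<tau>" "?m \<in> chart_ring (\<sigma> \<inter> \<tau>)"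
    using cuts_face_mterm[OF c] cuts_face_ring_subset[OF t i c] by auto
  have mem: "chart_point \<tau> q \<in> distinguished_open \<sigma> b \<longleftrightarrow> ?m * (?m ^ n * b) \<notin> q" if q: "q \<in> spec \<tau>" for q
  proof
    assume "chart_point \<tau> q \<in> distinguished_open \<sigma> b"
    then obtain p where p: "p \<in> spec \<sigma>" "chart_point \<sigma> p = chart_point \<tau> q" "b \<notin> p"
      unfolding distinguished_open_iff by metis
    then obtain P where P: "P \<in> spec (\<sigma> \<inter> \<tau>)" "P \<inter> chart_ring \<sigma> = p" "P \<inter> chart_ring \<tau> = q"
      using chart_point_eq_iff[OF s p(1) t q] by blast
    have "?m \<notin> P" by (rule cuts_face_unit[OF t i c P(1)])
    moreover have "b \<notin> P" using p P b by blast
    ultimately have "?m * (?m ^ n * b) \<notin> P"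
      using spec_prime[OF i P(1)] m(2) b' spec_power[OF i P(1) m(2)] chart_ring_power[OF i m(2)] chart_ring.mult by metis
    then show "?m * (?m ^ n * b) \<notin> q" using P(3) by blast
  next
    assume nq: "?m * (?m ^ n * b) \<notin> q"
    then have "?m \<notin> q" "?m ^ n * b \<notin> q" using spec_mult_iff[OF t q m(1) n] by auto
    then obtain P where P: "P \<in> spec (\<sigma> \<inter> \<tau>)" "P \<inter> chart_ring \<tau> = q" using spec_extend[OF t i c q] by blast
    have "?m ^ n * b \<notin> P" using P(2) n \<open>?m ^ n * b \<notin> q\<close> by blast
    then have "b \<notin> P" using spec_mult_left[OF i P(1)] chart_ring_power[OF i m(2)] by blast
    moreover have "P \<inter> chart_ring \<sigma> \<in> spec \<sigma>" using spec_contract[OF s i _ P(1)] by blast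
    moreover have "chart_point \<tau> q = chart_point \<sigma> (P \<inter> chart_ring \<sigma>)"
      using chart_point_eq_iff[OF s calculation(2) t q] P by metis
    ultimately show "chart_point \<tau> q \<in> distinguished_open \<sigma> b" unfolding distinguished_open_iff by blast
  qed
  have "?m * (?m ^ n * b) \<in> chart_ring \<tau>" using m(1) n by (rule chart_ring.mult)
  moreover have "chart_preimage \<tau> (distinguished_open \<sigma> b) = {q \<in> spec \<tau>. \<not> {?m * (?m ^ n * b)} \<subseteq> q}"
    unfolding chart_preimage_def using mem by blast
  ultimately show "\<exists>S \<subseteq> chart_ring \<tau>. chart_preimage \<tau> (distinguished_open \<sigma> b) = {p \<in> spec \<tau>. \<not> S \<subseteq> p}"
    by (intro exI[of _ "{?m * (?m ^ n * b)}"]) simp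
qed

lemma distinguished_open_one: "\<sigma> \<in> \<Sigma> \<Longrightarrow> distinguished_open \<sigma> 1 = chart \<sigma>"
  using spec_one unfolding distinguished_open_def chart_def by blast

lemma zariski_open_chart: "\<sigma> \<in> \<Sigma> \<Longrightarrow> zariski_open (chart \<sigma>)"
  using zariski_open_distinguished[OF _ one_in_chart_ring] distinguished_open_one by metis

lemma zariski_open_basis:
  assumes W: "zariski_open W" and s: "\<sigma> \<in> \<Sigma>" "p \<in> spec \<sigma>" "chart_point \<sigma> p \<in> W"
  shows "\<exists>h\<in>chart_ring \<sigma>. h \<notin> p \<and> distinguished_open \<sigma> h \<subseteq> W"
proof -
  obtain S where S: "S \<subseteq> chart_ring \<sigma>" "chart_preimage \<sigma> W = {p \<in> spec \<sigma>. \<not> S \<subseteq> p}"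
    using W s unfolding zariski_open_iff by blast
  have "p \<in> chart_preimage \<sigma> W" using s by (simp add: chart_preimage_def)
  then obtain h where h: "h \<in> S" "h \<notin> p" using S(2) by blast
  have "distinguished_open \<sigma> h \<subseteq> W"
  proof
    fix x assume "x \<in> distinguished_open \<sigma> h"
    then obtain q where q: "q \<in> spec \<sigma>" "x = chart_point \<sigma> q" "h \<notin> q" unfolding distinguished_open_iff by blast
    then have "q \<in> chart_preimage \<sigma> W" unfolding S(2) using h by blast
    then show "x \<in> W" using q by (simp add: chart_preimage_def)
  qed
  then show ?thesis using h S by blast
qed

lemma chart_face:
  assumes s: "\<sigma> \<in> \<Sigma>" "\<tau> \<in> \<Sigma>" and c: "cuts_face \<sigma> u a \<tau>"
  shows "chart \<tau> = distinguished_open \<sigma> (mterm u a)"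
proof -
  have sub: "\<tau> \<subseteq> \<sigma>" by (rule cuts_face_subset[OF s c])
  show ?thesis
  proof
    show "chart \<tau> \<subseteq> distinguished_open \<sigma> (mterm u a)"
    proof
      fix x assume "x \<in> chart \<tau>"
      then obtain P where P: "P \<in> spec \<tau>" "x = chart_point \<tau> P" unfolding chart_def by blast
      then show "x \<in> distinguished_open \<sigma> (mterm u a)"
        unfolding distinguished_open_iff using chart_point_face[OF s sub P(1)] spec_contract[OF s sub P(1)]
          cuts_face_unit[OF s c P(1)] by blast
    qed
    show "distinguished_open \<sigma> (mterm u a) \<subseteq> chart \<tau>"
    proof
      fix x assume "x \<in> distinguished_open \<sigma> (mterm u a)"
      then obtain p where p: "p \<in> spec \<sigma>" "x = chart_point \<sigma> p" "mterm u a \<notin> p"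
        unfolding distinguished_open_iff by blast
      then obtain P where P: "P \<in> spec \<tau>" "P \<inter> chart_ring \<sigma> = p" using spec_extend[OF s c] by blast
      then show "x \<in> chart \<tau>" unfolding chart_def p(2) using chart_point_face[OF s sub P(1)] by blast
    qed
  qed
qed

lemma chart_mono:
  assumes "\<sigma> \<in> \<Sigma>" "\<tau> \<in> \<Sigma>" "\<tau> \<subseteq> \<sigma>" shows "chart \<tau> \<subseteq> chart \<sigma>"
  using assms spec_contract[OF assms] chart_point_face[OF assms] unfolding chart_def by blast

lemma points_chart: "points = (\<Union>\<sigma>\<in>\<Sigma>. chart \<sigma>)"
  unfolding points_eq chart_def by blast

lemma zero_in_spec: "\<sigma> \<in> \<Sigma> \<Longrightarrow> {0} \<in> spec \<sigma>"
  unfolding spec_iff prime_in_def ideal_in_def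
  using subring_zero[OF subring_chart_ring] by auto

section \<open>The generic point and regular functions\<close>

definition generic_point :: "('n, 'k) point" where
  "generic_point = chart_point {0} {0}"

lemma generic_point_chart: "\<sigma> \<in> \<Sigma> \<Longrightarrow> generic_point = chart_point \<sigma> {0}"
  unfolding generic_point_def
  using chart_point_face[OF _ zero_cone_in_Sigma _ zero_in_spec[OF zero_cone_in_Sigma], of \<sigma>] zero_in_cone[of \<sigma>]
    subring_zero[OF subring_chart_ring[of \<sigma>]] by auto

lemma generic_point_in_open:
  assumes W: "zariski_open W" and x: "x \<in> W"
  shows "generic_point \<in> W"
proof -
  obtain \<sigma> p where s: "\<sigma> \<in> \<Sigma>" "p \<in> spec \<sigma>" "x = chart_point \<sigma> p"
    using zariski_open_points[OF W] x unfolding points_eq by blast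
  then obtain h where h: "h \<in> chart_ring \<sigma>" "h \<notin> p" "distinguished_open \<sigma> h \<subseteq> W"
    using zariski_open_basis[OF W s(1,2)] x by blast
  then have "h \<noteq> 0" using spec_nonzero[OF s(1,2)] by blast
  then have "chart_point \<sigma> {0} \<in> distinguished_open \<sigma> h"
    unfolding distinguished_open_iff using zero_in_spec[OF s(1)] by blast
  then show ?thesis using h(3) generic_point_chart[OF s(1)] by auto
qed

lemma generic_point_in_points: "generic_point \<in> points"
  unfolding generic_point_def points_eq using zero_cone_in_Sigma zero_in_spec by blast

lemma loc_generic_point: "loc generic_point = UNIV"
proof -
  have "q \<in> loc generic_point" for q
  proof -
    obtain a b where ab: "b \<noteq> 0" "q = Frac a b" by (rule Frac_cases)
    have "Frac a b \<in> loc (chart_point {0} {0})"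
      by (rule loc_chart_pointI[OF zero_cone_in_Sigma zero_in_spec[OF zero_cone_in_Sigma]])
        (use ab in \<open>auto simp: chart_ring_zero_cone\<close>)
    then show ?thesis unfolding generic_point_def ab(2) .
  qed
  then show ?thesis by blast
qed

text \<open>As the scheme is integral, regular functions are constant fractions.\<close>

definition cf :: "('n, 'k) point set \<Rightarrow> ('n, 'k) lfrac \<Rightarrow> ('n, 'k) func" where
  "cf W q = restrict_func W (\<lambda>_. q)"

lemma cf_apply [simp]: "x \<in> W \<Longrightarrow> cf W q x = q"
  by (simp add: cf_def restrict_func_def)

lemma regular_of_cf: "regular_of W f = cf W (of_laurent f)"
  by (simp add: regular_of_def cf_def of_laurent_def)

lemma cf_restrict: "V \<subseteq> W \<Longrightarrow> restrict_func V (cf W q) = cf V q"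
  by (auto simp: cf_def restrict_func_def fun_eq_iff)

lemma cf_eq_iff: "zariski_open W \<Longrightarrow> W \<noteq> {} \<Longrightarrow> cf W p = cf W q \<longleftrightarrow> p = q"
  by (metis cf_apply ex_in_conv)

text \<open>Over the empty set a function does not determine its fraction. This is the reason for
  the separate treatment of the empty open set in what follows.\<close>

lemma cf_empty: "cf {} p = cf {} q"
  by (simp add: cf_def restrict_func_def)

lemma loc_open_nbhd:
  assumes x: "x \<in> points" and q: "q \<in> loc x"
  shows "\<exists>V. zariski_open V \<and> x \<in> V \<and> (\<forall>y\<in>V. q \<in> loc y) \<and>
    (\<exists>\<sigma>\<in>\<Sigma>. \<exists>a\<in>chart_ring \<sigma>. \<exists>b\<in>chart_ring \<sigma>. q = Frac a b \<and> V = distinguished_open \<sigma> b)"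
proof -
  obtain \<sigma> p where s: "\<sigma> \<in> \<Sigma>" "p \<in> spec \<sigma>" "x = chart_point \<sigma> p" using x unfolding points_eq by blast
  obtain a b where ab: "a \<in> chart_ring \<sigma>" "b \<in> chart_ring \<sigma>" "b \<notin> p" "q = Frac a b"
    using q loc_chart_pointE[OF s(1,2)] unfolding s(3) by metis
  have "\<forall>y\<in>distinguished_open \<sigma> b. q \<in> loc y"
  proof
    fix y assume "y \<in> distinguished_open \<sigma> b"
    then obtain p' where p': "p' \<in> spec \<sigma>" "y = chart_point \<sigma> p'" "b \<notin> p'" unfolding distinguished_open_iff by blast
    show "q \<in> loc y" unfolding p'(2) ab(4) by (rule loc_chart_pointI[OF s(1) p'(1) ab(1,2) p'(3)])
  qed
  moreover have "x \<in> distinguished_open \<sigma> b" unfolding distinguished_open_iff using s ab by blast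
  ultimately show ?thesis using zariski_open_distinguished[OF s(1) ab(2)] s ab by blast
qed

lemma cf_regular_iff:
  assumes W: "zariski_open W"
  shows "cf W q \<in> regular_functions W \<longleftrightarrow> (\<forall>x\<in>W. q \<in> loc x)"
proof
  assume "cf W q \<in> regular_functions W"
  then have *: "\<forall>x\<in>W. \<exists>\<sigma>\<in>\<Sigma>. \<exists>a\<in>chart_ring \<sigma>. \<exists>b\<in>chart_ring \<sigma>. \<exists>V. zariski_open V \<and> x \<in> V \<and>
        V \<subseteq> W \<inter> distinguished_open \<sigma> b \<and> (\<forall>y\<in>V. cf W q y = Frac a b)"
    unfolding regular_functions_def by simp
  show "\<forall>x\<in>W. q \<in> loc x"
  proof
    fix x assume x: "x \<in> W"
    then obtain \<sigma> a b V where s: "\<sigma> \<in> \<Sigma>" "a \<in> chart_ring \<sigma>" "b \<in> chart_ring \<sigma>" "x \<in> V"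
      "V \<subseteq> W \<inter> distinguished_open \<sigma> b" "\<forall>y\<in>V. cf W q y = Frac a b" using * by meson
    then have "q = Frac a b" using x by auto
    moreover have "x \<in> distinguished_open \<sigma> b" using s(4,5) by blast
    then obtain p where "p \<in> spec \<sigma>" "x = chart_point \<sigma> p" "b \<notin> p" unfolding distinguished_open_iff by blast
    ultimately show "q \<in> loc x" using loc_chart_pointI s by blast
  qed
next
  assume q: "\<forall>x\<in>W. q \<in> loc x"
  have "\<exists>\<sigma>\<in>\<Sigma>. \<exists>a\<in>chart_ring \<sigma>. \<exists>b\<in>chart_ring \<sigma>. \<exists>V. zariski_open V \<and> x \<in> V \<and>
        V \<subseteq> W \<inter> distinguished_open \<sigma> b \<and> (\<forall>y\<in>V. cf W q y = Frac a b)" if x: "x \<in> W" for x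
  proof -
    obtain V \<sigma> a b where V: "zariski_open V" "x \<in> V" "\<sigma> \<in> \<Sigma>" "a \<in> chart_ring \<sigma>" "b \<in> chart_ring \<sigma>"
      "q = Frac a b" "V = distinguished_open \<sigma> b"
      using loc_open_nbhd[of x q] x q zariski_open_points[OF W] by blast
    have "zariski_open (V \<inter> W)" "x \<in> V \<inter> W" "V \<inter> W \<subseteq> W \<inter> distinguished_open \<sigma> b"
      "\<forall>y\<in>V \<inter> W. cf W q y = Frac a b"
      using V x zariski_open_Int[OF V(1) W] by auto
    then show ?thesis using V(3-5) by blast
  qed
  then show "cf W q \<in> regular_functions W"
    unfolding regular_functions_def by (simp add: cf_def restrict_func_def)
qed

text \<open>Near each point the function is one fixed fraction, and every such neighbourhood
  contains the generic point; so all these fractions equal the value there.\<close>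

lemma regular_functions_cf:
  assumes W: "zariski_open W" and a: "a \<in> regular_functions W"
  obtains q where "a = cf W q" "\<forall>x\<in>W. q \<in> loc x"
proof -
  have "a x = a generic_point" if x: "x \<in> W" for x
  proof -
    obtain \<sigma> f b V where V: "zariski_open V" "x \<in> V" "V \<subseteq> W" "\<forall>y\<in>V. a y = Frac f b"
      using a x unfolding regular_functions_def by blast
    then show ?thesis using generic_point_in_open[OF V(1,2)] by auto
  qed
  moreover have "a x = 0" if "x \<notin> W" for x using a that unfolding regular_functions_def by blast
  ultimately have "a = cf W (a generic_point)" by (auto simp: cf_def restrict_func_def)
  then show ?thesis using that cf_regular_iff[OF W] a by metis
qed

lemma cf_add: "(\<lambda>x. cf W p x + cf W q x) = cf W (p + q)"
  by (auto simp: cf_def restrict_func_def)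

lemma cf_mult: "(\<lambda>x. cf W p x * cf W q x) = cf W (p * q)"
  by (auto simp: cf_def restrict_func_def)

lemma structure_sheaf_simps:
  "carrier (structure_sheaf W) = regular_functions W"
  "cf W p \<oplus>\<^bsub>structure_sheaf W\<^esub> cf W q = cf W (p + q)"
  "cf W p \<otimes>\<^bsub>structure_sheaf W\<^esub> cf W q = cf W (p * q)"
  "\<zero>\<^bsub>structure_sheaf W\<^esub> = cf W 0"
  "\<one>\<^bsub>structure_sheaf W\<^esub> = cf W 1"
  by (simp_all add: structure_sheaf_def cf_add cf_mult) (auto simp: cf_def restrict_func_def)

text \<open>The denominators of \<open>q\<close> form an ideal. If it contained no power of
  \<open>h\<close>, some prime would contain the ideal and avoid \<open>h\<close>, although
  \<open>q\<close> has a denominator outside that prime.\<close>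

lemma loc_distinguished_open:
  assumes s: "\<sigma> \<in> \<Sigma>" and h: "h \<in> chart_ring \<sigma>" and q: "\<And>x. x \<in> distinguished_open \<sigma> h \<Longrightarrow> q \<in> loc x"
  shows "\<exists>n. \<exists>f\<in>chart_ring \<sigma>. of_laurent (h ^ n) * q = of_laurent f"
proof (rule ccontr)
  assume no: "\<not> ?thesis"
  let ?I = "{g \<in> chart_ring \<sigma>. \<exists>f\<in>chart_ring \<sigma>. of_laurent g * q = of_laurent f}"
  have R: "subring_of (chart_ring \<sigma>)" by (rule subring_chart_ring[OF s])
  have I: "ideal_in ?I (chart_ring \<sigma>)" unfolding ideal_in_def
  proof (intro conjI ballI)
    show "0 \<in> ?I" using subring_zero[OF R] by (auto intro: bexI[of _ 0])
    fix f g assume "f \<in> ?I" "g \<in> ?I"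
    then obtain f' g' where "f \<in> chart_ring \<sigma>" "f' \<in> chart_ring \<sigma>" "of_laurent f * q = of_laurent f'"
      "g \<in> chart_ring \<sigma>" "g' \<in> chart_ring \<sigma>" "of_laurent g * q = of_laurent g'" by blast
    then show "f + g \<in> ?I" by (auto simp: distrib_right intro!: chart_ring.add bexI[of _ "f' + g'"])
  next
    fix f g assume "f \<in> chart_ring \<sigma>" "g \<in> ?I"
    then obtain g' where "f \<in> chart_ring \<sigma>" "g \<in> chart_ring \<sigma>" "g' \<in> chart_ring \<sigma>" "of_laurent g * q = of_laurent g'" by blast
    then show "f * g \<in> ?I" by (auto simp: mult.assoc intro!: chart_ring.mult bexI[of _ "f * g'"])
  qed blast
  have "h ^ n \<notin> ?I" for n using no by blast
  then obtain p where p: "prime_in p (chart_ring \<sigma>)" "?I \<subseteq> p" "h \<notin> p" using ex_prime_avoiding[OF R I h] by blast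
  then have sp: "p \<in> spec \<sigma>" using spec_iff[OF s] by blast
  then have "q \<in> loc (chart_point \<sigma> p)" using q p(3) unfolding distinguished_open_iff by blast
  then obtain a b where ab: "a \<in> chart_ring \<sigma>" "b \<in> chart_ring \<sigma>" "b \<notin> p" "b \<noteq> 0" "q = Frac a b"
    by (rule loc_chart_pointE[OF s sp])
  then have "b \<in> ?I" using of_laurent_denominator by blast
  then show False using p(2) ab(3) by blast
qed

text \<open>The case \<open>h = 1\<close>: the global functions on an affine chart are its chart
  ring.\<close>

lemma loc_chart:
  assumes s: "\<sigma> \<in> \<Sigma>" and q: "\<And>x. x \<in> chart \<sigma> \<Longrightarrow> q \<in> loc x"
  shows "\<exists>f\<in>chart_ring \<sigma>. q = of_laurent f"
  using loc_distinguished_open[OF s one_in_chart_ring[OF s], of q] q unfolding distinguished_open_one[OF s] by simp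

lemma of_laurent_in_loc_chart: "\<sigma> \<in> \<Sigma> \<Longrightarrow> f \<in> chart_ring \<sigma> \<Longrightarrow> x \<in> chart \<sigma> \<Longrightarrow> of_laurent f \<in> loc x"
  unfolding chart_def using of_laurent_in_loc by blast

end

section \<open>Coordinates of sections with respect to a frame\<close>

text \<open>Vectors are functions on all of \<open>nat\<close>; only the number of summands is
  bounded here, while \<open>kvec\<close> later bounds the length of the vectors.\<close>

definition lc :: "nat \<Rightarrow> (nat \<Rightarrow> 'a::comm_ring_1) \<Rightarrow> (nat \<Rightarrow> nat \<Rightarrow> 'a) \<Rightarrow> nat \<Rightarrow> 'a" where
  "lc n a e = (\<lambda>j. \<Sum>i<n. a i * e i j)"

definition lc_free :: "nat \<Rightarrow> (nat \<Rightarrow> nat \<Rightarrow> 'a::comm_ring_1) \<Rightarrow> bool" where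
  "lc_free n e \<longleftrightarrow> (\<forall>a. lc n a e = (\<lambda>_. 0) \<longrightarrow> (\<forall>i<n. a i = 0))"

lemma lc_add: "(\<lambda>j. lc n a e j + lc n b e j) = lc n (\<lambda>i. a i + b i) e"
  by (simp add: lc_def distrib_right sum.distrib)

lemma lc_diff: "(\<lambda>j. lc n a e j - lc n b e j) = lc n (\<lambda>i. a i - b i) e"
  by (simp add: lc_def left_diff_distrib sum_subtractf)

lemma lc_smult: "(\<lambda>j. c * lc n a e j) = lc n (\<lambda>i. c * a i) e"
  by (simp add: lc_def sum_distrib_left mult.assoc)

lemma lc_cong: "(\<And>i. i < n \<Longrightarrow> a i = b i) \<Longrightarrow> (\<And>i. i < n \<Longrightarrow> e i = f i) \<Longrightarrow> lc n a e = lc n b f"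
  by (simp add: lc_def)

lemma lc_lc: "lc n a (\<lambda>i. lc m (b i) e) = lc m (\<lambda>j. \<Sum>i<n. a i * b i j) e"
  unfolding lc_def
  by (simp add: sum_distrib_left sum_distrib_right mult.assoc) (rule ext, rule sum.swap)

lemma lc_unit: "k < n \<Longrightarrow> lc n (\<lambda>i. if i = k then 1 else 0) e = e k"
  by (rule ext) (simp add: lc_def if_distrib[of "\<lambda>x. x * _"] cong: if_cong)

lemma lc_zero: "lc n (\<lambda>_. 0) e = (\<lambda>_. 0)"
  by (simp add: lc_def)

lemma lc_freeD: "lc_free n e \<Longrightarrow> lc n a e = lc n b e \<Longrightarrow> i < n \<Longrightarrow> a i = b i"
  using lc_diff[of n a e b] unfolding lc_free_def by auto

lemma finsum_lessThan_Suc: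
  fixes n :: nat
  assumes "abelian_monoid G" "\<And>i. i \<le> n \<Longrightarrow> f i \<in> carrier G"
  shows "finsum G f {..<Suc n} = finsum G f {..<n} \<oplus>\<^bsub>G\<^esub> f n"
proof -
  interpret abelian_monoid G by fact
  have "finsum G f {..<n} \<in> carrier G" using assms(2) by (intro finsum_closed) auto
  then show ?thesis using assms(2) by (simp add: lessThan_Suc finsum_insert Pi_iff a_comm)
qed

lemma finsum_additive:
  assumes G: "abelian_monoid G" and z: "\<phi> \<zero>\<^bsub>G\<^esub> = (0 :: 'b::comm_monoid_add)"
    and a: "\<And>x y. x \<in> carrier G \<Longrightarrow> y \<in> carrier G \<Longrightarrow> \<phi> (x \<oplus>\<^bsub>G\<^esub> y) = \<phi> x + \<phi> y"
    and A: "finite A" "\<And>i. i \<in> A \<Longrightarrow> f i \<in> carrier G"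
  shows "\<phi> (finsum G f A) = (\<Sum>i\<in>A. \<phi> (f i))"
proof -
  interpret abelian_monoid G by fact
  show ?thesis using A
  proof (induction A)
    case (insert x F)
    then have "finsum G f F \<in> carrier G" by (intro finsum_closed) auto
    then show ?case using insert a by (simp add: finsum_insert Pi_iff)
  qed (simp add: z)
qed

lemma finsum_hom:
  assumes G: "abelian_monoid G" "abelian_monoid H" and z: "\<phi> \<zero>\<^bsub>G\<^esub> = \<zero>\<^bsub>H\<^esub>"
    and a: "\<And>x y. x \<in> carrier G \<Longrightarrow> y \<in> carrier G \<Longrightarrow> \<phi> (x \<oplus>\<^bsub>G\<^esub> y) = \<phi> x \<oplus>\<^bsub>H\<^esub> \<phi> y"
    and c: "\<And>x. x \<in> carrier G \<Longrightarrow> \<phi> x \<in> carrier H"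
    and A: "finite A" "\<And>i. i \<in> A \<Longrightarrow> f i \<in> carrier G"
  shows "\<phi> (finsum G f A) = finsum H (\<lambda>i. \<phi> (f i)) A"
proof -
  interpret G: abelian_monoid G by fact
  interpret H: abelian_monoid H by fact
  show ?thesis using A
  proof (induction A)
    case (insert x F)
    then have "finsum G f F \<in> carrier G" by (intro G.finsum_closed) auto
    then show ?case using insert a c by (simp add: G.finsum_insert H.finsum_insert Pi_iff)
  qed (simp add: z)
qed

context toric_setup
begin

definition rg :: "('n, 'k) point set \<Rightarrow> ('n, 'k) lfrac \<Rightarrow> bool" where
  "rg W q \<longleftrightarrow> (\<forall>x\<in>W. q \<in> loc x)"

lemma rg_regular: "zariski_open W \<Longrightarrow> cf W q \<in> regular_functions W \<longleftrightarrow> rg W q"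
  by (simp add: cf_regular_iff rg_def)

lemma rg_mono: "V \<subseteq> W \<Longrightarrow> rg W q \<Longrightarrow> rg V q"
  by (auto simp: rg_def)

lemma rg_closed:
  assumes W: "zariski_open W"
  shows rg_add: "rg W p \<Longrightarrow> rg W q \<Longrightarrow> rg W (p + q)"
    and rg_mult: "rg W p \<Longrightarrow> rg W q \<Longrightarrow> rg W (p * q)"
    and rg_0: "rg W 0" and rg_1: "rg W 1"
  using subsetD[OF zariski_open_points[OF W]] loc_add loc_mult loc_0 loc_1
  by (simp_all add: rg_def)

lemma ex_rg_nbhd:
  fixes n :: nat
  assumes "x \<in> points" "\<And>i. i < n \<Longrightarrow> q i \<in> loc x"
  shows "\<exists>V. zariski_open V \<and> x \<in> V \<and> (\<forall>i<n. rg V (q i))"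
  using assms(2)
proof (induction n)
  case 0
  obtain \<sigma> where s: "\<sigma> \<in> \<Sigma>" "x \<in> chart \<sigma>" using assms(1) unfolding points_chart by (elim UN_E)
  show ?case by (intro exI[of _ "chart \<sigma>"]) (simp add: s zariski_open_chart)
next
  case (Suc n)
  then obtain V where V: "zariski_open V" "x \<in> V" "\<forall>i<n. rg V (q i)" by force
  obtain U where U: "zariski_open U" "x \<in> U" "rg U (q n)"
    using loc_open_nbhd[OF assms(1), of "q n"] Suc.prems[of n] unfolding rg_def by blast
  show ?case
    using V U rg_mono[of "V \<inter> U" V] rg_mono[of "V \<inter> U" U]
    by (intro exI[of _ "V \<inter> U"]) (auto simp: less_Suc_eq zariski_open_Int)
qed

end

section \<open>Sections as modules over constant fractions, and local frames\<close>

locale toric_bundle = toric_setup val \<pi> \<Sigma>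
  for val :: "'k::field \<Rightarrow> ereal" and \<pi> :: 'k and \<Sigma> :: "'n::finite cone set" +
  fixes r :: nat and F :: "('n, 'k, 'e) linearized_sheaf"
  assumes toric_vb: "toric_vector_bundle r F"
begin

abbreviation "H \<equiv> sections F"
abbreviation "res \<equiv> restriction F"

lemma sheaf: "sheaf_of_modules F" and locally_free: "locally_free r F" and linearized: "torus_linearized F"
  using toric_vb by (simp_all add: toric_vector_bundle_def vector_bundle_def)

lemma H_module: "zariski_open W \<Longrightarrow> module (structure_sheaf W) (H W)"
  using sheaf by (simp add: sheaf_of_modules_def)

lemma H_abelian_group: "zariski_open W \<Longrightarrow> abelian_group (H W)"
  using H_module by (simp add: module_def)

lemma H_abelian_monoid: "zariski_open W \<Longrightarrow> abelian_monoid (H W)"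
  using H_abelian_group by (simp add: abelian_group_def)

context
  fixes W assumes W: "zariski_open W"
begin

interpretation M: module "structure_sheaf W" "H W" by (rule H_module[OF W])

lemma H_zero_closed: "\<zero>\<^bsub>H W\<^esub> \<in> carrier (H W)" by simp

lemma H_add_closed: "s \<in> carrier (H W) \<Longrightarrow> t \<in> carrier (H W) \<Longrightarrow> s \<oplus>\<^bsub>H W\<^esub> t \<in> carrier (H W)" by simp

lemma rg_in_carrier: "rg W q \<Longrightarrow> cf W q \<in> carrier (structure_sheaf W)"
  by (simp add: structure_sheaf_simps rg_regular W)

lemma H_smult_closed: "rg W q \<Longrightarrow> s \<in> carrier (H W) \<Longrightarrow> cf W q \<odot>\<^bsub>H W\<^esub> s \<in> carrier (H W)"
  using rg_in_carrier by simp

lemma H_smult_add: "rg W p \<Longrightarrow> rg W q \<Longrightarrow> s \<in> carrier (H W) \<Longrightarrow>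
    cf W (p + q) \<odot>\<^bsub>H W\<^esub> s = cf W p \<odot>\<^bsub>H W\<^esub> s \<oplus>\<^bsub>H W\<^esub> cf W q \<odot>\<^bsub>H W\<^esub> s"
  using M.smult_l_distr[OF rg_in_carrier rg_in_carrier] by (simp add: structure_sheaf_simps)

lemma H_smult_smult: "rg W p \<Longrightarrow> rg W q \<Longrightarrow> s \<in> carrier (H W) \<Longrightarrow>
    cf W (p * q) \<odot>\<^bsub>H W\<^esub> s = cf W p \<odot>\<^bsub>H W\<^esub> (cf W q \<odot>\<^bsub>H W\<^esub> s)"
  using M.smult_assoc1[OF rg_in_carrier rg_in_carrier] by (simp add: structure_sheaf_simps)

lemma H_smult_add_right: "rg W p \<Longrightarrow> s \<in> carrier (H W) \<Longrightarrow> t \<in> carrier (H W) \<Longrightarrow>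
    cf W p \<odot>\<^bsub>H W\<^esub> (s \<oplus>\<^bsub>H W\<^esub> t) = cf W p \<odot>\<^bsub>H W\<^esub> s \<oplus>\<^bsub>H W\<^esub> cf W p \<odot>\<^bsub>H W\<^esub> t"
  using M.smult_r_distr[OF rg_in_carrier] by simp

lemma H_smult_zero: "s \<in> carrier (H W) \<Longrightarrow> cf W 0 \<odot>\<^bsub>H W\<^esub> s = \<zero>\<^bsub>H W\<^esub>"
  using M.smult_l_null by (simp add: structure_sheaf_simps)

lemma H_smult_zero_right: "rg W p \<Longrightarrow> cf W p \<odot>\<^bsub>H W\<^esub> \<zero>\<^bsub>H W\<^esub> = \<zero>\<^bsub>H W\<^esub>"
  using M.smult_r_null[OF rg_in_carrier] by simp

lemma H_smult_one: "s \<in> carrier (H W) \<Longrightarrow> cf W 1 \<odot>\<^bsub>H W\<^esub> s = s"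
  using M.smult_one by (simp add: structure_sheaf_simps)

definition lin :: "nat \<Rightarrow> (nat \<Rightarrow> ('n, 'k) lfrac) \<Rightarrow> (nat \<Rightarrow> 'e) \<Rightarrow> 'e" where
  "lin n q t = (\<Oplus>\<^bsub>H W\<^esub>i\<in>{..<n}. cf W (q i) \<odot>\<^bsub>H W\<^esub> t i)"

lemma lin_closed:
  "(\<And>i. i < n \<Longrightarrow> rg W (q i)) \<Longrightarrow> (\<And>i. i < n \<Longrightarrow> t i \<in> carrier (H W)) \<Longrightarrow> lin n q t \<in> carrier (H W)"
  unfolding lin_def by (intro M.M.finsum_closed) (auto intro: H_smult_closed)

lemma lin_cong:
  assumes "\<And>i. i < n \<Longrightarrow> q i = q' i" "\<And>i. i < n \<Longrightarrow> t i = t' i"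
    "\<And>i. i < n \<Longrightarrow> rg W (q' i)" "\<And>i. i < n \<Longrightarrow> t' i \<in> carrier (H W)"
  shows "lin n q t = lin n q' t'"
  unfolding lin_def using assms by (intro M.M.finsum_cong') (auto intro: H_smult_closed)

lemma lin_add:
  assumes "\<And>i. i < n \<Longrightarrow> rg W (p i)" "\<And>i. i < n \<Longrightarrow> rg W (q i)" "\<And>i. i < n \<Longrightarrow> t i \<in> carrier (H W)"
  shows "lin n (\<lambda>i. p i + q i) t = lin n p t \<oplus>\<^bsub>H W\<^esub> lin n q t"
proof -
  have "lin n (\<lambda>i. p i + q i) t = (\<Oplus>\<^bsub>H W\<^esub>i\<in>{..<n}. cf W (p i) \<odot>\<^bsub>H W\<^esub> t i \<oplus>\<^bsub>H W\<^esub> cf W (q i) \<odot>\<^bsub>H W\<^esub> t i)"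
    unfolding lin_def using assms by (intro M.M.finsum_cong') (auto simp: H_smult_add intro!: H_smult_closed H_add_closed)
  also have "\<dots> = lin n p t \<oplus>\<^bsub>H W\<^esub> lin n q t"
    unfolding lin_def using assms by (intro M.M.finsum_addf) (auto intro: H_smult_closed)
  finally show ?thesis .
qed

lemma lin_smult:
  assumes "rg W p" "\<And>i. i < n \<Longrightarrow> rg W (q i)" "\<And>i. i < n \<Longrightarrow> t i \<in> carrier (H W)"
  shows "lin n (\<lambda>i. p * q i) t = cf W p \<odot>\<^bsub>H W\<^esub> lin n q t"
proof -
  have "cf W p \<odot>\<^bsub>H W\<^esub> lin n q t = (\<Oplus>\<^bsub>H W\<^esub>i\<in>{..<n}. cf W p \<odot>\<^bsub>H W\<^esub> (cf W (q i) \<odot>\<^bsub>H W\<^esub> t i))"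
    unfolding lin_def
    by (rule finsum_hom[OF H_abelian_monoid[OF W] H_abelian_monoid[OF W]])
      (use assms in \<open>auto simp: H_smult_zero_right H_smult_add_right intro: H_smult_closed\<close>)
  also have "\<dots> = lin n (\<lambda>i. p * q i) t"
    unfolding lin_def using assms by (intro M.M.finsum_cong') (auto simp: H_smult_smult intro: H_smult_closed rg_mult W)
  finally show ?thesis ..
qed

end

lemma res_closed: "zariski_open W \<Longrightarrow> zariski_open V \<Longrightarrow> V \<subseteq> W \<Longrightarrow> s \<in> carrier (H W) \<Longrightarrow> res W V s \<in> carrier (H V)"
  and res_add: "zariski_open W \<Longrightarrow> zariski_open V \<Longrightarrow> V \<subseteq> W \<Longrightarrow> s \<in> carrier (H W) \<Longrightarrow> t \<in> carrier (H W) \<Longrightarrow>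
      res W V (s \<oplus>\<^bsub>H W\<^esub> t) = res W V s \<oplus>\<^bsub>H V\<^esub> res W V t"
  and res_id: "zariski_open W \<Longrightarrow> s \<in> carrier (H W) \<Longrightarrow> res W W s = s"
  and res_res: "zariski_open W \<Longrightarrow> zariski_open V \<Longrightarrow> zariski_open V' \<Longrightarrow> V' \<subseteq> V \<Longrightarrow> V \<subseteq> W \<Longrightarrow> s \<in> carrier (H W) \<Longrightarrow>
      res V V' (res W V s) = res W V' s"
  using sheaf unfolding sheaf_of_modules_def by simp_all

lemma res_smult:
  assumes "zariski_open W" "zariski_open V" "V \<subseteq> W" "s \<in> carrier (H W)" "rg W q"
  shows "res W V (cf W q \<odot>\<^bsub>H W\<^esub> s) = cf V q \<odot>\<^bsub>H V\<^esub> res W V s"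
proof -
  have "res W V (cf W q \<odot>\<^bsub>H W\<^esub> s) = restrict_func V (cf W q) \<odot>\<^bsub>H V\<^esub> res W V s"
    using sheaf assms rg_regular[OF assms(1), of q] unfolding sheaf_of_modules_def by simp
  then show ?thesis by (simp add: cf_restrict assms)
qed

lemma res_zero:
  assumes "zariski_open W" "zariski_open V" "V \<subseteq> W"
  shows "res W V \<zero>\<^bsub>H W\<^esub> = \<zero>\<^bsub>H V\<^esub>"
proof -
  have "res W V (cf W 0 \<odot>\<^bsub>H W\<^esub> \<zero>\<^bsub>H W\<^esub>) = cf V 0 \<odot>\<^bsub>H V\<^esub> res W V \<zero>\<^bsub>H W\<^esub>"
    using assms by (intro res_smult) (auto intro: H_zero_closed rg_0)
  then show ?thesis using assms
    by (simp add: H_smult_zero H_zero_closed res_closed)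
qed

lemma res_lin:
  assumes "zariski_open W" "zariski_open V" "V \<subseteq> W" "\<And>i. i < n \<Longrightarrow> rg W (q i)" "\<And>i. i < n \<Longrightarrow> t i \<in> carrier (H W)"
  shows "res W V (lin W n q t) = lin V n q (\<lambda>i. res W V (t i))"
proof -
  have "res W V (lin W n q t) = (\<Oplus>\<^bsub>H V\<^esub>i\<in>{..<n}. res W V (cf W (q i) \<odot>\<^bsub>H W\<^esub> t i))"
    unfolding lin_def[OF assms(1)]
    by (rule finsum_hom[OF H_abelian_monoid[OF assms(1)] H_abelian_monoid[OF assms(2)]])
      (use assms in \<open>auto simp: res_zero res_add intro: res_closed H_smult_closed\<close>)
  also have "\<dots> = lin V n q (\<lambda>i. res W V (t i))"
    unfolding lin_def[OF assms(2)]
    by (rule abelian_monoid.finsum_cong'[OF H_abelian_monoid[OF assms(2)]])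
      (use assms rg_mono in \<open>auto simp: res_smult intro!: H_smult_closed res_closed\<close>)
  finally show ?thesis .
qed

lemma gluing:
  assumes "\<And>V. V \<in> \<W> \<Longrightarrow> zariski_open V" "\<And>V. V \<in> \<W> \<Longrightarrow> s V \<in> carrier (H V)"
    "\<And>V V'. V \<in> \<W> \<Longrightarrow> V' \<in> \<W> \<Longrightarrow> res V (V \<inter> V') (s V) = res V' (V \<inter> V') (s V')"
  shows "\<exists>!t. t \<in> carrier (H (\<Union>\<W>)) \<and> (\<forall>V\<in>\<W>. res (\<Union>\<W>) V t = s V)"
proof -
  have "\<forall>\<W> s. (\<forall>V\<in>\<W>. zariski_open V \<and> s V \<in> carrier (sections F V)) \<and>
        (\<forall>V\<in>\<W>. \<forall>V'\<in>\<W>. restriction F V (V \<inter> V') (s V) = restriction F V' (V \<inter> V') (s V')) \<longrightarrow>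
        (\<exists>!t. t \<in> carrier (sections F (\<Union>\<W>)) \<and> (\<forall>V\<in>\<W>. restriction F (\<Union>\<W>) V t = s V))"
    using sheaf unfolding sheaf_of_modules_def by (elim conjE)
  from this[THEN spec[of _ \<W>], THEN spec[of _ s]] show ?thesis by (rule mp) (use assms in blast)
qed

text \<open>Uniqueness of gluing, applied to the cover by all open sets on which the two sections
  agree.\<close>

lemma section_eqI:
  assumes W: "zariski_open W" and st: "s \<in> carrier (H W)" "t \<in> carrier (H W)"
    and loc: "\<And>x. x \<in> W \<Longrightarrow> \<exists>V. zariski_open V \<and> x \<in> V \<and> V \<subseteq> W \<and> res W V s = res W V t"
  shows "s = t"
proof -
  let ?W = "{V. zariski_open V \<and> V \<subseteq> W \<and> res W V s = res W V t}"
  have U: "\<Union>?W = W" using loc by blast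
  have "\<exists>!t'. t' \<in> carrier (H (\<Union>?W)) \<and> (\<forall>V\<in>?W. res (\<Union>?W) V t' = res W V s)"
    by (rule gluing) (auto simp: res_closed res_res W st zariski_open_Int)
  then show ?thesis using st unfolding U by (metis (mono_tags, lifting) mem_Collect_eq)
qed

lemma section_empty: "s \<in> carrier (H {}) \<Longrightarrow> t \<in> carrier (H {}) \<Longrightarrow> s = t"
  by (rule section_eqI[OF zariski_open_empty]) auto

text \<open>A local frame with constant fractions as coefficients instead of regular functions.
  Uniqueness is required on nonempty sets only, since over the empty set all fractions give the same
  function.\<close>

definition frame :: "('n, 'k) point set \<Rightarrow> (nat \<Rightarrow> 'e) \<Rightarrow> bool" where
  "frame W t \<longleftrightarrow> zariski_open W \<and> W \<noteq> {} \<and> (\<forall>i<r. t i \<in> carrier (H W)) \<and>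
     (\<forall>V. zariski_open V \<and> V \<subseteq> W \<longrightarrow>
        (\<forall>s\<in>carrier (H V). \<exists>q. (\<forall>i<r. rg V (q i)) \<and> s = lin V r q (\<lambda>i. res W V (t i))) \<and>
        (\<forall>q q'. V \<noteq> {} \<and> (\<forall>i<r. rg V (q i)) \<and> (\<forall>i<r. rg V (q' i)) \<and>
           lin V r q (\<lambda>i. res W V (t i)) = lin V r q' (\<lambda>i. res W V (t i)) \<longrightarrow> (\<forall>i<r. q i = q' i)))"

lemma frameI:
  assumes W: "zariski_open W" "W \<noteq> {}" and t: "\<And>i. i < r \<Longrightarrow> t i \<in> carrier (H W)"
    and ex: "\<And>V s. zariski_open V \<Longrightarrow> V \<subseteq> W \<Longrightarrow> s \<in> carrier (H V) \<Longrightarrow>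
      \<exists>q. (\<forall>i<r. rg V (q i)) \<and> s = lin V r q (\<lambda>i. res W V (t i))"
    and un: "\<And>V q q' i. zariski_open V \<Longrightarrow> V \<subseteq> W \<Longrightarrow> V \<noteq> {} \<Longrightarrow> (\<And>i. i < r \<Longrightarrow> rg V (q i)) \<Longrightarrow> (\<And>i. i < r \<Longrightarrow> rg V (q' i)) \<Longrightarrow>
      lin V r q (\<lambda>i. res W V (t i)) = lin V r q' (\<lambda>i. res W V (t i)) \<Longrightarrow> i < r \<Longrightarrow> q i = q' i"
  shows "frame W t"
  unfolding frame_def
proof (intro conjI allI impI ballI)
  fix V s assume "zariski_open V \<and> V \<subseteq> W" "s \<in> carrier (H V)"
  then show "\<exists>q. (\<forall>i<r. rg V (q i)) \<and> s = lin V r q (\<lambda>i. res W V (t i))" using ex by simp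
next
  fix V q q' i
  assume "zariski_open V \<and> V \<subseteq> W" "V \<noteq> {} \<and> (\<forall>i<r. rg V (q i)) \<and> (\<forall>i<r. rg V (q' i)) \<and>
           lin V r q (\<lambda>i. res W V (t i)) = lin V r q' (\<lambda>i. res W V (t i))" "i < r"
  then show "q i = q' i" using un[of V q q' i] by simp
qed (use W t in auto)

lemma frame_facts:
  assumes "frame W t"
  shows frame_open: "zariski_open W" and frame_nonempty: "W \<noteq> {}"
    and frame_closed: "i < r \<Longrightarrow> t i \<in> carrier (H W)"
  using assms by (simp_all add: frame_def)

lemma frame_ex:
  assumes "frame W t" "zariski_open V" "V \<subseteq> W" "s \<in> carrier (H V)"
  obtains q where "\<And>i. i < r \<Longrightarrow> rg V (q i)" "\<And>i. r \<le> i \<Longrightarrow> q i = 0" "s = lin V r q (\<lambda>i. res W V (t i))"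
proof -
  obtain q where q: "\<forall>i<r. rg V (q i)" "s = lin V r q (\<lambda>i. res W V (t i))"
    using assms unfolding frame_def by blast
  let ?q = "\<lambda>i. if i < r then q i else 0"
  have "lin V r ?q (\<lambda>i. res W V (t i)) = lin V r q (\<lambda>i. res W V (t i))"
    by (rule lin_cong[OF assms(2)]) (use q assms frame_open[OF assms(1)] frame_closed[OF assms(1)] in \<open>auto intro: res_closed\<close>)
  then show ?thesis using q by (intro that[of ?q]) auto
qed

lemma frame_unique:
  assumes "frame W t" "zariski_open V" "V \<subseteq> W" "V \<noteq> {}" "\<And>i. i < r \<Longrightarrow> rg V (q i)" "\<And>i. i < r \<Longrightarrow> rg V (q' i)"
    "lin V r q (\<lambda>i. res W V (t i)) = lin V r q' (\<lambda>i. res W V (t i))" "i < r"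
  shows "q i = q' i"
proof -
  have "\<forall>q q'. V \<noteq> {} \<and> (\<forall>i<r. rg V (q i)) \<and> (\<forall>i<r. rg V (q' i)) \<and>
           lin V r q (\<lambda>i. res W V (t i)) = lin V r q' (\<lambda>i. res W V (t i)) \<longrightarrow> (\<forall>i<r. q i = q' i)"
    using assms(1-3) by (simp add: frame_def)
  then show ?thesis using assms(4-8) by blast
qed

lemma ex_frame:
  assumes x: "x \<in> points"
  obtains W t where "x \<in> W" "frame W t"
proof -
  obtain W t where W0: "zariski_open W \<and> x \<in> W \<and> (\<forall>i<r. t i \<in> carrier (H W)) \<and>
    (\<forall>V. zariski_open V \<and> V \<subseteq> W \<longrightarrow> (\<forall>s\<in>carrier (H V).
      \<exists>!a. a \<in> {..<r} \<rightarrow>\<^sub>E regular_functions V \<and> s = (\<Oplus>\<^bsub>H V\<^esub>i\<in>{..<r}. a i \<odot>\<^bsub>H V\<^esub> res W V (t i))))"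
    using bspec[OF locally_free[unfolded locally_free_def] x] by (elim exE)
  then have W: "zariski_open W" "x \<in> W" "\<And>i. i < r \<Longrightarrow> t i \<in> carrier (H W)" by simp_all
  have ex1: "\<exists>!a. a \<in> {..<r} \<rightarrow>\<^sub>E regular_functions V \<and> s = (\<Oplus>\<^bsub>H V\<^esub>i\<in>{..<r}. a i \<odot>\<^bsub>H V\<^esub> res W V (t i))"
    if "zariski_open V" "V \<subseteq> W" "s \<in> carrier (H V)" for V s
    using W0[THEN conjunct2, THEN conjunct2, THEN conjunct2, THEN spec, THEN mp, OF conjI[OF that(1,2)]] that(3)
    by (rule bspec)
  have lin_eq: "lin V r q (\<lambda>i. res W V (t i)) = (\<Oplus>\<^bsub>H V\<^esub>i\<in>{..<r}. a i \<odot>\<^bsub>H V\<^esub> res W V (t i))"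
    if V: "zariski_open V" "V \<subseteq> W" and q: "\<And>i. i < r \<Longrightarrow> rg V (q i)" "\<And>i. i < r \<Longrightarrow> a i = cf V (q i)" for V q a
    unfolding lin_def[OF V(1)]
    by (rule abelian_monoid.finsum_cong'[OF H_abelian_monoid[OF V(1)]])
      (use V q W in \<open>auto intro!: H_smult_closed res_closed\<close>)
  have "frame W t"
  proof (rule frameI)
    fix V s assume V: "zariski_open V" "V \<subseteq> W" "s \<in> carrier (H V)"
    obtain a where a: "a \<in> {..<r} \<rightarrow>\<^sub>E regular_functions V" "s = (\<Oplus>\<^bsub>H V\<^esub>i\<in>{..<r}. a i \<odot>\<^bsub>H V\<^esub> res W V (t i))"
      using ex1[OF V] by blast
    have "\<exists>q. a i = cf V q \<and> rg V q" if "i < r" for i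
      using regular_functions_cf[OF V(1), of "a i"] a(1) that unfolding rg_def by blast
    then obtain q where q: "\<And>i. i < r \<Longrightarrow> a i = cf V (q i)" "\<And>i. i < r \<Longrightarrow> rg V (q i)" by metis
    then show "\<exists>q. (\<forall>i<r. rg V (q i)) \<and> s = lin V r q (\<lambda>i. res W V (t i))"
      using lin_eq[OF V(1,2), of q a] a(2) by (intro exI[of _ q]) simp
  next
    fix V q q' i
    assume V: "zariski_open V" "V \<subseteq> W" "V \<noteq> {}" and q: "\<And>i. i < r \<Longrightarrow> rg V (q i)" and q': "\<And>i. i < r \<Longrightarrow> rg V (q' i)"
      and eq: "lin V r q (\<lambda>i. res W V (t i)) = lin V r q' (\<lambda>i. res W V (t i))" and i: "i < r"
    let ?a = "\<lambda>q. \<lambda>i\<in>{..<r}. cf V (q i)"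
    let ?s = "lin V r q (\<lambda>i. res W V (t i))"
    have s: "?s \<in> carrier (H V)" using V q W by (intro lin_closed) (auto intro: res_closed)
    have "?a q \<in> {..<r} \<rightarrow>\<^sub>E regular_functions V" "?a q' \<in> {..<r} \<rightarrow>\<^sub>E regular_functions V"
      using q q' rg_regular[OF V(1)] by auto
    moreover have "?s = (\<Oplus>\<^bsub>H V\<^esub>i\<in>{..<r}. ?a q i \<odot>\<^bsub>H V\<^esub> res W V (t i))"
      by (rule lin_eq[OF V(1,2) q]) auto
    moreover have "?s = (\<Oplus>\<^bsub>H V\<^esub>i\<in>{..<r}. ?a q' i \<odot>\<^bsub>H V\<^esub> res W V (t i))"
      unfolding eq by (rule lin_eq[OF V(1,2) q']) auto
    ultimately have "?a q = ?a q'" using ex1[OF V(1,2) s] by blast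
    from fun_cong[OF this, of i] have "cf V (q i) = cf V (q' i)" using i by simp
    then show "q i = q' i" using cf_eq_iff[OF V(1,3)] by blast
  qed (use W in auto)
  then show ?thesis using that W(2) by blast
qed

end

text \<open>One frame on one open set is fixed. Every nonempty open set meets it, so sections over
  any open set can be written in this single frame.\<close>

locale framed_bundle = toric_bundle val \<pi> \<Sigma> r F
  for val :: "'k::field \<Rightarrow> ereal" and \<pi> :: 'k and \<Sigma> :: "'n::finite cone set"
    and r :: nat and F :: "('n, 'k, 'e) linearized_sheaf" +
  fixes W0 :: "('n, 'k) point set" and t0 :: "nat \<Rightarrow> 'e"
  assumes frame0: "frame W0 t0"
begin

lemma open0: "zariski_open W0"
  and generic0: "generic_point \<in> W0"
proof -
  show W: "zariski_open W0" by (rule frame_open[OF frame0])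
  show "generic_point \<in> W0" using frame_nonempty[OF frame0] generic_point_in_open[OF W] by blast
qed

lemma open_Int0: "zariski_open W \<Longrightarrow> zariski_open (W \<inter> W0)"
  using zariski_open_Int open0 by blast

lemma nonempty_Int0: "zariski_open W \<Longrightarrow> W \<noteq> {} \<Longrightarrow> W \<inter> W0 \<noteq> {}"
  using generic0 generic_point_in_open by blast

section \<open>Coordinates of sections in the fixed frame\<close>

definition coords :: "('n, 'k) point set \<Rightarrow> 'e \<Rightarrow> (nat \<Rightarrow> ('n, 'k) lfrac) \<Rightarrow> bool" where
  "coords W s q \<longleftrightarrow> (\<forall>i\<ge>r. q i = 0) \<and> (\<forall>i<r. rg (W \<inter> W0) (q i)) \<and>
     res W (W \<inter> W0) s = lin (W \<inter> W0) r q (\<lambda>i. res W0 (W \<inter> W0) (t0 i))"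

text \<open>The coordinates are read on \<open>W \<inter> W0\<close>, so they are fractions that may
  have poles on the rest of \<open>W\<close>. On the empty set they are 0 by convention.\<close>

definition cd :: "('n, 'k) point set \<Rightarrow> 'e \<Rightarrow> nat \<Rightarrow> ('n, 'k) lfrac" where
  "cd W s = (if W = {} then (\<lambda>_. 0) else THE q. coords W s q)"

lemma t0_closed: "zariski_open V \<Longrightarrow> V \<subseteq> W0 \<Longrightarrow> i < r \<Longrightarrow> res W0 V (t0 i) \<in> carrier (H V)"
  using res_closed[OF open0] frame_closed[OF frame0] by blast

context
  fixes W assumes W: "zariski_open W" "W \<noteq> {}"
begin

lemma coords_unique:
  assumes "coords W s q" "coords W s q'" shows "q = q'"
proof
  fix i
  show "q i = q' i"
  proof (cases "i < r")
    case True
    then show ?thesis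
      using frame_unique[OF frame0 open_Int0[OF W(1)] _ nonempty_Int0[OF W], of q q' i] assms
      unfolding coords_def by auto
  next
    case False
    then show ?thesis using assms by (simp add: coords_def)
  qed
qed

lemma coords_ex:
  assumes s: "s \<in> carrier (H W)" shows "\<exists>q. coords W s q"
proof -
  have "res W (W \<inter> W0) s \<in> carrier (H (W \<inter> W0))" using res_closed W(1) open_Int0[OF W(1)] s by blast
  then show ?thesis using frame_ex[OF frame0 open_Int0[OF W(1)]] unfolding coords_def by (metis Int_lower2)
qed

lemma cd_eqI: "coords W s q \<Longrightarrow> cd W s = q"
  unfolding cd_def using W coords_unique by (auto intro!: the_equality)

lemma coords_cd: "s \<in> carrier (H W) \<Longrightarrow> coords W s (cd W s)"
  using coords_ex cd_eqI by blast

end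

lemma cd_empty: "cd {} s = (\<lambda>_. 0)"
  by (simp add: cd_def)

lemma cd_ge: "zariski_open W \<Longrightarrow> s \<in> carrier (H W) \<Longrightarrow> r \<le> i \<Longrightarrow> cd W s i = 0"
  using coords_cd[of W s] by (cases "W = {}") (auto simp: cd_empty coords_def)

lemma cd_add:
  assumes W: "zariski_open W" and s: "s \<in> carrier (H W)" "t \<in> carrier (H W)"
  shows "cd W (s \<oplus>\<^bsub>H W\<^esub> t) = (\<lambda>i. cd W s i + cd W t i)"
proof (cases "W = {}")
  case False
  note V = open_Int0[OF W]
  show ?thesis
  proof (rule cd_eqI[OF W False])
    show "coords W (s \<oplus>\<^bsub>H W\<^esub> t) (\<lambda>i. cd W s i + cd W t i)"
      using coords_cd[OF W False s(1)] coords_cd[OF W False s(2)] s V W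
      by (simp add: coords_def rg_add res_add lin_add t0_closed)
  qed
qed (simp add: cd_empty)

lemma cd_smult:
  assumes W: "zariski_open W" and s: "s \<in> carrier (H W)" and p: "rg W p"
  shows "cd W (cf W p \<odot>\<^bsub>H W\<^esub> s) = (\<lambda>i. p * cd W s i)"
proof (cases "W = {}")
  case False
  note V = open_Int0[OF W]
  have p': "rg (W \<inter> W0) p" using rg_mono[OF _ p] by blast
  show ?thesis
  proof (rule cd_eqI[OF W False])
    show "coords W (cf W p \<odot>\<^bsub>H W\<^esub> s) (\<lambda>i. p * cd W s i)"
      using coords_cd[OF W False s] s V W p p'
      by (simp add: coords_def rg_mult res_smult lin_smult t0_closed)
  qed
qed (simp add: cd_empty)

lemma cd_zero:
  assumes W: "zariski_open W" shows "cd W \<zero>\<^bsub>H W\<^esub> = (\<lambda>_. 0)"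
  using cd_smult[OF W H_zero_closed[OF W] rg_0[OF W]] by (simp add: H_smult_zero H_zero_closed W)

lemma cd_res:
  assumes W: "zariski_open W" and V: "zariski_open V" "V \<noteq> {}" "V \<subseteq> W" and s: "s \<in> carrier (H W)"
  shows "cd V (res W V s) = cd W s"
proof -
  have ne: "W \<noteq> {}" using V by blast
  note W' = open_Int0[OF W] and V' = open_Int0[OF V(1)]
  have sub: "V \<inter> W0 \<subseteq> W \<inter> W0" using V by blast
  note c = coords_cd[OF W ne s, unfolded coords_def]
  have "res V (V \<inter> W0) (res W V s) = res (W \<inter> W0) (V \<inter> W0) (res W (W \<inter> W0) s)"
    using res_res[OF W V(1) V' _ V(3) s] res_res[OF W W' V' sub _ s] by simp
  also have "\<dots> = lin (V \<inter> W0) r (cd W s) (\<lambda>i. res (W \<inter> W0) (V \<inter> W0) (res W0 (W \<inter> W0) (t0 i)))"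
    using c res_lin[OF W' V' sub, of r "cd W s" "\<lambda>i. res W0 (W \<inter> W0) (t0 i)"] by (simp add: t0_closed W')
  also have "\<dots> = lin (V \<inter> W0) r (cd W s) (\<lambda>i. res W0 (V \<inter> W0) (t0 i))"
    using c rg_mono[OF sub]
    by (intro lin_cong[OF V']) (auto simp: res_res[OF open0 W' V' sub _ frame_closed[OF frame0]] intro: t0_closed[OF V'])
  finally have "coords V (res W V s) (cd W s)"
    using c rg_mono[OF sub] by (auto simp: coords_def)
  then show ?thesis by (rule cd_eqI[OF V(1,2)])
qed

lemma cd_finsum:
  assumes W: "zariski_open W" and A: "finite A" "\<And>i. i \<in> A \<Longrightarrow> s i \<in> carrier (H W)"
  shows "cd W (\<Oplus>\<^bsub>H W\<^esub>i\<in>A. s i) j = (\<Sum>i\<in>A. cd W (s i) j)"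
  by (rule finsum_additive[OF H_abelian_monoid[OF W]]) (auto simp: cd_zero cd_add W A)

lemma cd_lin:
  assumes W: "zariski_open W" and q: "\<And>i. i < n \<Longrightarrow> rg W (q i)" and u: "\<And>i. i < n \<Longrightarrow> u i \<in> carrier (H W)"
  shows "cd W (lin W n q u) = lc n q (\<lambda>i. cd W (u i))"
proof
  fix j
  have "cd W (lin W n q u) j = (\<Sum>i<n. cd W (cf W (q i) \<odot>\<^bsub>H W\<^esub> u i) j)"
    unfolding lin_def[OF W] by (rule cd_finsum[OF W]) (use q u in \<open>auto intro: H_smult_closed[OF W]\<close>)
  also have "\<dots> = lc n q (\<lambda>i. cd W (u i)) j"
    unfolding lc_def by (rule sum.cong[OF refl]) (simp add: cd_smult[OF W u q])
  finally show "cd W (lin W n q u) j = lc n q (\<lambda>i. cd W (u i)) j" .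
qed

text \<open>In a frame on \<open>W1\<close> the coefficients are constant fractions, so their
  agreement on the smaller set \<open>V \<inter> W0\<close> already gives agreement on
  \<open>V\<close>. This is where torsion-freeness enters.\<close>

lemma res_eq_iff_coords_eq:
  assumes V: "zariski_open V" "V \<noteq> {}" "V \<subseteq> W1" and f: "frame W1 t"
    and s: "s \<in> carrier (H V)" "s' \<in> carrier (H V)" and eq: "cd V s = cd V s'"
  shows "s = s'"
proof -
  note W1 = frame_open[OF f]
  obtain q where q: "\<And>i. i < r \<Longrightarrow> rg V (q i)" "s = lin V r q (\<lambda>i. res W1 V (t i))"
    using frame_ex[OF f V(1,3) s(1)] by metis
  obtain q' where q': "\<And>i. i < r \<Longrightarrow> rg V (q' i)" "s' = lin V r q' (\<lambda>i. res W1 V (t i))"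
    using frame_ex[OF f V(1,3) s(2)] by metis
  note V0 = open_Int0[OF V(1)] and ne = nonempty_Int0[OF V(1,2)]
  have tc: "res W1 V (t i) \<in> carrier (H V)" if "i < r" for i
    using res_closed[OF W1 V(1,3) frame_closed[OF f that]] .
  have tr: "res V (V \<inter> W0) (res W1 V (t i)) = res W1 (V \<inter> W0) (t i)" if "i < r" for i
    using res_res[OF W1 V(1) V0 _ V(3) frame_closed[OF f that]] by blast
  have tc': "res W1 (V \<inter> W0) (t i) \<in> carrier (H (V \<inter> W0))" if "i < r" for i
    using res_closed[OF W1 V0 _ frame_closed[OF f that]] V(3) by blast
  have rq: "rg (V \<inter> W0) (q i)" "rg (V \<inter> W0) (q' i)" if "i < r" for i
    using rg_mono[of "V \<inter> W0" V] q(1) q'(1) that by blast+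
  have "res V (V \<inter> W0) s = res V (V \<inter> W0) s'"
    using coords_cd[OF V(1,2) s(1)] coords_cd[OF V(1,2) s(2)] eq unfolding coords_def by simp
  moreover have "res V (V \<inter> W0) s = lin (V \<inter> W0) r q (\<lambda>i. res W1 (V \<inter> W0) (t i))"
    unfolding q(2) using res_lin[OF V(1) V0 _ q(1) tc] lin_cong[OF V0, of r q q, OF _ tr rq(1) tc'] by simp
  moreover have "res V (V \<inter> W0) s' = lin (V \<inter> W0) r q' (\<lambda>i. res W1 (V \<inter> W0) (t i))"
    unfolding q'(2) using res_lin[OF V(1) V0 _ q'(1) tc] lin_cong[OF V0, of r q' q', OF _ tr rq(2) tc'] by simp
  ultimately have "q i = q' i" if "i < r" for i
    using frame_unique[OF f V0 _ ne, of q q' i] rq V(3) that by auto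
  then show ?thesis unfolding q(2) q'(2) using q'(1) tc by (intro lin_cong[OF V(1)]) auto
qed

lemma cd_inj:
  assumes W: "zariski_open W" and s: "s \<in> carrier (H W)" "s' \<in> carrier (H W)" and eq: "cd W s = cd W s'"
  shows "s = s'"
proof (rule section_eqI[OF W s])
  fix x assume x: "x \<in> W"
  then obtain W1 t where f: "x \<in> W1" "frame W1 t" using ex_frame zariski_open_points[OF W] by blast
  let ?V = "W \<inter> W1"
  have V: "zariski_open ?V" "?V \<noteq> {}" using zariski_open_Int[OF W frame_open[OF f(2)]] x f(1) by auto
  have "res W ?V s = res W ?V s'"
    by (rule res_eq_iff_coords_eq[OF V _ f(2)]) (use s eq W V in \<open>auto simp: cd_res intro: res_closed\<close>)
  then show "\<exists>V. zariski_open V \<and> x \<in> V \<and> V \<subseteq> W \<and> res W V s = res W V s'" using V x f by blast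
qed

text \<open>The stalk at \<open>x\<close>, embedded as a lattice of coordinate vectors in the
  generic stalk.\<close>

definition Lam :: "('n, 'k) point \<Rightarrow> (nat \<Rightarrow> ('n, 'k) lfrac) set" where
  "Lam x = {cd V s | V s. zariski_open V \<and> x \<in> V \<and> s \<in> carrier (H V)}"

text \<open>Sections over \<open>W\<close> as the intersection of the stalks. The second clause
  keeps the description correct over the empty set, where the zero section is the only one.\<close>

definition Gam :: "('n, 'k) point set \<Rightarrow> (nat \<Rightarrow> ('n, 'k) lfrac) set" where
  "Gam W = {v. (\<forall>x\<in>W. v \<in> Lam x) \<and> (W = {} \<longrightarrow> v = (\<lambda>_. 0))}"

lemma cd_in_Gam: "zariski_open W \<Longrightarrow> s \<in> carrier (H W) \<Longrightarrow> cd W s \<in> Gam W"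
  unfolding Gam_def Lam_def by (auto simp: cd_empty)

text \<open>A vector in all stalks comes from sections locally; they agree on overlaps because
  coordinates are injective, and so they glue.\<close>

lemma cd_surj:
  assumes W: "zariski_open W" and v: "v \<in> Gam W"
  shows "\<exists>s\<in>carrier (H W). cd W s = v"
proof (cases "W = {}")
  case True
  then show ?thesis using v H_zero_closed[OF W] by (auto simp: Gam_def cd_empty)
next
  case False
  let ?W = "{V. zariski_open V \<and> V \<noteq> {} \<and> V \<subseteq> W \<and> (\<exists>s\<in>carrier (H V). cd V s = v)}"
  define s where "s V = (SOME s. s \<in> carrier (H V) \<and> cd V s = v)" for V
  have s: "s V \<in> carrier (H V)" "cd V (s V) = v" if "V \<in> ?W" for V
    using someI_ex[of "\<lambda>s. s \<in> carrier (H V) \<and> cd V s = v"] that unfolding s_def by auto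
  have U: "\<Union>?W = W"
  proof
    show "W \<subseteq> \<Union>?W"
    proof
      fix x assume x: "x \<in> W"
      then have "v \<in> Lam x" using v by (simp add: Gam_def)
      then obtain V s where V: "zariski_open V" "x \<in> V" "s \<in> carrier (H V)" "cd V s = v"
        unfolding Lam_def by blast
      have o: "zariski_open (V \<inter> W)" "V \<inter> W \<noteq> {}" using zariski_open_Int[OF V(1) W] V x by auto
      have "cd (V \<inter> W) (res V (V \<inter> W) s) = v" using cd_res[OF V(1) o _ V(3)] V(4) by simp
      moreover have "res V (V \<inter> W) s \<in> carrier (H (V \<inter> W))" using res_closed[OF V(1) o(1) _ V(3)] by simp
      ultimately show "x \<in> \<Union>?W" using o x V(2) by blast
    qed
  qed blast
  have "\<exists>!t. t \<in> carrier (H (\<Union>?W)) \<and> (\<forall>V\<in>?W. res (\<Union>?W) V t = s V)"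
  proof (rule gluing)
    fix V V' assume V: "V \<in> ?W" "V' \<in> ?W"
    have o: "zariski_open (V \<inter> V')" using zariski_open_Int V by blast
    have ne: "V \<inter> V' \<noteq> {}" using generic_point_in_open V by blast
    show "res V (V \<inter> V') (s V) = res V' (V \<inter> V') (s V')"
      using V s[OF V(1)] s[OF V(2)] o ne
      by (intro cd_inj[OF o]) (auto simp: cd_res intro: res_closed)
  qed (use s in auto)
  then obtain t where t: "t \<in> carrier (H W)" "\<forall>V\<in>?W. res W V t = s V" unfolding U by blast
  obtain V where V: "V \<in> ?W" using U False by blast
  have "cd V (res W V t) = cd W t" using V t(1) by (intro cd_res[OF W]) auto
  then have "cd W t = v" using t(2) s(2)[OF V] V by simp
  then show ?thesis using t(1) by blast
qed

lemma bij_cd: "zariski_open W \<Longrightarrow> bij_betw (cd W) (carrier (H W)) (Gam W)"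
proof (rule bij_betw_imageI)
  assume W: "zariski_open W"
  show "inj_on (cd W) (carrier (H W))" by (rule inj_onI) (rule cd_inj[OF W])
  show "cd W ` carrier (H W) = Gam W"
  proof
    show "cd W ` carrier (H W) \<subseteq> Gam W" using cd_in_Gam[OF W] by (rule image_subsetI)
    show "Gam W \<subseteq> cd W ` carrier (H W)" using cd_surj[OF W] by (metis imageI subsetI)
  qed
qed

text \<open>Independence is meant over all fractions, not only over the local ring. Hence the
  coefficients of a vector are the same at all points at which \<open>e\<close> is a frame.\<close>

definition lframe :: "('n, 'k) point \<Rightarrow> (nat \<Rightarrow> nat \<Rightarrow> ('n, 'k) lfrac) \<Rightarrow> bool" where
  "lframe x e \<longleftrightarrow> Lam x = {lc r a e | a. \<forall>i<r. a i \<in> loc x} \<and> lc_free r e"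

lemma ex_lframe:
  assumes x: "x \<in> points"
  shows "\<exists>W e. zariski_open W \<and> x \<in> W \<and> (\<forall>y\<in>W. lframe y e)"
proof -
  obtain W t where f: "x \<in> W" "frame W t" by (rule ex_frame[OF x])
  note W = frame_open[OF f(2)] and tc = frame_closed[OF f(2)]
  let ?e = "\<lambda>i. cd W (t i)"
  have e: "cd V (lin V r q (\<lambda>i. res W V (t i))) = lc r q ?e"
    and ecl: "lin V r q (\<lambda>i. res W V (t i)) \<in> carrier (H V)"
    if V: "zariski_open V" "V \<subseteq> W" "V \<noteq> {}" and q: "\<And>i. i < r \<Longrightarrow> rg V (q i)" for V q
  proof -
    have c: "res W V (t i) \<in> carrier (H V)" if "i < r" for i using res_closed[OF W V(1,2) tc[OF that]] .
    then show "lin V r q (\<lambda>i. res W V (t i)) \<in> carrier (H V)" using q by (intro lin_closed[OF V(1)])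
    show "cd V (lin V r q (\<lambda>i. res W V (t i))) = lc r q ?e"
    proof -
      have "cd V (lin V r q (\<lambda>i. res W V (t i))) = lc r q (\<lambda>i. cd V (res W V (t i)))"
        by (rule cd_lin[OF V(1)]) (use q c in auto)
      also have "\<dots> = lc r q ?e" by (rule lc_cong) (auto simp: cd_res[OF W V(1,3,2) tc])
      finally show ?thesis .
    qed
  qed
  have "lframe y ?e" if y: "y \<in> W" for y
    unfolding lframe_def
  proof (intro conjI equalityI subsetI)
    fix v assume "v \<in> Lam y"
    then obtain V s where V: "zariski_open V" "y \<in> V" "s \<in> carrier (H V)" "v = cd V s" unfolding Lam_def by blast
    let ?V = "V \<inter> W"
    have o: "zariski_open ?V" "?V \<noteq> {}" using zariski_open_Int[OF V(1) W] V y by auto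
    have sc: "res V ?V s \<in> carrier (H ?V)" using res_closed[OF V(1) o(1) _ V(3)] by simp
    obtain q where q: "\<And>i. i < r \<Longrightarrow> rg ?V (q i)" "res V ?V s = lin ?V r q (\<lambda>i. res W ?V (t i))"
      using frame_ex[OF f(2) o(1) _ sc] by (metis Int_lower2)
    have "v = lc r q ?e" using e[OF o(1) _ o(2) q(1)] cd_res[OF V(1) o _ V(3)] V(4) q(2) by simp
    moreover have "\<forall>i<r. q i \<in> loc y" using q(1) V(2) y by (auto simp: rg_def)
    ultimately show "v \<in> {lc r a ?e | a. \<forall>i<r. a i \<in> loc y}" by blast
  next
    fix v assume "v \<in> {lc r a ?e | a. \<forall>i<r. a i \<in> loc y}"
    then obtain a where a: "v = lc r a ?e" "\<And>i. i < r \<Longrightarrow> a i \<in> loc y" by blast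
    have yp: "y \<in> points" using zariski_open_points[OF W] y by blast
    obtain V where V: "zariski_open V" "y \<in> V" "\<forall>i<r. rg V (a i)" using ex_rg_nbhd[OF yp, of r a] a(2) by blast
    let ?V = "V \<inter> W"
    have o: "zariski_open ?V" "?V \<noteq> {}" using zariski_open_Int[OF V(1) W] V y by auto
    have "rg ?V (a i)" if "i < r" for i using V(3) that rg_mono[of ?V V] by blast
    from e[OF o(1) _ o(2) this] ecl[OF o(1) _ o(2) this] show "v \<in> Lam y"
      unfolding Lam_def a(1) using o V(2) y by (intro CollectI exI[of _ ?V] exI[of _ "lin ?V r a (\<lambda>i. res W ?V (t i))"]) auto
  next
    show "lc_free r ?e" unfolding lc_free_def
    proof (intro allI impI)
      fix a i assume a: "lc r a ?e = (\<lambda>_. 0)" and i: "i < r"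
      \<comment> \<open>Arbitrary fractions are regular near the generic point, whose local ring is
        the whole field of fractions; there the uniqueness of the frame applies.\<close>
      obtain V where V: "zariski_open V" "generic_point \<in> V" "\<forall>i<r. rg V (a i)"
        using ex_rg_nbhd[OF generic_point_in_points, of r a] unfolding loc_generic_point by blast
      let ?V = "V \<inter> W"
      have o: "zariski_open ?V" "?V \<noteq> {}"
        using zariski_open_Int[OF V(1) W] V generic_point_in_open[OF W f(1)] by auto
      have ra: "rg ?V (a i)" if "i < r" for i using V(3) that rg_mono[of ?V V] by blast
      have r0: "rg ?V 0" for i :: nat using rg_0[OF o(1)] .
      have "cd ?V (lin ?V r a (\<lambda>i. res W ?V (t i))) = cd ?V (lin ?V r (\<lambda>_. 0) (\<lambda>i. res W ?V (t i)))"
        using e[OF o(1) _ o(2) ra] e[OF o(1) _ o(2), of "\<lambda>_. 0"] r0 a by (simp add: lc_zero)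
      then have "lin ?V r a (\<lambda>i. res W ?V (t i)) = lin ?V r (\<lambda>_. 0) (\<lambda>i. res W ?V (t i))"
        using cd_inj[OF o(1) ecl[OF o(1) _ o(2) ra] ecl[OF o(1) _ o(2)]] r0 by simp
      then show "a i = 0"
        using frame_unique[OF f(2) o(1) _ o(2), of a "\<lambda>_. 0" i] ra r0 i by simp
    qed
  qed
  then show ?thesis using W f(1) by blast
qed

context
  fixes x assumes x: "x \<in> points"
begin

lemma Lam_add: "v \<in> Lam x \<Longrightarrow> w \<in> Lam x \<Longrightarrow> (\<lambda>j. v j + w j) \<in> Lam x"
  and Lam_smult: "a \<in> loc x \<Longrightarrow> v \<in> Lam x \<Longrightarrow> (\<lambda>j. a * v j) \<in> Lam x"
  and Lam_zero: "(\<lambda>_. 0) \<in> Lam x"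
proof -
  obtain e where e: "Lam x = {lc r a e | a. \<forall>i<r. a i \<in> loc x}" using ex_lframe[OF x] unfolding lframe_def by blast
  show "(\<lambda>j. v j + w j) \<in> Lam x" if vw: "v \<in> Lam x" "w \<in> Lam x"
  proof -
    obtain a b where "v = lc r a e" "w = lc r b e" "\<forall>i<r. a i \<in> loc x" "\<forall>i<r. b i \<in> loc x" using vw unfolding e by blast
    then show ?thesis unfolding e using lc_add[of r a e b] loc_add[OF x] by (intro CollectI exI[of _ "\<lambda>i. a i + b i"]) auto
  qed
  show "(\<lambda>j. a * v j) \<in> Lam x" if a: "a \<in> loc x" "v \<in> Lam x"
  proof -
    obtain b where "v = lc r b e" "\<forall>i<r. b i \<in> loc x" using a unfolding e by blast
    then show ?thesis unfolding e using lc_smult[of a r b e] loc_mult[OF x] a by (intro CollectI exI[of _ "\<lambda>i. a * b i"]) auto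
  qed
  show "(\<lambda>_. 0) \<in> Lam x" unfolding e using lc_zero[of r e] loc_0[OF x] by (intro CollectI exI[of _ "\<lambda>_. 0"]) auto
qed

lemma Lam_lc: "(\<And>i. i < n \<Longrightarrow> a i \<in> loc x) \<Longrightarrow> (\<And>i. i < n \<Longrightarrow> e i \<in> Lam x) \<Longrightarrow> lc n a e \<in> Lam x"
  by (induction n) (auto simp: lc_def Lam_zero intro!: Lam_add Lam_smult)

end

lemma Gam_subset: "V \<noteq> {} \<Longrightarrow> V \<subseteq> W \<Longrightarrow> Gam W \<subseteq> Gam V"
  by (auto simp: Gam_def)

end

section \<open>Homogeneous frames\<close>

context toric_setup
begin

lemma distinguished_openI: "p \<in> spec \<sigma> \<Longrightarrow> f \<notin> p \<Longrightarrow> chart_point \<sigma> p \<in> distinguished_open \<sigma> f"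
  unfolding distinguished_open_iff by blast

lemma chart_ring_term: "\<sigma> \<in> \<Sigma> \<Longrightarrow> f \<in> chart_ring \<sigma> \<Longrightarrow> mterm k (coef f k) \<in> chart_ring \<sigma>"
  by (rule mterm_in_chart_ring) (simp add: chart_ring_iff)

lemma loc_common_denominator:
  fixes n :: nat
  assumes s: "\<sigma> \<in> \<Sigma>" "p \<in> spec \<sigma>" and a: "\<And>i. i < n \<Longrightarrow> a i \<in> loc (chart_point \<sigma> p)"
  shows "\<exists>f\<in>chart_ring \<sigma>. f \<notin> p \<and> (\<forall>i<n. \<exists>g\<in>chart_ring \<sigma>. of_laurent f * a i = of_laurent g)"
  using a
proof (induction n)
  case 0
  then show ?case using one_in_chart_ring[OF s(1)] spec_one[OF s] by auto
next
  case (Suc n)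
  then obtain f where f: "f \<in> chart_ring \<sigma>" "f \<notin> p" "\<forall>i<n. \<exists>g\<in>chart_ring \<sigma>. of_laurent f * a i = of_laurent g" by force
  obtain c b where b: "c \<in> chart_ring \<sigma>" "b \<in> chart_ring \<sigma>" "b \<notin> p" "b \<noteq> 0" "a n = Frac c b"
    by (rule loc_chart_pointE[OF s Suc.prems[of n]]) auto
  have "\<exists>g\<in>chart_ring \<sigma>. of_laurent (f * b) * a i = of_laurent g" if i: "i < Suc n" for i
  proof (cases "i = n")
    case True
    have "of_laurent (f * b) * a i = of_laurent (f * c)"
      unfolding True b(5) of_laurent_mult mult.assoc of_laurent_denominator[OF b(4)] ..
    then show ?thesis using f b chart_ring.mult by blast
  next
    case False
    then have "i < n" using i by simp
    then obtain g where g: "g \<in> chart_ring \<sigma>" "of_laurent f * a i = of_laurent g" using f(3) by blast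
    have "of_laurent (f * b) * a i = of_laurent (b * g)"
      unfolding of_laurent_mult g(2)[symmetric] by (simp add: ac_simps)
    then show ?thesis using g b chart_ring.mult by blast
  qed
  moreover have "f * b \<notin> p" using spec_mult_iff[OF s f(1) b(2)] f b by blast
  ultimately show ?case using chart_ring.mult[OF f(1) b(2)] by blast
qed

end

context framed_bundle
begin

lemma Lam_nbhd: "v \<in> Lam x \<Longrightarrow> \<exists>V. zariski_open V \<and> x \<in> V \<and> (\<forall>y\<in>V. v \<in> Lam y)"
  unfolding Lam_def by blast

lemma lframe_Lam: "lframe x e \<Longrightarrow> v \<in> Lam x \<longleftrightarrow> (\<exists>a. v = lc r a e \<and> (\<forall>i<r. a i \<in> loc x))"
  and lframe_free: "lframe x e \<Longrightarrow> lc_free r e"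
  by (auto simp: lframe_def)

lemma Lam_power_mono:
  assumes s: "\<sigma> \<in> \<Sigma>" "p \<in> spec \<sigma>" "h \<in> chart_ring \<sigma>"
    and v: "(\<lambda>j. of_laurent (h ^ n) * v j) \<in> Lam (chart_point \<sigma> p)"
  shows "(\<lambda>j. of_laurent (h ^ (m + n)) * v j) \<in> Lam (chart_point \<sigma> p)"
proof -
  have x: "chart_point \<sigma> p \<in> points" using s unfolding points_eq by blast
  have "of_laurent (h ^ m) \<in> loc (chart_point \<sigma> p)"
    using of_laurent_in_loc[OF s(1,2)] chart_ring_power[OF s(1,3)] by blast
  from Lam_smult[OF x this v] show ?thesis by (simp add: power_add mult.assoc)
qed

text \<open>
  Quasi-coherence. The functions \<open>g\<close> for which some power of \<open>h\<close> clears the denominators of \<open>v\<close> on the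
  distinguished open set of \<open>g\<close> form an ideal that is contained in no prime ideal.
\<close>

lemma Lam_extend:
  assumes s: "\<sigma> \<in> \<Sigma>" and h: "h \<in> chart_ring \<sigma>" "h \<noteq> 0"
    and v: "\<And>y. y \<in> distinguished_open \<sigma> h \<Longrightarrow> v \<in> Lam y"
  shows "\<exists>n. (\<lambda>j. of_laurent (h ^ n) * v j) \<in> Gam (chart \<sigma>)"
proof -
  let ?ok = "\<lambda>n y. (\<lambda>j. of_laurent (h ^ n) * v j) \<in> Lam y"
  let ?J = "{g \<in> chart_ring \<sigma>. \<exists>n. \<forall>y\<in>distinguished_open \<sigma> g. ?ok n y}"
  have R: "subring_of (chart_ring \<sigma>)" by (rule subring_chart_ring[OF s])
  have J: "ideal_in ?J (chart_ring \<sigma>)" unfolding ideal_in_def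
  proof (intro conjI ballI)
    have "distinguished_open \<sigma> 0 = {}" using spec_zero[OF s] unfolding distinguished_open_def by blast
    then show "0 \<in> ?J" using subring_zero[OF R] by simp
    fix f g assume fg: "f \<in> ?J" "g \<in> ?J"
    then obtain m n where m: "\<forall>y\<in>distinguished_open \<sigma> f. ?ok m y" and n: "\<forall>y\<in>distinguished_open \<sigma> g. ?ok n y" by blast
    have "?ok (m + n) y" if y: "y \<in> distinguished_open \<sigma> (f + g)" for y
    proof -
      obtain p where p: "p \<in> spec \<sigma>" "y = chart_point \<sigma> p" "f + g \<notin> p" using y unfolding distinguished_open_iff by blast
      then have "f \<notin> p \<or> g \<notin> p" using spec_add[OF s p(1)] by blast
      moreover have "f \<notin> p \<Longrightarrow> y \<in> distinguished_open \<sigma> f" "g \<notin> p \<Longrightarrow> y \<in> distinguished_open \<sigma> g"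
        unfolding p(2) by (rule distinguished_openI[OF p(1)], assumption)+
      ultimately have "?ok m y \<or> ?ok n y" using bspec[OF m] bspec[OF n] by metis
      then show ?thesis
        unfolding p(2) using Lam_power_mono[OF s p(1) h(1), of m v n] Lam_power_mono[OF s p(1) h(1), of n v m]
        by (auto simp: add.commute)
    qed
    then show "f + g \<in> ?J" using fg chart_ring.add by blast
  next
    fix f g assume f: "f \<in> chart_ring \<sigma>" and g: "g \<in> ?J"
    have "distinguished_open \<sigma> (f * g) \<subseteq> distinguished_open \<sigma> g"
      using spec_mult_left[OF s _ f] unfolding distinguished_open_def by blast
    then show "f * g \<in> ?J" using f g chart_ring.mult by blast
  qed blast
  have "\<not> ?J \<subseteq> p" if p: "prime_in p (chart_ring \<sigma>)" for p
  proof -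
    have sp: "p \<in> spec \<sigma>" using p spec_iff[OF s] by blast
    let ?y = "chart_point \<sigma> p"
    have "?y \<in> points" using s sp unfolding points_eq by blast
    then obtain W e where W: "zariski_open W" "?y \<in> W" "\<forall>z\<in>W. lframe z e" using ex_lframe by blast
    obtain g where g: "g \<in> chart_ring \<sigma>" "g \<notin> p" "distinguished_open \<sigma> g \<subseteq> W"
      using zariski_open_basis[OF W(1) s sp W(2)] by blast
    have gW: "generic_point \<in> W" by (rule generic_point_in_open[OF W(1,2)])
    have "generic_point \<in> distinguished_open \<sigma> h"
      unfolding distinguished_open_iff generic_point_chart[OF s] using zero_in_spec[OF s] h(2) by blast
    then have "v \<in> Lam generic_point" by (rule v)
    \<comment> \<open>The coefficients are found at the generic point, where denominators do not
      matter; by independence they are the coefficients at all points of \<open>W\<close> whose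
      stalk contains \<open>v\<close>.\<close>
    then obtain a where a: "v = lc r a e" using lframe_Lam gW W(3) by blast
    have "\<exists>n. \<exists>f\<in>chart_ring \<sigma>. of_laurent ((g * h) ^ n) * a i = of_laurent f" if i: "i < r" for i
    proof (rule loc_distinguished_open[OF s chart_ring.mult[OF g(1) h(1)]])
      fix z assume "z \<in> distinguished_open \<sigma> (g * h)"
      then obtain q where q: "q \<in> spec \<sigma>" "z = chart_point \<sigma> q" "g * h \<notin> q" unfolding distinguished_open_iff by blast
      then have "g \<notin> q" "h \<notin> q" using spec_mult_iff[OF s q(1) g(1) h(1)] by auto
      then have z: "z \<in> distinguished_open \<sigma> g" "z \<in> distinguished_open \<sigma> h" using q unfolding distinguished_open_iff by blast+
      then have lf: "lframe z e" and "v \<in> Lam z" using W(3) g(3) v by blast+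
      then obtain b where b: "v = lc r b e" "\<forall>i<r. b i \<in> loc z" using lframe_Lam by blast
      then have "a i = b i" using lc_freeD[OF lframe_free[OF lf] _ i] a by metis
      then show "a i \<in> loc z" using b(2) i by simp
    qed
    then obtain n where n: "\<And>i. i < r \<Longrightarrow> \<exists>f\<in>chart_ring \<sigma>. of_laurent ((g * h) ^ n i) * a i = of_laurent f" by metis
    \<comment> \<open>The sum is at least every \<open>n i\<close>, so one power of \<open>h\<close>
      serves all coefficients.\<close>
    define N where "N = (\<Sum>i<r. n i)"
    have "?ok N z" if z: "z \<in> distinguished_open \<sigma> g" for z
    proof -
      obtain q where q: "q \<in> spec \<sigma>" "z = chart_point \<sigma> q" "g \<notin> q" using z unfolding distinguished_open_iff by blast
      have "of_laurent (h ^ N) * a i \<in> loc z" if i: "i < r" for i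
      proof -
        obtain f where f: "f \<in> chart_ring \<sigma>" "of_laurent ((g * h) ^ n i) * a i = of_laurent f" using n[OF i] by blast
        have "n i \<le> N" unfolding N_def using i by (intro member_le_sum) auto
        then have "of_laurent (h ^ N) = of_laurent (h ^ (N - n i)) * of_laurent (h ^ n i)"
          by (metis le_add_diff_inverse2 of_laurent_mult power_add)
        \<comment> \<open>At \<open>z\<close> the function \<open>g\<close> is invertible, so of the
          denominator \<open>(g * h) ^ n i\<close> only the power of \<open>h\<close> has to be
          cleared.\<close>
        then have "of_laurent (g ^ n i) * (of_laurent (h ^ N) * a i) = of_laurent (h ^ (N - n i)) * (of_laurent ((g * h) ^ n i) * a i)"
          unfolding power_mult_distrib of_laurent_mult by (simp only: ac_simps)
        also have "\<dots> = of_laurent (h ^ (N - n i) * f)" unfolding f(2) of_laurent_mult ..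
        also have "\<dots> \<in> loc z"
          unfolding q(2) using f(1) h(1) chart_ring.mult chart_ring_power[OF s] by (intro of_laurent_in_loc[OF s q(1)]) blast
        finally show ?thesis unfolding q(2) using loc_inverse_power[OF s q(1) g(1) q(3)] by blast
      qed
      moreover have "(\<lambda>j. of_laurent (h ^ N) * v j) = lc r (\<lambda>i. of_laurent (h ^ N) * a i) e"
        unfolding a by (rule lc_smult)
      moreover have "lframe z e" using W(3) g(3) z by blast
      ultimately show ?thesis using lframe_Lam by blast
    qed
    then have "g \<in> ?J" using g(1) by blast
    then show ?thesis using g(2) by blast
  qed
  from ideal_in_no_prime[OF R J this] obtain n where "\<forall>y\<in>distinguished_open \<sigma> 1. ?ok n y" by blast
  then have "\<forall>y\<in>chart \<sigma>. ?ok n y" unfolding distinguished_open_one[OF s] .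
  moreover have "chart \<sigma> \<noteq> {}" unfolding chart_def using zero_in_spec[OF s] by blast
  ultimately show ?thesis unfolding Gam_def by blast
qed

lemma chart_nonempty: "\<sigma> \<in> \<Sigma> \<Longrightarrow> chart \<sigma> \<noteq> {}"
  unfolding chart_def using zero_in_spec by blast

lemma Gam_chart_iff: "\<sigma> \<in> \<Sigma> \<Longrightarrow> v \<in> Gam (chart \<sigma>) \<longleftrightarrow> (\<forall>x\<in>chart \<sigma>. v \<in> Lam x)"
  using chart_nonempty by (auto simp: Gam_def)

text \<open>A vector of the stalk is a section on some distinguished neighbourhood, from which
  \<open>Lam_extend\<close> spreads a multiple of it over the chart.\<close>

lemma Lam_clear_denominator:
  assumes s: "\<sigma> \<in> \<Sigma>" "p \<in> spec \<sigma>" and v: "v \<in> Lam (chart_point \<sigma> p)"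
  shows "\<exists>f\<in>chart_ring \<sigma>. f \<notin> p \<and> (\<lambda>j. of_laurent f * v j) \<in> Gam (chart \<sigma>)"
proof -
  obtain V where V: "zariski_open V" "chart_point \<sigma> p \<in> V" "\<forall>y\<in>V. v \<in> Lam y" using Lam_nbhd[OF v] by blast
  obtain h where h: "h \<in> chart_ring \<sigma>" "h \<notin> p" "distinguished_open \<sigma> h \<subseteq> V"
    using zariski_open_basis[OF V(1) s V(2)] by blast
  obtain n where "(\<lambda>j. of_laurent (h ^ n) * v j) \<in> Gam (chart \<sigma>)"
    using Lam_extend[OF s(1) h(1) spec_nonzero[OF s h(2)], of v] V(3) h(3) by blast
  then show ?thesis using chart_ring_power[OF s(1) h(1)] spec_power[OF s h(1,2)] by blast
qed

context
  fixes \<sigma> assumes s: "\<sigma> \<in> \<Sigma>"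
begin

lemma Gam_add: "v \<in> Gam (chart \<sigma>) \<Longrightarrow> w \<in> Gam (chart \<sigma>) \<Longrightarrow> (\<lambda>j. v j + w j) \<in> Gam (chart \<sigma>)"
  using Lam_add zariski_open_points[OF zariski_open_chart[OF s]] unfolding Gam_chart_iff[OF s] by blast

lemma Gam_smult: "f \<in> chart_ring \<sigma> \<Longrightarrow> v \<in> Gam (chart \<sigma>) \<Longrightarrow> (\<lambda>j. of_laurent f * v j) \<in> Gam (chart \<sigma>)"
  using Lam_smult of_laurent_in_loc_chart[OF s] zariski_open_points[OF zariski_open_chart[OF s]]
  unfolding Gam_chart_iff[OF s] by blast

lemma Gam_zero: "(\<lambda>_. 0) \<in> Gam (chart \<sigma>)"
  using Lam_zero zariski_open_points[OF zariski_open_chart[OF s]] unfolding Gam_chart_iff[OF s] by blast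

lemma Gam_sum: "(\<And>i. i \<in> A \<Longrightarrow> v i \<in> Gam (chart \<sigma>)) \<Longrightarrow> (\<lambda>j. \<Sum>i\<in>A. v i j) \<in> Gam (chart \<sigma>)"
  by (induction A rule: infinite_finite_induct) (auto simp: Gam_zero Gam_add)

lemma Gam_lc: "(\<And>i. i < n \<Longrightarrow> f i \<in> chart_ring \<sigma>) \<Longrightarrow> (\<And>i. i < n \<Longrightarrow> h i \<in> Gam (chart \<sigma>)) \<Longrightarrow>
    lc n (\<lambda>i. of_laurent (f i)) h \<in> Gam (chart \<sigma>)"
  unfolding lc_def by (rule Gam_sum) (auto intro: Gam_smult)

section \<open>The weight grading of the sections over a chart\<close>

lemma coaction_facts:
  assumes "t \<in> carrier (H (chart \<sigma>))"
  shows co_closed: "coaction F \<sigma> t u \<in> carrier (H (chart \<sigma>))"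
    and co_finite: "finite {u. coaction F \<sigma> t u \<noteq> \<zero>\<^bsub>H (chart \<sigma>)\<^esub>}"
    and co_sum: "(\<Oplus>\<^bsub>H (chart \<sigma>)\<^esub>u\<in>{u. coaction F \<sigma> t u \<noteq> \<zero>\<^bsub>H (chart \<sigma>)\<^esub>}. coaction F \<sigma> t u) = t"
    and co_co: "coaction F \<sigma> (coaction F \<sigma> t u) w = (if w = u then coaction F \<sigma> t u else \<zero>\<^bsub>H (chart \<sigma>)\<^esub>)"
    and co_add: "t' \<in> carrier (H (chart \<sigma>)) \<Longrightarrow>
      coaction F \<sigma> (t \<oplus>\<^bsub>H (chart \<sigma>)\<^esub> t') u = coaction F \<sigma> t u \<oplus>\<^bsub>H (chart \<sigma>)\<^esub> coaction F \<sigma> t' u"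
    and co_smult: "mterm w a \<in> chart_ring \<sigma> \<Longrightarrow>
      coaction F \<sigma> (cf (chart \<sigma>) (of_laurent (mterm w a)) \<odot>\<^bsub>H (chart \<sigma>)\<^esub> t) u =
      cf (chart \<sigma>) (of_laurent (mterm w a)) \<odot>\<^bsub>H (chart \<sigma>)\<^esub> coaction F \<sigma> t (u - w)"
    and co_res: "\<tau> \<in> \<Sigma> \<Longrightarrow> \<tau> \<subseteq> \<sigma> \<Longrightarrow>
      res (chart \<sigma>) (chart \<tau>) (coaction F \<sigma> t u) = coaction F \<tau> (res (chart \<sigma>) (chart \<tau>) t) u"
  using linearized s assms unfolding torus_linearized_def Let_def regular_of_cf by simp_all

definition sec :: "(nat \<Rightarrow> ('n, 'k) lfrac) \<Rightarrow> 'e" where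
  "sec = the_inv_into (carrier (H (chart \<sigma>))) (cd (chart \<sigma>))"

text \<open>The coaction transported to coordinate vectors, so that weight components can be handled
  without mentioning the sheaf.\<close>

definition rho :: "(nat \<Rightarrow> ('n, 'k) lfrac) \<Rightarrow> int ^ 'n \<Rightarrow> nat \<Rightarrow> ('n, 'k) lfrac" where
  "rho v u = cd (chart \<sigma>) (coaction F \<sigma> (sec v) u)"

lemma sec_closed: "v \<in> Gam (chart \<sigma>) \<Longrightarrow> sec v \<in> carrier (H (chart \<sigma>))"
  and cd_sec: "v \<in> Gam (chart \<sigma>) \<Longrightarrow> cd (chart \<sigma>) (sec v) = v"
  and sec_cd: "t \<in> carrier (H (chart \<sigma>)) \<Longrightarrow> sec (cd (chart \<sigma>) t) = t"
proof -
  have b: "bij_betw (cd (chart \<sigma>)) (carrier (H (chart \<sigma>))) (Gam (chart \<sigma>))" by (rule bij_cd[OF zariski_open_chart[OF s]])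
  then have i: "inj_on (cd (chart \<sigma>)) (carrier (H (chart \<sigma>)))" and im: "cd (chart \<sigma>) ` carrier (H (chart \<sigma>)) = Gam (chart \<sigma>)"
    by (auto simp: bij_betw_def)
  show "v \<in> Gam (chart \<sigma>) \<Longrightarrow> sec v \<in> carrier (H (chart \<sigma>))"
    unfolding sec_def using the_inv_into_into[OF i, of v "carrier (H (chart \<sigma>))"] im by simp
  show "v \<in> Gam (chart \<sigma>) \<Longrightarrow> cd (chart \<sigma>) (sec v) = v"
    unfolding sec_def using f_the_inv_into_f[OF i, of v] im by simp
  show "t \<in> carrier (H (chart \<sigma>)) \<Longrightarrow> sec (cd (chart \<sigma>) t) = t"
    unfolding sec_def using the_inv_into_f_f[OF i] by simp
qed

lemma rho_cd: "t \<in> carrier (H (chart \<sigma>)) \<Longrightarrow> rho (cd (chart \<sigma>) t) u = cd (chart \<sigma>) (coaction F \<sigma> t u)"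
  by (simp add: rho_def sec_cd)

lemma rho_closed: "v \<in> Gam (chart \<sigma>) \<Longrightarrow> rho v u \<in> Gam (chart \<sigma>)"
  unfolding rho_def by (rule cd_in_Gam[OF zariski_open_chart[OF s] co_closed[OF sec_closed]])

lemma rho_add:
  assumes v: "v \<in> Gam (chart \<sigma>)" "w \<in> Gam (chart \<sigma>)"
  shows "rho (\<lambda>j. v j + w j) u = (\<lambda>j. rho v u j + rho w u j)"
proof -
  note o = zariski_open_chart[OF s] and c = sec_closed[OF v(1)] sec_closed[OF v(2)]
  have "(\<lambda>j. v j + w j) = cd (chart \<sigma>) (sec v \<oplus>\<^bsub>H (chart \<sigma>)\<^esub> sec w)"
    using cd_add[OF o c] cd_sec v by simp
  then show ?thesis
    by (simp add: rho_cd H_add_closed[OF o] c co_add) (simp add: cd_add[OF o] co_closed c rho_def)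
qed

lemma rho_smult:
  assumes v: "v \<in> Gam (chart \<sigma>)" and m: "mterm w a \<in> chart_ring \<sigma>"
  shows "rho (\<lambda>j. of_laurent (mterm w a) * v j) u = (\<lambda>j. of_laurent (mterm w a) * rho v (u - w) j)"
proof -
  note o = zariski_open_chart[OF s] and c = sec_closed[OF v]
  have rg: "rg (chart \<sigma>) (of_laurent (mterm w a))" unfolding rg_def using of_laurent_in_loc_chart[OF s m] by blast
  have "(\<lambda>j. of_laurent (mterm w a) * v j) = cd (chart \<sigma>) (cf (chart \<sigma>) (of_laurent (mterm w a)) \<odot>\<^bsub>H (chart \<sigma>)\<^esub> sec v)"
    using cd_smult[OF o c rg] cd_sec[OF v] by simp
  then show ?thesis
    by (simp add: rho_cd H_smult_closed[OF o rg] c co_smult m) (simp add: cd_smult[OF o _ rg] co_closed c rho_def)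
qed

lemma rho_zero: "rho (\<lambda>_. 0) u = (\<lambda>_. 0)"
  using rho_smult[OF Gam_zero, of 0 0 u] subring_zero[OF subring_chart_ring[OF s]] by simp

lemma rho_finite_sum:
  "(\<And>i. i \<in> A \<Longrightarrow> v i \<in> Gam (chart \<sigma>)) \<Longrightarrow> rho (\<lambda>j. \<Sum>i\<in>A. v i j) u = (\<lambda>j. \<Sum>i\<in>A. rho (v i) u j)"
proof (induction A rule: infinite_finite_induct)
  case (insert x A)
  then show ?case using rho_add[OF insert(4)[of x] Gam_sum[of A v], of u] by simp
qed (auto simp: rho_zero)

lemma rho_decompose:
  assumes v: "v \<in> Gam (chart \<sigma>)"
  shows "\<exists>A. finite A \<and> v = (\<lambda>j. \<Sum>u\<in>A. rho v u j)"
proof -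
  note o = zariski_open_chart[OF s] and c = sec_closed[OF v]
  let ?A = "{u. coaction F \<sigma> (sec v) u \<noteq> \<zero>\<^bsub>H (chart \<sigma>)\<^esub>}"
  have "v j = (\<Sum>u\<in>?A. rho v u j)" for j
    using cd_finsum[OF o co_finite[OF c], of "coaction F \<sigma> (sec v)" j] co_sum[OF c] cd_sec[OF v] co_closed[OF c]
    by (simp add: rho_def)
  then show ?thesis using co_finite[OF c] by blast
qed

definition hom :: "(nat \<Rightarrow> ('n, 'k) lfrac) \<Rightarrow> int ^ 'n \<Rightarrow> bool" where
  "hom v w \<longleftrightarrow> v \<in> Gam (chart \<sigma>) \<and> (\<forall>u. rho v u = (if u = w then v else (\<lambda>_. 0)))"

lemma hom_rho:
  assumes v: "v \<in> Gam (chart \<sigma>)" shows "hom (rho v w) w"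
proof -
  note o = zariski_open_chart[OF s] and c = sec_closed[OF v]
  have "rho (rho v w) u = (if u = w then rho v w else (\<lambda>_. 0))" for u
    using rho_cd[OF co_closed[OF c], of w u] co_co[OF c, of w u] cd_zero[OF o] by (auto simp: rho_def)
  then show ?thesis using rho_closed[OF v] by (simp add: hom_def)
qed

text \<open>Among the terms of \<open>f\<close>, only the one with exponent \<open>u - w\<close>
  moves weight \<open>w\<close> to weight \<open>u\<close>.\<close>

lemma rho_smult_hom:
  assumes h: "hom v w" and f: "f \<in> chart_ring \<sigma>"
  shows "rho (\<lambda>j. of_laurent f * v j) u = (\<lambda>j. of_laurent (mterm (u - w) (coef f (u - w))) * v j)"
proof -
  have v: "v \<in> Gam (chart \<sigma>)" using h by (simp add: hom_def)
  have m: "mterm k (coef f k) \<in> chart_ring \<sigma>" for k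
    by (rule chart_ring_term[OF s f])
  have "(\<lambda>j. of_laurent f * v j) = (\<lambda>j. \<Sum>k\<in>supp f. of_laurent (mterm k (coef f k)) * v j)"
    by (subst sum_mterms[of f, symmetric]) (simp add: sum_distrib_right)
  then have "rho (\<lambda>j. of_laurent f * v j) u = (\<lambda>j. \<Sum>k\<in>supp f. of_laurent (mterm k (coef f k)) * rho v (u - k) j)"
    using Gam_smult[OF m v] by (simp add: rho_finite_sum rho_smult[OF v m])
  also have "\<dots> = (\<lambda>j. \<Sum>k\<in>supp f. if k = u - w then of_laurent (mterm k (coef f k)) * v j else 0)"
    by (intro ext sum.cong) (use h in \<open>auto simp: hom_def\<close>)
  also have "\<dots> = (\<lambda>j. of_laurent (mterm (u - w) (coef f (u - w))) * v j)"
    by (rule ext) (simp add: in_keys_iff)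
  finally show ?thesis .
qed

text \<open>Steinitz exchange over a local ring: a member of a frame may be replaced by a
  combination in which it occurs with an invertible coefficient.\<close>

lemma lframe_exchange:
  assumes x: "x \<in> points" and e: "lframe x e" and k: "k < r" and c: "\<And>i. i < r \<Longrightarrow> c i \<in> loc x"
    and d: "d \<in> loc x" "c k * d = 1"
  shows "lframe x (e(k := lc r c e))"
proof -
  let ?e = "e(k := lc r c e)"
  have eq: "lc r a ?e = lc r (\<lambda>i. if i = k then a k * c k else a i + a k * c i) e" for a
  proof
    fix j
    have "lc r a ?e j = (\<Sum>i\<in>{..<r} - {k}. a i * e i j) + a k * lc r c e j"
      using k by (simp add: lc_def sum.remove[of "{..<r}" k] add.commute)
    also have "a k * lc r c e j = (\<Sum>i\<in>{..<r} - {k}. a k * c i * e i j) + a k * c k * e k j"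
      using k by (simp add: lc_def sum.remove[of "{..<r}" k] distrib_left sum_distrib_left mult.assoc)
    also have "(\<Sum>i\<in>{..<r} - {k}. a i * e i j) + ((\<Sum>i\<in>{..<r} - {k}. a k * c i * e i j) + a k * c k * e k j)
        = lc r (\<lambda>i. if i = k then a k * c k else a i + a k * c i) e j"
      using k by (simp add: lc_def sum.remove[of "{..<r}" k] distrib_right sum.distrib algebra_simps)
    finally show "lc r a ?e j = lc r (\<lambda>i. if i = k then a k * c k else a i + a k * c i) e j" .
  qed
  show ?thesis unfolding lframe_def
  proof (intro conjI equalityI subsetI)
    fix v assume "v \<in> Lam x"
    then obtain b where b: "v = lc r b e" "\<forall>i<r. b i \<in> loc x" using lframe_Lam[OF e] by blast
    \<comment> \<open>These coefficients solve the substitution formula \<open>eq\<close> for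
      \<open>a\<close>, with \<open>d\<close> as the inverse of \<open>c k\<close>.\<close>
    define a where "a i = (if i = k then b k * d else b i - b k * d * c i)" for i
    have "lc r a ?e = v" unfolding eq b(1) using d(2)
      by (intro lc_cong) (auto simp: a_def mult.assoc mult.commute[of d])
    moreover have "a i \<in> loc x" if "i < r" for i
      unfolding a_def using b(2) d(1) c k that loc_mult[OF x] loc_add[OF x] loc_uminus[OF x]
      by (auto simp: diff_conv_add_uminus simp del: add_uminus_conv_diff)
    ultimately show "v \<in> {lc r a ?e | a. \<forall>i<r. a i \<in> loc x}" by blast
  next
    fix v assume "v \<in> {lc r a ?e | a. \<forall>i<r. a i \<in> loc x}"
    then obtain a where a: "v = lc r a ?e" "\<forall>i<r. a i \<in> loc x" by blast
    show "v \<in> Lam x" unfolding lframe_Lam[OF e] a(1) eq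
      using a(2) c k loc_mult[OF x] loc_add[OF x] by (intro exI conjI[OF refl]) auto
  next
    show "lc_free r ?e" unfolding lc_free_def
    proof (intro allI impI)
      fix a i assume a: "lc r a ?e = (\<lambda>_. 0)" and i: "i < r"
      have z: "(if i = k then a k * c k else a i + a k * c i) = 0" if "i < r" for i
        using lframe_free[OF e] a that unfolding eq lc_free_def by blast
      have "a k * c k = 0" using z[OF k] by simp
      then have "a k * (c k * d) = 0" by (simp add: mult.assoc[symmetric])
      then have "a k = 0" using d(2) by simp
      then show "a i = 0" using z[OF i] by (auto split: if_splits)
    qed
  qed
qed

text \<open>The members are made homogeneous one at a time. A multiple of \<open>e k\<close> by some
  \<open>f\<close> outside the prime is a global section, hence the sum of its weight
  components.\<close>

lemma ex_homogeneous_lframe: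
  assumes q: "q \<in> spec \<sigma>"
  shows "\<exists>e w. lframe (chart_point \<sigma> q) e \<and> (\<forall>i<r. hom (e i) (w i))"
proof -
  let ?x = "chart_point \<sigma> q"
  have x: "?x \<in> points" using s q unfolding points_eq by blast
  have xc: "?x \<in> chart \<sigma>" unfolding chart_def using q by blast
  have "k \<le> r \<Longrightarrow> \<exists>e w. lframe ?x e \<and> (\<forall>i<k. hom (e i) (w i))" for k
  proof (induction k)
    case 0
    then show ?case using ex_lframe[OF x] by auto
  next
    case (Suc k)
    then obtain e w where e: "lframe ?x e" "\<forall>i<k. hom (e i) (w i)" by auto
    have k: "k < r" using Suc.prems by simp
    have "e k \<in> Lam ?x"
      unfolding lframe_Lam[OF e(1)] lc_unit[OF k, of e, symmetric] using loc_0[OF x] loc_1[OF x]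
      by (intro exI[of _ "\<lambda>i. if i = k then 1 else 0"]) auto
    then obtain f where f: "f \<in> chart_ring \<sigma>" "f \<notin> q" "(\<lambda>j. of_laurent f * e k j) \<in> Gam (chart \<sigma>)"
      using Lam_clear_denominator[OF s q] by blast
    let ?v = "\<lambda>j. of_laurent f * e k j"
    obtain A where A: "finite A" "?v = (\<lambda>j. \<Sum>u\<in>A. rho ?v u j)" using rho_decompose[OF f(3)] by blast
    have "rho ?v u \<in> Lam ?x" for u using rho_closed[OF f(3)] xc unfolding Gam_chart_iff[OF s] by blast
    then have "\<forall>u. \<exists>a. rho ?v u = lc r a e \<and> (\<forall>i<r. a i \<in> loc ?x)" using lframe_Lam[OF e(1)] by blast
    then obtain c where c: "\<And>u. rho ?v u = lc r (c u) e" "\<And>u i. i < r \<Longrightarrow> c u i \<in> loc ?x" by metis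
    \<comment> \<open>The \<open>k\<close>-coordinates of the weight components add up to
      \<open>f\<close>, a unit of the local ring; so one component has an invertible
      \<open>k\<close>-coordinate and can take the place of \<open>e k\<close>.\<close>
    have "lc r (\<lambda>i. if i = k then of_laurent f else 0) e = ?v"
      by (rule ext) (simp add: lc_def k if_distrib[of "\<lambda>x. x * _"] cong: if_cong)
    also have "\<dots> = (\<lambda>j. \<Sum>u\<in>A. lc r (c u) e j)" using A(2) unfolding c(1) .
    also have "\<dots> = lc r (\<lambda>i. \<Sum>u\<in>A. c u i) e"
      unfolding lc_def sum_distrib_right by (rule ext, rule sum.swap)
    finally have eqk: "lc r (\<lambda>i. if i = k then of_laurent f else 0) e = lc r (\<lambda>i. \<Sum>u\<in>A. c u i) e" .
    have "(\<Sum>u\<in>A. c u k) = of_laurent f" using lc_freeD[OF lframe_free[OF e(1)] eqk k] by simp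
    then obtain u d where u: "d \<in> loc ?x" "c u k * d = 1"
      using loc_sum_unit[OF s q A(1), of "\<lambda>u. c u k" f] c(2)[OF k] f(1,2) by blast
    have "lframe ?x (e(k := rho ?v u))"
      unfolding c(1) by (rule lframe_exchange[OF x e(1) k, where c = "c u" and d = d]) (use c(2) u in auto)
    moreover have "\<forall>i<Suc k. hom ((e(k := rho ?v u)) i) ((w(k := u)) i)"
      using e(2) hom_rho[OF f(3)] by (auto simp: less_Suc_eq)
    ultimately show ?case by blast
  qed
  then show ?thesis by blast
qed

text \<open>The homogeneous frame at the special prime turns out to be a frame everywhere on the
  chart. It suffices to expand homogeneous sections over the chart ring, because every section is a
  finite sum of its weight components.\<close>

theorem homogeneous_frame:
  "\<exists>h w. (\<forall>i<r. hom (h i) (w i)) \<and> (\<forall>y\<in>chart \<sigma>. lframe y h) \<and>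
    Gam (chart \<sigma>) = {lc r (\<lambda>i. of_laurent (f i)) h | f. \<forall>i<r. f i \<in> chart_ring \<sigma>}"
proof -
  obtain q where q: "prime_in q (chart_ring \<sigma>)"
    and unit: "\<And>f. f \<in> chart_ring \<sigma> - q \<Longrightarrow> \<exists>w. coef f w \<noteq> 0 \<and> mterm (- w) (inverse (coef f w)) \<in> chart_ring \<sigma>"
    using ex_prime_unit_terms[OF s] by blast
  have q: "q \<in> spec \<sigma>" using q spec_iff[OF s] by blast
  let ?x = "chart_point \<sigma> q"
  have xc: "?x \<in> chart \<sigma>" unfolding chart_def using q by blast
  obtain h w where h: "lframe ?x h" "\<And>i. i < r \<Longrightarrow> hom (h i) (w i)" using ex_homogeneous_lframe[OF q] by blast
  have hG: "h i \<in> Gam (chart \<sigma>)" if "i < r" for i using h(2)[OF that] by (simp add: hom_def)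
  let ?P = "{lc r (\<lambda>i. of_laurent (f i)) h | f. \<forall>i<r. f i \<in> chart_ring \<sigma>}"
  have hom_P: "\<exists>f. (\<forall>i<r. f i \<in> chart_ring \<sigma>) \<and> p = lc r (\<lambda>i. of_laurent (f i)) h" if p: "hom p u" for p u
  proof -
    have pG: "p \<in> Gam (chart \<sigma>)" using p by (simp add: hom_def)
    then have "p \<in> Lam ?x" using xc unfolding Gam_chart_iff[OF s] by blast
    then obtain a where a: "p = lc r a h" "\<And>i. i < r \<Longrightarrow> a i \<in> loc ?x" using lframe_Lam[OF h(1)] by blast
    obtain f where f: "f \<in> chart_ring \<sigma>" "f \<notin> q" "\<forall>i<r. \<exists>g\<in>chart_ring \<sigma>. of_laurent f * a i = of_laurent g"
      using loc_common_denominator[OF s q, of r a] a(2) by blast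
    then obtain g where g: "\<And>i. i < r \<Longrightarrow> g i \<in> chart_ring \<sigma>" "\<And>i. i < r \<Longrightarrow> of_laurent f * a i = of_laurent (g i)" by metis
    \<comment> \<open>The common denominator \<open>f\<close> lies outside the special prime and so
      has a unit term, with exponent \<open>k\<close>.\<close>
    obtain k where k: "coef f k \<noteq> 0" "mterm (- k) (inverse (coef f k)) \<in> chart_ring \<sigma>" using unit f(1,2) by blast
    have eq: "(\<lambda>j. of_laurent f * p j) = (\<lambda>j. \<Sum>i<r. of_laurent (g i) * h i j)"
      unfolding a(1) lc_smult unfolding lc_def by (intro ext sum.cong) (use g(2) in auto)
    \<comment> \<open>Since \<open>p\<close> has weight \<open>u\<close>, taking the component of
      weight \<open>k + u\<close> of \<open>f p\<close> keeps only the unit term of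
      \<open>f\<close>. On the other side it keeps one term of each \<open>g i\<close>, which again
      lies in the chart ring.\<close>
    have "rho (\<lambda>j. of_laurent f * p j) (k + u) = (\<lambda>j. of_laurent (mterm k (coef f k)) * p j)"
      using rho_smult_hom[OF p f(1), of "k + u"] by simp
    moreover have "rho (\<lambda>j. \<Sum>i<r. of_laurent (g i) * h i j) (k + u)
        = (\<lambda>j. \<Sum>i<r. of_laurent (mterm (k + u - w i) (coef (g i) (k + u - w i))) * h i j)"
      by (subst rho_finite_sum) (auto intro!: Gam_smult g hG sum.cong simp: rho_smult_hom[OF h(2) g(1)])
    ultimately have eq2: "of_laurent (mterm k (coef f k)) * p j
        = (\<Sum>i<r. of_laurent (mterm (k + u - w i) (coef (g i) (k + u - w i))) * h i j)" for j
      unfolding eq by metis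
    let ?f = "\<lambda>i. mterm (- k) (inverse (coef f k)) * mterm (k + u - w i) (coef (g i) (k + u - w i))"
    have "p j = lc r (\<lambda>i. of_laurent (?f i)) h j" for j
    proof -
      have "p j = of_laurent (mterm (- k) (inverse (coef f k)) * mterm k (coef f k)) * p j"
        using mterm_inverse[OF k(1), of k] by (simp add: mult.commute)
      also have "\<dots> = of_laurent (mterm (- k) (inverse (coef f k))) * (of_laurent (mterm k (coef f k)) * p j)"
        unfolding of_laurent_mult mult.assoc ..
      also have "\<dots> = lc r (\<lambda>i. of_laurent (?f i)) h j"
        unfolding eq2 lc_def sum_distrib_left of_laurent_mult mult.assoc ..
      finally show ?thesis .
    qed
    moreover have "mterm v (coef (g i) v) \<in> chart_ring \<sigma>" if "i < r" for i v
      by (rule chart_ring_term[OF s g(1)[OF that]])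
    ultimately show ?thesis using k(2) by (intro exI[of _ ?f] conjI) (auto intro: chart_ring.mult)
  qed
  have GP: "Gam (chart \<sigma>) = ?P"
  proof
    show "?P \<subseteq> Gam (chart \<sigma>)" using Gam_lc hG by blast
    show "Gam (chart \<sigma>) \<subseteq> ?P"
    proof
      fix v assume v: "v \<in> Gam (chart \<sigma>)"
      obtain A where A: "finite A" "v = (\<lambda>j. \<Sum>u\<in>A. rho v u j)" using rho_decompose[OF v] by blast
      have "\<forall>u. \<exists>f. (\<forall>i<r. f i \<in> chart_ring \<sigma>) \<and> rho v u = lc r (\<lambda>i. of_laurent (f i)) h"
        using hom_P[OF hom_rho[OF v]] by blast
      then obtain f where f: "\<And>u i. i < r \<Longrightarrow> f u i \<in> chart_ring \<sigma>" "\<And>u. rho v u = lc r (\<lambda>i. of_laurent (f u i)) h" by metis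
      have "v = (\<lambda>j. \<Sum>u\<in>A. lc r (\<lambda>i. of_laurent (f u i)) h j)" using A(2) unfolding f(2) .
      also have "\<dots> = lc r (\<lambda>i. of_laurent (\<Sum>u\<in>A. f u i)) h"
        unfolding lc_def of_laurent_sum sum_distrib_right by (rule ext, rule sum.swap)
      finally have "v = lc r (\<lambda>i. of_laurent (\<Sum>u\<in>A. f u i)) h" .
      moreover have "\<forall>i<r. (\<Sum>u\<in>A. f u i) \<in> chart_ring \<sigma>"
        by (intro allI impI subring_sum[OF subring_chart_ring[OF s]] f(1))
      ultimately show "v \<in> ?P" by (intro CollectI exI conjI)
    qed
  qed
  \<comment> \<open>At an arbitrary point of the chart a denominator is cleared, the result is
    expanded globally, and the denominator is put back.\<close>
  have "lframe y h" if y: "y \<in> chart \<sigma>" for y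
  proof -
    obtain p where p: "p \<in> spec \<sigma>" "y = chart_point \<sigma> p" using y unfolding chart_def by blast
    have yp: "y \<in> points" unfolding points_eq using s p by blast
    show ?thesis unfolding lframe_def
    proof (intro conjI equalityI subsetI)
      show "lc_free r h" by (rule lframe_free[OF h(1)])
    next
      fix v assume "v \<in> {lc r a h | a. \<forall>i<r. a i \<in> loc y}"
      then show "v \<in> Lam y" using Lam_lc[OF yp] hG y unfolding Gam_chart_iff[OF s] by blast
    next
      fix v assume "v \<in> Lam y"
      then obtain f where f: "f \<in> chart_ring \<sigma>" "f \<notin> p" "(\<lambda>j. of_laurent f * v j) \<in> Gam (chart \<sigma>)"
        using Lam_clear_denominator[OF s p(1)] unfolding p(2) by blast
      then obtain g where g: "(\<lambda>j. of_laurent f * v j) = lc r (\<lambda>i. of_laurent (g i)) h" "\<forall>i<r. g i \<in> chart_ring \<sigma>"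
        unfolding GP by blast
      have fn: "f \<noteq> 0" by (rule spec_nonzero[OF s p(1) f(2)])
      have "(\<lambda>j. of_laurent f * lc r (\<lambda>i. Frac (g i) f) h j) = lc r (\<lambda>i. of_laurent (g i)) h"
        unfolding lc_smult of_laurent_denominator[OF fn] ..
      then have "of_laurent f * v j = of_laurent f * lc r (\<lambda>i. Frac (g i) f) h j" for j using g(1) by metis
      then have "v = lc r (\<lambda>i. Frac (g i) f) h"
        using lfrac_mult_left_cancel fn by (metis of_laurent_eq_0_iff ext)
      then show "v \<in> {lc r a h | a. \<forall>i<r. a i \<in> loc y}"
        unfolding p(2) using loc_chart_pointI[OF s p(1) _ f(1,2)] g(2) by (intro CollectI exI conjI) auto
    qed
  qed
  then show ?thesis using h(2) GP by (intro exI[of _ h] exI[of _ w] conjI) simp_all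
qed

end

lemma rho_face:
  assumes s: "\<sigma> \<in> \<Sigma>" "\<tau> \<in> \<Sigma>" "\<tau> \<subseteq> \<sigma>" and v: "v \<in> Gam (chart \<sigma>)"
  shows "v \<in> Gam (chart \<tau>)" "rho \<tau> v u = rho \<sigma> v u"
proof -
  note o = zariski_open_chart[OF s(1)] zariski_open_chart[OF s(2)] and ne = chart_nonempty[OF s(2)] and sub = chart_mono[OF s]
  show "v \<in> Gam (chart \<tau>)" using Gam_subset[OF ne sub] v by blast
  let ?t = "sec \<sigma> v"
  have t: "?t \<in> carrier (H (chart \<sigma>))" by (rule sec_closed[OF s(1) v])
  have "v = cd (chart \<tau>) (res (chart \<sigma>) (chart \<tau>) ?t)"
    using cd_res[OF o(1,2) ne sub t] cd_sec[OF s(1) v] by simp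
  then have "rho \<tau> v u = cd (chart \<tau>) (coaction F \<tau> (res (chart \<sigma>) (chart \<tau>) ?t) u)"
    using rho_cd[OF s(2) res_closed[OF o sub t], of u] by simp
  also have "\<dots> = cd (chart \<tau>) (res (chart \<sigma>) (chart \<tau>) (coaction F \<sigma> ?t u))"
    using co_res[OF s(1) t s(2,3)] by simp
  also have "\<dots> = rho \<sigma> v u"
    using cd_res[OF o(1,2) ne sub co_closed[OF s(1) t]] unfolding rho_def[OF s(1)] by simp
  finally show "rho \<tau> v u = rho \<sigma> v u" .
qed

end

section \<open>Invariant frames on the generic torus\<close>

definition kvec :: "nat \<Rightarrow> (nat \<Rightarrow> 'a::zero) set" where
  "kvec r = {v. \<forall>i\<ge>r. v i = 0}"

text \<open>The number \<open>n\<close> of vectors is kept apart from the rank \<open>r\<close>,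
  because apartments, chart frames and splittings each bring their own index range.\<close>

definition kbasis :: "nat \<Rightarrow> nat \<Rightarrow> (nat \<Rightarrow> nat \<Rightarrow> 'a::comm_ring_1) \<Rightarrow> bool" where
  "kbasis r n e \<longleftrightarrow> (\<forall>i<n. e i \<in> kvec r) \<and> lc_free n e \<and> (\<forall>v\<in>kvec r. \<exists>c. v = lc n c e)"

lemma mterm_sum: "mterm u (sum f A) = (\<Sum>i\<in>A. mterm u (f i))"
  by (induction A rule: infinite_finite_induct) (simp_all add: single_add)

lemma kvec_lc: "(\<And>i. i < n \<Longrightarrow> e i \<in> kvec r) \<Longrightarrow> lc n c e \<in> kvec r"
  by (simp add: kvec_def lc_def)

context toric_bundle
begin

text \<open>On the torus every monomial is a unit, so a homogeneous frame can be twisted to weight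
  0. The frame that supplies coordinates inside this proof is auxiliary.\<close>

lemma ex_torus_frame:
  obtains t where "frame (chart {0}) t"
    "\<And>i u. i < r \<Longrightarrow> coaction F {0} (t i) u = (if u = 0 then t i else \<zero>\<^bsub>H (chart {0})\<^esub>)"
proof -
  obtain W t1 where f: "frame W t1" using ex_frame[OF generic_point_in_points] by blast
  interpret framed_bundle val \<pi> \<Sigma> r F W t1 by unfold_locales (rule f)
  note s = zero_cone_in_Sigma
  note o = zariski_open_chart[OF s]
  obtain h w where "(\<forall>i<r. hom {0} (h i) (w i)) \<and> (\<forall>y\<in>chart {0}. lframe y h) \<and>
      Gam (chart {0}) = {lc r (\<lambda>i. of_laurent (f i)) h | f. \<forall>i<r. f i \<in> chart_ring {0}}"
    using homogeneous_frame[OF s] by (elim exE)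
  then have h: "\<And>i. i < r \<Longrightarrow> hom {0} (h i) (w i)" "\<And>y. y \<in> chart {0} \<Longrightarrow> lframe y h" by simp_all
  have hG: "h i \<in> Gam (chart {0})" if "i < r" for i using h(1)[OF that] by (simp add: hom_def s)
  have R: "f \<in> chart_ring {0}" for f by (simp add: chart_ring_zero_cone)
  define m where "m i = of_laurent (mterm (w i) (1 :: 'k))" for i
  define m' where "m' i = of_laurent (mterm (- w i) (1 :: 'k))" for i
  have mm: "m i * m' i = 1" for i
    unfolding m_def m'_def of_laurent_mult[symmetric] by (simp add: mult_single)
  have mm': "m' i * m i = 1" for i using mm[of i] by (simp add: mult.commute)
  \<comment> \<open>Multiplication by the inverse monomial moves the weight \<open>w i\<close> to
    0.\<close>
  define g where "g i = (\<lambda>j. m' i * h i j)" for i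
  have g: "hom {0} (g i) 0" if i: "i < r" for i
    unfolding hom_def[OF s]
  proof (intro conjI allI)
    show "g i \<in> Gam (chart {0})" unfolding g_def m'_def by (rule Gam_smult[OF s R hG[OF i]])
    fix u
    have "rho {0} (g i) u = (\<lambda>j. of_laurent (mterm (u - w i) (coef (mterm (- w i) (1::'k)) (u - w i))) * h i j)"
      unfolding g_def m'_def by (rule rho_smult_hom[OF s h(1)[OF i] R])
    also have "\<dots> = (if u = 0 then g i else (\<lambda>_. 0))"
      by (auto simp: lookup_single when_def g_def m'_def)
    finally show "rho {0} (g i) u = (if u = 0 then g i else (\<lambda>_. 0))" .
  qed
  have gG: "g i \<in> Gam (chart {0})" if "i < r" for i using g[OF that] by (simp add: hom_def s)
  have lcg: "lc r q g = lc r (\<lambda>i. q i * m' i) h" for q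
    by (simp add: lc_def g_def mult.assoc)
  have lch: "lc r q h = lc r (\<lambda>i. q i * m i) g" for q
    unfolding lcg mult.assoc mm by simp
  define t where "t i = sec {0} (g i)" for i
  have t: "t i \<in> carrier (H (chart {0}))" "cd (chart {0}) (t i) = g i" if "i < r" for i
    unfolding t_def using sec_closed[OF s gG[OF that]] cd_sec[OF s gG[OF that]] by auto
  have cdl: "cd V (lin V r q (\<lambda>i. res (chart {0}) V (t i))) = lc r q g"
    and cll: "lin V r q (\<lambda>i. res (chart {0}) V (t i)) \<in> carrier (H V)"
    if V: "zariski_open V" "V \<subseteq> chart {0}" "V \<noteq> {}" and q: "\<And>i. i < r \<Longrightarrow> rg V (q i)" for V q
  proof -
    have c: "res (chart {0}) V (t i) \<in> carrier (H V)" if "i < r" for i by (rule res_closed[OF o V(1,2) t(1)[OF that]])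
    show "lin V r q (\<lambda>i. res (chart {0}) V (t i)) \<in> carrier (H V)" using q c by (intro lin_closed[OF V(1)])
    have "cd V (lin V r q (\<lambda>i. res (chart {0}) V (t i))) = lc r q (\<lambda>i. cd V (res (chart {0}) V (t i)))"
      by (rule cd_lin[OF V(1)]) (use q c in auto)
    also have "\<dots> = lc r q g" by (rule lc_cong) (auto simp: cd_res[OF o V(1,3,2)] t)
    finally show "cd V (lin V r q (\<lambda>i. res (chart {0}) V (t i))) = lc r q g" .
  qed
  obtain y where y: "y \<in> chart {0}" using chart_nonempty[OF s] by blast
  have fr: "frame (chart {0}) t"
  proof (rule frameI[OF o chart_nonempty[OF s] t(1)])
    fix V sec' assume V: "zariski_open V" "V \<subseteq> chart {0}" and c: "sec' \<in> carrier (H V)"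
    show "\<exists>q. (\<forall>i<r. rg V (q i)) \<and> sec' = lin V r q (\<lambda>i. res (chart {0}) V (t i))"
    proof (cases "V = {}")
      case True
      have "lin V r (\<lambda>_. 0) (\<lambda>i. res (chart {0}) V (t i)) \<in> carrier (H V)"
        using V t(1) by (intro lin_closed) (auto intro: res_closed[OF o] rg_0)
      then show ?thesis using section_empty c True rg_0[OF V(1)] by (intro exI[of _ "\<lambda>_. 0"]) auto
    next
      case False
      have L: "cd V sec' \<in> Lam x" if "x \<in> V" for x using that V(1) c unfolding Lam_def by blast
      obtain x0 where x0: "x0 \<in> V" using False by blast
      have lf: "lframe x h" if "x \<in> V" for x using h(2) V(2) that by blast
      obtain a where a: "cd V sec' = lc r a h" using lframe_Lam[OF lf[OF x0]] L[OF x0] by blast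
      have al: "a i \<in> loc x" if i: "i < r" and x: "x \<in> V" for i x
      proof -
        obtain b where b: "cd V sec' = lc r b h" "\<forall>i<r. b i \<in> loc x" using lframe_Lam[OF lf[OF x]] L[OF x] by blast
        have "a i = b i" using lc_freeD[OF lframe_free[OF lf[OF x]] _ i, of a b] a b(1) by simp
        then show ?thesis using b(2) i by simp
      qed
      have ml: "m i \<in> loc x" if "x \<in> V" for i x
        unfolding m_def using of_laurent_in_loc_chart[OF s R] V(2) that by blast
      have rq: "rg V (a i * m i)" if i: "i < r" for i
        unfolding rg_def
      proof
        fix x assume x: "x \<in> V"
        then have "x \<in> points" using zariski_open_points[OF V(1)] by blast
        then show "a i * m i \<in> loc x" using al[OF i x] ml[OF x] by (rule loc_mult)
      qed
      have "sec' = lin V r (\<lambda>i. a i * m i) (\<lambda>i. res (chart {0}) V (t i))"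
        by (rule cd_inj[OF V(1) c cll[OF V False]]) (use rq cdl[OF V False, of "\<lambda>i. a i * m i"] a lch in auto)
      then show ?thesis using rq by (intro exI[of _ "\<lambda>i. a i * m i"]) simp
    qed
  next
    fix V q q' i
    assume V: "zariski_open V" "V \<subseteq> chart {0}" "V \<noteq> {}" and q: "\<And>i. i < r \<Longrightarrow> rg V (q i)" "\<And>i. i < r \<Longrightarrow> rg V (q' i)"
      and eq: "lin V r q (\<lambda>i. res (chart {0}) V (t i)) = lin V r q' (\<lambda>i. res (chart {0}) V (t i))" and i: "i < r"
    have "lc r q g = lc r q' g" using cdl[OF V, of q] cdl[OF V, of q'] q eq by simp
    then have "q i * m' i = q' i * m' i" unfolding lcg using lc_freeD[OF lframe_free[OF h(2)[OF y]] _ i] by blast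
    then have "(q i * m' i) * m i = (q' i * m' i) * m i" by simp
    then show "q i = q' i" by (simp add: mult.assoc mm')
  qed
  have "coaction F {0} (t i) u = (if u = 0 then t i else \<zero>\<^bsub>H (chart {0})\<^esub>)" if i: "i < r" for i u
  proof (rule cd_inj[OF o co_closed[OF s t(1)[OF i]]])
    show "(if u = 0 then t i else \<zero>\<^bsub>H (chart {0})\<^esub>) \<in> carrier (H (chart {0}))"
      using t(1)[OF i] H_zero_closed[OF o] by simp
    show "cd (chart {0}) (coaction F {0} (t i) u) = cd (chart {0}) (if u = 0 then t i else \<zero>\<^bsub>H (chart {0})\<^esub>)"
      using rho_cd[OF s t(1)[OF i], of u] g[OF i] t(2)[OF i] cd_zero[OF o] unfolding hom_def[OF s] by auto
  qed
  then show ?thesis using that fr by blast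
qed

end

text \<open>With an invariant reference frame on the torus, the exponents in the coordinates of a
  section are its weights.\<close>

locale torus_framed_bundle = toric_bundle val \<pi> \<Sigma> r F
  for val :: "'k::field \<Rightarrow> ereal" and \<pi> :: 'k and \<Sigma> :: "'n::finite cone set"
    and r :: nat and F :: "('n, 'k, 'e) linearized_sheaf" +
  fixes t0 :: "nat \<Rightarrow> 'e"
  assumes torus_frame: "frame (chart {0}) t0"
    and torus_frame_invariant: "\<And>i u. i < r \<Longrightarrow> coaction F {0} (t0 i) u = (if u = 0 then t0 i else \<zero>\<^bsub>H (chart {0})\<^esub>)"

sublocale torus_framed_bundle \<subseteq> framed_bundle val \<pi> \<Sigma> r F "chart {0}" t0
  by unfold_locales (rule torus_frame)

context torus_framed_bundle
begin

lemma cd_t0: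
  assumes i: "i < r"
  shows "cd (chart {0}) (t0 i) = (\<lambda>j. if j = i then 1 else 0)"
proof (rule cd_eqI)
  note o = zariski_open_chart[OF zero_cone_in_Sigma]
  note tc = frame_closed[OF torus_frame]
  show "zariski_open (chart {0})" "chart {0} \<noteq> {}" using o chart_nonempty[OF zero_cone_in_Sigma] by auto
  let ?q = "\<lambda>j. if j = i then 1 else 0"
  have rq: "rg (chart {0}) (?q j)" for j using rg_0[OF o] rg_1[OF o] by simp
  have inj: "(\<lambda>i. res (chart {0}) (chart {0}) (t0 i)) j = t0 j" if "j < r" for j using res_id[OF o tc[OF that]] by simp
  obtain q where q: "\<And>j. j < r \<Longrightarrow> rg (chart {0}) (q j)" "t0 i = lin (chart {0}) r q (\<lambda>i. res (chart {0}) (chart {0}) (t0 i))"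
    using frame_ex[OF torus_frame o order_refl tc[OF i]] by metis
  interpret M: abelian_monoid "H (chart {0})" by (rule H_abelian_monoid[OF o])
  have "lin (chart {0}) r ?q (\<lambda>i. res (chart {0}) (chart {0}) (t0 i)) = t0 i"
  proof -
    have "lin (chart {0}) r ?q (\<lambda>i. res (chart {0}) (chart {0}) (t0 i)) = (\<Oplus>\<^bsub>H (chart {0})\<^esub>j\<in>{..<r}. if i = j then t0 j else \<zero>\<^bsub>H (chart {0})\<^esub>)"
      unfolding lin_def[OF o]
      by (intro M.finsum_cong') (auto simp: inj H_smult_zero[OF o] H_smult_one[OF o] tc)
    also have "\<dots> = t0 i" using i tc by (intro M.finsum_singleton) auto
    finally show ?thesis .
  qed
  then show "coords (chart {0}) (t0 i) ?q"
    unfolding coords_def using i rq res_id[OF o tc[OF i]] by simp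
qed

lemma hom_unit: "i < r \<Longrightarrow> hom {0} (\<lambda>j. if j = i then 1 else 0) 0"
  unfolding hom_def[OF zero_cone_in_Sigma]
proof (intro conjI allI)
  assume i: "i < r"
  note o = zariski_open_chart[OF zero_cone_in_Sigma] and tc = frame_closed[OF torus_frame i]
  show "(\<lambda>j. if j = i then 1 else 0) \<in> Gam (chart {0})" using cd_in_Gam[OF o tc] cd_t0[OF i] by simp
  fix u
  show "rho {0} (\<lambda>j. if j = i then 1 else 0) u = (if u = 0 then (\<lambda>j. if j = i then 1 else 0) else (\<lambda>_. 0))"
    using rho_cd[OF zero_cone_in_Sigma tc, of u] cd_t0[OF i] torus_frame_invariant[OF i, of u] cd_zero[OF o] by auto
qed

section \<open>Sections over charts as vectors of Laurent polynomials\<close>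

definition ofl :: "(nat \<Rightarrow> ('n, 'k) laurent) \<Rightarrow> nat \<Rightarrow> ('n, 'k) lfrac" where
  "ofl v = (\<lambda>j. of_laurent (v j))"

lemma ofl_eq_iff [simp]: "ofl v = ofl w \<longleftrightarrow> v = w"
  by (auto simp: ofl_def fun_eq_iff)

lemma ofl_unit_expansion:
  assumes "v \<in> kvec r"
  shows "ofl v = (\<lambda>j. \<Sum>i<r. of_laurent (v i) * (if j = i then 1 else 0))"
proof
  fix j
  have "(\<Sum>i<r. of_laurent (v i) * (if j = i then 1 else 0)) = (\<Sum>i<r. if j = i then of_laurent (v i) else 0)"
    by (rule sum.cong) auto
  also have "\<dots> = ofl v j" using assms by (cases "j < r") (auto simp: ofl_def kvec_def)
  finally show "ofl v j = (\<Sum>i<r. of_laurent (v i) * (if j = i then 1 else 0))" ..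
qed

text \<open>The reference frame lives on the whole torus, so coordinates over it have no poles there
  and are Laurent polynomials by \<open>loc_chart\<close>.\<close>

lemma Gam_torus: "Gam (chart {0}) = ofl ` kvec r"
proof
  note s = zero_cone_in_Sigma
  note o = zariski_open_chart[OF s]
  show "Gam (chart {0}) \<subseteq> ofl ` kvec r"
  proof
    fix v assume "v \<in> Gam (chart {0})"
    then obtain t where t: "t \<in> carrier (H (chart {0}))" "v = cd (chart {0}) t" using cd_surj[OF o] by blast
    have "coords (chart {0}) t v" using coords_cd[OF o chart_nonempty[OF s] t(1)] t(2) by simp
    then have v: "\<And>i. r \<le> i \<Longrightarrow> v i = 0" "\<And>i. i < r \<Longrightarrow> rg (chart {0}) (v i)" by (auto simp: coords_def)
    have "\<exists>f. v i = of_laurent f" if "i < r" for i using loc_chart[OF s] v(2)[OF that] unfolding rg_def by blast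
    then obtain f where f: "\<And>i. i < r \<Longrightarrow> v i = of_laurent (f i)" by metis
    have "v = ofl (\<lambda>i. if i < r then f i else 0)" using f v(1) by (auto simp: ofl_def fun_eq_iff)
    moreover have "(\<lambda>i. if i < r then f i else 0) \<in> kvec r" by (simp add: kvec_def)
    ultimately show "v \<in> ofl ` kvec r" by blast
  qed
  show "ofl ` kvec r \<subseteq> Gam (chart {0})"
  proof
    fix v assume "v \<in> ofl ` kvec r"
    then obtain f where f: "f \<in> kvec r" "v = ofl f" by blast
    show "v \<in> Gam (chart {0})" unfolding f(2) ofl_unit_expansion[OF f(1)]
      by (rule Gam_sum[OF s], rule Gam_smult[OF s])
        (use hom_unit in \<open>auto simp: hom_def[OF s] chart_ring_zero_cone\<close>)
  qed
qed

text \<open>As the reference frame has weight 0, the component of weight \<open>u\<close> collects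
  the terms of exponent \<open>u\<close> in all coordinates.\<close>

lemma rho_torus:
  assumes v: "v \<in> kvec r"
  shows "rho {0} (ofl v) u = ofl (\<lambda>j. mterm u (coef (v j) u))"
proof -
  note s = zero_cone_in_Sigma
  have w: "(\<lambda>j. mterm u (coef (v j) u)) \<in> kvec r" using v by (simp add: kvec_def)
  have "rho {0} (ofl v) u = (\<lambda>j. \<Sum>i<r. rho {0} (\<lambda>j. of_laurent (v i) * (if j = i then 1 else 0)) u j)"
    unfolding ofl_unit_expansion[OF v]
    by (rule rho_finite_sum[OF s], rule Gam_smult[OF s])
      (use hom_unit in \<open>auto simp: hom_def[OF s] chart_ring_zero_cone\<close>)
  also have "\<dots> = (\<lambda>j. \<Sum>i<r. of_laurent (mterm u (coef (v i) u)) * (if j = i then 1 else 0))"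
    by (intro ext sum.cong refl) (simp add: rho_smult_hom[OF s hom_unit] chart_ring_zero_cone del: mult_cancel_left mult_eq_0_iff)
  also have "\<dots> = ofl (\<lambda>j. mterm u (coef (v j) u))" unfolding ofl_unit_expansion[OF w] ..
  finally show ?thesis .
qed

text \<open>The sections over the chart as a graded submodule of \<open>K[M]^r\<close>; every chart
  contains the torus, so Laurent polynomials suffice as coordinates.\<close>

definition PS :: "'n cone \<Rightarrow> (nat \<Rightarrow> ('n, 'k) laurent) set" where
  "PS \<sigma> = {v. ofl v \<in> Gam (chart \<sigma>)}"

definition crd :: "'n cone \<Rightarrow> 'e \<Rightarrow> nat \<Rightarrow> ('n, 'k) laurent" where
  "crd \<sigma> t = inv_into UNIV ofl (cd (chart \<sigma>) t)"

lemma PS_torus: "PS {0} = kvec r"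
  unfolding PS_def Gam_torus by auto

context
  fixes \<sigma> assumes s: "\<sigma> \<in> \<Sigma>"
begin

lemma Gam_chart_ofl: "v \<in> Gam (chart \<sigma>) \<Longrightarrow> \<exists>w\<in>kvec r. v = ofl w"
  using rho_face(1)[OF s zero_cone_in_Sigma, of v] zero_in_cone[OF s] unfolding Gam_torus by auto

lemma PS_kvec: "PS \<sigma> \<subseteq> kvec r"
  unfolding PS_def using Gam_chart_ofl by force

lemma ofl_crd: "t \<in> carrier (H (chart \<sigma>)) \<Longrightarrow> ofl (crd \<sigma> t) = cd (chart \<sigma>) t"
  unfolding crd_def using Gam_chart_ofl[OF cd_in_Gam[OF zariski_open_chart[OF s]]] f_inv_into_f[of _ ofl UNIV] by blast

lemma crd_in_PS: "t \<in> carrier (H (chart \<sigma>)) \<Longrightarrow> crd \<sigma> t \<in> PS \<sigma>"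
  unfolding PS_def using ofl_crd cd_in_Gam[OF zariski_open_chart[OF s]] by simp

lemma crd_inj: "t \<in> carrier (H (chart \<sigma>)) \<Longrightarrow> t' \<in> carrier (H (chart \<sigma>)) \<Longrightarrow> crd \<sigma> t = crd \<sigma> t' \<Longrightarrow> t = t'"
  using cd_inj[OF zariski_open_chart[OF s]] ofl_crd by metis

lemma crd_surj: "v \<in> PS \<sigma> \<Longrightarrow> \<exists>t\<in>carrier (H (chart \<sigma>)). crd \<sigma> t = v"
  unfolding PS_def using cd_surj[OF zariski_open_chart[OF s]] ofl_crd ofl_eq_iff by (metis mem_Collect_eq)

lemma of_laurent_crd: "t \<in> carrier (H (chart \<sigma>)) \<Longrightarrow> of_laurent (crd \<sigma> t j) = cd (chart \<sigma>) t j"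
  using fun_cong[OF ofl_crd, of t j] by (simp add: ofl_def)

lemma crd_add:
  assumes t: "t \<in> carrier (H (chart \<sigma>))" "t' \<in> carrier (H (chart \<sigma>))"
  shows "crd \<sigma> (t \<oplus>\<^bsub>H (chart \<sigma>)\<^esub> t') = (\<lambda>j. crd \<sigma> t j + crd \<sigma> t' j)"
proof
  note o = zariski_open_chart[OF s]
  fix j
  have "of_laurent (crd \<sigma> (t \<oplus>\<^bsub>H (chart \<sigma>)\<^esub> t') j) = of_laurent (crd \<sigma> t j + crd \<sigma> t' j)"
    by (simp add: of_laurent_crd t H_add_closed[OF o] cd_add[OF o])
  then show "crd \<sigma> (t \<oplus>\<^bsub>H (chart \<sigma>)\<^esub> t') j = crd \<sigma> t j + crd \<sigma> t' j" by (simp only: of_laurent_eq_iff)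
qed

lemma crd_smult:
  assumes t: "t \<in> carrier (H (chart \<sigma>))" and f: "f \<in> chart_ring \<sigma>"
  shows "regular_of (chart \<sigma>) f \<odot>\<^bsub>H (chart \<sigma>)\<^esub> t \<in> carrier (H (chart \<sigma>))"
    and "crd \<sigma> (regular_of (chart \<sigma>) f \<odot>\<^bsub>H (chart \<sigma>)\<^esub> t) = (\<lambda>j. f * crd \<sigma> t j)"
proof -
  note o = zariski_open_chart[OF s]
  have rg: "rg (chart \<sigma>) (of_laurent f)" unfolding rg_def using of_laurent_in_loc_chart[OF s f] by blast
  show c: "regular_of (chart \<sigma>) f \<odot>\<^bsub>H (chart \<sigma>)\<^esub> t \<in> carrier (H (chart \<sigma>))"
    unfolding regular_of_cf by (rule H_smult_closed[OF o rg t])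
  show "crd \<sigma> (regular_of (chart \<sigma>) f \<odot>\<^bsub>H (chart \<sigma>)\<^esub> t) = (\<lambda>j. f * crd \<sigma> t j)"
  proof
    fix j
    have "of_laurent (crd \<sigma> (regular_of (chart \<sigma>) f \<odot>\<^bsub>H (chart \<sigma>)\<^esub> t) j) = of_laurent (f * crd \<sigma> t j)"
      unfolding of_laurent_crd[OF c] of_laurent_mult of_laurent_crd[OF t] unfolding regular_of_cf
      by (simp add: cd_smult[OF o t rg])
    then show "crd \<sigma> (regular_of (chart \<sigma>) f \<odot>\<^bsub>H (chart \<sigma>)\<^esub> t) j = f * crd \<sigma> t j" by (simp only: of_laurent_eq_iff)
  qed
qed

lemma crd_zero: "crd \<sigma> \<zero>\<^bsub>H (chart \<sigma>)\<^esub> = (\<lambda>_. 0)"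
  using ofl_crd[OF H_zero_closed[OF zariski_open_chart[OF s]]] cd_zero[OF zariski_open_chart[OF s]]
  by (simp add: ofl_def fun_eq_iff)

lemma crd_finsum:
  assumes "finite A" "\<And>i. i \<in> A \<Longrightarrow> t i \<in> carrier (H (chart \<sigma>))"
  shows "crd \<sigma> (\<Oplus>\<^bsub>H (chart \<sigma>)\<^esub>i\<in>A. t i) j = (\<Sum>i\<in>A. crd \<sigma> (t i) j)"
  by (rule finsum_additive[OF H_abelian_monoid[OF zariski_open_chart[OF s]]]) (auto simp: crd_zero crd_add assms)

lemma crd_res:
  assumes t: "\<tau> \<in> \<Sigma>" "\<tau> \<subseteq> \<sigma>" and c: "t \<in> carrier (H (chart \<sigma>))"
  shows "crd \<tau> (res (chart \<sigma>) (chart \<tau>) t) = crd \<sigma> t"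
  unfolding crd_def
  using cd_res[OF zariski_open_chart[OF s] zariski_open_chart[OF t(1)] chart_nonempty[OF t(1)] chart_mono[OF s t] c] by simp

lemma crd_coaction:
  assumes t: "t \<in> carrier (H (chart \<sigma>))"
  shows "crd \<sigma> (coaction F \<sigma> t u) = (\<lambda>j. mterm u (coef (crd \<sigma> t j) u))"
proof -
  have k: "crd \<sigma> t \<in> kvec r" using crd_in_PS[OF t] PS_kvec by blast
  have G: "cd (chart \<sigma>) t \<in> Gam (chart \<sigma>)" by (rule cd_in_Gam[OF zariski_open_chart[OF s] t])
  have "ofl (crd \<sigma> (coaction F \<sigma> t u)) = rho \<sigma> (cd (chart \<sigma>) t) u"
    using ofl_crd[OF co_closed[OF s t]] rho_cd[OF s t] by simp
  also have "\<dots> = rho {0} (ofl (crd \<sigma> t)) u"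
    using rho_face(2)[OF s zero_cone_in_Sigma _ G] zero_in_cone[OF s] ofl_crd[OF t] by simp
  also have "\<dots> = ofl (\<lambda>j. mterm u (coef (crd \<sigma> t j) u))" by (rule rho_torus[OF k])
  finally show ?thesis by simp
qed

lemma PS_term: "v \<in> PS \<sigma> \<Longrightarrow> (\<lambda>j. mterm u (coef (v j) u)) \<in> PS \<sigma>"
  using crd_surj[of v] crd_coaction crd_in_PS co_closed[OF s] by metis

text \<open>The sign of the weights follows \<open>chart_frame\<close>, so that \<open>u i\<close>
  itself is the linear function that enters the norm.\<close>

definition pspan :: "nat \<Rightarrow> (nat \<Rightarrow> int ^ 'n) \<Rightarrow> (nat \<Rightarrow> nat \<Rightarrow> 'k) \<Rightarrow> (nat \<Rightarrow> ('n, 'k) laurent) set" where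
  "pspan n u e = {\<lambda>j. \<Sum>i<n. f i * mterm (- u i) (e i j) | f. \<forall>i<n. f i \<in> chart_ring \<sigma>}"

text \<open>A homogeneous section over the torus is a monomial times a constant vector. The constant
  vectors of a homogeneous frame inherit independence and spanning over \<open>K\<close> from the
  frame property at the generic point.\<close>

lemma PS_frame: "\<exists>u e. kbasis r r e \<and> PS \<sigma> = pspan r u e"
proof -
  obtain h w where hw: "(\<forall>i<r. hom \<sigma> (h i) (w i)) \<and> (\<forall>y\<in>chart \<sigma>. lframe y h) \<and>
      Gam (chart \<sigma>) = {lc r (\<lambda>i. of_laurent (f i)) h | f. \<forall>i<r. f i \<in> chart_ring \<sigma>}"
    using homogeneous_frame[OF s] by (elim exE)
  have h: "\<And>i. i < r \<Longrightarrow> hom \<sigma> (h i) (w i)" "\<And>y. y \<in> chart \<sigma> \<Longrightarrow> lframe y h"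
    "Gam (chart \<sigma>) = {lc r (\<lambda>i. of_laurent (f i)) h | f. \<forall>i<r. f i \<in> chart_ring \<sigma>}"
    using hw by simp_all
  have z: "{0} \<subseteq> \<sigma>" using zero_in_cone[OF s] by simp
  have "\<exists>e\<in>kvec r. h i = ofl (\<lambda>j. mterm (w i) (e j))" if i: "i < r" for i
  proof -
    have hG: "h i \<in> Gam (chart \<sigma>)" and hr: "rho \<sigma> (h i) (w i) = h i" using h(1)[OF i] by (auto simp: hom_def[OF s])
    obtain v where v: "v \<in> kvec r" "h i = ofl v" using Gam_chart_ofl[OF hG] by blast
    have "h i = rho {0} (ofl v) (w i)" using rho_face(2)[OF s zero_cone_in_Sigma z hG] hr v by simp
    also have "\<dots> = ofl (\<lambda>j. mterm (w i) (coef (v j) (w i)))" by (rule rho_torus[OF v(1)])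
    finally show ?thesis using v(1) by (intro bexI[of _ "\<lambda>j. coef (v j) (w i)"]) (auto simp: kvec_def)
  qed
  then obtain e where e: "\<And>i. i < r \<Longrightarrow> e i \<in> kvec r" "\<And>i. i < r \<Longrightarrow> h i = ofl (\<lambda>j. mterm (w i) (e i j))" by metis
  have lch: "lc r (\<lambda>i. of_laurent (f i)) h = ofl (\<lambda>j. \<Sum>i<r. f i * mterm (w i) (e i j))" for f
    unfolding lc_def ofl_def by (rule ext) (simp add: e(2) ofl_def)
  obtain y where y: "y \<in> chart \<sigma>" using chart_nonempty[OF s] by blast
  have free: "lc_free r h" by (rule lframe_free[OF h(2)[OF y]])
  have "kbasis r r e" unfolding kbasis_def
  proof (intro conjI allI impI ballI)
    show "e i \<in> kvec r" if "i < r" for i by (rule e(1)[OF that])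
    show "lc_free r e" unfolding lc_free_def
    proof (intro allI impI)
      fix c i assume c: "lc r c e = (\<lambda>_. 0)" and i: "i < r"
      \<comment> \<open>Twisting the coefficients by \<open>- w i\<close> turns a relation over
        \<open>K\<close> among the \<open>e i\<close> into a relation among the
        \<open>h i\<close>.\<close>
      have "lc r (\<lambda>i. of_laurent (mterm (- w i) (c i))) h = ofl (\<lambda>j. mterm 0 (lc r c e j))"
        unfolding lch by (rule arg_cong[of _ _ ofl]) (auto simp: lc_def mult_single mterm_sum)
      also have "\<dots> = (\<lambda>_. 0)" by (simp add: c ofl_def)
      finally have "of_laurent (mterm (- w i) (c i)) = 0" using free i unfolding lc_free_def by blast
      then show "c i = 0" by (metis lookup_single_eq lookup_zero of_laurent_eq_0_iff)
    qed
    fix v :: "nat \<Rightarrow> 'k" assume v: "v \<in> kvec r"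
    let ?v = "\<lambda>j. mterm (0 :: int ^ 'n) (v j)"
    have "ofl ?v \<in> Gam (chart {0})" unfolding Gam_torus using v by (auto simp: kvec_def)
    then have "ofl ?v \<in> Lam generic_point"
      using generic_point_in_open[OF zariski_open_chart[OF zero_cone_in_Sigma]] chart_nonempty[OF zero_cone_in_Sigma]
      unfolding Gam_chart_iff[OF zero_cone_in_Sigma] by blast
    then obtain f where f: "f \<in> chart_ring \<sigma>" "f \<notin> {0}" "(\<lambda>j. of_laurent f * ofl ?v j) \<in> Gam (chart \<sigma>)"
      using Lam_clear_denominator[OF s zero_in_spec[OF s]] unfolding generic_point_chart[OF s] by blast
    then obtain g where g: "(\<lambda>j. of_laurent f * ofl ?v j) = lc r (\<lambda>i. of_laurent (g i)) h" unfolding h(3) by blast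
    have "ofl (\<lambda>j. f * ?v j) = ofl (\<lambda>j. \<Sum>i<r. g i * mterm (w i) (e i j))"
      using g unfolding lch by (simp add: ofl_def)
    then have eq: "f * ?v j = (\<Sum>i<r. g i * mterm (w i) (e i j))" for j
      unfolding ofl_eq_iff by (rule fun_cong)
    \<comment> \<open>Any exponent of \<open>f\<close> with nonzero coefficient will do: comparing
      coefficients there expresses a multiple of \<open>v\<close> over \<open>K\<close>.\<close>
    obtain k where k: "coef f k \<noteq> 0" using f(2) by (metis insertCI lookup_zero poly_mapping_eqI)
    have "coef f k * v j = (\<Sum>i<r. coef (g i) (k - w i) * e i j)" for j
      using arg_cong[OF eq[of j], of "\<lambda>x. coef x k"]
      by (simp add: mult.commute[of f] mult.commute[of "g _"] coef_mterm_mult lookup_sum) (simp add: mult.commute)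
    then have "inverse (coef f k) * (coef f k * v j) = (\<Sum>i<r. inverse (coef f k) * coef (g i) (k - w i) * e i j)" for j
      by (simp add: sum_distrib_left mult.assoc)
    then have "v j = (\<Sum>i<r. inverse (coef f k) * coef (g i) (k - w i) * e i j)" for j
      using k by (simp add: mult.assoc[symmetric])
    then have "v = lc r (\<lambda>i. inverse (coef f k) * coef (g i) (k - w i)) e" by (simp add: lc_def fun_eq_iff)
    then show "\<exists>c. v = lc r c e" by blast
  qed
  moreover have "PS \<sigma> = pspan r (\<lambda>i. - w i) e"
    unfolding PS_def h(3) pspan_def by (auto simp: lch)
  ultimately show ?thesis by blast
qed

end

text \<open>Quasi-coherence, as the chart of the face is the distinguished open set of the
  monomial.\<close>

lemma PS_face:
  assumes s: "\<sigma> \<in> \<Sigma>" "\<tau> \<in> \<Sigma>" and c: "cuts_face \<sigma> u a \<tau>" and v: "v \<in> PS \<tau>"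
  shows "\<exists>n. (\<lambda>j. mterm u a ^ n * v j) \<in> PS \<sigma>"
proof -
  have a: "mterm u a \<noteq> 0" using c by (metis cuts_face_def lookup_single_eq lookup_zero)
  have "ofl v \<in> Lam y" if "y \<in> distinguished_open \<sigma> (mterm u a)" for y
  proof -
    have "\<forall>y\<in>chart \<tau>. ofl v \<in> Lam y" using v unfolding PS_def mem_Collect_eq Gam_chart_iff[OF s(2)] .
    then show ?thesis using that unfolding chart_face[OF s c] by blast
  qed
  then obtain n where "(\<lambda>j. of_laurent (mterm u a ^ n) * ofl v j) \<in> Gam (chart \<sigma>)"
    using Lam_extend[OF s(1) cuts_face_mterm[OF c] a, of "ofl v"] by blast
  then show ?thesis unfolding PS_def by (auto simp: ofl_def)
qed

lemma PS_mono: "\<sigma> \<in> \<Sigma> \<Longrightarrow> \<tau> \<in> \<Sigma> \<Longrightarrow> \<tau> \<subseteq> \<sigma> \<Longrightarrow> PS \<sigma> \<subseteq> PS \<tau>"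
  unfolding PS_def using rho_face(1) by blast

end

section \<open>The fiber at the identity point\<close>

text \<open>Evaluation at the identity point of the torus, where every character takes the value
  1.\<close>

definition aug :: "('n::finite, 'k::field) laurent \<Rightarrow> 'k" where
  "aug f = (\<Sum>u\<in>supp f. coef f u)"

lemma aug_superset: "finite A \<Longrightarrow> supp f \<subseteq> A \<Longrightarrow> aug f = (\<Sum>u\<in>A. coef f u)"
  unfolding aug_def by (rule sum.mono_neutral_left) (auto simp: in_keys_iff)

lemma aug_add: "aug (f + g) = aug f + aug g"
proof -
  let ?A = "supp f \<union> supp g"
  have "supp (f + g) \<subseteq> ?A" by (rule keys_add)
  then show ?thesis
    using aug_superset[of ?A f] aug_superset[of ?A g] aug_superset[of ?A "f + g"]
    by (simp add: lookup_add sum.distrib)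
qed

lemma aug_0 [simp]: "aug 0 = 0"
  by (simp add: aug_def)

lemma aug_mterm [simp]: "aug (mterm u a) = a"
  by (simp add: aug_def)

lemma aug_sum: "aug (sum f A) = (\<Sum>i\<in>A. aug (f i))"
  by (induction A rule: infinite_finite_induct) (auto simp: aug_add)

lemma aug_mterm_mult: "aug (mterm u a * g) = a * aug g"
proof -
  let ?A = "(\<lambda>k. k + u) ` supp g"
  have "supp (mterm u a * g) \<subseteq> ?A"
  proof
    fix k assume "k \<in> supp (mterm u a * g)"
    then have "k - u \<in> supp g" by (auto simp: in_keys_iff coef_mterm_mult)
    then have "(k - u) + u \<in> ?A" by blast
    then show "k \<in> ?A" by simp
  qed
  then have "aug (mterm u a * g) = (\<Sum>k\<in>?A. a * coef g (k - u))"
    by (subst aug_superset[of ?A]) (auto simp: coef_mterm_mult)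
  also have "\<dots> = (\<Sum>k\<in>supp g. a * coef g k)"
    by (subst sum.reindex) (auto simp: inj_on_def)
  finally show ?thesis by (simp add: aug_def sum_distrib_left)
qed

lemma aug_mult: "aug (f * g) = aug f * aug g"
proof -
  have "aug (f * g) = aug (\<Sum>u\<in>supp f. mterm u (coef f u) * g)"
    by (subst sum_mterms[of f, symmetric]) (simp add: sum_distrib_right)
  also have "\<dots> = aug f * aug g"
    by (simp add: aug_sum aug_mterm_mult) (simp add: aug_def sum_distrib_right)
  finally show ?thesis .
qed

context torus_framed_bundle
begin

abbreviation "HT \<equiv> H (chart {0})"

lemmas s0 = zero_cone_in_Sigma
lemmas o0 = zariski_open_chart[OF zero_cone_in_Sigma]

lemma R0 [simp]: "f \<in> chart_ring {0}"
  by (simp add: chart_ring_zero_cone)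

lemma identity_ideal_iff: "f \<in> identity_ideal \<longleftrightarrow> aug f = 0"
  by (simp add: identity_ideal_def aug_def)

definition val0 :: "'e \<Rightarrow> nat \<Rightarrow> 'k" where
  "val0 t = (\<lambda>j. aug (crd {0} t j))"

text \<open>A point of the fiber is a coset of sections; \<open>cls v\<close> is the coset of the
  sections with coordinates \<open>v\<close> at the identity point.\<close>

definition cls :: "(nat \<Rightarrow> 'k) \<Rightarrow> 'e set" where
  "cls v = {t \<in> carrier HT. val0 t = v}"

definition csec :: "(nat \<Rightarrow> 'k) \<Rightarrow> 'e" where
  "csec v = (SOME t. t \<in> carrier HT \<and> crd {0} t = (\<lambda>j. mterm 0 (v j)))"

lemma crd_kvec: "t \<in> carrier HT \<Longrightarrow> crd {0} t \<in> kvec r"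
  using crd_in_PS[OF s0] PS_torus by blast

lemma crd_torus_surj: "v \<in> kvec r \<Longrightarrow> \<exists>t\<in>carrier HT. crd {0} t = v"
  using crd_surj[OF s0] PS_torus by blast

lemma csec:
  assumes "v \<in> kvec r"
  shows csec_closed: "csec v \<in> carrier HT" and crd_csec: "crd {0} (csec v) = (\<lambda>j. mterm 0 (v j))"
proof -
  have "(\<lambda>j. mterm 0 (v j)) \<in> kvec r" using assms by (simp add: kvec_def)
  then have "\<exists>t. t \<in> carrier HT \<and> crd {0} t = (\<lambda>j. mterm 0 (v j))" using crd_torus_surj by blast
  from someI_ex[OF this] show "csec v \<in> carrier HT" "crd {0} (csec v) = (\<lambda>j. mterm 0 (v j))"
    unfolding csec_def by simp_all
qed

lemma val0_kvec: "t \<in> carrier HT \<Longrightarrow> val0 t \<in> kvec r"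
  using crd_kvec[of t] by (simp add: val0_def kvec_def)

lemma val0_csec: "v \<in> kvec r \<Longrightarrow> val0 (csec v) = v"
  by (simp add: val0_def crd_csec)

lemma val0_add: "t \<in> carrier HT \<Longrightarrow> t' \<in> carrier HT \<Longrightarrow> val0 (t \<oplus>\<^bsub>HT\<^esub> t') = (\<lambda>j. val0 t j + val0 t' j)"
  by (simp add: val0_def crd_add[OF s0] aug_add)

lemma val0_smult: "t \<in> carrier HT \<Longrightarrow> val0 (regular_of (chart {0}) f \<odot>\<^bsub>HT\<^esub> t) = (\<lambda>j. aug f * val0 t j)"
  by (simp add: val0_def crd_smult(2)[OF s0] aug_mult)

lemma csec_in_cls: "v \<in> kvec r \<Longrightarrow> csec v \<in> cls v"
  by (simp add: cls_def csec_closed val0_csec)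

lemma cls_inj: "v \<in> kvec r \<Longrightarrow> cls v = cls w \<Longrightarrow> v = w"
  using csec_in_cls[of v] by (auto simp: cls_def val0_csec)

lemma cls_subtract:
  assumes t: "t \<in> carrier HT" and t': "t' \<in> carrier HT"
  obtains d where "d \<in> carrier HT" "t = d \<oplus>\<^bsub>HT\<^esub> t'" "val0 d = (\<lambda>j. val0 t j - val0 t' j)"
proof -
  interpret abelian_group HT by (rule H_abelian_group[OF o0])
  let ?d = "t \<ominus>\<^bsub>HT\<^esub> t'"
  have d: "?d \<in> carrier HT" using t t' by simp
  have e: "t = ?d \<oplus>\<^bsub>HT\<^esub> t'" using t t' by (simp add: minus_eq a_assoc l_neg)
  have "val0 ?d = (\<lambda>j. val0 t j - val0 t' j)"
    using val0_add[OF d t'] e by (simp add: fun_eq_iff)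
  then show ?thesis using that d e by blast
qed

lemma crd_t0: "i < r \<Longrightarrow> crd {0} (t0 i) = (\<lambda>j. if j = i then 1 else 0)"
proof
  fix j assume i: "i < r"
  have "of_laurent (crd {0} (t0 i) j) = of_laurent (if j = i then 1 else 0)"
    using of_laurent_crd[OF s0 frame_closed[OF torus_frame i], of j] cd_t0[OF i] by simp
  then show "crd {0} (t0 i) j = (if j = i then 1 else 0)" by (simp only: of_laurent_eq_iff)
qed

text \<open>The coordinates of a section are its coefficients in the reference frame. If all of them
  lie in the augmentation ideal, the expansion in that frame is itself a witness for
  vanishing.\<close>

lemma vanishing_sections_eq: "vanishing_sections F = cls (\<lambda>_. 0)"
proof
  show "vanishing_sections F \<subseteq> cls (\<lambda>_. 0)"
  proof
    fix x assume "x \<in> vanishing_sections F"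
    then obtain l :: nat and f t where x: "x = (\<Oplus>\<^bsub>HT\<^esub>j\<in>{..<l}. regular_of (chart {0}) (f j) \<odot>\<^bsub>HT\<^esub> t j)"
      and ft: "\<And>j. j < l \<Longrightarrow> f j \<in> identity_ideal" "\<And>j. j < l \<Longrightarrow> t j \<in> carrier HT"
      unfolding vanishing_sections_def Let_def by blast
    interpret abelian_monoid HT by (rule H_abelian_monoid[OF o0])
    have c: "regular_of (chart {0}) (f j) \<odot>\<^bsub>HT\<^esub> t j \<in> carrier HT" if "j < l" for j
      using crd_smult(1)[OF s0 ft(2)[OF that] R0] .
    have "x \<in> carrier HT" unfolding x using c by (intro finsum_closed) auto
    moreover have "val0 x j = 0" for j
    proof -
      have "crd {0} x j = (\<Sum>i<l. crd {0} (regular_of (chart {0}) (f i) \<odot>\<^bsub>HT\<^esub> t i) j)"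
        unfolding x by (rule crd_finsum[OF s0]) (use c in auto)
      then show ?thesis
        unfolding val0_def using ft by (simp add: crd_smult(2)[OF s0] aug_sum aug_mult identity_ideal_iff)
    qed
    ultimately show "x \<in> cls (\<lambda>_. 0)" unfolding cls_def by auto
  qed
  show "cls (\<lambda>_. 0) \<subseteq> vanishing_sections F"
  proof
    fix x assume "x \<in> cls (\<lambda>_. 0)"
    then have x: "x \<in> carrier HT" "val0 x = (\<lambda>_. 0)" by (auto simp: cls_def)
    interpret abelian_monoid HT by (rule H_abelian_monoid[OF o0])
    note tc = frame_closed[OF torus_frame]
    let ?y = "\<Oplus>\<^bsub>HT\<^esub>j\<in>{..<r}. regular_of (chart {0}) (crd {0} x j) \<odot>\<^bsub>HT\<^esub> t0 j"
    have c: "regular_of (chart {0}) (crd {0} x j) \<odot>\<^bsub>HT\<^esub> t0 j \<in> carrier HT" if "j < r" for j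
      using crd_smult(1)[OF s0 tc[OF that] R0] .
    have "x = ?y"
    proof (rule crd_inj[OF s0 x(1)])
      show "?y \<in> carrier HT" using c by (intro finsum_closed) auto
      show "crd {0} x = crd {0} ?y"
      proof
        fix k
        have "crd {0} ?y k = (\<Sum>j<r. crd {0} (regular_of (chart {0}) (crd {0} x j) \<odot>\<^bsub>HT\<^esub> t0 j) k)"
          by (rule crd_finsum[OF s0]) (use c in auto)
        also have "\<dots> = (\<Sum>j<r. crd {0} x j * (if k = j then 1 else 0))"
          using tc by (simp add: crd_smult(2)[OF s0] crd_t0)
        also have "\<dots> = (\<Sum>j<r. if k = j then crd {0} x j else 0)" by (rule sum.cong) auto
        also have "\<dots> = crd {0} x k" using crd_kvec[OF x(1)] by (auto simp: kvec_def)
        finally show "crd {0} x k = crd {0} ?y k" ..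
      qed
    qed
    moreover have "aug (crd {0} x j) = 0" for j using fun_cong[OF x(2), of j] by (simp add: val0_def)
    ultimately show "x \<in> vanishing_sections F"
      unfolding vanishing_sections_def Let_def
      by (intro CollectI exI[of _ r] exI[of _ "crd {0} x"] exI[of _ t0]) (auto simp: identity_ideal_iff tc)
  qed
qed

lemma value_at_identity_eq: 
  assumes t: "t \<in> carrier HT" shows "value_at_identity F t = cls (val0 t)"
proof
  show "value_at_identity F t \<subseteq> cls (val0 t)"
    unfolding value_at_identity_def vanishing_sections_eq a_r_coset_def'
    using t by (auto simp: cls_def val0_add H_add_closed[OF o0])
  show "cls (val0 t) \<subseteq> value_at_identity F t"
  proof
    fix x assume "x \<in> cls (val0 t)"
    then have x: "x \<in> carrier HT" "val0 x = val0 t" by (auto simp: cls_def)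
    obtain d where "d \<in> carrier HT" "x = d \<oplus>\<^bsub>HT\<^esub> t" "val0 d = (\<lambda>j. val0 x j - val0 t j)"
      by (rule cls_subtract[OF x(1) t])
    then show "x \<in> value_at_identity F t"
      unfolding value_at_identity_def vanishing_sections_eq a_r_coset_def' using x(2) by (auto simp: cls_def)
  qed
qed

lemma fiber_carrier: "carrier (fiber F) = cls ` kvec r"
proof -
  have "carrier (fiber F) = value_at_identity F ` carrier HT" by (simp add: fiber_def Let_def)
  also have "\<dots> = (\<lambda>t. cls (val0 t)) ` carrier HT" by (rule image_cong) (auto simp: value_at_identity_eq)
  also have "\<dots> = cls ` kvec r"
  proof
    show "(\<lambda>t. cls (val0 t)) ` carrier HT \<subseteq> cls ` kvec r" using val0_kvec by blast
    show "cls ` kvec r \<subseteq> (\<lambda>t. cls (val0 t)) ` carrier HT"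
    proof
      fix x assume "x \<in> cls ` kvec r"
      then obtain v where v: "v \<in> kvec r" "x = cls v" by blast
      show "x \<in> (\<lambda>t. cls (val0 t)) ` carrier HT"
        by (rule image_eqI[of _ _ "csec v"]) (simp_all add: v val0_csec csec_closed)
    qed
  qed
  finally show ?thesis .
qed

lemma fiber_zero: "\<zero>\<^bsub>fiber F\<^esub> = cls (\<lambda>_. 0)"
  by (simp add: fiber_def Let_def vanishing_sections_eq)

lemma fiber_add:
  assumes v: "v \<in> kvec r" "w \<in> kvec r"
  shows "cls v \<oplus>\<^bsub>fiber F\<^esub> cls w = cls (\<lambda>j. v j + w j)"
proof -
  have "cls v \<oplus>\<^bsub>fiber F\<^esub> cls w = (\<Union>h\<in>cls v. \<Union>k\<in>cls w. {h \<oplus>\<^bsub>HT\<^esub> k})"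
    by (simp add: fiber_def Let_def set_add_def')
  also have "\<dots> = cls (\<lambda>j. v j + w j)"
  proof
    show "(\<Union>h\<in>cls v. \<Union>k\<in>cls w. {h \<oplus>\<^bsub>HT\<^esub> k}) \<subseteq> cls (\<lambda>j. v j + w j)"
      by (auto simp: cls_def val0_add H_add_closed[OF o0])
    show "cls (\<lambda>j. v j + w j) \<subseteq> (\<Union>h\<in>cls v. \<Union>k\<in>cls w. {h \<oplus>\<^bsub>HT\<^esub> k})"
    proof
      fix x assume "x \<in> cls (\<lambda>j. v j + w j)"
      then have x: "x \<in> carrier HT" "val0 x = (\<lambda>j. v j + w j)" by (auto simp: cls_def)
      obtain d where d: "d \<in> carrier HT" "x = d \<oplus>\<^bsub>HT\<^esub> csec w" "val0 d = (\<lambda>j. val0 x j - val0 (csec w) j)"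
        by (rule cls_subtract[OF x(1) csec_closed[OF v(2)]])
      then have "d \<in> cls v" using x(2) val0_csec[OF v(2)] by (simp add: cls_def)
      then show "x \<in> (\<Union>h\<in>cls v. \<Union>k\<in>cls w. {h \<oplus>\<^bsub>HT\<^esub> k})" using d(2) csec_in_cls[OF v(2)] by blast
    qed
  qed
  finally show ?thesis .
qed

lemma fiber_smult:
  assumes v: "v \<in> kvec r"
  shows "c \<odot>\<^bsub>fiber F\<^esub> cls v = cls (\<lambda>j. c * v j)"
proof -
  have "c \<odot>\<^bsub>fiber F\<^esub> cls v = (\<Union>t\<in>cls v. value_at_identity F (regular_of (chart {0}) (mterm 0 c) \<odot>\<^bsub>HT\<^esub> t))"
    by (simp add: fiber_def Let_def)
  also have "\<dots> = (\<Union>t\<in>cls v. cls (\<lambda>j. c * v j))"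
    by (rule SUP_cong) (auto simp: cls_def value_at_identity_eq crd_smult(1)[OF s0] val0_smult)
  finally show ?thesis using csec_in_cls[OF v] by auto
qed

lemma kvec_closed:
  "v \<in> kvec r \<Longrightarrow> w \<in> kvec r \<Longrightarrow> (\<lambda>j. v j + w j) \<in> kvec r" "v \<in> kvec r \<Longrightarrow> (\<lambda>j. c * v j) \<in> kvec r"
  "(\<lambda>_. 0) \<in> kvec r" "v \<in> kvec r \<Longrightarrow> (\<lambda>j. - v j) \<in> kvec r" for v w :: "nat \<Rightarrow> 'k"
  by (simp_all add: kvec_def)

lemma fiber_abelian_group: "abelian_group (fiber F)"
proof (rule abelian_groupI)
  fix x assume "x \<in> carrier (fiber F)"
  then obtain v where v: "v \<in> kvec r" "x = cls v" unfolding fiber_carrier by blast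
  then have "cls (\<lambda>j. - v j) \<oplus>\<^bsub>fiber F\<^esub> x = \<zero>\<^bsub>fiber F\<^esub>"
    by (simp add: fiber_add kvec_closed fiber_zero)
  then show "\<exists>y\<in>carrier (fiber F). y \<oplus>\<^bsub>fiber F\<^esub> x = \<zero>\<^bsub>fiber F\<^esub>"
    using kvec_closed(4)[OF v(1)] unfolding fiber_carrier by blast
qed (auto simp: fiber_carrier fiber_zero fiber_add kvec_closed ac_simps)

section \<open>Bases of the fiber and chart frames in coordinates\<close>

lemma fiber_lin_comb:
  assumes b: "\<And>i. i < n \<Longrightarrow> e i \<in> kvec r" "\<And>i. i < n \<Longrightarrow> b i = cls (e i)"
  shows "lin_comb (fiber F) n c b = cls (lc n c e)"
proof -
  interpret abelian_group "fiber F" by (rule fiber_abelian_group)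
  have "m \<le> n \<Longrightarrow> lin_comb (fiber F) m c b = cls (lc m c e)" for m
  proof (induction m)
    case 0 then show ?case by (simp add: lin_comb_def lc_def fiber_zero)
  next
    case (Suc m)
    have "lin_comb (fiber F) (Suc m) c b = lin_comb (fiber F) m c b \<oplus>\<^bsub>fiber F\<^esub> c m \<odot>\<^bsub>fiber F\<^esub> b m"
      unfolding lin_comb_def
      by (rule finsum_lessThan_Suc[OF abelian_monoid_axioms])
        (use b Suc.prems in \<open>auto simp: fiber_smult fiber_carrier kvec_closed\<close>)
    also have "\<dots> = cls (\<lambda>j. lc m c e j + c m * e m j)"
      using b Suc by (simp add: fiber_smult fiber_add kvec_closed kvec_lc)
    also have "\<dots> = cls (lc (Suc m) c e)" by (simp add: lc_def)
    finally show ?case .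
  qed
  then show ?thesis by simp
qed

lemma fiber_vectors:
  assumes "\<And>i. i < n \<Longrightarrow> b i \<in> carrier (fiber F)"
  obtains e where "\<And>i. i < n \<Longrightarrow> e i \<in> kvec r" "\<And>i. i < n \<Longrightarrow> b i = cls (e i)"
proof -
  have "\<forall>i. \<exists>v. i < n \<longrightarrow> v \<in> kvec r \<and> b i = cls v" using assms unfolding fiber_carrier by blast
  from choice[OF this] obtain e where e: "\<forall>i. i < n \<longrightarrow> e i \<in> kvec r \<and> b i = cls (e i)" by (elim exE)
  show ?thesis by (rule that[of e]) (use e in simp_all)
qed

lemma is_basis_iff:
  assumes b: "\<And>i. i < n \<Longrightarrow> e i \<in> kvec r" "\<And>i. i < n \<Longrightarrow> b i = cls (e i)"
  shows "is_basis (fiber F) n b \<longleftrightarrow> kbasis r n e"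
proof -
  have lcr: "lc n (restrict c {..<n}) e = lc n c e" for c by (rule lc_cong) auto
  have eq: "cls v = lin_comb (fiber F) n c b \<longleftrightarrow> v = lc n c e" if "v \<in> kvec r" for v c
  proof -
    have "lin_comb (fiber F) n c b = cls (lc n c e)" by (rule fiber_lin_comb) (use b in auto)
    then show ?thesis using cls_inj[OF that, of "lc n c e"] by auto
  qed
  have "is_basis (fiber F) n b \<longleftrightarrow> (\<forall>v\<in>kvec r. \<exists>!c. c \<in> extensional {..<n} \<and> v = lc n c e)"
    unfolding is_basis_def fiber_carrier using b eq by simp
  also have "\<dots> \<longleftrightarrow> kbasis r n e"
  proof
    assume ex1: "\<forall>v\<in>kvec r. \<exists>!c. c \<in> extensional {..<n} \<and> v = lc n c e"
    show "kbasis r n e" unfolding kbasis_def lc_free_def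
    proof (intro conjI allI impI ballI)
      fix a i assume a: "lc n a e = (\<lambda>_. 0)" and i: "i < n"
      have "\<exists>!c. c \<in> extensional {..<n} \<and> (\<lambda>_. 0) = lc n c e" using ex1 kvec_closed(3) by blast
      moreover have "restrict a {..<n} \<in> extensional {..<n} \<and> (\<lambda>_. 0) = lc n (restrict a {..<n}) e" by (simp add: lcr a)
      moreover have "restrict (\<lambda>_. 0) {..<n} \<in> extensional {..<n} \<and> (\<lambda>_. 0) = lc n (restrict (\<lambda>_. 0) {..<n}) e"
        by (simp add: lcr lc_zero)
      ultimately have "restrict a {..<n} = restrict (\<lambda>_. 0) {..<n}" by blast
      from fun_cong[OF this, of i] show "a i = 0" using i by simp
    qed (use b ex1 in blast)+
  next
    assume k: "kbasis r n e"
    show "\<forall>v\<in>kvec r. \<exists>!c. c \<in> extensional {..<n} \<and> v = lc n c e"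
    proof
      fix v :: "nat \<Rightarrow> 'k" assume "v \<in> kvec r"
      then obtain c where c: "v = lc n c e" using k unfolding kbasis_def by blast
      show "\<exists>!c. c \<in> extensional {..<n} \<and> v = lc n c e"
      proof (rule ex1I[of _ "restrict c {..<n}"])
        show "restrict c {..<n} \<in> extensional {..<n} \<and> v = lc n (restrict c {..<n}) e" by (simp add: lcr c)
        fix d assume d: "d \<in> extensional {..<n} \<and> v = lc n d e"
        have "d i = c i" if "i < n" for i using lc_freeD[of n e d c i] k c d that by (auto simp: kbasis_def)
        then show "d = restrict c {..<n}" using d by (intro extensionalityI[of d "{..<n}"]) auto
      qed
    qed
  qed
  finally show ?thesis .
qed

text \<open>Invariance leaves only the exponent 0, so the coordinates are constants and are
  determined by their augmentations.\<close>

lemma invariant_section_cls: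
  assumes v: "v \<in> kvec r"
  shows "invariant_section F (cls v) = csec v"
  unfolding invariant_section_def Let_def
proof (rule the_equality)
  note c = csec_closed[OF v]
  show "csec v \<in> carrier HT \<and> (\<forall>u. coaction F {0} (csec v) u = (if u = 0 then csec v else \<zero>\<^bsub>HT\<^esub>)) \<and>
      value_at_identity F (csec v) = cls v"
  proof (intro conjI allI)
    fix u
    show "coaction F {0} (csec v) u = (if u = 0 then csec v else \<zero>\<^bsub>HT\<^esub>)"
      by (rule crd_inj[OF s0 co_closed[OF s0 c]])
        (use c H_zero_closed[OF o0] in \<open>auto simp: crd_coaction[OF s0] crd_csec[OF v] crd_zero[OF s0] lookup_single when_def\<close>)
  qed (use c in \<open>simp_all add: value_at_identity_eq val0_csec v\<close>)
  fix t
  assume t: "t \<in> carrier HT \<and> (\<forall>u. coaction F {0} t u = (if u = 0 then t else \<zero>\<^bsub>HT\<^esub>)) \<and> value_at_identity F t = cls v"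
  then have tc: "t \<in> carrier HT" and "coaction F {0} t 0 = t" and vt: "cls (val0 t) = cls v"
    using value_at_identity_eq[of t] by auto
  then have "crd {0} t = (\<lambda>j. mterm 0 (coef (crd {0} t j) 0))" using crd_coaction[OF s0 tc, of 0] by simp
  then have 1: "crd {0} t j = mterm 0 (coef (crd {0} t j) 0)" for j by (rule fun_cong)
  have "val0 t = v" using cls_inj[OF val0_kvec[OF tc]] vt by blast
  then have "coef (crd {0} t j) 0 = v j" for j
    using arg_cong[OF 1[of j], of aug] by (auto simp: val0_def)
  then have "crd {0} t = crd {0} (csec v)" unfolding crd_csec[OF v] using 1 by auto
  then show "t = csec v" by (rule crd_inj[OF s0 tc c])
qed

lemma tensor_section_cls:
  assumes v: "v \<in> kvec r"
  shows "tensor_section F f (cls v) \<in> carrier HT"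
    and "crd {0} (tensor_section F f (cls v)) = (\<lambda>j. f * mterm 0 (v j))"
  unfolding tensor_section_def invariant_section_cls[OF v]
  using crd_smult[OF s0 csec_closed[OF v] R0, of f] by (simp_all add: crd_csec[OF v])

text \<open>Both modules consist of sections over the torus, where \<open>crd {0}\<close> is
  injective, so they may be compared through their images.\<close>

lemma chart_frame_iff:
  assumes s: "\<sigma> \<in> \<Sigma>" and b: "\<And>i. i < n \<Longrightarrow> e i \<in> kvec r" "\<And>i. i < n \<Longrightarrow> b i = cls (e i)"
  shows "chart_frame F \<sigma> n u b \<longleftrightarrow> kbasis r n e \<and> PS \<sigma> = pspan \<sigma> n u e"
proof -
  interpret abelian_monoid HT by (rule H_abelian_monoid[OF o0])
  have z: "{0} \<subseteq> \<sigma>" using zero_in_cone[OF s] by simp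
  let ?A = "res (chart \<sigma>) (chart {0}) ` carrier (H (chart \<sigma>))"
  let ?t = "\<lambda>f. \<Oplus>\<^bsub>HT\<^esub>i\<in>{..<n}. tensor_section F (f i * mterm (- u i) 1) (b i)"
  let ?B = "{?t f | f. \<forall>i<n. f i \<in> chart_ring \<sigma>}"
  have tc: "tensor_section F (f i * mterm (- u i) 1) (b i) \<in> carrier HT" if "i < n" for f i
    using tensor_section_cls(1)[OF b(1)[OF that]] b(2)[OF that] by simp
  have tcl: "?t f \<in> carrier HT" for f using tc by (intro finsum_closed) auto
  have crt: "crd {0} (?t f) = (\<lambda>j. \<Sum>i<n. f i * mterm (- u i) (e i j))" for f
  proof
    fix j
    have "crd {0} (?t f) j = (\<Sum>i<n. crd {0} (tensor_section F (f i * mterm (- u i) 1) (b i)) j)"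
      by (rule crd_finsum[OF s0]) (auto simp: tc)
    also have "\<dots> = (\<Sum>i<n. f i * mterm (- u i) (e i j))"
      by (rule sum.cong) (auto simp: b tensor_section_cls(2) mult.assoc mult_single)
    finally show "crd {0} (?t f) j = (\<Sum>i<n. f i * mterm (- u i) (e i j))" .
  qed
  have A: "?A \<subseteq> carrier HT" using res_closed[OF zariski_open_chart[OF s] o0 chart_mono[OF s s0 z]] by blast
  have B: "?B \<subseteq> carrier HT" using tcl by blast
  have "crd {0} ` ?A = crd \<sigma> ` carrier (H (chart \<sigma>))"
    unfolding image_image by (rule image_cong) (simp_all add: crd_res[OF s s0 z])
  also have "\<dots> = PS \<sigma>"
  proof
    show "crd \<sigma> ` carrier (H (chart \<sigma>)) \<subseteq> PS \<sigma>" using crd_in_PS[OF s] by (rule image_subsetI)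
    show "PS \<sigma> \<subseteq> crd \<sigma> ` carrier (H (chart \<sigma>))" using crd_surj[OF s] by (metis imageI subsetI)
  qed
  finally have iA: "crd {0} ` ?A = PS \<sigma>" .
  have iB: "crd {0} ` ?B = pspan \<sigma> n u e"
  proof (rule Set.set_eqI)
    fix v
    have "v \<in> crd {0} ` ?B \<longleftrightarrow> (\<exists>f. (\<forall>i<n. f i \<in> chart_ring \<sigma>) \<and> v = crd {0} (?t f))" by blast
    also have "\<dots> \<longleftrightarrow> v \<in> pspan \<sigma> n u e" unfolding crt pspan_def[OF s] by blast
    finally show "v \<in> crd {0} ` ?B \<longleftrightarrow> v \<in> pspan \<sigma> n u e" .
  qed
  have "inj_on (crd {0}) (carrier HT)" by (rule inj_onI) (rule crd_inj[OF s0])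
  then have "?A = ?B \<longleftrightarrow> PS \<sigma> = pspan \<sigma> n u e"
    using inj_on_image_eq_iff[of "crd {0}" "carrier HT" ?A ?B] A B iA iB by simp
  then show ?thesis unfolding chart_frame_def using is_basis_iff[OF b] by simp
qed

end

section \<open>Norms and apartments\<close>

text \<open>Extended real norms are compared by their real lower bounds, which unfold to finitely
  many real inequalities and cover the value \<open>\<infinity>\<close> without a case
  distinction.\<close>

lemma ereal_le_realI:
  assumes "\<And>t::real. ereal t \<le> x \<Longrightarrow> ereal t \<le> y" shows "x \<le> y"
proof (rule ccontr)
  assume "\<not> x \<le> y"
  then have "y < x" by simp
  from ereal_dense2[OF this] obtain t where t: "y < ereal t" "ereal t < x" by blast
  have "ereal t \<le> y" by (rule assms) (use t(2) in simp)
  then show False using t(1) by simp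
qed

lemma ereal_eq_realI:
  assumes "\<And>t::real. ereal t \<le> x \<longleftrightarrow> ereal t \<le> y" shows "x = y"
  by (rule antisym; rule ereal_le_realI; simp only: assms)

context toric_setup
begin

text \<open>The norm at \<open>z\<close> attached to a chart frame, on coefficient vectors. The
  infimum over the empty set provides the value \<open>\<infinity>\<close> at the zero
  vector.\<close>

definition fnorm :: "nat \<Rightarrow> (nat \<Rightarrow> int ^ 'n) \<Rightarrow> (real ^ 'n) \<times> real \<Rightarrow> (nat \<Rightarrow> 'k) \<Rightarrow> ereal" where
  "fnorm n u z c = (INF i\<in>{i. i < n \<and> c i \<noteq> 0}. ereal (functional (u i) (vl (c i)) z))"

lemma le_fnorm_iff: "ereal t \<le> fnorm n u z c \<longleftrightarrow> (\<forall>i<n. c i \<noteq> 0 \<longrightarrow> t \<le> functional (u i) (vl (c i)) z)"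
  unfolding fnorm_def by (auto simp: le_INF_iff)

lemma fnorm_eq: "(INF i\<in>{i. i < n \<and> c i \<noteq> 0}. ereal m * val (c i) + ereal (pairing (u i) x)) = fnorm n u (x, m) c"
  unfolding fnorm_def by (rule INF_cong) (auto simp: val_vl functional_def algebra_simps)

lemma fnorm_cong: "(\<And>i. i < n \<Longrightarrow> c i = d i) \<Longrightarrow> fnorm n u z c = fnorm n u z d"
  by (rule ereal_eq_realI) (simp add: le_fnorm_iff)

definition bounded_below :: "(real ^ 'n) \<times> real \<Rightarrow> real \<Rightarrow> int ^ 'n \<Rightarrow> 'k \<Rightarrow> bool" where
  "bounded_below z t u a \<longleftrightarrow> a = 0 \<or> t \<le> functional u (vl a) z"

lemma bounded_below_add:
  assumes z: "0 \<le> snd z" and ab: "bounded_below z t u a" "bounded_below z t u b"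
  shows "bounded_below z t u (a + b)"
proof (cases "a = 0 \<or> b = 0 \<or> a + b = 0")
  case True
  then show ?thesis using ab by (auto simp: bounded_below_def)
next
  case False
  then have "min (vl a) (vl b) \<le> vl (a + b)" using vl_add by blast
  then have "vl a \<le> vl (a + b) \<or> vl b \<le> vl (a + b)" by linarith
  then have "functional u (vl a) z \<le> functional u (vl (a + b)) z \<or> functional u (vl b) z \<le> functional u (vl (a + b)) z"
    using functional_mono[OF _ z] by blast
  then show ?thesis using ab False by (auto simp: bounded_below_def)
qed

lemma bounded_below_sum:
  assumes z: "0 \<le> snd z" and "\<And>i. i \<in> A \<Longrightarrow> bounded_below z t u (f i)"
  shows "bounded_below z t u (sum f A)"
  using assms(2) by (induction A rule: infinite_finite_induct) (simp_all add: bounded_below_add z, simp_all add: bounded_below_def)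

text \<open>At the point \<open>(0, 1)\<close> the functional of weight 0 is the bare valuation, so
  this is an instance of \<open>bounded_below_sum\<close>.\<close>

lemma vl_sum_ge:
  assumes "\<And>i. i \<in> A \<Longrightarrow> f i = 0 \<or> k \<le> vl (f i)" shows "sum f A = 0 \<or> k \<le> vl (sum f A)"
  using bounded_below_sum[of "(0, 1)" A "of_int k" 0 f] assms by (simp add: bounded_below_def functional_def)

lemma functional_add_vl:
  "a \<noteq> 0 \<Longrightarrow> b \<noteq> 0 \<Longrightarrow> functional u (vl (a * b)) z = functional u (vl b) z + of_int (vl a) * snd z"
  by (simp add: functional_def vl_mult algebra_simps)

lemma functional_add_weight: "functional (w + u) k z = pairing w (fst z) + functional u k z"
  by (simp add: functional_def pairing_add_left)

lemma fnorm_smult: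
  assumes "a \<noteq> 0"
  shows "fnorm n u z (\<lambda>i. a * c i) = ereal (of_int (vl a) * snd z) + fnorm n u z c"
proof (rule ereal_eq_realI)
  fix t
  have "ereal t \<le> ereal (of_int (vl a) * snd z) + fnorm n u z c \<longleftrightarrow> ereal (t - of_int (vl a) * snd z) \<le> fnorm n u z c"
    by (cases "fnorm n u z c") auto
  then show "ereal t \<le> fnorm n u z (\<lambda>i. a * c i) \<longleftrightarrow> ereal t \<le> ereal (of_int (vl a) * snd z) + fnorm n u z c"
    using assms by (simp add: le_fnorm_iff functional_add_vl diff_le_eq)
qed

lemma fnorm_add:
  assumes z: "0 \<le> snd z"
  shows "min (fnorm n u z c) (fnorm n u z d) \<le> fnorm n u z (\<lambda>i. c i + d i)"
proof (rule ereal_le_realI)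
  fix t assume "ereal t \<le> min (fnorm n u z c) (fnorm n u z d)"
  then have "bounded_below z t (u i) (c i)" "bounded_below z t (u i) (d i)" if "i < n" for i
    using that by (auto simp: le_fnorm_iff bounded_below_def)
  then have "bounded_below z t (u i) (c i + d i)" if "i < n" for i
    using that bounded_below_add[OF z] by blast
  then show "ereal t \<le> fnorm n u z (\<lambda>i. c i + d i)" by (auto simp: le_fnorm_iff bounded_below_def)
qed

lemma fnorm_finite:
  "fnorm n u z c \<noteq> - \<infinity>" "fnorm n u z c = \<infinity> \<longleftrightarrow> (\<forall>i<n. c i = 0)"
proof -
  let ?t = "Min (insert 0 ((\<lambda>i. functional (u i) (vl (c i)) z) ` {..<n}))"
  have "ereal ?t \<le> fnorm n u z c"
    unfolding le_fnorm_iff by (auto intro: Min_le)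
  then show "fnorm n u z c \<noteq> - \<infinity>" by auto
  show "fnorm n u z c = \<infinity> \<longleftrightarrow> (\<forall>i<n. c i = 0)"
  proof
    assume inf: "fnorm n u z c = \<infinity>"
    show "\<forall>i<n. c i = 0"
    proof (intro allI impI, rule ccontr)
      fix i assume "i < n" "c i \<noteq> 0"
      moreover have "ereal (functional (u i) (vl (c i)) z + 1) \<le> fnorm n u z c" using inf by simp
      ultimately show False unfolding le_fnorm_iff by force
    qed
  next
    assume "\<forall>i<n. c i = 0"
    then have "\<And>t. ereal t \<le> fnorm n u z c" by (simp add: le_fnorm_iff)
    then show "fnorm n u z c = \<infinity>" by (meson ereal_top)
  qed
qed

lemma fnorm_unit:
  "j < n \<Longrightarrow> fnorm n u z (\<lambda>i. if i = j then a else 0) = (if a = 0 then \<infinity> else ereal (functional (u j) (vl a) z))"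
  by (rule ereal_eq_realI) (auto simp: le_fnorm_iff)

end

context torus_framed_bundle
begin

text \<open>The coordinate form of \<open>chart_frame\<close>, to which
  \<open>chart_frame_frame_at\<close> relates it.\<close>

definition frame_at :: "'n cone \<Rightarrow> nat \<Rightarrow> (nat \<Rightarrow> int ^ 'n) \<Rightarrow> (nat \<Rightarrow> nat \<Rightarrow> 'k) \<Rightarrow> bool" where
  "frame_at \<sigma> n u e \<longleftrightarrow> kbasis r n e \<and> PS \<sigma> = pspan \<sigma> n u e"

lemma kbasis_kvec: "kbasis r n e \<Longrightarrow> i < n \<Longrightarrow> e i \<in> kvec r"
  and kbasis_free: "kbasis r n e \<Longrightarrow> lc_free n e"
  and kbasis_ex: "kbasis r n e \<Longrightarrow> v \<in> kvec r \<Longrightarrow> \<exists>c. v = lc n c e"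
  by (auto simp: kbasis_def)

lemma kbasis_eqD: "kbasis r n e \<Longrightarrow> lc n a e = lc n b e \<Longrightarrow> i < n \<Longrightarrow> a i = b i"
  by (rule lc_freeD[OF kbasis_free])

context
  fixes \<sigma> assumes s: "\<sigma> \<in> \<Sigma>"
begin

lemma PS_add: "v \<in> PS \<sigma> \<Longrightarrow> w \<in> PS \<sigma> \<Longrightarrow> (\<lambda>j. v j + w j) \<in> PS \<sigma>"
  using Gam_add[OF s, of "ofl v" "ofl w"] by (simp add: PS_def ofl_def)

lemma PS_smult: "f \<in> chart_ring \<sigma> \<Longrightarrow> v \<in> PS \<sigma> \<Longrightarrow> (\<lambda>j. f * v j) \<in> PS \<sigma>"
  using Gam_smult[OF s, of f "ofl v"] by (simp add: PS_def ofl_def)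

lemma PS_zero: "(\<lambda>_. 0) \<in> PS \<sigma>"
  using Gam_zero[OF s] by (simp add: PS_def ofl_def)

lemma PS_sum: "(\<And>i. i \<in> A \<Longrightarrow> v i \<in> PS \<sigma>) \<Longrightarrow> (\<lambda>j. \<Sum>i\<in>A. v i j) \<in> PS \<sigma>"
  by (induction A rule: infinite_finite_induct) (auto simp: PS_zero PS_add)

lemma pspan_subset_PS:
  assumes "\<And>i. i < n \<Longrightarrow> (\<lambda>j. mterm (- u i) (e i j)) \<in> PS \<sigma>"
  shows "pspan \<sigma> n u e \<subseteq> PS \<sigma>"
  unfolding pspan_def[OF s] by (auto intro!: PS_sum PS_smult assms)

lemma frame_generator:
  assumes "frame_at \<sigma> n u e" "i < n" shows "(\<lambda>j. mterm (- u i) (e i j)) \<in> PS \<sigma>"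
proof -
  have R: "subring_of (chart_ring \<sigma>)" by (rule subring_chart_ring[OF s])
  have "(\<lambda>j. mterm (- u i) (e i j)) = (\<lambda>j. \<Sum>k<n. (if k = i then 1 else 0) * mterm (- u k) (e k j))"
    using assms(2) by (simp add: if_distrib[of "\<lambda>x. x * _"] cong: if_cong)
  moreover have "\<forall>k<n. (if k = i then 1 else 0) \<in> chart_ring \<sigma>"
    using one_in_chart_ring[OF s] subring_zero[OF R] by simp
  ultimately have "(\<lambda>j. mterm (- u i) (e i j)) \<in> pspan \<sigma> n u e"
    unfolding pspan_def[OF s] by (intro CollectI exI[of _ "\<lambda>k. if k = i then 1 else 0"] conjI)
  then show ?thesis using assms(1) by (simp add: frame_at_def)
qed

text \<open>Comparison of the coefficients at the exponent \<open>w\<close>. The right-hand side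
  consists of inequalities between functionals on the cone, which is what ties the module to the
  norms.\<close>

lemma frame_mterm_iff:
  assumes f: "frame_at \<sigma> n u e"
  shows "(\<lambda>j. mterm w (lc n c e j)) \<in> PS \<sigma> \<longleftrightarrow> (\<forall>i<n. monomial_ok \<sigma> (w + u i) (c i))"
proof
  have k: "kbasis r n e" and P: "PS \<sigma> = pspan \<sigma> n u e" using f by (auto simp: frame_at_def)
  assume "(\<lambda>j. mterm w (lc n c e j)) \<in> PS \<sigma>"
  then obtain g where g: "(\<lambda>j. mterm w (lc n c e j)) = (\<lambda>j. \<Sum>i<n. g i * mterm (- u i) (e i j))" "\<forall>i<n. g i \<in> chart_ring \<sigma>"
    unfolding P pspan_def[OF s] by blast
  have "lc n c e j = (\<Sum>i<n. coef (g i) (w + u i) * e i j)" for j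
    using arg_cong[OF fun_cong[OF g(1), of j], of "\<lambda>x. coef x w"]
    by (simp add: mult.commute[of "g _"] coef_mterm_mult lookup_sum) (simp add: mult.commute)
  then have "lc n c e = lc n (\<lambda>i. coef (g i) (w + u i)) e" by (simp add: lc_def fun_eq_iff)
  then have "c i = coef (g i) (w + u i)" if "i < n" for i using kbasis_eqD[OF k _ that] by blast
  then show "\<forall>i<n. monomial_ok \<sigma> (w + u i) (c i)" using g(2) unfolding chart_ring_iff[OF s] by simp
next
  assume ok: "\<forall>i<n. monomial_ok \<sigma> (w + u i) (c i)"
  have "(\<lambda>j. mterm w (lc n c e j)) = (\<lambda>j. \<Sum>i<n. mterm (w + u i) (c i) * mterm (- u i) (e i j))"
    by (simp add: lc_def mterm_sum mult_single)
  also have "\<dots> \<in> PS \<sigma>"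
    by (rule PS_sum, rule PS_smult) (use ok frame_generator[OF f] mterm_in_chart_ring in auto)
  finally show "(\<lambda>j. mterm w (lc n c e j)) \<in> PS \<sigma>" .
qed

text \<open>A graded submodule is determined by its homogeneous elements, so it is enough to know
  which monomial multiples of constant vectors it contains.\<close>

lemma frame_atI:
  assumes k: "kbasis r n e"
    and iff: "\<And>w c. (\<lambda>j. mterm w (lc n c e j)) \<in> PS \<sigma> \<longleftrightarrow> (\<forall>i<n. monomial_ok \<sigma> (w + u i) (c i))"
  shows "frame_at \<sigma> n u e"
  unfolding frame_at_def
proof (intro conjI k equalityI)
  show "pspan \<sigma> n u e \<subseteq> PS \<sigma>"
  proof (rule pspan_subset_PS)
    fix i assume i: "i < n"
    have "\<forall>k<n. monomial_ok \<sigma> (- u i + u k) (if k = i then 1 else 0)" by (simp add: monomial_ok_def)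
    then show "(\<lambda>j. mterm (- u i) (e i j)) \<in> PS \<sigma>"
      using iff[of "- u i" "\<lambda>k. if k = i then 1 else 0"] lc_unit[OF i, of e] by simp
  qed
  show "PS \<sigma> \<subseteq> pspan \<sigma> n u e"
  proof
    fix v assume v: "v \<in> PS \<sigma>"
    then have vk: "v \<in> kvec r" using PS_kvec[OF s] by blast
    have "\<exists>c. (\<lambda>j. coef (v j) w) = lc n c e" for w
      using vk by (intro kbasis_ex[OF k]) (simp add: kvec_def)
    then obtain c where c: "\<And>w. (\<lambda>j. coef (v j) w) = lc n (c w) e" by metis
    have ok: "monomial_ok \<sigma> (w + u i) (c w i)" if "i < n" for w i
      using iff[of w "c w"] PS_term[OF s v, of w] c[of w] that by (simp add: fun_eq_iff)
    \<comment> \<open>A finite set of exponents that serves all coordinates of \<open>v\<close> at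
      once, so that the two sums can be interchanged.\<close>
    define A where "A = (\<Union>j<r. supp (v j))"
    have A: "finite A" "\<And>j. supp (v j) \<subseteq> A"
    proof -
      show "finite A" by (simp add: A_def)
      show "supp (v j) \<subseteq> A" for j using vk by (cases "j < r") (auto simp: A_def kvec_def)
    qed
    have vs: "v j = (\<Sum>w\<in>A. mterm w (coef (v j) w))" for j
    proof -
      have "(\<Sum>w\<in>A. mterm w (coef (v j) w)) = (\<Sum>w\<in>supp (v j). mterm w (coef (v j) w))"
        by (rule sum.mono_neutral_right) (use A in \<open>auto simp: in_keys_iff\<close>)
      then show ?thesis by (simp add: sum_mterms)
    qed
    define g where "g i = (\<Sum>w\<in>A. mterm (w + u i) (c w i))" for i
    have "v j = (\<Sum>i<n. g i * mterm (- u i) (e i j))" for j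
    proof -
      have "v j = (\<Sum>w\<in>A. \<Sum>i<n. mterm (w + u i) (c w i) * mterm (- u i) (e i j))"
        by (subst vs) (simp add: fun_cong[OF c] lc_def mterm_sum mult_single)
      also have "\<dots> = (\<Sum>i<n. \<Sum>w\<in>A. mterm (w + u i) (c w i) * mterm (- u i) (e i j))" by (rule sum.swap)
      finally show ?thesis by (simp add: g_def sum_distrib_right)
    qed
    moreover have "\<forall>i<n. g i \<in> chart_ring \<sigma>"
      unfolding g_def using ok by (intro allI impI subring_sum[OF subring_chart_ring[OF s]] mterm_in_chart_ring) auto
    ultimately show "v \<in> pspan \<sigma> n u e" unfolding pspan_def[OF s] by (intro CollectI exI[of _ g] conjI ext)
  qed
qed

text \<open>The generators of the second frame lie in the module spanned by the first, so their
  coefficients \<open>a\<close> satisfy the inequalities of the chart ring. Hence each product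
  \<open>c' j * a j i\<close> keeps the lower bound of \<open>c' j\<close>, and so do the sums of
  such products.\<close>

lemma frame_norm_le:
  assumes f: "frame_at \<sigma> n u e" "frame_at \<sigma> n' u' e'" and z: "z \<in> \<sigma>" and eq: "lc n c e = lc n' c' e'"
  shows "fnorm n' u' z c' \<le> fnorm n u z c"
proof (rule ereal_le_realI)
  have k: "kbasis r n e" "kbasis r n' e'" using f by (auto simp: frame_at_def)
  fix t assume "ereal t \<le> fnorm n' u' z c'"
  then have t: "t \<le> functional (u' j) (vl (c' j)) z" if "j < n'" "c' j \<noteq> 0" for j using that by (simp add: le_fnorm_iff)
  have "\<exists>a. e' j = lc n a e" if "j < n'" for j using kbasis_ex[OF k(1) kbasis_kvec[OF k(2) that]] .
  then obtain a where a: "\<And>j. j < n' \<Longrightarrow> e' j = lc n (a j) e" by metis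
  have ok: "monomial_ok \<sigma> (- u' j + u i) (a j i)" if "j < n'" "i < n" for i j
    using frame_generator[OF f(2) that(1)] frame_mterm_iff[OF f(1), of "- u' j" "a j"] a[OF that(1)] that(2) by simp
  have "lc n c e = lc n' c' (\<lambda>j. lc n (a j) e)" unfolding eq by (rule lc_cong) (auto simp: a)
  then have "lc n c e = lc n (\<lambda>i. \<Sum>j<n'. c' j * a j i) e" unfolding lc_lc .
  then have ci: "c i = (\<Sum>j<n'. c' j * a j i)" if "i < n" for i using kbasis_eqD[OF k(1) _ that] by blast
  have "bounded_below z t (u i) (c' j * a j i)" if "i < n" "j < n'" for i j
  proof (cases "c' j * a j i = 0")
    case False
    have "0 \<le> functional (- u' j + u i) (vl (a j i)) z"
      using ok[OF that(2,1)] False z by (auto simp: monomial_ok_def)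
    then have "pairing (u' j) (fst z) \<le> functional (u i) (vl (a j i)) z"
      using functional_add_weight[of "- u' j" "u i" "vl (a j i)" z] by (simp add: pairing_uminus_left)
    moreover have "t \<le> pairing (u' j) (fst z) + of_int (vl (c' j)) * snd z"
      using t[OF that(2)] False by (simp add: functional_def)
    ultimately show ?thesis using False by (simp add: bounded_below_def functional_add_vl)
  qed (simp add: bounded_below_def)
  then have "bounded_below z t (u i) (c i)" if "i < n" for i
    unfolding ci[OF that] using that by (intro bounded_below_sum cone_half_space[OF s z]) auto
  then show "ereal t \<le> fnorm n u z c" by (auto simp: le_fnorm_iff bounded_below_def)
qed

lemma frame_norm_unique:
  assumes "frame_at \<sigma> n u e" "frame_at \<sigma> n' u' e'" "z \<in> \<sigma>" "lc n c e = lc n' c' e'"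
  shows "fnorm n u z c = fnorm n' u' z c'"
  using frame_norm_le[OF assms] frame_norm_le[OF assms(2,1,3) assms(4)[symmetric]] by simp

end

text \<open>A power of the monomial of the face carries a section over the face to one over
  \<open>\<sigma>\<close>. That one is expanded in the frame, and the power, a unit on the face, is
  divided out again.\<close>

lemma frame_face:
  assumes s: "\<sigma> \<in> \<Sigma>" "\<tau> \<in> \<Sigma>" "\<tau> \<subseteq> \<sigma>" and f: "frame_at \<sigma> n u e"
  shows "frame_at \<tau> n u e"
  unfolding frame_at_def
proof (intro conjI equalityI)
  show "kbasis r n e" using f by (simp add: frame_at_def)
  show "pspan \<tau> n u e \<subseteq> PS \<tau>"
    using frame_generator[OF s(1) f] PS_mono[OF s] by (intro pspan_subset_PS[OF s(2)]) blast
  show "PS \<tau> \<subseteq> pspan \<tau> n u e"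
  proof
    fix v assume v: "v \<in> PS \<tau>"
    obtain w a where c: "cuts_face \<sigma> w a \<tau>" using ex_cuts_face[OF s] by blast
    obtain k where "(\<lambda>j. mterm w a ^ k * v j) \<in> PS \<sigma>" using PS_face[OF s(1,2) c v] by blast
    then obtain g where g: "(\<lambda>j. mterm w a ^ k * v j) = (\<lambda>j. \<Sum>i<n. g i * mterm (- u i) (e i j))" "\<forall>i<n. g i \<in> chart_ring \<sigma>"
      using f unfolding frame_at_def pspan_def[OF s(1)] by blast
    let ?m = "mterm (- w) (inverse a)"
    have a: "a \<noteq> 0" using c by (simp add: cuts_face_def)
    have mk: "?m ^ k * mterm w a ^ k = 1"
      unfolding power_mult_distrib[symmetric] using mterm_inverse[OF a, of w] by (simp add: mult.commute)
    have "v j = (\<Sum>i<n. (?m ^ k * g i) * mterm (- u i) (e i j))" for j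
    proof -
      have "v j = ?m ^ k * (mterm w a ^ k * v j)" by (simp add: mult.assoc[symmetric] mk)
      also have "\<dots> = (\<Sum>i<n. (?m ^ k * g i) * mterm (- u i) (e i j))"
        unfolding fun_cong[OF g(1), of j] by (simp add: sum_distrib_left mult.assoc)
      finally show ?thesis .
    qed
    moreover have "\<forall>i<n. ?m ^ k * g i \<in> chart_ring \<tau>"
      using g(2) cuts_face_ring_subset[OF s(1,2) c] chart_ring_power[OF s(2) cuts_face_inverse[OF c]]
      by (auto intro: chart_ring.mult)
    ultimately show "v \<in> pspan \<tau> n u e"
      unfolding pspan_def[OF s(2)] by (intro CollectI exI[of _ "\<lambda>i. ?m ^ k * g i"] conjI ext)
  qed
qed

lemma ex_frame_at: "\<sigma> \<in> \<Sigma> \<Longrightarrow> \<exists>u e. frame_at \<sigma> r u e"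
  using PS_frame by (simp add: frame_at_def)

lemma chart_frame_frame_at:
  assumes "\<sigma> \<in> \<Sigma>" "\<And>i. i < n \<Longrightarrow> e i \<in> kvec r" "\<And>i. i < n \<Longrightarrow> b i = cls (e i)"
  shows "chart_frame F \<sigma> n u b \<longleftrightarrow> frame_at \<sigma> n u e"
  unfolding frame_at_def by (rule chart_frame_iff) (use assms in auto)

section \<open>Well-definedness of the norms\<close>

abbreviation Phi_at :: "(real ^ 'n) \<times> real \<Rightarrow> 'e set \<Rightarrow> ereal" where
  "Phi_at z \<equiv> Phi_norm F (fst z) (snd z)"

text \<open>The definite description in \<open>Phi_norm\<close> ranges over all cones through
  \<open>z\<close> and all frames of their charts; it has to be shown that they give one and the
  same norm.\<close>

theorem Phi_at_frame:
  assumes s: "\<sigma> \<in> \<Sigma>" and z: "z \<in> \<sigma>" and f: "frame_at \<sigma> n u e"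
  shows "Phi_at z \<in> additive_norms val (fiber F) (snd z)"
    and "Phi_at z (cls (lc n c e)) = fnorm n u z c"
proof -
  have k: "kbasis r n e" using f by (simp add: frame_at_def)
  obtain x m where zz: "z = (x, m)" by force
  have m: "0 \<le> m" using cone_half_space[OF s z] zz by simp
  define co where "co w = (SOME c. w = lc n c e)" for w
  have co: "w = lc n (co w) e" if "w \<in> kvec r" for w
    using someI_ex[OF kbasis_ex[OF k that]] unfolding co_def .
  have lck: "lc n c e \<in> kvec r" for c by (rule kvec_lc[OF kbasis_kvec[OF k]])
  have co_lc: "co (lc n c e) i = c i" if "i < n" for c i
    using kbasis_eqD[OF k _ that, of "co (lc n c e)" c] co[OF lck[of c]] by simp
  \<comment> \<open>The norm of the given frame, moved to cosets by way of their coordinate vectors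
    and cut off outside the fiber, as \<open>additive_norms\<close> consists of extensional
    functions.\<close>
  define v0 where "v0 = (\<lambda>y\<in>carrier (fiber F). fnorm n u z (co (THE w. w \<in> kvec r \<and> cls w = y)))"
  have the: "(THE w'. w' \<in> kvec r \<and> cls w' = cls w) = w" if "w \<in> kvec r" for w
    using that cls_inj by (intro the_equality) auto
  have v0: "v0 (cls w) = fnorm n u z (co w)" if "w \<in> kvec r" for w
    unfolding v0_def using that by (simp add: the fiber_carrier)
  have v0c: "v0 (cls (lc n c e)) = fnorm n u z c" for c
    unfolding v0[OF lck] by (rule fnorm_cong) (rule co_lc)
  have v0n: "v0 \<in> additive_norms val (fiber F) m"
    unfolding additive_norms_def fiber_carrier
  proof (intro CollectI conjI ballI allI impI)
    show "v0 \<in> extensional (cls ` kvec r)" unfolding v0_def fiber_carrier by simp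
    fix y assume "y \<in> cls ` kvec r"
    then obtain w where "w \<in> kvec r" "y = cls w" by blast
    then obtain c where c: "y = cls (lc n c e)" using co by metis
    show "v0 y \<noteq> - \<infinity>" unfolding c v0c by (rule fnorm_finite)
    have "y = \<zero>\<^bsub>fiber F\<^esub> \<longleftrightarrow> lc n c e = lc n (\<lambda>_. 0) e"
      unfolding c fiber_zero lc_zero using cls_inj[OF lck, of c "\<lambda>_. 0"] by auto
    also have "\<dots> \<longleftrightarrow> (\<forall>i<n. c i = 0)"
      using kbasis_eqD[OF k, of c "\<lambda>_. 0"] by (auto intro: lc_cong)
    finally show "v0 y = \<infinity> \<longleftrightarrow> y = \<zero>\<^bsub>fiber F\<^esub>" unfolding c v0c fnorm_finite(2) by simp
    show "v0 (a \<odot>\<^bsub>fiber F\<^esub> y) = ereal m * val a + v0 y" if a: "a \<noteq> 0" for a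
    proof -
      have "a \<odot>\<^bsub>fiber F\<^esub> y = cls (lc n (\<lambda>i. a * c i) e)" unfolding c fiber_smult[OF lck] lc_smult ..
      then show ?thesis unfolding c using v0c a by (simp add: fnorm_smult val_vl zz mult.commute)
    qed
    fix y' assume "y' \<in> cls ` kvec r"
    then obtain w where "w \<in> kvec r" "y' = cls w" by blast
    then obtain d where d: "y' = cls (lc n d e)" using co by metis
    have "y \<oplus>\<^bsub>fiber F\<^esub> y' = cls (lc n (\<lambda>i. c i + d i) e)" unfolding c d fiber_add[OF lck lck] lc_add ..
    then show "min (v0 y) (v0 y') \<le> v0 (y \<oplus>\<^bsub>fiber F\<^esub> y')"
      unfolding c d using v0c fnorm_add[of z n u c d] m zz by simp
  qed
  let ?P = "\<lambda>v. v \<in> additive_norms val (fiber F) m \<and>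
     (\<exists>\<sigma>\<in>\<Sigma>. (x, m) \<in> \<sigma> \<and> (\<exists>r u b. chart_frame F \<sigma> r u b \<and>
        (\<forall>c. v (lin_comb (fiber F) r c b) =
           (INF i\<in>{i. i < r \<and> c i \<noteq> 0}. ereal m * val (c i) + ereal (pairing (u i) x)))))"
  have "Phi_norm F x m = v0"
    unfolding Phi_norm_def
  proof (rule the_equality)
    let ?b = "\<lambda>i. cls (e i)"
    have "chart_frame F \<sigma> n u ?b" using chart_frame_frame_at[OF s kbasis_kvec[OF k], where b = ?b] f by simp
    moreover have "v0 (lin_comb (fiber F) n c ?b) = fnorm n u (x, m) c" for c
      using fiber_lin_comb[OF kbasis_kvec[OF k], where b = ?b and c = c] v0c zz by simp
    ultimately show "?P v0" unfolding fnorm_eq using v0n s z zz by blast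
    fix v assume v: "?P v"
    then obtain \<tau> n' u' b where t: "\<tau> \<in> \<Sigma>" "z \<in> \<tau>" "chart_frame F \<tau> n' u' b"
      and vb: "\<And>c. v (lin_comb (fiber F) n' c b) = fnorm n' u' z c"
      unfolding fnorm_eq zz by blast
    have "b i \<in> carrier (fiber F)" if "i < n'" for i using t(3) that by (auto simp: chart_frame_def is_basis_def)
    then obtain e' where e': "\<And>i. i < n' \<Longrightarrow> e' i \<in> kvec r" "\<And>i. i < n' \<Longrightarrow> b i = cls (e' i)"
      using fiber_vectors by blast
    have f': "frame_at \<tau> n' u' e'" using chart_frame_frame_at[of \<tau> n' e' b u'] t e' by blast
    have k': "kbasis r n' e'" using f' by (simp add: frame_at_def)
    have i: "\<sigma> \<inter> \<tau> \<in> \<Sigma>" "z \<in> \<sigma> \<inter> \<tau>" using cone_Int_in_Sigma s t z by auto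
    \<comment> \<open>Both frames remain frames on the chart of the intersection, which is a cone of
      the fan that contains \<open>z\<close>; there \<open>frame_norm_unique\<close> compares
      them.\<close>
    have fi: "frame_at (\<sigma> \<inter> \<tau>) n u e" "frame_at (\<sigma> \<inter> \<tau>) n' u' e'"
      using frame_face[OF s i(1) _ f] frame_face[OF t(1) i(1) _ f'] by auto
    show "v = v0"
    proof (rule extensionalityI[of _ "carrier (fiber F)"])
      show "v \<in> extensional (carrier (fiber F))" "v0 \<in> extensional (carrier (fiber F))"
        using v v0n by (auto simp: additive_norms_def)
      fix y assume "y \<in> carrier (fiber F)"
      then obtain w where w: "w \<in> kvec r" "y = cls w" unfolding fiber_carrier by blast
      obtain c' where c': "w = lc n' c' e'" using kbasis_ex[OF k' w(1)] by blast
      have "v y = fnorm n' u' z c'"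
        using vb[of c'] fiber_lin_comb[of n' e' b c'] e' w(2) c' by simp
      also have "\<dots> = fnorm n u z (co w)"
        by (rule frame_norm_unique[OF i(1) fi(2,1) i(2)]) (use co[OF w(1)] c' in simp)
      also have "\<dots> = v0 y" using v0[OF w(1)] w(2) by simp
      finally show "v y = v0 y" .
    qed
  qed
  then have "Phi_at z = v0" by (simp add: zz)
  then show "Phi_at z \<in> additive_norms val (fiber F) (snd z)" "Phi_at z (cls (lc n c e)) = fnorm n u z c"
    using v0n v0c zz by auto
qed

end

section \<open>Testing functionals on part of a cone, and complete fans\<close>

context toric_setup
begin

text \<open>Functionals are tested on the part \<open>D\<close> of a cone where the norms are known to lie in an apartment.\<close>

definition determining :: "'n cone \<Rightarrow> 'n cone \<Rightarrow> bool" where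
  "determining D \<sigma> \<longleftrightarrow> D \<subseteq> \<sigma> \<and> (\<forall>u k. (\<forall>z\<in>D. 0 \<le> functional u k z) \<longrightarrow> (\<forall>z\<in>\<sigma>. 0 \<le> functional u k z))"

lemma monomial_ok_determining:
  assumes "determining D \<sigma>"
  shows "monomial_ok \<sigma> u a \<longleftrightarrow> (a \<noteq> 0 \<longrightarrow> (\<forall>z\<in>D. 0 \<le> functional u (vl a) z))"
  using assms unfolding determining_def monomial_ok_def by (meson subsetD)

lemma functional_linear_right:
  "functional u k (z + w) = functional u k z + functional u k w"
  "functional u k (c *\<^sub>R z) = c * functional u k z"
  by (simp_all add: functional_inner inner_add_right)

text \<open>Points of positive height can be scaled to height one. A point of height 0 is the limit
  of the points \<open>z + e z1\<close> of positive height.\<close>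

lemma determining_height_one:
  assumes s: "\<sigma> \<in> \<Sigma>" and z1: "z1 \<in> \<sigma>" "0 < snd z1"
  shows "determining (\<sigma> \<inter> {z. snd z = 1}) \<sigma>"
  unfolding determining_def
proof (intro conjI allI impI ballI)
  fix u k z assume nn: "\<forall>z\<in>\<sigma> \<inter> {z. snd z = 1}. 0 \<le> functional u k z" and z: "z \<in> \<sigma>"
  note cc = cone_convex_cone[OF s]
  have pos: "0 \<le> functional u k y" if y: "y \<in> \<sigma>" "0 < snd y" for y
  proof -
    have "inverse (snd y) *\<^sub>R y \<in> \<sigma>" using convex_cone_scaleR[OF cc _ y(1)] y(2) by simp
    moreover have "snd (inverse (snd y) *\<^sub>R y) = 1" using y(2) by simp
    ultimately have "0 \<le> functional u k (inverse (snd y) *\<^sub>R y)" using nn by blast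
    then show ?thesis using y(2) by (simp add: functional_linear_right zero_le_mult_iff)
  qed
  have "0 \<le> functional u k z + e * functional u k z1" if e: "0 < e" for e
  proof -
    have "z + e *\<^sub>R z1 \<in> \<sigma>" using convex_cone_add[OF cc z] convex_cone_scaleR[OF cc _ z1(1)] e by simp
    moreover have "0 < snd (z + e *\<^sub>R z1)" using cone_half_space[OF s z] e z1(2) by (simp add: add_nonneg_pos)
    ultimately show ?thesis using pos by (simp add: functional_linear_right[symmetric] del: functional_linear_right)
  qed note le = this
  show "0 \<le> functional u k z"
  proof (rule ccontr)
    assume neg: "\<not> 0 \<le> functional u k z"
    show False
    proof (cases "functional u k z1 \<le> 0")
      case True
      then show False using le[of 1] neg by simp
    next
      case False
      \<comment> \<open>With this \<open>e\<close> the value at \<open>z + e z1\<close> is half of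
        the negative value at \<open>z\<close>.\<close>
      define e where "e = - functional u k z / (2 * functional u k z1)"
      have "0 < e" unfolding e_def using neg False by (simp add: field_simps)
      moreover have "e * functional u k z1 = - functional u k z / 2" unfolding e_def using False by simp
      ultimately show False using le[of e] neg by simp
    qed
  qed
qed simp

lemma closed_cone:
  assumes "\<sigma> \<in> \<Sigma>" shows "closed \<sigma>"
proof -
  obtain G where "finite G" "\<sigma> = convex_cone hull G"
    using cone_rational[OF assms] unfolding rational_polyhedral_cone_def by blast
  then show ?thesis using polyhedron_convex_cone_hull polyhedron_imp_closed by blast
qed

text \<open>A relative interior point \<open>z0\<close> of \<open>\<sigma>\<close> is moved slightly
  upwards. A cone that contains the moved point contains \<open>z0\<close> as well, so its
  intersection with \<open>\<sigma>\<close> is a face of \<open>\<sigma>\<close> through a relative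
  interior point, that is, all of \<open>\<sigma>\<close>.\<close>

lemma complete_fan_positive_cone:
  assumes c: "complete_fan \<Sigma>" and s: "\<sigma> \<in> \<Sigma>"
  shows "\<exists>\<tau>\<in>\<Sigma>. \<sigma> \<subseteq> \<tau> \<and> (\<exists>z\<in>\<tau>. 0 < snd z)"
proof -
  obtain z0 where z0: "z0 \<in> \<sigma>"
    "\<forall>u k. (\<forall>z\<in>\<sigma>. 0 \<le> functional u k z) \<and> functional u k z0 = 0 \<longrightarrow> (\<forall>z\<in>\<sigma>. functional u k z = 0)"
    using rational_cone_interior_point[OF cone_rational[OF s]] by (elim bexE)
  \<comment> \<open>The cones that miss \<open>z0\<close> are finitely many closed sets, so a small
    neighbourhood of \<open>z0\<close> avoids them.\<close>
  define U where "U = (\<Inter>\<tau>\<in>{\<tau>\<in>\<Sigma>. z0 \<notin> \<tau>}. - \<tau>)"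
  have fin: "finite \<Sigma>" using fan_Sigma by (simp add: fan_def)
  have "open U" unfolding U_def using fin closed_cone by (intro open_INT) auto
  moreover have "z0 \<in> U" by (simp add: U_def)
  ultimately obtain e where e: "0 < e" "\<And>y. dist y z0 < e \<Longrightarrow> y \<in> U" by (metis open_dist)
  let ?y = "z0 + (0, e / 2)"
  have "dist ?y z0 < e" using e(1) by (simp add: dist_norm norm_Pair)
  then have yU: "?y \<in> U" by (rule e(2))
  have y0: "0 < snd ?y" using cone_half_space[OF s z0(1)] e(1) by simp
  have "?y \<in> half_space" using y0 by (cases z0) (simp add: half_space_def)
  then obtain \<tau> where t: "\<tau> \<in> \<Sigma>" "?y \<in> \<tau>" using c unfolding complete_fan_def support_def by blast
  have zt: "z0 \<in> \<tau>" using yU t unfolding U_def by blast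
  have "\<sigma> \<inter> \<tau> \<in> \<Sigma>" by (rule cone_Int_in_Sigma[OF s t(1)])
  then obtain u a where ua: "cuts_face \<sigma> u a (\<sigma> \<inter> \<tau>)" using ex_cuts_face[OF s] by blast
  then have nn: "\<forall>z\<in>\<sigma>. 0 \<le> functional u (vl a) z" and eq: "\<sigma> \<inter> \<tau> = {z \<in> \<sigma>. functional u (vl a) z = 0}"
    by (simp_all add: cuts_face_def)
  have "functional u (vl a) z0 = 0" using eq zt z0(1) by blast
  then have "\<forall>z\<in>\<sigma>. functional u (vl a) z = 0" using z0(2) nn by blast
  then have "\<sigma> \<subseteq> \<tau>" using eq by blast
  then show ?thesis using t y0 by blast
qed

lemma support_height_one: "support (height_one_complex \<Sigma>) = {z \<in> support \<Sigma>. snd z = 1}"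
  unfolding support_def height_one_complex_def by auto

end

section \<open>Common frames and apartments\<close>

context torus_framed_bundle
begin

text \<open>The scalars may vary with the cone. Rescaling basis vectors does not change an
  apartment, whereas the generators in a chart frame are characters times vectors, so that the
  constants must be put into the vectors.\<close>

definition common_frame :: "nat \<Rightarrow> (nat \<Rightarrow> nat \<Rightarrow> 'k) \<Rightarrow> bool" where
  "common_frame n e \<longleftrightarrow> kbasis r n e \<and>
     (\<forall>\<sigma>\<in>\<Sigma>. \<exists>u d. (\<forall>i<n. d i \<noteq> 0) \<and> frame_at \<sigma> n u (\<lambda>i j. d i * e i j))"

lemma lc_rescale: "(\<And>i. i < n \<Longrightarrow> d i \<noteq> 0) \<Longrightarrow> lc n c e = lc n (\<lambda>i. c i * inverse (d i)) (\<lambda>i j. d i * e i j)"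
  for d :: "nat \<Rightarrow> 'k"
  unfolding lc_def by (intro ext sum.cong) auto

lemma kbasis_rescale:
  fixes d :: "nat \<Rightarrow> 'k"
  assumes d: "\<And>i. i < n \<Longrightarrow> d i \<noteq> 0" and k: "kbasis r n e"
  shows "kbasis r n (\<lambda>i j. d i * e i j)"
  unfolding kbasis_def lc_free_def
proof (intro conjI allI impI ballI)
  fix c :: "nat \<Rightarrow> 'k" and i assume "lc n c (\<lambda>i j. d i * e i j) = (\<lambda>_. 0)" "i < n"
  moreover have "lc n c (\<lambda>i j. d i * e i j) = lc n (\<lambda>i. c i * d i) e" by (simp add: lc_def mult.assoc)
  ultimately have "c i * d i = 0"
    using kbasis_free[OF k, unfolded lc_free_def, THEN spec[of _ "\<lambda>i. c i * d i"]] by simp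
  then show "c i = 0" using d[OF \<open>i < n\<close>] by simp
next
  fix v :: "nat \<Rightarrow> 'k" assume "v \<in> kvec r"
  then obtain c where "v = lc n c e" using kbasis_ex[OF k] by blast
  then have "v = lc n (\<lambda>i. c i * inverse (d i)) (\<lambda>i j. d i * e i j)" using lc_rescale[of n d c e] d by simp
  then show "\<exists>c. v = lc n c (\<lambda>i j. d i * e i j)" by blast
qed (use kbasis_kvec[OF k] in \<open>simp add: kvec_def\<close>)

lemma level_apartment_iff:
  assumes e: "\<And>i. i < n \<Longrightarrow> e i \<in> kvec r" "\<And>i. i < n \<Longrightarrow> b i = cls (e i)"
    and v: "v \<in> additive_norms val (fiber F) m"
  shows "v \<in> level_apartment val (fiber F) n b m \<longleftrightarrow>
    (\<forall>c. v (cls (lc n c e)) = (INF i\<in>{..<n}. v (cls (\<lambda>j. c i * e i j))))"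
proof -
  have "lin_comb (fiber F) n c b = cls (lc n c e)" for c by (rule fiber_lin_comb) (use e in auto)
  moreover have "(INF i\<in>{..<n}. v (c i \<odot>\<^bsub>fiber F\<^esub> b i)) = (INF i\<in>{..<n}. v (cls (\<lambda>j. c i * e i j)))" for c
    by (rule INF_cong) (auto simp: e fiber_smult)
  ultimately show ?thesis using v by (simp add: level_apartment_def)
qed

text \<open>In the chart frame the norm is a minimum over the coefficients. Rescaling acts on each
  coefficient separately, so the minimum also splits along the unscaled basis.\<close>

lemma common_frame_apartment:
  assumes c: "common_frame n e" and s: "\<sigma> \<in> \<Sigma>" "z \<in> \<sigma>"
  shows "Phi_at z \<in> level_apartment val (fiber F) n (\<lambda>i. cls (e i)) (snd z)"
proof -
  have k: "kbasis r n e" using c by (simp add: common_frame_def)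
  obtain u d where d: "\<forall>i<n. d i \<noteq> 0" and f: "frame_at \<sigma> n u (\<lambda>i j. d i * e i j)"
    using c s(1) unfolding common_frame_def by blast
  have P: "Phi_at z (cls (lc n c e)) = fnorm n u z (\<lambda>i. c i * inverse (d i))" for c
    using Phi_at_frame(2)[OF s f, of "\<lambda>i. c i * inverse (d i)"] lc_rescale[of n d c e] d by simp
  have ce: "(\<lambda>j. c i * e i j) = lc n (\<lambda>k. if k = i then c i else 0) e" if "i < n" for c i
    using that by (simp add: lc_def if_distrib[of "\<lambda>x. x * _"] cong: if_cong)
  have Pi: "Phi_at z (cls (\<lambda>j. c i * e i j)) = (if c i = 0 then \<infinity> else ereal (functional (u i) (vl (c i * inverse (d i))) z))"
    if i: "i < n" for c i
  proof -
    have "Phi_at z (cls (\<lambda>j. c i * e i j)) = fnorm n u z (\<lambda>k. (if k = i then c i else 0) * inverse (d k))"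
      unfolding ce[OF i] by (rule P)
    also have "\<dots> = fnorm n u z (\<lambda>k. if k = i then c i * inverse (d i) else 0)" by (rule fnorm_cong) auto
    finally show ?thesis using fnorm_unit[OF i] d i by simp
  qed
  have "\<forall>c. Phi_at z (cls (lc n c e)) = (INF i\<in>{..<n}. Phi_at z (cls (\<lambda>j. c i * e i j)))"
  proof
    fix c
    show "Phi_at z (cls (lc n c e)) = (INF i\<in>{..<n}. Phi_at z (cls (\<lambda>j. c i * e i j)))"
    proof (rule ereal_eq_realI)
      fix t
      have "ereal t \<le> Phi_at z (cls (\<lambda>j. c i * e i j)) \<longleftrightarrow> (c i \<noteq> 0 \<longrightarrow> t \<le> functional (u i) (vl (c i * inverse (d i))) z)"
        if "i < n" for i unfolding Pi[OF that] by simp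
      then show "ereal t \<le> Phi_at z (cls (lc n c e)) \<longleftrightarrow> ereal t \<le> (INF i\<in>{..<n}. Phi_at z (cls (\<lambda>j. c i * e i j)))"
        unfolding P le_fnorm_iff le_INF_iff using d by auto
    qed
  qed
  then show ?thesis
    by (subst level_apartment_iff[where e = e]) (use kbasis_kvec[OF k] Phi_at_frame(1)[OF s f] in auto)
qed

text \<open>
  If \<open>A\<close> and \<open>C\<close> are the transition matrices between a frame of the cone and the basis of an apartment, then
  every diagonal entry \<open>1\<close> of \<open>A C\<close> has a summand of valuation at most \<open>0\<close>, and this forces the value of the
  norm at the corresponding basis vector to be a single integral functional on the cone.
\<close>

lemma apartment_frame:
  assumes s: "\<sigma> \<in> \<Sigma>" and D: "determining D \<sigma>" and k: "kbasis r n e"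
    and ap: "\<And>z. z \<in> D \<Longrightarrow> Phi_at z \<in> level_apartment val (fiber F) n (\<lambda>i. cls (e i)) (snd z)"
  shows "\<exists>u d. (\<forall>i<n. d i \<noteq> 0) \<and> frame_at \<sigma> n u (\<lambda>i j. d i * e i j)"
proof -
  obtain u f where f: "frame_at \<sigma> r u f" using ex_frame_at[OF s] by blast
  have kf: "kbasis r r f" using f by (simp add: frame_at_def)
  have D\<sigma>: "z \<in> \<sigma>" if "z \<in> D" for z using D that unfolding determining_def by blast
  note Phi = Phi_at_frame[OF s D\<sigma> f]
  have "\<exists>c. f i = lc n c e" if "i < r" for i using kbasis_ex[OF k kbasis_kvec[OF kf that]] .
  then obtain C where C: "\<And>i. i < r \<Longrightarrow> f i = lc n (C i) e" by metis
  have "\<exists>c. e j = lc r c f" if "j < n" for j using kbasis_ex[OF kf kbasis_kvec[OF k that]] .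
  then obtain A where A: "\<And>j. j < n \<Longrightarrow> e j = lc r (A j) f" by metis
  have AC: "(\<Sum>i<r. A j i * C i j) = 1" if j: "j < n" for j
  proof -
    have "lc n (\<lambda>k. if k = j then 1 else 0) e = lc r (A j) (\<lambda>i. lc n (C i) e)"
      unfolding lc_unit[OF j] A[OF j] by (rule lc_cong) (auto simp: C)
    also have "\<dots> = lc n (\<lambda>k. \<Sum>i<r. A j i * C i k) e" by (rule lc_lc)
    finally have "lc n (\<lambda>k. if k = j then 1 else 0) e = lc n (\<lambda>k. \<Sum>i<r. A j i * C i k) e" .
    from kbasis_eqD[OF k this j] show ?thesis by simp
  qed
  \<comment> \<open>If every nonzero summand had valuation at least 1, then so would their sum,
    which is 1.\<close>
  have "\<exists>i<r. A j i \<noteq> 0 \<and> C i j \<noteq> 0 \<and> vl (A j i * C i j) \<le> 0" if j: "j < n" for j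
  proof (rule ccontr)
    assume "\<not> ?thesis"
    then have "A j i * C i j = 0 \<or> 1 \<le> vl (A j i * C i j)" if "i \<in> {..<r}" for i using that by force
    then show False using vl_sum_ge[of "{..<r}" "\<lambda>i. A j i * C i j" 1] AC[OF j] by simp
  qed
  then obtain p where p: "\<And>j. j < n \<Longrightarrow> p j < r" "\<And>j. j < n \<Longrightarrow> A j (p j) \<noteq> 0" "\<And>j. j < n \<Longrightarrow> C (p j) j \<noteq> 0"
    "\<And>j. j < n \<Longrightarrow> vl (A j (p j) * C (p j) j) \<le> 0" by metis
  have apI: "Phi_at z (cls (lc n c e)) = (INF i\<in>{..<n}. Phi_at z (cls (\<lambda>j. c i * e i j)))" if z: "z \<in> D" for z c
  proof -
    have "\<forall>c. Phi_at z (cls (lc n c e)) = (INF i\<in>{..<n}. Phi_at z (cls (\<lambda>j. c i * e i j)))"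
      using level_apartment_iff[of n e "\<lambda>i. cls (e i)", OF _ _ Phi(1)[OF z]] ap[OF z] kbasis_kvec[OF k] by simp
    then show ?thesis by (rule spec)
  qed
  have smult: "Phi_at z (cls (\<lambda>j. a * e i j)) = ereal (of_int (vl a) * snd z) + Phi_at z (cls (e i))"
    if z: "z \<in> D" and a: "a \<noteq> 0" and i: "i < n" for z a i
  proof -
    have "cls (e i) \<in> carrier (fiber F)" unfolding fiber_carrier using kbasis_kvec[OF k i] by blast
    then have "Phi_at z (a \<odot>\<^bsub>fiber F\<^esub> cls (e i)) = ereal (snd z) * val a + Phi_at z (cls (e i))"
      using Phi(1)[OF z] a unfolding additive_norms_def by blast
    then show ?thesis using a by (simp add: fiber_smult kbasis_kvec[OF k i] val_vl mult.commute)
  qed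
  \<comment> \<open>The value is at most this functional, because the norm of \<open>e j\<close> is
    a minimum in the frame \<open>f\<close>. For the converse, the apartment property is applied to
    \<open>f (p j)\<close>: its norm, the weight \<open>u (p j)\<close> alone, is at most that of
    its component along \<open>e j\<close>. The entry of \<open>C\<close> then has to be traded for
    that of \<open>A\<close>, which the choice of \<open>p j\<close> and the nonnegative height
    permit.\<close>
  have h: "Phi_at z (cls (e j)) = ereal (functional (u (p j)) (vl (A j (p j))) z)" if z: "z \<in> D" and j: "j < n" for z j
  proof -
    have Pe: "Phi_at z (cls (e j)) = fnorm r u z (A j)" unfolding A[OF j] by (rule Phi(2)[OF z])
    have "Phi_at z (cls (e j)) \<noteq> \<infinity>" unfolding Pe fnorm_finite(2) using p(1,2)[OF j] by blast
    moreover have "Phi_at z (cls (e j)) \<noteq> - \<infinity>" unfolding Pe by (rule fnorm_finite)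
    ultimately obtain h where h: "Phi_at z (cls (e j)) = ereal h" by (cases "Phi_at z (cls (e j))") auto
    have "ereal h \<le> fnorm r u z (A j)" using h Pe by simp
    then have 1: "h \<le> functional (u (p j)) (vl (A j (p j))) z" unfolding le_fnorm_iff using p(1,2)[OF j] by blast
    have "Phi_at z (cls (lc n (C (p j)) e)) = fnorm r u z (\<lambda>i. if i = p j then 1 else 0)"
      using Phi(2)[OF z, of "\<lambda>i. if i = p j then 1 else 0"] C[OF p(1)[OF j]] lc_unit[OF p(1)[OF j], of f] by simp
    also have "\<dots> = ereal (functional (u (p j)) 0 z)" by (simp add: fnorm_unit[OF p(1)[OF j]])
    finally have "ereal (functional (u (p j)) 0 z) = (INF i\<in>{..<n}. Phi_at z (cls (\<lambda>k. C (p j) i * e i k)))"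
      unfolding apI[OF z] ..
    also have "\<dots> \<le> Phi_at z (cls (\<lambda>k. C (p j) j * e j k))" by (rule INF_lower) (use j in simp)
    finally have "ereal (functional (u (p j)) 0 z) \<le> Phi_at z (cls (\<lambda>k. C (p j) j * e j k))" .
    then have 2: "functional (u (p j)) 0 z \<le> of_int (vl (C (p j) j)) * snd z + h"
      using smult[OF z p(3)[OF j] j] h by simp
    have "(of_int (vl (A j (p j))) + of_int (vl (C (p j) j))) * snd z \<le> 0"
      using p(4)[OF j] vl_mult[OF p(2)[OF j] p(3)[OF j]] cone_half_space[OF s D\<sigma>[OF z]]
      by (intro mult_nonpos_nonneg) (auto simp flip: of_int_add)
    then have "functional (u (p j)) (vl (A j (p j))) z \<le> h"
      using 2 by (simp add: functional_def algebra_simps)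
    then show ?thesis using 1 h by simp
  qed
  \<comment> \<open>After this rescaling the norm of the basis vector is the weight
    \<open>u (p j)\<close> without a constant part.\<close>
  define d where "d j = inverse (A j (p j))" for j
  have d: "d j \<noteq> 0" if "j < n" for j using p(2)[OF that] by (simp add: d_def)
  have "frame_at \<sigma> n (\<lambda>j. u (p j)) (\<lambda>i j. d i * e i j)"
  proof (rule frame_atI[OF s kbasis_rescale[OF d k]])
    fix w c
    define g where "g j = c j * d j" for j
    have lg: "lc n c (\<lambda>i j. d i * e i j) = lc n g e" by (simp add: lc_def g_def mult.assoc)
    obtain a where a: "lc n g e = lc r a f" using kbasis_ex[OF kf kvec_lc] kbasis_kvec[OF k] by blast
    have gc: "g j = 0 \<longleftrightarrow> c j = 0" "g j * A j (p j) = c j" if "j < n" for j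
      using d[OF that] p(2)[OF that] by (auto simp: g_def d_def)
    have step: "ereal (- pairing w (fst z)) \<le> Phi_at z (cls (\<lambda>k. g j * e j k)) \<longleftrightarrow>
        (c j \<noteq> 0 \<longrightarrow> 0 \<le> functional (w + u (p j)) (vl (c j)) z)" if z: "z \<in> D" and j: "j < n" for z j
    proof (cases "c j = 0")
      case True
      then have "Phi_at z (cls (\<lambda>k. g j * e j k)) = Phi_at z (cls (lc r (\<lambda>_. 0) f))" using gc[OF j] by (simp add: lc_zero)
      also have "\<dots> = \<infinity>" unfolding Phi(2)[OF z] fnorm_finite by simp
      finally show ?thesis using True by simp
    next
      case False
      then have gj: "g j \<noteq> 0" using gc[OF j] by simp
      have "Phi_at z (cls (\<lambda>k. g j * e j k)) = ereal (functional (u (p j)) (vl (g j * A j (p j))) z)"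
        unfolding smult[OF z gj j] h[OF z j] functional_add_vl[OF gj p(2)[OF j]] by (simp add: add.commute)
      then show ?thesis using False unfolding gc(2)[OF j] functional_add_weight by auto
    qed
    \<comment> \<open>Membership becomes a lower bound for the norm on \<open>D\<close>, which the
      apartment distributes over the basis vectors; each of these bounds is a condition on one
      functional and extends from \<open>D\<close> back to the cone.\<close>
    have "(\<lambda>j. mterm w (lc n g e j)) \<in> PS \<sigma> \<longleftrightarrow> (\<forall>i<r. monomial_ok \<sigma> (w + u i) (a i))"
      unfolding a by (rule frame_mterm_iff[OF s f])
    also have "\<dots> \<longleftrightarrow> (\<forall>z\<in>D. \<forall>i<r. a i \<noteq> 0 \<longrightarrow> 0 \<le> functional (w + u i) (vl (a i)) z)"
      unfolding monomial_ok_determining[OF D] by blast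
    also have "\<dots> \<longleftrightarrow> (\<forall>z\<in>D. ereal (- pairing w (fst z)) \<le> fnorm r u z a)"
    proof -
      have "0 \<le> x + y \<longleftrightarrow> - x \<le> y" for x y :: real by linarith
      then show ?thesis unfolding le_fnorm_iff functional_add_weight by simp
    qed
    also have "\<dots> \<longleftrightarrow> (\<forall>z\<in>D. ereal (- pairing w (fst z)) \<le> (INF j\<in>{..<n}. Phi_at z (cls (\<lambda>k. g j * e j k))))"
      by (rule ball_cong) (simp_all add: apI[symmetric] a Phi(2))
    also have "\<dots> \<longleftrightarrow> (\<forall>z\<in>D. \<forall>j<n. c j \<noteq> 0 \<longrightarrow> 0 \<le> functional (w + u (p j)) (vl (c j)) z)"
      by (rule ball_cong) (auto simp add: le_INF_iff step)
    also have "\<dots> \<longleftrightarrow> (\<forall>j<n. monomial_ok \<sigma> (w + u (p j)) (c j))"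
      unfolding monomial_ok_determining[OF D] by blast
    finally show "(\<lambda>j. mterm w (lc n c (\<lambda>i j. d i * e i j) j)) \<in> PS \<sigma> \<longleftrightarrow> (\<forall>j<n. monomial_ok \<sigma> (w + u (p j)) (c j))"
      unfolding lg .
  qed
  then show ?thesis using d by blast
qed

lemma Phi_eq: "Phi F z = (snd z, Phi_at z)"
  by (cases z) (simp add: Phi_def)

lemma is_basis_cls:
  assumes "is_basis (fiber F) n b"
  shows "\<exists>e. kbasis r n e \<and> (\<forall>i<n. b i = cls (e i))"
proof -
  have "b i \<in> carrier (fiber F)" if "i < n" for i using assms that by (simp add: is_basis_def)
  then obtain e where e: "\<And>i. i < n \<Longrightarrow> e i \<in> kvec r" "\<And>i. i < n \<Longrightarrow> b i = cls (e i)" using fiber_vectors by blast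
  then have "kbasis r n e" using is_basis_iff[of n e b] assms by blast
  then show ?thesis using e(2) by blast
qed

lemma level_apartment_cong:
  assumes "kbasis r n e" "\<And>i. i < n \<Longrightarrow> b i = cls (e i)"
  shows "level_apartment val (fiber F) n b m = level_apartment val (fiber F) n (\<lambda>i. cls (e i)) m"
proof -
  have "v \<in> level_apartment val (fiber F) n b m \<longleftrightarrow> v \<in> level_apartment val (fiber F) n (\<lambda>i. cls (e i)) m" for v
  proof (cases "v \<in> additive_norms val (fiber F) m")
    case True
    show ?thesis
      using level_apartment_iff[of n e b, OF _ _ True] level_apartment_iff[of n e "\<lambda>i. cls (e i)", OF _ _ True]
        kbasis_kvec[OF assms(1)] assms(2) by simp
  qed (simp add: level_apartment_def)
  then show ?thesis by blast
qed

text \<open>Each cone is its own determining set, so \<open>apartment_frame\<close> yields a frame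
  of every chart from the one basis of the apartment.\<close>

theorem extended_apartment_iff:
  "in_one_extended_apartment val (fiber F) (Phi F ` support \<Sigma>) \<longleftrightarrow> (\<exists>n e. common_frame n e)"
proof
  assume "in_one_extended_apartment val (fiber F) (Phi F ` support \<Sigma>)"
  then obtain n b where b: "is_basis (fiber F) n b" "Phi F ` support \<Sigma> \<subseteq> extended_apartment val (fiber F) n b"
    unfolding in_one_extended_apartment_def by blast
  obtain e where "kbasis r n e \<and> (\<forall>i<n. b i = cls (e i))" using is_basis_cls[OF b(1)] by (elim exE)
  then have e: "kbasis r n e" "\<And>i. i < n \<Longrightarrow> b i = cls (e i)" by simp_all
  have cong: "level_apartment val (fiber F) n b m = level_apartment val (fiber F) n (\<lambda>i. cls (e i)) m" for m
    by (rule level_apartment_cong) (use e in auto)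
  have ap: "Phi_at z \<in> level_apartment val (fiber F) n (\<lambda>i. cls (e i)) (snd z)" if "z \<in> support \<Sigma>" for z
  proof -
    have "Phi F z \<in> extended_apartment val (fiber F) n b" using b(2) that by blast
    then show ?thesis unfolding Phi_eq extended_apartment_def cong by simp
  qed
  have "common_frame n e" unfolding common_frame_def
  proof (intro conjI ballI)
    fix \<sigma> assume s: "\<sigma> \<in> \<Sigma>"
    show "\<exists>u d. (\<forall>i<n. d i \<noteq> 0) \<and> frame_at \<sigma> n u (\<lambda>i j. d i * e i j)"
    proof (rule apartment_frame[OF s _ e(1)])
      show "determining \<sigma> \<sigma>" by (simp add: determining_def)
      show "\<And>z. z \<in> \<sigma> \<Longrightarrow> Phi_at z \<in> level_apartment val (fiber F) n (\<lambda>i. cls (e i)) (snd z)"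
        using ap s unfolding support_def by blast
    qed
  qed (rule e(1))
  then show "\<exists>n e. common_frame n e" by blast
next
  assume "\<exists>n e. common_frame n e"
  then obtain n e where c: "common_frame n e" by blast
  have k: "kbasis r n e" using c by (simp add: common_frame_def)
  have "is_basis (fiber F) n (\<lambda>i. cls (e i))" using is_basis_iff[of n e "\<lambda>i. cls (e i)"] kbasis_kvec[OF k] k by simp
  moreover have "Phi F z \<in> extended_apartment val (fiber F) n (\<lambda>i. cls (e i))" if z: "z \<in> support \<Sigma>" for z
  proof -
    obtain \<sigma> where s: "\<sigma> \<in> \<Sigma>" "z \<in> \<sigma>" using z unfolding support_def by blast
    then show ?thesis
      unfolding Phi_eq extended_apartment_def using common_frame_apartment[OF c s] cone_half_space[OF s] by simp
  qed
  ultimately show "in_one_extended_apartment val (fiber F) (Phi F ` support \<Sigma>)"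
    unfolding in_one_extended_apartment_def by blast
qed

text \<open>Norms at height one say nothing directly about a cone of height 0. Such a cone is first
  enlarged to one of positive height, whose frame then restricts to the face.\<close>

theorem affine_apartment_iff:
  assumes cp: "complete_fan \<Sigma>"
  shows "in_one_affine_extended_apartment val (fiber F) (Phi_affine F ` support (height_one_complex \<Sigma>)) \<longleftrightarrow>
    (\<exists>n e. common_frame n e)"
proof
  assume "in_one_affine_extended_apartment val (fiber F) (Phi_affine F ` support (height_one_complex \<Sigma>))"
  then obtain n b where b: "is_basis (fiber F) n b"
    "Phi_affine F ` support (height_one_complex \<Sigma>) \<subseteq> affine_extended_apartment val (fiber F) n b"
    unfolding in_one_affine_extended_apartment_def by blast
  obtain e where "kbasis r n e \<and> (\<forall>i<n. b i = cls (e i))" using is_basis_cls[OF b(1)] by (elim exE)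
  then have e: "kbasis r n e" "\<And>i. i < n \<Longrightarrow> b i = cls (e i)" by simp_all
  have cong: "level_apartment val (fiber F) n b m = level_apartment val (fiber F) n (\<lambda>i. cls (e i)) m" for m
    by (rule level_apartment_cong) (use e in auto)
  have ap: "Phi_at z \<in> level_apartment val (fiber F) n (\<lambda>i. cls (e i)) (snd z)" if z: "z \<in> support \<Sigma>" "snd z = 1" for z
  proof -
    have "Phi_affine F z \<in> affine_extended_apartment val (fiber F) n b"
      using b(2) z unfolding support_height_one by blast
    then show ?thesis
      using z(2) unfolding Phi_affine_def Phi_eq affine_extended_apartment_def cong by simp
  qed
  have "common_frame n e" unfolding common_frame_def
  proof (intro conjI ballI)
    fix \<sigma> assume s: "\<sigma> \<in> \<Sigma>"
    obtain \<tau> z where t: "\<tau> \<in> \<Sigma>" "\<sigma> \<subseteq> \<tau>" "z \<in> \<tau>" "0 < snd z" using complete_fan_positive_cone[OF cp s] by blast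
    have "\<exists>u d. (\<forall>i<n. d i \<noteq> 0) \<and> frame_at \<tau> n u (\<lambda>i j. d i * e i j)"
      by (rule apartment_frame[OF t(1) determining_height_one[OF t(1,3,4)] e(1)], rule ap)
        (use t(1) in \<open>auto simp: support_def\<close>)
    then show "\<exists>u d. (\<forall>i<n. d i \<noteq> 0) \<and> frame_at \<sigma> n u (\<lambda>i j. d i * e i j)"
      using frame_face[OF t(1) s t(2)] by blast
  qed (rule e(1))
  then show "\<exists>n e. common_frame n e" by blast
next
  assume "\<exists>n e. common_frame n e"
  then obtain n e where c: "common_frame n e" by blast
  have k: "kbasis r n e" using c by (simp add: common_frame_def)
  have "is_basis (fiber F) n (\<lambda>i. cls (e i))" using is_basis_iff[of n e "\<lambda>i. cls (e i)"] kbasis_kvec[OF k] k by simp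
  moreover have "Phi_affine F z \<in> affine_extended_apartment val (fiber F) n (\<lambda>i. cls (e i))"
    if z: "z \<in> support (height_one_complex \<Sigma>)" for z
  proof -
    have z': "z \<in> support \<Sigma>" and 1: "snd z = 1" using z unfolding support_height_one by simp_all
    obtain \<sigma> where s: "\<sigma> \<in> \<Sigma>" "z \<in> \<sigma>" using z' unfolding support_def by blast
    then show ?thesis
      unfolding Phi_affine_def Phi_eq affine_extended_apartment_def using common_frame_apartment[OF c s] 1 by simp
  qed
  ultimately show "in_one_affine_extended_apartment val (fiber F) (Phi_affine F ` support (height_one_complex \<Sigma>))"
    unfolding in_one_affine_extended_apartment_def by blast
qed

end

section \<open>Splitting along a common frame\<close>

lemma finsum_carrier_update:
  assumes G: "abelian_monoid G" and C: "abelian_monoid (G\<lparr>carrier := C\<rparr>)" "C \<subseteq> carrier G"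
    and A: "finite A" "\<And>i. i \<in> A \<Longrightarrow> f i \<in> C"
  shows "finsum (G\<lparr>carrier := C\<rparr>) f A = finsum G f A"
  by (rule finsum_hom[OF C(1) G, of "\<lambda>x. x"]) (use C(2) A in auto)

context torus_framed_bundle
begin

section \<open>Coordinate functionals of a common frame\<close>

definition qvec :: "(nat \<Rightarrow> 'k) \<Rightarrow> nat \<Rightarrow> ('n, 'k) lfrac" where
  "qvec v = (\<lambda>k. of_laurent (mterm 0 (v k)))"

context
  fixes n e assumes cfr: "common_frame n e"
begin

lemma cfr_kbasis: "kbasis r n e"
  using cfr by (simp add: common_frame_def)

text \<open>Independence over \<open>K\<close> passes to the fractions: after clearing denominators,
  a relation is compared exponent by exponent.\<close>

lemma qvec_free: "lc_free n (\<lambda>j. qvec (e j))"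
  unfolding lc_free_def
proof (intro allI impI)
  fix q j assume q: "lc n q (\<lambda>j. qvec (e j)) = (\<lambda>_. 0)" and j: "j < n"
  have "\<exists>f\<in>chart_ring {0}. f \<notin> {0} \<and> (\<forall>i<n. \<exists>g\<in>chart_ring {0}. of_laurent f * q i = of_laurent g)"
    by (rule loc_common_denominator[OF s0 zero_in_spec[OF s0]])
      (simp add: loc_generic_point generic_point_chart[OF s0, symmetric])
  then obtain f where f: "f \<noteq> 0" "\<And>i. i < n \<Longrightarrow> \<exists>g. of_laurent f * q i = of_laurent g" by blast
  then obtain g where g: "\<And>i. i < n \<Longrightarrow> of_laurent f * q i = of_laurent (g i)" by metis
  have z: "(\<Sum>i<n. g i * mterm 0 (e i k)) = 0" for k
  proof -
    have "of_laurent (\<Sum>i<n. g i * mterm 0 (e i k)) = of_laurent f * lc n q (\<lambda>j. qvec (e j)) k"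
      by (simp add: lc_def qvec_def sum_distrib_left g[symmetric] mult.assoc)
    then have "of_laurent (\<Sum>i<n. g i * mterm 0 (e i k)) = of_laurent 0" by (simp only: q mult_zero_right of_laurent_0)
    then show ?thesis by (simp only: of_laurent_eq_iff)
  qed
  have "coef (g j) u = 0" for u
  proof -
    have "(\<Sum>i<n. coef (g i) u * e i k) = 0" for k
      using arg_cong[OF z[of k], of "\<lambda>x. coef x u"]
      by (simp add: mult.commute[of "g _"] coef_mterm_mult lookup_sum) (simp add: mult.commute)
    then have "lc n (\<lambda>i. coef (g i) u) e = (\<lambda>_. 0)" by (simp add: lc_def)
    then show ?thesis using kbasis_free[OF cfr_kbasis, unfolded lc_free_def, THEN spec[of _ "\<lambda>i. coef (g i) u"]] j by simp
  qed
  then have "g j = 0" by (intro poly_mapping_eqI) simp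
  then show "q j = 0" using g[OF j] f(1) by simp
qed

text \<open>The rows of the inverse of the matrix formed by the basis vectors.\<close>

definition dualc :: "nat \<Rightarrow> nat \<Rightarrow> 'k" where
  "dualc k = (SOME c. (\<lambda>j. if j = k then 1 else 0) = lc n c e)"

lemma dualc:
  assumes "k < r" shows "(\<lambda>j. if j = k then 1 else 0) = lc n (dualc k) e"
proof -
  have "(\<lambda>j. if j = k then 1 else 0) \<in> kvec r" using assms by (simp add: kvec_def)
  from someI_ex[OF kbasis_ex[OF cfr_kbasis this]] show ?thesis unfolding dualc_def .
qed

text \<open>The coordinate functional \<open>j\<close> of the basis \<open>e\<close>, extended
  linearly from \<open>K\<close> to the fractions.\<close>

definition pr :: "nat \<Rightarrow> (nat \<Rightarrow> ('n, 'k) lfrac) \<Rightarrow> ('n, 'k) lfrac" where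
  "pr j v = (\<Sum>k<r. v k * of_laurent (mterm 0 (dualc k j)))"

lemma pr_add: "pr j (\<lambda>k. v k + w k) = pr j v + pr j w"
  by (simp add: pr_def distrib_right sum.distrib)

lemma pr_smult: "pr j (\<lambda>k. q * v k) = q * pr j v"
  by (simp add: pr_def sum_distrib_left mult.assoc)

lemma pr_expansion:
  assumes v: "v \<in> kvec r" shows "v = lc n (\<lambda>j. pr j v) (\<lambda>j. qvec (e j))"
proof
  fix l
  have "lc n (\<lambda>j. pr j v) (\<lambda>j. qvec (e j)) l
      = (\<Sum>k<r. v k * (\<Sum>j<n. of_laurent (mterm 0 (dualc k j)) * of_laurent (mterm 0 (e j l))))"
    unfolding lc_def pr_def qvec_def sum_distrib_right sum_distrib_left mult.assoc by (rule sum.swap)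
  also have "\<dots> = (\<Sum>k<r. v k * of_laurent (mterm 0 (if l = k then 1 else 0)))"
  proof (rule sum.cong[OF refl])
    fix k assume "k \<in> {..<r}"
    then have "(if l = k then 1 else 0) = lc n (dualc k) e l" using fun_cong[OF dualc[of k], of l] by simp
    then show "v k * (\<Sum>j<n. of_laurent (mterm 0 (dualc k j)) * of_laurent (mterm 0 (e j l))) =
        v k * of_laurent (mterm 0 (if l = k then 1 else 0))"
      by (simp add: lc_def mterm_sum mult_single flip: of_laurent_mult)
  qed
  also have "\<dots> = (\<Sum>k<r. if l = k then v k else 0)" by (rule sum.cong) auto
  also have "\<dots> = v l" using v by (auto simp: kvec_def)
  finally show "v l = lc n (\<lambda>j. pr j v) (\<lambda>j. qvec (e j)) l" ..
qed

lemma qvec_kvec: "j < n \<Longrightarrow> qvec (e j) \<in> kvec r"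
  using kbasis_kvec[OF cfr_kbasis, of j] by (simp add: qvec_def kvec_def)

lemma pr_lc:
  assumes j: "j < n" shows "pr j (lc n q (\<lambda>j. qvec (e j))) = q j"
proof -
  have "lc n q (\<lambda>j. qvec (e j)) \<in> kvec r" by (rule kvec_lc) (rule qvec_kvec)
  from lc_freeD[OF qvec_free pr_expansion[OF this] j] show ?thesis ..
qed

lemma pr_qvec: "i < n \<Longrightarrow> j < n \<Longrightarrow> pr j (\<lambda>k. q * qvec (e i) k) = (if j = i then q else 0)"
proof -
  assume i: "i < n" and j: "j < n"
  have "(\<lambda>k. q * qvec (e i) k) = lc n (\<lambda>l. if l = i then q else 0) (\<lambda>j. qvec (e j))"
    using i by (simp add: lc_def if_distrib[of "\<lambda>x. x * _"] cong: if_cong)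
  then show ?thesis using pr_lc[OF j] by simp
qed

lemma qvec_nonzero: "j < n \<Longrightarrow> \<exists>k. e j k \<noteq> 0"
proof (rule ccontr)
  assume j: "j < n" and "\<not> (\<exists>k. e j k \<noteq> 0)"
  then have "lc n (\<lambda>l. if l = j then 1 else 0) e = (\<lambda>_. 0)" unfolding lc_unit[OF j] by auto
  then have "\<forall>i<n. (if i = j then 1 else 0) = (0 :: 'k)"
    using kbasis_free[OF cfr_kbasis, unfolded lc_free_def, THEN spec[of _ "\<lambda>l. if l = j then 1 else 0"]] by blast
  from this[rule_format, OF j] show False by simp
qed

lemma qvec_cancel:
  assumes j: "j < n" and eq: "(\<lambda>k. p * qvec (e j) k) = (\<lambda>k. q * qvec (e j) k)"
  shows "p = q"
  using arg_cong[OF eq, of "pr j"] by (simp add: pr_qvec[OF j j])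

text \<open>\<open>m j\<close> is the scaled character that generates line \<open>j\<close> on the
  chart, and \<open>m'\<close> is its inverse. The last clause says that projecting a stalk to the
  line stays inside the local multiples of the generator, so the line is a direct summand of the
  stalk.\<close>

lemma ex_line_generator:
  assumes s: "\<sigma> \<in> \<Sigma>"
  shows "\<exists>m m'. \<forall>j<n. m j * m' j = 1 \<and> (\<lambda>k. m j * qvec (e j) k) \<in> Gam (chart \<sigma>) \<and>
    (\<forall>x\<in>chart \<sigma>. \<forall>v\<in>Lam x. \<exists>a\<in>loc x. pr j v = a * m j)"
proof -
  obtain u d where d: "\<forall>i<n. d i \<noteq> 0" and f: "frame_at \<sigma> n u (\<lambda>i j. d i * e i j)"
    using cfr s unfolding common_frame_def by blast
  define m where "m j = of_laurent (mterm (- u j) (d j))" for j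
  define m' where "m' j = of_laurent (mterm (u j) (inverse (d j)))" for j
  have mm: "m j * m' j = 1" if "j < n" for j
    unfolding m_def m'_def of_laurent_mult[symmetric] mult_single using d that by simp
  have mE: "of_laurent (mterm (- u j) (d j * e j k)) = m j * qvec (e j) k" for j k
    unfolding m_def qvec_def of_laurent_mult[symmetric] mult_single by simp
  have mG: "(\<lambda>k. m j * qvec (e j) k) \<in> Gam (chart \<sigma>)" if "j < n" for j
    using frame_generator[OF s f that] by (simp add: PS_def ofl_def mE)
  have "\<exists>a\<in>loc x. pr j v = a * m j" if j: "j < n" and x: "x \<in> chart \<sigma>" and v: "v \<in> Lam x" for x j v
  proof -
    obtain p where p: "p \<in> spec \<sigma>" "x = chart_point \<sigma> p" using x unfolding chart_def by blast
    obtain g where g: "g \<in> chart_ring \<sigma>" "g \<notin> p" "(\<lambda>j. of_laurent g * v j) \<in> Gam (chart \<sigma>)"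
      using Lam_clear_denominator[OF s p(1)] v unfolding p(2) by blast
    have gn: "g \<noteq> 0" by (rule spec_nonzero[OF s p(1) g(2)])
    obtain w where w: "(\<lambda>j. of_laurent g * v j) = ofl w" using Gam_chart_ofl[OF s g(3)] by blast
    then have "w \<in> PS \<sigma>" using g(3) by (simp add: PS_def)
    then obtain h where h: "w = (\<lambda>j. \<Sum>i<n. h i * mterm (- u i) (d i * e i j))" "\<forall>i<n. h i \<in> chart_ring \<sigma>"
      using f unfolding frame_at_def pspan_def[OF s] by blast
    have "(\<lambda>j. of_laurent g * v j) = lc n (\<lambda>i. of_laurent (h i) * m i) (\<lambda>j. qvec (e j))"
      unfolding w h(1) ofl_def lc_def by (simp add: mE mult.assoc)
    then have "of_laurent g * pr j v = of_laurent (h j) * m j"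
      using pr_smult[of j "of_laurent g" v] pr_lc[OF j] by simp
    also have "\<dots> = of_laurent g * (Frac (h j) g * m j)"
      using of_laurent_denominator[OF gn, of "h j"] by (simp add: mult.assoc[symmetric])
    finally have "pr j v = Frac (h j) g * m j" using lfrac_mult_left_cancel gn by (metis of_laurent_eq_0_iff)
    moreover have "Frac (h j) g \<in> loc x" unfolding p(2) using h(2) j by (intro loc_chart_pointI[OF s p(1) _ g(1,2)]) simp
    ultimately show ?thesis by blast
  qed
  then show ?thesis using mm mG by blast
qed

text \<open>Checked stalk by stalk with the line generator of a chart around the point.\<close>

lemma pr_Gam:
  assumes W: "zariski_open W" and v: "v \<in> Gam W" and j: "j < n"
  shows "(\<lambda>k. pr j v * qvec (e j) k) \<in> Gam W"
  unfolding Gam_def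
proof (intro CollectI conjI ballI impI)
  fix x assume x: "x \<in> W"
  then have xp: "x \<in> points" using zariski_open_points[OF W] by blast
  then obtain \<sigma> where s: "\<sigma> \<in> \<Sigma>" "x \<in> chart \<sigma>" unfolding points_chart by blast
  obtain m m' where m: "\<forall>j<n. m j * m' j = 1 \<and> (\<lambda>k. m j * qvec (e j) k) \<in> Gam (chart \<sigma>) \<and>
    (\<forall>x\<in>chart \<sigma>. \<forall>v\<in>Lam x. \<exists>a\<in>loc x. pr j v = a * m j)" using ex_line_generator[OF s(1)] by (elim exE)
  have "v \<in> Lam x" using v x by (simp add: Gam_def)
  then obtain a where a: "a \<in> loc x" "pr j v = a * m j" using m j s(2) by blast
  have "(\<lambda>k. m j * qvec (e j) k) \<in> Lam x" using m j s(2) unfolding Gam_chart_iff[OF s(1)] by blast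
  from Lam_smult[OF xp a(1) this] show "(\<lambda>k. pr j v * qvec (e j) k) \<in> Lam x" unfolding a(2) by (simp add: mult.assoc)
next
  assume "W = {}"
  then have "v = (\<lambda>_. 0)" using v by (simp add: Gam_def)
  then show "(\<lambda>k. pr j v * qvec (e j) k) = (\<lambda>_. 0)" by (simp add: pr_def)
qed

section \<open>The line subbundles\<close>

definition line_carrier :: "nat \<Rightarrow> ('n, 'k) point set \<Rightarrow> 'e set" where
  "line_carrier j W = {t \<in> carrier (H W). \<exists>q. cd W t = (\<lambda>k. q * qvec (e j) k)}"

text \<open>Only the carriers shrink, to the sections whose coordinates lie on line
  \<open>j\<close>; operations, restrictions and coaction are those of \<open>F\<close>, so most
  axioms are inherited.\<close>

definition line :: "nat \<Rightarrow> ('n, 'k, 'e) linearized_sheaf" where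
  "line j = F\<lparr>sections := \<lambda>W. (H W)\<lparr>carrier := line_carrier j W\<rparr>\<rparr>"

lemma line_simps [simp]:
  "sections (line j) W = (H W)\<lparr>carrier := line_carrier j W\<rparr>"
  "restriction (line j) = res" "coaction (line j) = coaction F"
  by (simp_all add: line_def)

lemma line_carrier_subset: "line_carrier j W \<subseteq> carrier (H W)"
  by (auto simp: line_carrier_def)

context
  fixes W assumes W: "zariski_open W"
begin

lemma line_carrierI: "t \<in> carrier (H W) \<Longrightarrow> cd W t = (\<lambda>k. q * qvec (e j) k) \<Longrightarrow> t \<in> line_carrier j W"
  by (auto simp: line_carrier_def)

lemma line_add: "s \<in> line_carrier j W \<Longrightarrow> t \<in> line_carrier j W \<Longrightarrow> s \<oplus>\<^bsub>H W\<^esub> t \<in> line_carrier j W"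
proof -
  assume "s \<in> line_carrier j W" "t \<in> line_carrier j W"
  then obtain p q where "s \<in> carrier (H W)" "t \<in> carrier (H W)"
    "cd W s = (\<lambda>k. p * qvec (e j) k)" "cd W t = (\<lambda>k. q * qvec (e j) k)" unfolding line_carrier_def by blast
  then show ?thesis
    by (intro line_carrierI[of _ "p + q"]) (simp_all add: cd_add[OF W] H_add_closed[OF W] distrib_right)
qed

lemma line_smult: "rg W p \<Longrightarrow> t \<in> line_carrier j W \<Longrightarrow> cf W p \<odot>\<^bsub>H W\<^esub> t \<in> line_carrier j W"
proof -
  assume p: "rg W p" and "t \<in> line_carrier j W"
  then obtain q where "t \<in> carrier (H W)" "cd W t = (\<lambda>k. q * qvec (e j) k)" unfolding line_carrier_def by blast
  then show ?thesis
    using p by (intro line_carrierI[of _ "p * q"]) (simp_all add: cd_smult[OF W] H_smult_closed[OF W] mult.assoc)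
qed

lemma line_module: "module (structure_sheaf W) (sections (line j) W)"
proof -
  interpret M: module "structure_sheaf W" "H W" by (rule H_module[OF W])
  have z: "\<zero>\<^bsub>H W\<^esub> \<in> line_carrier j W" by (rule line_carrierI[of _ 0]) (simp_all add: cd_zero[OF W])
  have "submodule (line_carrier j W) (structure_sheaf W) (H W)"
  proof (rule M.submoduleI)
    show "line_carrier j W \<subseteq> carrier (H W)" by (rule line_carrier_subset)
    show "\<zero>\<^bsub>H W\<^esub> \<in> line_carrier j W" by (rule z)
    show "s \<oplus>\<^bsub>H W\<^esub> t \<in> line_carrier j W" if "s \<in> line_carrier j W" "t \<in> line_carrier j W" for s t
      using line_add that .
    show sm: "a \<odot>\<^bsub>H W\<^esub> t \<in> line_carrier j W" if a: "a \<in> carrier (structure_sheaf W)" and t: "t \<in> line_carrier j W" for a t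
    proof -
      obtain q where q: "a = cf W q" "\<forall>x\<in>W. q \<in> loc x"
        using regular_functions_cf[OF W] a by (metis structure_sheaf_simps(1))
      show ?thesis unfolding q(1) by (rule line_smult[OF _ t]) (use q(2) in \<open>simp add: rg_def\<close>)
    qed
    show "\<ominus>\<^bsub>H W\<^esub> t \<in> line_carrier j W" if t: "t \<in> line_carrier j W" for t
    proof -
      have tc: "t \<in> carrier (H W)" using t line_carrier_subset by blast
      have "(\<ominus>\<^bsub>structure_sheaf W\<^esub> \<one>\<^bsub>structure_sheaf W\<^esub>) \<odot>\<^bsub>H W\<^esub> t \<in> line_carrier j W" by (rule sm[OF _ t]) simp
      then show ?thesis using M.smult_l_minus[OF _ tc, of "\<one>\<^bsub>structure_sheaf W\<^esub>"] tc by simp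
    qed
  qed
  from submodule.submodule_is_module[OF this M.module_axioms] show ?thesis by simp
qed

lemma line_abelian_monoid: "abelian_monoid ((H W)\<lparr>carrier := line_carrier j W\<rparr>)"
  using line_module[of j] unfolding module_def abelian_group_def by simp

end

lemma line_res:
  assumes W: "zariski_open W" and V: "zariski_open V" "V \<subseteq> W" and t: "t \<in> line_carrier j W"
  shows "res W V t \<in> line_carrier j V"
proof (cases "V = {}")
  case True
  have "t \<in> carrier (H W)" using t line_carrier_subset by blast
  then show ?thesis using res_closed[OF W V] True
    by (intro line_carrierI[OF V(1), of _ 0]) (simp_all add: cd_empty)
next
  case False
  obtain q where "t \<in> carrier (H W)" "cd W t = (\<lambda>k. q * qvec (e j) k)" using t unfolding line_carrier_def by blast
  then show ?thesis using cd_res[OF W V(1) False V(2)] res_closed[OF W V]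
    by (intro line_carrierI[OF V(1), of _ q]) simp_all
qed

text \<open>Gluing takes place in \<open>F\<close>. The glued section has the coordinates of any
  nonempty member of the cover and therefore lies on the line.\<close>

lemma line_sheaf: "sheaf_of_modules (line j)"
  unfolding sheaf_of_modules_def
proof (intro conjI allI impI ballI; (elim conjE)?)
  show "module (structure_sheaf W) (sections (line j) W)" if "zariski_open W" for W by (rule line_module[OF that])
  fix W V assume W: "zariski_open W" and V: "zariski_open V" "V \<subseteq> W"
  show "restriction (line j) W V s \<in> carrier (sections (line j) V)" if "s \<in> carrier (sections (line j) W)" for s
    using line_res[OF W V] that by simp
  show "restriction (line j) W V (s \<oplus>\<^bsub>sections (line j) W\<^esub> t) =
      restriction (line j) W V s \<oplus>\<^bsub>sections (line j) V\<^esub> restriction (line j) W V t"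
    if "s \<in> carrier (sections (line j) W)" "t \<in> carrier (sections (line j) W)" for s t
    using res_add[OF W V subsetD[OF line_carrier_subset] subsetD[OF line_carrier_subset]] that by simp
  show "restriction (line j) W V (a \<odot>\<^bsub>sections (line j) W\<^esub> s) =
      restrict_func V a \<odot>\<^bsub>sections (line j) V\<^esub> restriction (line j) W V s"
    if a: "a \<in> regular_functions W" and s: "s \<in> carrier (sections (line j) W)" for a s
  proof -
    obtain q where q: "a = cf W q" "\<forall>x\<in>W. q \<in> loc x" by (rule regular_functions_cf[OF W a])
    have "s \<in> carrier (H W)" using s line_carrier_subset by auto
    then show ?thesis using res_smult[OF W V] q(2) unfolding q(1) by (simp add: rg_def cf_restrict[OF V(2)])
  qed
next
  fix W s assume "zariski_open W" "s \<in> carrier (sections (line j) W)"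
  then show "restriction (line j) W W s = s" using res_id[OF _ subsetD[OF line_carrier_subset]] by simp
next
  fix W V V' s assume "zariski_open W" "zariski_open V" "zariski_open V'" "V' \<subseteq> V" "V \<subseteq> W" "s \<in> carrier (sections (line j) W)"
  then show "restriction (line j) V V' (restriction (line j) W V s) = restriction (line j) W V' s"
    using res_res[OF _ _ _ _ _ subsetD[OF line_carrier_subset]] by simp
next
  fix \<W> s
  assume s: "\<forall>V\<in>\<W>. zariski_open V \<and> s V \<in> carrier (sections (line j) V)"
    and eq: "\<forall>V\<in>\<W>. \<forall>V'\<in>\<W>. restriction (line j) V (V \<inter> V') (s V) = restriction (line j) V' (V \<inter> V') (s V')"
  have o: "\<And>V. V \<in> \<W> \<Longrightarrow> zariski_open V" and sl: "\<And>V. V \<in> \<W> \<Longrightarrow> s V \<in> line_carrier j V" using s by auto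
  have U: "zariski_open (\<Union>\<W>)" by (rule zariski_open_Union[OF o])
  have ex1: "\<exists>!t. t \<in> carrier (H (\<Union>\<W>)) \<and> (\<forall>V\<in>\<W>. res (\<Union>\<W>) V t = s V)"
    by (rule gluing) (use o subsetD[OF line_carrier_subset sl] eq in auto)
  then obtain t where t: "t \<in> carrier (H (\<Union>\<W>))" "\<forall>V\<in>\<W>. res (\<Union>\<W>) V t = s V" by blast
  have "t \<in> line_carrier j (\<Union>\<W>)"
  proof (cases "\<Union>\<W> = {}")
    case True
    show ?thesis by (rule line_carrierI[OF U t(1), of 0]) (simp only: True cd_empty mult_zero_left)
  next
    case False
    then obtain V where V: "V \<in> \<W>" "V \<noteq> {}" by blast
    then obtain q where "cd V (s V) = (\<lambda>k. q * qvec (e j) k)" using sl unfolding line_carrier_def by blast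
    moreover have "V \<subseteq> \<Union>\<W>" using V(1) by blast
    ultimately have "cd (\<Union>\<W>) t = (\<lambda>k. q * qvec (e j) k)" using cd_res[OF U o[OF V(1)] V(2) _ t(1)] t(2) V(1) by simp
    then show ?thesis using t(1) by (intro line_carrierI[OF U])
  qed
  then have tl: "t \<in> line_carrier j (\<Union>\<W>)" .
  show "\<exists>!t. t \<in> carrier (sections (line j) (\<Union>\<W>)) \<and> (\<forall>V\<in>\<W>. restriction (line j) (\<Union>\<W>) V t = s V)"
  proof (rule ex1I[of _ t])
    show "t \<in> carrier (sections (line j) (\<Union>\<W>)) \<and> (\<forall>V\<in>\<W>. restriction (line j) (\<Union>\<W>) V t = s V)"
      using tl t(2) by simp
    fix t' assume t': "t' \<in> carrier (sections (line j) (\<Union>\<W>)) \<and> (\<forall>V\<in>\<W>. restriction (line j) (\<Union>\<W>) V t' = s V)"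
    then have tl': "t' \<in> line_carrier j (\<Union>\<W>)" and tr': "\<forall>V\<in>\<W>. res (\<Union>\<W>) V t' = s V" by simp_all
    have "t' \<in> carrier (H (\<Union>\<W>)) \<and> (\<forall>V\<in>\<W>. res (\<Union>\<W>) V t' = s V)"
      using subsetD[OF line_carrier_subset tl'] tr' by simp
    from the1_equality[OF ex1 this] the1_equality[OF ex1 conjI[OF t]] show "t' = t" by simp
  qed
qed

text \<open>The generator \<open>b\<close> has the coordinates \<open>m j * qvec (e j)\<close>. A
  section with factor \<open>q\<close> is \<open>q * m' j\<close> times \<open>b\<close>, and this
  coefficient is regular by the last clause of \<open>ex_line_generator\<close>.\<close>

lemma line_locally_free:
  assumes j: "j < n" shows "locally_free 1 (line j)"
  unfolding locally_free_def
proof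
  fix x assume "x \<in> points"
  then obtain \<sigma> where s: "\<sigma> \<in> \<Sigma>" "x \<in> chart \<sigma>" unfolding points_chart by blast
  note o = zariski_open_chart[OF s(1)]
  obtain m m' where m: "\<forall>j<n. m j * m' j = 1 \<and> (\<lambda>k. m j * qvec (e j) k) \<in> Gam (chart \<sigma>) \<and>
    (\<forall>x\<in>chart \<sigma>. \<forall>v\<in>Lam x. \<exists>a\<in>loc x. pr j v = a * m j)" using ex_line_generator[OF s(1)] by (elim exE)
  have mm: "m j * m' j = 1" and mG: "(\<lambda>k. m j * qvec (e j) k) \<in> Gam (chart \<sigma>)"
    and ma: "\<And>x v. x \<in> chart \<sigma> \<Longrightarrow> v \<in> Lam x \<Longrightarrow> \<exists>a\<in>loc x. pr j v = a * m j" using m j by blast+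
  obtain b where b: "b \<in> carrier (H (chart \<sigma>))" "cd (chart \<sigma>) b = (\<lambda>k. m j * qvec (e j) k)" using cd_surj[OF o mG] by blast
  have bl: "b \<in> line_carrier j (chart \<sigma>)" by (rule line_carrierI[OF o b])
  have ex1: "\<exists>!a. a \<in> {..<1::nat} \<rightarrow>\<^sub>E regular_functions V \<and>
      s = (\<Oplus>\<^bsub>sections (line j) V\<^esub>i\<in>{..<1}. a i \<odot>\<^bsub>sections (line j) V\<^esub> restriction (line j) (chart \<sigma>) V b)"
    if V: "zariski_open V" "V \<subseteq> chart \<sigma>" and sl: "s \<in> line_carrier j V" for V s
  proof -
    interpret L: abelian_monoid "(H V)\<lparr>carrier := line_carrier j V\<rparr>" by (rule line_abelian_monoid[OF V(1)])
    have sc: "s \<in> carrier (H V)" using sl line_carrier_subset by blast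
    have rb: "res (chart \<sigma>) V b \<in> line_carrier j V" by (rule line_res[OF o V bl])
    have rbc: "res (chart \<sigma>) V b \<in> carrier (H V)" using rb line_carrier_subset by blast
    have sum: "(\<Oplus>\<^bsub>sections (line j) V\<^esub>i\<in>{..<1}. a i \<odot>\<^bsub>sections (line j) V\<^esub> restriction (line j) (chart \<sigma>) V b)
        = cf V q \<odot>\<^bsub>H V\<^esub> res (chart \<sigma>) V b"
      if "a 0 = cf V q" "rg V q" for a :: "nat \<Rightarrow> ('n, 'k) func" and q
    proof -
      have "{..<1} = insert (0::nat) {}" by auto
      then show ?thesis using L.finsum_insert[of "{}" 0 "\<lambda>i. a i \<odot>\<^bsub>H V\<^esub> res (chart \<sigma>) V b"]
          line_smult[OF V(1) that(2) rb] that(1) L.r_zero by simp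
    qed
    have cdb: "cd V (cf V q \<odot>\<^bsub>H V\<^esub> res (chart \<sigma>) V b) = (\<lambda>k. (q * m j) * qvec (e j) k)" if "rg V q" "V \<noteq> {}" for q
      using cd_smult[OF V(1) rbc that(1)] cd_res[OF o V(1) that(2) V(2) b(1)] b(2) by (simp add: mult.assoc)
    obtain q where q: "cd V s = (\<lambda>k. q * qvec (e j) k)" using sl unfolding line_carrier_def by blast
    define a where "a = (if V = {} then 0 else q * m' j)"
    have ra: "rg V a" unfolding rg_def
    proof
      fix y assume y: "y \<in> V"
      have "cd V s \<in> Lam y" using cd_in_Gam[OF V(1) sc] y by (simp add: Gam_def)
      then obtain c where c: "c \<in> loc y" "pr j (cd V s) = c * m j" using ma V(2) y by blast
      have "q = c * m j" using c(2) unfolding q pr_qvec[OF j j] by simp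
      then have "a = c" using y mm by (auto simp: a_def mult.assoc)
      then show "a \<in> loc y" using c(1) by simp
    qed
    have sa: "s = cf V a \<odot>\<^bsub>H V\<^esub> res (chart \<sigma>) V b"
    proof (cases "V = {}")
      case True
      then show ?thesis using section_empty sc H_smult_closed[OF V(1) ra rbc] by simp
    next
      case False
      have "q * (m' j * m j) = q" using mm by (simp add: mult.commute)
      then have "a * m j = q" using False by (simp add: a_def mult.assoc)
      then show ?thesis using cdb[OF ra False] q by (intro cd_inj[OF V(1) sc H_smult_closed[OF V(1) ra rbc]]) simp
    qed
    show ?thesis
    proof (rule ex1I[of _ "\<lambda>i\<in>{..<1}. cf V a"])
      let ?a = "\<lambda>i\<in>{..<1::nat}. cf V a"
      have P: "?a \<in> {..<1} \<rightarrow>\<^sub>E regular_functions V" using rg_regular[OF V(1), of a] ra by (auto simp: PiE_def)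
      have S: "(\<Oplus>\<^bsub>sections (line j) V\<^esub>i\<in>{..<1}. ?a i \<odot>\<^bsub>sections (line j) V\<^esub> restriction (line j) (chart \<sigma>) V b)
          = cf V a \<odot>\<^bsub>H V\<^esub> res (chart \<sigma>) V b"
        by (rule sum[OF _ ra]) simp
      show "?a \<in> {..<1} \<rightarrow>\<^sub>E regular_functions V \<and>
          s = (\<Oplus>\<^bsub>sections (line j) V\<^esub>i\<in>{..<1}. ?a i \<odot>\<^bsub>sections (line j) V\<^esub> restriction (line j) (chart \<sigma>) V b)"
        by (rule conjI[OF P trans[OF sa S[symmetric]]])
      fix c assume c: "c \<in> {..<1::nat} \<rightarrow>\<^sub>E regular_functions V \<and>
          s = (\<Oplus>\<^bsub>sections (line j) V\<^esub>i\<in>{..<1}. c i \<odot>\<^bsub>sections (line j) V\<^esub> restriction (line j) (chart \<sigma>) V b)"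
      then have "c 0 \<in> regular_functions V" by auto
      then obtain p where p: "c 0 = cf V p" "\<forall>x\<in>V. p \<in> loc x" by (rule regular_functions_cf[OF V(1)])
      have rp: "rg V p" using p(2) by (simp add: rg_def)
      have sp: "s = cf V p \<odot>\<^bsub>H V\<^esub> res (chart \<sigma>) V b" using c sum[of c p, OF p(1) rp] by simp
      have "cf V p = cf V a"
      proof (cases "V = {}")
        case True then show ?thesis by (simp add: cf_empty)
      next
        case False
        have "(\<lambda>k. (p * m j) * qvec (e j) k) = (\<lambda>k. (a * m j) * qvec (e j) k)"
          using cdb[OF rp False] cdb[OF ra False] sp sa by metis
        then have "p * m j = a * m j" by (rule qvec_cancel[OF j])
        then have "p * (m j * m' j) = a * (m j * m' j)" unfolding mult.assoc[symmetric] by simp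
        then show ?thesis using mm by simp
      qed
      then have "c i = (\<lambda>i\<in>{..<1}. cf V a) i" if "i \<in> {..<1}" for i using p(1) that by auto
      then show "c = (\<lambda>i\<in>{..<1}. cf V a)" using c by (intro extensionalityI[of c "{..<1}"]) (auto simp: PiE_def)
    qed
  qed
  show "\<exists>W b. zariski_open W \<and> x \<in> W \<and> (\<forall>i<1::nat. b i \<in> carrier (sections (line j) W)) \<and>
      (\<forall>V. zariski_open V \<and> V \<subseteq> W \<longrightarrow> (\<forall>s\<in>carrier (sections (line j) V).
         \<exists>!a. a \<in> {..<1} \<rightarrow>\<^sub>E regular_functions V \<and>
           s = (\<Oplus>\<^bsub>sections (line j) V\<^esub>i\<in>{..<1}. a i \<odot>\<^bsub>sections (line j) V\<^esub> restriction (line j) W V (b i))))"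
  proof (intro exI[of _ "chart \<sigma>"] exI[of _ "\<lambda>_. b"] conjI allI impI ballI; (elim conjE)?)
    show "zariski_open (chart \<sigma>)" by (rule o)
    show "x \<in> chart \<sigma>" by (rule s(2))
    show "b \<in> carrier (sections (line j) (chart \<sigma>))" using bl by simp
    fix V v assume V: "zariski_open V" "V \<subseteq> chart \<sigma>" and v: "v \<in> carrier (sections (line j) V)"
    from v have "v \<in> line_carrier j V" by simp
    then show "\<exists>!a. a \<in> {..<1::nat} \<rightarrow>\<^sub>E regular_functions V \<and>
           v = (\<Oplus>\<^bsub>sections (line j) V\<^esub>i\<in>{..<1}. a i \<odot>\<^bsub>sections (line j) V\<^esub> restriction (line j) (chart \<sigma>) V b)"
      by (rule ex1[OF V])
  qed
qed

text \<open>The factor \<open>q\<close> of a section on the line is a Laurent polynomial, recovered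
  from a coordinate in which \<open>e j\<close> does not vanish. The coaction replaces it by one of
  its terms and keeps the direction.\<close>

lemma line_coaction:
  assumes s: "\<sigma> \<in> \<Sigma>" and j: "j < n" and t: "t \<in> line_carrier j (chart \<sigma>)"
  shows "coaction F \<sigma> t u \<in> line_carrier j (chart \<sigma>)"
proof -
  obtain q where tc: "t \<in> carrier (H (chart \<sigma>))" and q: "cd (chart \<sigma>) t = (\<lambda>k. q * qvec (e j) k)"
    using t unfolding line_carrier_def by blast
  obtain k0 where k0: "e j k0 \<noteq> 0" using qvec_nonzero[OF j] by blast
  define g where "g = crd \<sigma> t k0 * mterm 0 (inverse (e j k0))"
  have "of_laurent (crd \<sigma> t k0) = q * qvec (e j) k0" using of_laurent_crd[OF s tc, of k0] q by simp
  then have "of_laurent g = q * (qvec (e j) k0 * of_laurent (mterm 0 (inverse (e j k0))))"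
    by (simp add: g_def mult.assoc)
  also have "qvec (e j) k0 * of_laurent (mterm 0 (inverse (e j k0))) = 1"
    unfolding qvec_def of_laurent_mult[symmetric] mult_single using k0 by simp
  finally have qg: "q = of_laurent g" by simp
  have "of_laurent (crd \<sigma> t k) = of_laurent (mterm 0 (e j k) * g)" for k
    using of_laurent_crd[OF s tc, of k] q qg by (simp add: qvec_def mult.commute)
  then have ck: "crd \<sigma> t k = mterm 0 (e j k) * g" for k by (simp only: of_laurent_eq_iff)
  have "cd (chart \<sigma>) (coaction F \<sigma> t u) k = of_laurent (mterm u (coef g u)) * qvec (e j) k" for k
  proof -
    have "crd \<sigma> (coaction F \<sigma> t u) k = mterm u (coef g u) * mterm 0 (e j k)"
      unfolding crd_coaction[OF s tc] ck coef_mterm_mult by (simp add: mult_single mult.commute)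
    then show ?thesis using of_laurent_crd[OF s co_closed[OF s tc], of u k] by (simp add: qvec_def)
  qed
  then show ?thesis by (intro line_carrierI[OF zariski_open_chart[OF s] co_closed[OF s tc]] ext)
qed

lemma line_linearized:
  assumes j: "j < n" shows "torus_linearized (line j)"
proof -
  have "(\<Oplus>\<^bsub>sections (line j) (chart \<sigma>)\<^esub>u\<in>{u. coaction F \<sigma> t u \<noteq> \<zero>\<^bsub>H (chart \<sigma>)\<^esub>}. coaction F \<sigma> t u) = t"
    if s: "\<sigma> \<in> \<Sigma>" and t: "t \<in> line_carrier j (chart \<sigma>)" for \<sigma> t
  proof -
    note o = zariski_open_chart[OF s]
    have tc: "t \<in> carrier (H (chart \<sigma>))" using t line_carrier_subset by blast
    let ?A = "{u. coaction F \<sigma> t u \<noteq> \<zero>\<^bsub>H (chart \<sigma>)\<^esub>}"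
    have "finsum ((H (chart \<sigma>))\<lparr>carrier := line_carrier j (chart \<sigma>)\<rparr>) (coaction F \<sigma> t) ?A = finsum (H (chart \<sigma>)) (coaction F \<sigma> t) ?A"
      by (rule finsum_carrier_update[OF H_abelian_monoid[OF o] line_abelian_monoid[OF o] line_carrier_subset co_finite[OF s tc]])
        (rule line_coaction[OF s j t])
    then show ?thesis using co_sum[OF s tc] by simp
  qed note sum = this
  have c: "t \<in> line_carrier j W \<Longrightarrow> t \<in> carrier (H W)" for t W using line_carrier_subset by blast
  show ?thesis
    unfolding torus_linearized_def Let_def regular_of_cf
  proof (intro conjI ballI allI impI)
    fix \<sigma> t assume s: "\<sigma> \<in> \<Sigma>" and t': "t \<in> carrier (sections (line j) (chart \<sigma>))"
    then have t: "t \<in> line_carrier j (chart \<sigma>)" by simp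
    note tc = c[OF t]
    show "coaction (line j) \<sigma> t u \<in> carrier (sections (line j) (chart \<sigma>))" for u using line_coaction[OF s j t] by simp
    show "finite {u. coaction (line j) \<sigma> t u \<noteq> \<zero>\<^bsub>sections (line j) (chart \<sigma>)\<^esub>}" using co_finite[OF s tc] by simp
    show "(\<Oplus>\<^bsub>sections (line j) (chart \<sigma>)\<^esub>u\<in>{u. coaction (line j) \<sigma> t u \<noteq> \<zero>\<^bsub>sections (line j) (chart \<sigma>)\<^esub>}. coaction (line j) \<sigma> t u) = t"
      using sum[OF s t] by simp
    show "coaction (line j) \<sigma> (coaction (line j) \<sigma> t u) w = (if w = u then coaction (line j) \<sigma> t u else \<zero>\<^bsub>sections (line j) (chart \<sigma>)\<^esub>)" for u w
      using co_co[OF s tc, of u w] by simp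
    show "coaction (line j) \<sigma> (t \<oplus>\<^bsub>sections (line j) (chart \<sigma>)\<^esub> t2) u =
        coaction (line j) \<sigma> t u \<oplus>\<^bsub>sections (line j) (chart \<sigma>)\<^esub> coaction (line j) \<sigma> t2 u"
      if "t2 \<in> carrier (sections (line j) (chart \<sigma>))" for t2 u
      using co_add[OF s tc, of t2 u] c[of t2] that by simp
  next
    fix \<sigma> u a t w assume s: "\<sigma> \<in> \<Sigma>" and m: "mterm u a \<in> chart_ring \<sigma>" and t: "t \<in> carrier (sections (line j) (chart \<sigma>))"
    show "coaction (line j) \<sigma> (cf (chart \<sigma>) (of_laurent (mterm u a)) \<odot>\<^bsub>sections (line j) (chart \<sigma>)\<^esub> t) w =
        cf (chart \<sigma>) (of_laurent (mterm u a)) \<odot>\<^bsub>sections (line j) (chart \<sigma>)\<^esub> coaction (line j) \<sigma> t (w - u)"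
      using co_smult[OF s _ m] c t by simp
  next
    fix \<sigma> \<tau> t u assume s: "\<sigma> \<in> \<Sigma>" "\<tau> \<in> \<Sigma>" "\<tau> \<subseteq> \<sigma>" and t: "t \<in> carrier (sections (line j) (chart \<sigma>))"
    show "restriction (line j) (chart \<sigma>) (chart \<tau>) (coaction (line j) \<sigma> t u) =
        coaction (line j) \<tau> (restriction (line j) (chart \<sigma>) (chart \<tau>) t) u"
      using co_res[OF s(1) _ s(2,3)] c t by simp
  qed
qed

lemma line_toric: "j < n \<Longrightarrow> toric_line_bundle (line j)"
  unfolding toric_vector_bundle_def vector_bundle_def
  by (intro conjI line_sheaf line_locally_free line_linearized)

section \<open>The splitting isomorphism\<close>

definition proj :: "nat \<Rightarrow> ('n, 'k) point set \<Rightarrow> 'e \<Rightarrow> 'e" where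
  "proj j W s = (SOME t. t \<in> carrier (H W) \<and> cd W t = (\<lambda>k. pr j (cd W s) * qvec (e j) k))"

lemma cd_kvec: "zariski_open W \<Longrightarrow> s \<in> carrier (H W) \<Longrightarrow> cd W s \<in> kvec r"
  by (simp add: kvec_def cd_ge)

context
  fixes W j assumes W: "zariski_open W" and j: "j < n"
begin

lemma proj:
  assumes "s \<in> carrier (H W)"
  shows proj_closed: "proj j W s \<in> carrier (H W)" and cd_proj: "cd W (proj j W s) = (\<lambda>k. pr j (cd W s) * qvec (e j) k)"
proof -
  have "\<exists>t. t \<in> carrier (H W) \<and> cd W t = (\<lambda>k. pr j (cd W s) * qvec (e j) k)"
    using cd_surj[OF W pr_Gam[OF W cd_in_Gam[OF W assms] j]] by blast
  from someI_ex[OF this] show "proj j W s \<in> carrier (H W)" "cd W (proj j W s) = (\<lambda>k. pr j (cd W s) * qvec (e j) k)"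
    unfolding proj_def by simp_all
qed

lemma proj_line: "s \<in> carrier (H W) \<Longrightarrow> proj j W s \<in> line_carrier j W"
  by (rule line_carrierI[OF W proj_closed cd_proj])

lemma proj_eqI:
  assumes "s \<in> carrier (H W)" "t \<in> carrier (H W)" "cd W t = (\<lambda>k. pr j (cd W s) * qvec (e j) k)"
  shows "proj j W s = t"
  by (rule cd_inj[OF W proj_closed[OF assms(1)] assms(2)]) (simp only: cd_proj[OF assms(1)] assms(3))

lemma proj_add:
  assumes s: "s \<in> carrier (H W)" "t \<in> carrier (H W)"
  shows "proj j W (s \<oplus>\<^bsub>H W\<^esub> t) = proj j W s \<oplus>\<^bsub>H W\<^esub> proj j W t"
  by (rule proj_eqI)
    (simp_all add: H_add_closed[OF W] s proj_closed cd_add[OF W] cd_proj pr_add distrib_right)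

lemma proj_smult:
  assumes s: "s \<in> carrier (H W)" and q: "rg W q"
  shows "proj j W (cf W q \<odot>\<^bsub>H W\<^esub> s) = cf W q \<odot>\<^bsub>H W\<^esub> proj j W s"
  by (rule proj_eqI)
    (simp_all add: H_smult_closed[OF W q] s proj_closed cd_smult[OF W _ q] cd_proj pr_smult mult.assoc)

end

lemma proj_res:
  assumes W: "zariski_open W" and V: "zariski_open V" "V \<subseteq> W" and j: "j < n" and s: "s \<in> carrier (H W)"
  shows "proj j V (res W V s) = res W V (proj j W s)"
proof (cases "V = {}")
  case True
  have "proj j V (res W V s) \<in> carrier (H V)" "res W V (proj j W s) \<in> carrier (H V)"
    using proj_closed[OF V(1) j res_closed[OF W V s]] res_closed[OF W V proj_closed[OF W j s]] by auto
  then show ?thesis unfolding True by (rule section_empty)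
next
  case False
  show ?thesis
    by (rule proj_eqI[OF V(1) j])
      (simp_all add: res_closed[OF W V] s proj_closed[OF W j] cd_res[OF W V(1) False V(2)] cd_proj[OF W j])
qed

text \<open>The projection is given by a matrix over \<open>K\<close>, so it commutes with
  extracting the terms of one exponent.\<close>

lemma proj_coaction:
  assumes s: "\<sigma> \<in> \<Sigma>" and j: "j < n" and t: "t \<in> carrier (H (chart \<sigma>))"
  shows "proj j (chart \<sigma>) (coaction F \<sigma> t u) = coaction F \<sigma> (proj j (chart \<sigma>) t) u"
proof -
  note o = zariski_open_chart[OF s]
  define g where "g t = (\<Sum>k<r. mterm 0 (dualc k j) * crd \<sigma> t k)" for t
  have pg: "pr j (cd (chart \<sigma>) t) = of_laurent (g t)" if "t \<in> carrier (H (chart \<sigma>))" for t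
    unfolding pr_def g_def of_laurent_sum of_laurent_mult of_laurent_crd[OF s that] by (simp add: mult.commute)
  have crdp: "crd \<sigma> (proj j (chart \<sigma>) t) k = mterm 0 (e j k) * g t" if "t \<in> carrier (H (chart \<sigma>))" for t k
  proof -
    have "of_laurent (crd \<sigma> (proj j (chart \<sigma>) t) k) = of_laurent (mterm 0 (e j k) * g t)"
      unfolding of_laurent_crd[OF s proj_closed[OF o j that]] cd_proj[OF o j that] pg[OF that] qvec_def of_laurent_mult
      by (rule mult.commute)
    then show ?thesis by (simp only: of_laurent_eq_iff)
  qed
  have gc: "g (coaction F \<sigma> t u) = mterm u (coef (g t) u)"
    unfolding g_def crd_coaction[OF s t] by (simp add: mult_single lookup_sum coef_mterm_mult mterm_sum)
  show ?thesis
  proof (rule crd_inj[OF s proj_closed[OF o j co_closed[OF s t]] co_closed[OF s proj_closed[OF o j t]]], rule ext)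
    fix k
    show "crd \<sigma> (proj j (chart \<sigma>) (coaction F \<sigma> t u)) k = crd \<sigma> (coaction F \<sigma> (proj j (chart \<sigma>) t) u) k"
      unfolding crdp[OF co_closed[OF s t]] crd_coaction[OF s proj_closed[OF o j t]] crdp[OF t] gc coef_mterm_mult
      by (simp add: mult_single)
  qed
qed

definition splitting :: "('n, 'k) point set \<Rightarrow> 'e \<Rightarrow> nat \<Rightarrow> 'e" where
  "splitting W s = (\<lambda>j\<in>{..<n}. proj j W s)"

lemma direct_sum_simps:
  "carrier (sections (direct_sum n line) W) = (\<Pi>\<^sub>E i\<in>{..<n}. line_carrier i W)"
  "x \<oplus>\<^bsub>sections (direct_sum n line) W\<^esub> y = (\<lambda>i\<in>{..<n}. x i \<oplus>\<^bsub>H W\<^esub> y i)"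
  "a \<odot>\<^bsub>sections (direct_sum n line) W\<^esub> x = (\<lambda>i\<in>{..<n}. a \<odot>\<^bsub>H W\<^esub> x i)"
  "restriction (direct_sum n line) W V x = (\<lambda>i\<in>{..<n}. res W V (x i))"
  "coaction (direct_sum n line) \<sigma> x u = (\<lambda>i\<in>{..<n}. coaction F \<sigma> (x i) u)"
  by (simp_all add: direct_sum_def module_direct_sum_def)

text \<open>Coordinates are recovered from the projections by \<open>pr_expansion\<close>, which
  gives injectivity. A tuple of sections of the lines is hit by its sum, whose components
  \<open>pr_lc\<close> reads off.\<close>

lemma splitting_bij:
  assumes W: "zariski_open W"
  shows "bij_betw (splitting W) (carrier (H W)) (\<Pi>\<^sub>E i\<in>{..<n}. line_carrier i W)"
proof (rule bij_betw_imageI)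
  show "inj_on (splitting W) (carrier (H W))"
  proof (rule inj_onI)
    fix s t assume s: "s \<in> carrier (H W)" "t \<in> carrier (H W)" and eq: "splitting W s = splitting W t"
    have "pr j (cd W s) = pr j (cd W t)" if j: "j < n" for j
    proof -
      have "proj j W s = proj j W t" using fun_cong[OF eq, of j] j by (simp add: splitting_def)
      then have "(\<lambda>k. pr j (cd W s) * qvec (e j) k) = (\<lambda>k. pr j (cd W t) * qvec (e j) k)"
        unfolding cd_proj[OF W j s(1), symmetric] cd_proj[OF W j s(2), symmetric] by simp
      then show ?thesis by (rule qvec_cancel[OF j])
    qed
    then have "lc n (\<lambda>j. pr j (cd W s)) (\<lambda>j. qvec (e j)) = lc n (\<lambda>j. pr j (cd W t)) (\<lambda>j. qvec (e j))"
      by (intro lc_cong) auto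
    then have "cd W s = cd W t"
      using pr_expansion[OF cd_kvec[OF W s(1)]] pr_expansion[OF cd_kvec[OF W s(2)]] by simp
    then show "s = t" by (rule cd_inj[OF W s])
  qed
  show "splitting W ` carrier (H W) = (\<Pi>\<^sub>E i\<in>{..<n}. line_carrier i W)"
  proof
    show "splitting W ` carrier (H W) \<subseteq> (\<Pi>\<^sub>E i\<in>{..<n}. line_carrier i W)"
    proof (rule image_subsetI)
      fix s assume s: "s \<in> carrier (H W)"
      show "splitting W s \<in> (\<Pi>\<^sub>E i\<in>{..<n}. line_carrier i W)"
        unfolding splitting_def restrict_PiE_iff using proj_line[OF W _ s] by simp
    qed
    show "(\<Pi>\<^sub>E i\<in>{..<n}. line_carrier i W) \<subseteq> splitting W ` carrier (H W)"
    proof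
      fix y assume y: "y \<in> (\<Pi>\<^sub>E i\<in>{..<n}. line_carrier i W)"
      then have yl: "y i \<in> line_carrier i W" if "i < n" for i using that by auto
      then have yc: "y i \<in> carrier (H W)" if "i < n" for i using line_carrier_subset that by blast
      have "\<exists>q. cd W (y i) = (\<lambda>k. q * qvec (e i) k)" if "i < n" for i
        using yl[OF that] unfolding line_carrier_def by blast
      then obtain q where q: "\<And>i. i < n \<Longrightarrow> cd W (y i) = (\<lambda>k. q i * qvec (e i) k)" by metis
      interpret abelian_monoid "H W" by (rule H_abelian_monoid[OF W])
      let ?s = "\<Oplus>\<^bsub>H W\<^esub>i\<in>{..<n}. y i"
      have s: "?s \<in> carrier (H W)" using yc by (intro finsum_closed) auto
      have cs: "cd W ?s = lc n q (\<lambda>i. qvec (e i))"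
      proof
        fix k
        have "cd W ?s k = (\<Sum>i<n. cd W (y i) k)" by (rule cd_finsum[OF W]) (use yc in auto)
        then show "cd W ?s k = lc n q (\<lambda>i. qvec (e i)) k" by (simp add: lc_def q)
      qed
      have p: "proj j W ?s = y j" if j: "j < n" for j
        by (rule proj_eqI[OF W j s yc[OF j]]) (simp add: cs pr_lc[OF j] q[OF j])
      have "splitting W ?s = y"
        by (rule extensionalityI[of _ "{..<n}"]) (use y p in \<open>auto simp: splitting_def PiE_def\<close>)
      then show "y \<in> splitting W ` carrier (H W)" by (rule image_eqI[OF sym s])
    qed
  qed
qed

lemma splitting_isomorphism: "equivariant_isomorphism F (direct_sum n line) splitting"
  unfolding equivariant_isomorphism_def direct_sum_simps
proof (intro conjI allI impI ballI; (elim conjE)?)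
  fix W assume W: "zariski_open W"
  show "bij_betw (splitting W) (carrier (H W)) (\<Pi>\<^sub>E i\<in>{..<n}. line_carrier i W)" by (rule splitting_bij[OF W])
  show "splitting W (s \<oplus>\<^bsub>H W\<^esub> t) = (\<lambda>i\<in>{..<n}. splitting W s i \<oplus>\<^bsub>H W\<^esub> splitting W t i)"
    if "s \<in> carrier (H W)" "t \<in> carrier (H W)" for s t
    unfolding splitting_def by (rule restrict_ext) (simp add: proj_add[OF W _ that])
  show "splitting W (a \<odot>\<^bsub>H W\<^esub> s) = (\<lambda>i\<in>{..<n}. a \<odot>\<^bsub>H W\<^esub> splitting W s i)"
    if a: "a \<in> regular_functions W" and s: "s \<in> carrier (H W)" for a s
  proof -
    obtain q where q: "a = cf W q" "\<forall>x\<in>W. q \<in> loc x" by (rule regular_functions_cf[OF W a])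
    have "rg W q" using q(2) by (simp add: rg_def)
    then show ?thesis unfolding splitting_def q(1) by (intro restrict_ext) (simp add: proj_smult[OF W _ s])
  qed
next
  fix W V s assume "zariski_open W" "zariski_open V" "V \<subseteq> W" "s \<in> carrier (H W)"
  then show "splitting V (res W V s) = (\<lambda>i\<in>{..<n}. res W V (splitting W s i))"
    unfolding splitting_def by (intro restrict_ext) (simp add: proj_res)
next
  fix \<sigma> s u assume "\<sigma> \<in> \<Sigma>" "s \<in> carrier (H (chart \<sigma>))"
  then show "splitting (chart \<sigma>) (coaction F \<sigma> s u) = (\<lambda>i\<in>{..<n}. coaction F \<sigma> (splitting (chart \<sigma>) s i) u)"
    unfolding splitting_def by (intro restrict_ext) (simp add: proj_coaction)
qed

lemma common_frame_splits: "splits_equivariantly F"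
  unfolding splits_equivariantly_def using line_toric splitting_isomorphism by blast

end

end

section \<open>Common frames from splittings\<close>

context torus_framed_bundle
begin

section \<open>Line bundles seen from the torus\<close>

lemma torus_generator_mult:
  assumes r: "r = 1" and t: "t \<in> carrier HT" and c: "crd {0} t = (\<lambda>j. if j = 0 then f else 0)"
  shows "t = regular_of (chart {0}) f \<odot>\<^bsub>HT\<^esub> t0 0"
proof (rule crd_inj[OF s0 t])
  have t0: "t0 0 \<in> carrier HT" using frame_closed[OF torus_frame] r by simp
  show "regular_of (chart {0}) f \<odot>\<^bsub>HT\<^esub> t0 0 \<in> carrier HT" by (rule crd_smult(1)[OF s0 t0 R0])
  show "crd {0} t = crd {0} (regular_of (chart {0}) f \<odot>\<^bsub>HT\<^esub> t0 0)"
    unfolding c crd_smult(2)[OF s0 t0 R0] using crd_t0[of 0] r by auto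
qed

lemma kvec_1: "v \<in> kvec 1 \<Longrightarrow> v = (\<lambda>j. if j = 0 then v 0 else 0)" for v :: "nat \<Rightarrow> 'a::zero"
  by (auto simp: kvec_def)

text \<open>In rank one the basis in \<open>PS_frame\<close> is a single nonzero scalar, which
  becomes \<open>c\<close>.\<close>

lemma line_bundle_image:
  assumes r: "r = 1" and s: "\<sigma> \<in> \<Sigma>"
  shows "\<exists>u c. c \<noteq> 0 \<and> res (chart \<sigma>) (chart {0}) ` carrier (H (chart \<sigma>)) =
    {regular_of (chart {0}) (f * mterm (- u) c) \<odot>\<^bsub>HT\<^esub> t0 0 | f. f \<in> chart_ring \<sigma>}"
proof -
  note o = zariski_open_chart[OF s]
  have z: "{0} \<subseteq> \<sigma>" using zero_in_cone[OF s] by simp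
  obtain u e where ue: "kbasis 1 1 e" "PS \<sigma> = pspan \<sigma> 1 u e" using PS_frame[OF s] unfolding r by blast
  have e0: "e 0 j = 0" if "j \<noteq> 0" for j
    using ue(1) that by (auto simp: kbasis_def kvec_def)
  have "e 0 0 \<noteq> 0"
  proof
    assume "e 0 0 = 0"
    then have "e 0 j = 0" for j using e0[of j] by (cases "j = 0") simp_all
    then have "lc 1 (\<lambda>_. 1) e = lc 1 (\<lambda>_. 0) e" by (simp add: lc_def)
    moreover have "lc_free 1 e" using ue(1) by (simp only: kbasis_def)
    ultimately show False using lc_freeD[of 1 e "\<lambda>_. 1" "\<lambda>_. 0" 0] by simp
  qed
  have image: "res (chart \<sigma>) (chart {0}) t = regular_of (chart {0}) (f * mterm (- u 0) (e 0 0)) \<odot>\<^bsub>HT\<^esub> t0 0"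
    if t: "t \<in> carrier (H (chart \<sigma>))" and c: "crd \<sigma> t = (\<lambda>j. f * mterm (- u 0) (e 0 j))" for t f
  proof (rule torus_generator_mult[OF r])
    show "res (chart \<sigma>) (chart {0}) t \<in> carrier HT" by (rule res_closed[OF o o0 chart_mono[OF s s0 z] t])
    show "crd {0} (res (chart \<sigma>) (chart {0}) t) = (\<lambda>j. if j = 0 then f * mterm (- u 0) (e 0 0) else 0)"
      unfolding crd_res[OF s s0 z t] c using e0 by auto
  qed
  have "res (chart \<sigma>) (chart {0}) ` carrier (H (chart \<sigma>)) =
    {regular_of (chart {0}) (f * mterm (- u 0) (e 0 0)) \<odot>\<^bsub>HT\<^esub> t0 0 | f. f \<in> chart_ring \<sigma>}"
  proof (intro Set.set_eqI iffI)
    fix y assume "y \<in> res (chart \<sigma>) (chart {0}) ` carrier (H (chart \<sigma>))"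
    then obtain t where t: "t \<in> carrier (H (chart \<sigma>))" "y = res (chart \<sigma>) (chart {0}) t" by blast
    have "crd \<sigma> t \<in> pspan \<sigma> 1 u e" using crd_in_PS[OF s t(1)] unfolding ue(2) .
    then obtain f where "crd \<sigma> t = (\<lambda>j. \<Sum>i<1. f i * mterm (- u i) (e i j))" "\<forall>i<(1::nat). f i \<in> chart_ring \<sigma>"
      unfolding pspan_def[OF s] by blast
    then show "y \<in> {regular_of (chart {0}) (f * mterm (- u 0) (e 0 0)) \<odot>\<^bsub>HT\<^esub> t0 0 | f. f \<in> chart_ring \<sigma>}"
      using image[OF t(1), of "f 0"] t(2) by auto
  next
    fix y assume "y \<in> {regular_of (chart {0}) (f * mterm (- u 0) (e 0 0)) \<odot>\<^bsub>HT\<^esub> t0 0 | f. f \<in> chart_ring \<sigma>}"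
    then obtain f where f: "f \<in> chart_ring \<sigma>" "y = regular_of (chart {0}) (f * mterm (- u 0) (e 0 0)) \<odot>\<^bsub>HT\<^esub> t0 0"
      by blast
    have "(\<lambda>j. f * mterm (- u 0) (e 0 j)) \<in> pspan \<sigma> 1 u e"
      unfolding pspan_def[OF s] mem_Collect_eq by (rule exI[of _ "\<lambda>_. f"]) (simp add: f(1))
    then obtain t where "t \<in> carrier (H (chart \<sigma>))" "crd \<sigma> t = (\<lambda>j. f * mterm (- u 0) (e 0 j))"
      using crd_surj[OF s] unfolding ue(2)[symmetric] by blast
    then show "y \<in> res (chart \<sigma>) (chart {0}) ` carrier (H (chart \<sigma>))" using image f(2) by (metis image_eqI)
  qed
  then show ?thesis using \<open>e 0 0 \<noteq> 0\<close> by blast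
qed

end

context toric_setup
begin

text \<open>The facts about a toric line bundle that the converse needs, stated without coordinates
  so that they can be used for all summands at once. The clause on the zero section serves for
  tuples in which all but one component vanish.\<close>

definition torus_generator :: "('n, 'k, 'e) linearized_sheaf \<Rightarrow> 'e \<Rightarrow> bool" where
  "torus_generator L \<beta> \<longleftrightarrow> \<beta> \<in> carrier (sections L (chart {0})) \<and> coaction L {0} \<beta> 0 = \<beta> \<and>
     coaction L {0} \<zero>\<^bsub>sections L (chart {0})\<^esub> 0 = \<zero>\<^bsub>sections L (chart {0})\<^esub> \<and>
     bij_betw (\<lambda>f. regular_of (chart {0}) f \<odot>\<^bsub>sections L (chart {0})\<^esub> \<beta>) UNIV (carrier (sections L (chart {0}))) \<and>
     (\<forall>\<sigma>\<in>\<Sigma>. \<exists>u c. c \<noteq> 0 \<and> restriction L (chart \<sigma>) (chart {0}) ` carrier (sections L (chart \<sigma>)) =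
        {regular_of (chart {0}) (f * mterm (- u) c) \<odot>\<^bsub>sections L (chart {0})\<^esub> \<beta> | f. f \<in> chart_ring \<sigma>})"

lemma ex_torus_generator:
  assumes "toric_line_bundle L" shows "\<exists>\<beta>. torus_generator L \<beta>"
proof -
  have B: "toric_bundle val \<pi> \<Sigma> 1 L" by unfold_locales (rule assms)
  obtain t where t: "toric_bundle.frame val \<pi> \<Sigma> 1 L (chart {0}) t"
    "\<And>i u. i < 1 \<Longrightarrow> coaction L {0} (t i) u = (if u = 0 then t i else \<zero>\<^bsub>sections L (chart {0})\<^esub>)"
    by (rule toric_bundle.ex_torus_frame[OF B]) blast
  interpret torus_framed_bundle val \<pi> \<Sigma> 1 L t
    by (rule torus_framed_bundle.intro[OF B], unfold_locales) (use t in auto)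
  have t0: "t 0 \<in> carrier HT" using frame_closed[OF torus_frame] by simp
  have c: "crd {0} (regular_of (chart {0}) f \<odot>\<^bsub>HT\<^esub> t 0) 0 = f" for f
    unfolding crd_smult(2)[OF s0 t0 R0] using crd_t0[of 0] by simp
  have "torus_generator L (t 0)"
    unfolding torus_generator_def
  proof (intro conjI ballI)
    show "t 0 \<in> carrier HT" by (rule t0)
    show "coaction L {0} (t 0) 0 = t 0" using t(2)[of 0 0] by simp
    show "coaction L {0} \<zero>\<^bsub>HT\<^esub> 0 = \<zero>\<^bsub>HT\<^esub>"
      by (rule crd_inj[OF s0 co_closed[OF s0 H_zero_closed[OF o0]] H_zero_closed[OF o0]])
        (simp only: crd_coaction[OF s0 H_zero_closed[OF o0]] crd_zero[OF s0], simp)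
    show "bij_betw (\<lambda>f. regular_of (chart {0}) f \<odot>\<^bsub>HT\<^esub> t 0) UNIV (carrier HT)"
    proof (rule bij_betw_imageI)
      show "inj (\<lambda>f. regular_of (chart {0}) f \<odot>\<^bsub>HT\<^esub> t 0)" by (rule injI) (metis c)
      show "range (\<lambda>f. regular_of (chart {0}) f \<odot>\<^bsub>HT\<^esub> t 0) = carrier HT"
      proof (intro Set.set_eqI iffI)
        fix x assume "x \<in> carrier HT"
        then show "x \<in> range (\<lambda>f. regular_of (chart {0}) f \<odot>\<^bsub>HT\<^esub> t 0)"
          using torus_generator_mult[OF refl _ kvec_1[OF crd_kvec]] by blast
      qed (use crd_smult(1)[OF s0 t0 R0] in auto)
    qed
  qed (rule line_bundle_image[OF refl])
  then show ?thesis by blast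
qed

end

context torus_framed_bundle
begin

section \<open>The basis of the fiber given by a splitting\<close>

context
  fixes l L \<phi> \<beta>
  assumes line: "\<And>i. i < l \<Longrightarrow> toric_line_bundle (L i)"
    and iso: "equivariant_isomorphism F (direct_sum l L) \<phi>"
    and generator: "\<And>i. i < l \<Longrightarrow> torus_generator (L i) (\<beta> i)"
begin

abbreviation "HL i \<equiv> sections (L i) (chart {0})"

lemma summand_bundle: "i < l \<Longrightarrow> toric_bundle val \<pi> \<Sigma> 1 (L i)"
  by unfold_locales (rule line)

lemma generator_closed: "i < l \<Longrightarrow> \<beta> i \<in> carrier (HL i)"
  using generator unfolding torus_generator_def by blast

lemma summand_zero: "i < l \<Longrightarrow> \<zero>\<^bsub>HL i\<^esub> \<in> carrier (HL i)"
  by (rule toric_bundle.H_zero_closed[OF summand_bundle o0])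

lemma iso_bij: "zariski_open W \<Longrightarrow> bij_betw (\<phi> W) (carrier (H W)) (\<Pi>\<^sub>E i\<in>{..<l}. carrier (sections (L i) W))"
  using iso unfolding equivariant_isomorphism_def by (simp add: direct_sum_def module_direct_sum_def)

lemma iso_add:
  "s \<in> carrier HT \<Longrightarrow> t \<in> carrier HT \<Longrightarrow> \<phi> (chart {0}) (s \<oplus>\<^bsub>HT\<^esub> t) = (\<lambda>i\<in>{..<l}. \<phi> (chart {0}) s i \<oplus>\<^bsub>HL i\<^esub> \<phi> (chart {0}) t i)"
  using iso o0 unfolding equivariant_isomorphism_def by (simp add: direct_sum_def module_direct_sum_def)

lemma iso_smult:
  assumes s: "s \<in> carrier HT"
  shows "\<phi> (chart {0}) (regular_of (chart {0}) f \<odot>\<^bsub>HT\<^esub> s) = (\<lambda>i\<in>{..<l}. regular_of (chart {0}) f \<odot>\<^bsub>HL i\<^esub> \<phi> (chart {0}) s i)"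
proof -
  have "regular_of (chart {0}) f \<in> regular_functions (chart {0})"
    unfolding regular_of_cf rg_regular[OF o0] rg_def using of_laurent_in_loc_chart[OF s0 R0] by blast
  then show ?thesis using iso o0 s unfolding equivariant_isomorphism_def by (simp add: direct_sum_def module_direct_sum_def)
qed

lemma iso_res:
  "\<sigma> \<in> \<Sigma> \<Longrightarrow> s \<in> carrier (H (chart \<sigma>)) \<Longrightarrow> \<phi> (chart {0}) (res (chart \<sigma>) (chart {0}) s) =
    (\<lambda>i\<in>{..<l}. restriction (L i) (chart \<sigma>) (chart {0}) (\<phi> (chart \<sigma>) s i))"
  using iso o0 zariski_open_chart[of \<sigma>] chart_mono[of \<sigma> "{0}"] zero_cone_in_Sigma zero_in_cone[of \<sigma>]
  unfolding equivariant_isomorphism_def by (simp add: direct_sum_def)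

lemma iso_coaction:
  "s \<in> carrier HT \<Longrightarrow> \<phi> (chart {0}) (coaction F {0} s u) = (\<lambda>i\<in>{..<l}. coaction (L i) {0} (\<phi> (chart {0}) s i) u)"
  using iso zero_cone_in_Sigma unfolding equivariant_isomorphism_def by (simp add: direct_sum_def)

lemma iso_inj: "s \<in> carrier HT \<Longrightarrow> t \<in> carrier HT \<Longrightarrow> \<phi> (chart {0}) s = \<phi> (chart {0}) t \<Longrightarrow> s = t"
  using iso_bij[OF o0] by (auto simp: bij_betw_def dest: inj_onD)

lemma iso_closed: "s \<in> carrier HT \<Longrightarrow> i < l \<Longrightarrow> \<phi> (chart {0}) s i \<in> carrier (HL i)"
  using bij_betwE[OF iso_bij[OF o0]] by blast

lemma iso_zero: "\<phi> (chart {0}) \<zero>\<^bsub>HT\<^esub> = (\<lambda>i\<in>{..<l}. \<zero>\<^bsub>HL i\<^esub>)"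
proof (rule extensionalityI[of _ "{..<l}"])
  show "\<phi> (chart {0}) \<zero>\<^bsub>HT\<^esub> \<in> extensional {..<l}"
    using bij_betwE[OF iso_bij[OF o0]] H_zero_closed[OF o0] by (auto simp: PiE_def)
  fix i assume i: "i \<in> {..<l}"
  interpret M: abelian_group HT by (rule H_abelian_group[OF o0])
  interpret A: abelian_group "HL i" by (rule toric_bundle.H_abelian_group[OF summand_bundle o0]) (use i in simp)
  let ?z = "\<phi> (chart {0}) \<zero>\<^bsub>HT\<^esub> i"
  have z: "?z \<in> carrier (HL i)" using iso_closed[of "\<zero>\<^bsub>HT\<^esub>" i] i by simp
  have "\<phi> (chart {0}) (\<zero>\<^bsub>HT\<^esub> \<oplus>\<^bsub>HT\<^esub> \<zero>\<^bsub>HT\<^esub>) i = ?z \<oplus>\<^bsub>HL i\<^esub> ?z"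
    using i by (subst iso_add) auto
  then have "?z \<oplus>\<^bsub>HL i\<^esub> ?z = ?z" by simp
  then have "?z = \<zero>\<^bsub>HL i\<^esub>" using A.add.r_cancel_one[OF z z] by simp
  then show "?z = (\<lambda>i\<in>{..<l}. \<zero>\<^bsub>HL i\<^esub>) i" using i by simp
qed (rule restrict_extensional)

text \<open>The generator of summand \<open>i\<close>, carried back to \<open>F\<close>. For
  \<open>i\<close> at least \<open>l\<close> no component is singled out and the zero section
  results.\<close>

definition lift :: "nat \<Rightarrow> 'e" where
  "lift i = (SOME s. s \<in> carrier HT \<and> \<phi> (chart {0}) s = (\<lambda>j\<in>{..<l}. if j = i then \<beta> j else \<zero>\<^bsub>HL j\<^esub>))"

lemma iso_surj:
  assumes W: "zariski_open W" and y: "\<And>i. i < l \<Longrightarrow> y i \<in> carrier (sections (L i) W)"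
  shows "\<exists>s. s \<in> carrier (H W) \<and> \<phi> W s = (\<lambda>i\<in>{..<l}. y i)"
proof -
  have "(\<lambda>i\<in>{..<l}. y i) \<in> \<phi> W ` carrier (H W)"
    unfolding bij_betw_imp_surj_on[OF iso_bij[OF W]] using y by simp
  then show ?thesis by (auto simp: image_iff)
qed

lemma lift: "lift i \<in> carrier HT \<and> \<phi> (chart {0}) (lift i) = (\<lambda>j\<in>{..<l}. if j = i then \<beta> j else \<zero>\<^bsub>HL j\<^esub>)"
  unfolding lift_def
  by (rule someI_ex, rule iso_surj[OF o0]) (use generator_closed summand_zero in auto)

lemmas lift_closed = conjunct1[OF lift] and iso_lift = conjunct2[OF lift]

definition lvec :: "nat \<Rightarrow> nat \<Rightarrow> 'k" where
  "lvec i j = coef (crd {0} (lift i) j) 0"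

text \<open>The isomorphism is equivariant and the generators are invariant, so the lifts are
  invariant as well and only the exponent 0 occurs in their coordinates.\<close>

lemma crd_lift: "crd {0} (lift i) = (\<lambda>j. mterm 0 (lvec i j))"
proof -
  have "coaction F {0} (lift i) 0 = lift i"
  proof (rule iso_inj[OF co_closed[OF s0 lift_closed] lift_closed])
    show "\<phi> (chart {0}) (coaction F {0} (lift i) 0) = \<phi> (chart {0}) (lift i)"
      unfolding iso_coaction[OF lift_closed] iso_lift
      by (rule restrict_ext) (use generator in \<open>auto simp: torus_generator_def\<close>)
  qed
  then show ?thesis using crd_coaction[OF s0 lift_closed, of i 0] by (simp add: lvec_def)
qed

lemma iso_lift_sum:
  "n \<le> l \<Longrightarrow> \<phi> (chart {0}) (\<Oplus>\<^bsub>HT\<^esub>i\<in>{..<n}. regular_of (chart {0}) (g i) \<odot>\<^bsub>HT\<^esub> lift i) =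
    (\<lambda>i\<in>{..<l}. if i < n then regular_of (chart {0}) (g i) \<odot>\<^bsub>HL i\<^esub> \<beta> i else \<zero>\<^bsub>HL i\<^esub>)"
proof (induction n)
  case 0
  interpret M: abelian_monoid HT by (rule H_abelian_monoid[OF o0])
  show ?case using iso_zero by simp
next
  case (Suc n)
  interpret M: abelian_monoid HT by (rule H_abelian_monoid[OF o0])
  have c: "regular_of (chart {0}) (g i) \<odot>\<^bsub>HT\<^esub> lift i \<in> carrier HT" for i by (rule crd_smult(1)[OF s0 lift_closed R0])
  have sc: "(\<Oplus>\<^bsub>HT\<^esub>i\<in>{..<n}. regular_of (chart {0}) (g i) \<odot>\<^bsub>HT\<^esub> lift i) \<in> carrier HT" using c by (intro M.finsum_closed) auto
  have "\<phi> (chart {0}) (\<Oplus>\<^bsub>HT\<^esub>i\<in>{..<Suc n}. regular_of (chart {0}) (g i) \<odot>\<^bsub>HT\<^esub> lift i) =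
    \<phi> (chart {0}) ((\<Oplus>\<^bsub>HT\<^esub>i\<in>{..<n}. regular_of (chart {0}) (g i) \<odot>\<^bsub>HT\<^esub> lift i) \<oplus>\<^bsub>HT\<^esub> (regular_of (chart {0}) (g n) \<odot>\<^bsub>HT\<^esub> lift n))"
    by (subst finsum_lessThan_Suc[OF H_abelian_monoid[OF o0]]) (use c in auto)
  also have "\<dots> = (\<lambda>i\<in>{..<l}. if i < Suc n then regular_of (chart {0}) (g i) \<odot>\<^bsub>HL i\<^esub> \<beta> i else \<zero>\<^bsub>HL i\<^esub>)"
    unfolding iso_add[OF sc c] iso_smult[OF lift_closed] iso_lift Suc.IH[OF Suc_leD[OF Suc.prems]]
  proof (rule restrict_ext)
    fix i assume i: "i \<in> {..<l}"
    then have B: "toric_bundle val \<pi> \<Sigma> 1 (L i)" using summand_bundle by simp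
    interpret A: abelian_group "HL i" by (rule toric_bundle.H_abelian_group[OF B o0])
    have rg: "rg (chart {0}) (of_laurent f)" for f unfolding rg_def using of_laurent_in_loc_chart[OF s0 R0] by blast
    have c: "regular_of (chart {0}) f \<odot>\<^bsub>HL i\<^esub> \<beta> i \<in> carrier (HL i)" for f
      unfolding regular_of_cf by (rule toric_bundle.H_smult_closed[OF B o0 rg generator_closed]) (use i in simp)
    moreover have "regular_of (chart {0}) f \<odot>\<^bsub>HL i\<^esub> \<zero>\<^bsub>HL i\<^esub> = \<zero>\<^bsub>HL i\<^esub>" for f
      unfolding regular_of_cf by (rule toric_bundle.H_smult_zero_right[OF B o0 rg])
    moreover note A.l_zero[OF c] A.r_zero[OF c] A.l_zero[OF A.zero_closed]
    ultimately show "(\<lambda>i\<in>{..<l}. if i < n then regular_of (chart {0}) (g i) \<odot>\<^bsub>HL i\<^esub> \<beta> i else \<zero>\<^bsub>HL i\<^esub>) i \<oplus>\<^bsub>HL i\<^esub>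
        (\<lambda>i\<in>{..<l}. regular_of (chart {0}) (g n) \<odot>\<^bsub>HL i\<^esub> (\<lambda>j\<in>{..<l}. if j = n then \<beta> j else \<zero>\<^bsub>HL j\<^esub>) i) i =
        (if i < Suc n then regular_of (chart {0}) (g i) \<odot>\<^bsub>HL i\<^esub> \<beta> i else \<zero>\<^bsub>HL i\<^esub>)"
      using i by (cases i n rule: linorder_cases) auto
  qed
  finally show ?case .
qed

text \<open>A section is determined by its components, so it equals the combination of the lifts
  with the same coefficients.\<close>

lemma crd_summands:
  assumes t: "t \<in> carrier HT" and g: "\<And>i. i < l \<Longrightarrow> \<phi> (chart {0}) t i = regular_of (chart {0}) (g i) \<odot>\<^bsub>HL i\<^esub> \<beta> i"
  shows "crd {0} t j = (\<Sum>i<l. g i * mterm 0 (lvec i j))"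
proof -
  interpret M: abelian_monoid HT by (rule H_abelian_monoid[OF o0])
  have c: "regular_of (chart {0}) (g i) \<odot>\<^bsub>HT\<^esub> lift i \<in> carrier HT" for i by (rule crd_smult(1)[OF s0 lift_closed R0])
  let ?s = "\<Oplus>\<^bsub>HT\<^esub>i\<in>{..<l}. regular_of (chart {0}) (g i) \<odot>\<^bsub>HT\<^esub> lift i"
  have sc: "?s \<in> carrier HT" using c by (intro M.finsum_closed) auto
  have "t = ?s"
  proof (rule iso_inj[OF t sc], rule extensionalityI[of _ "{..<l}"])
    show "\<phi> (chart {0}) t \<in> extensional {..<l}" "\<phi> (chart {0}) ?s \<in> extensional {..<l}"
      using bij_betwE[OF iso_bij[OF o0]] t sc by (auto simp: PiE_def)
  qed (simp add: iso_lift_sum g)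
  then have "crd {0} t j = crd {0} ?s j" by simp
  also have "\<dots> = (\<Sum>i<l. crd {0} (regular_of (chart {0}) (g i) \<odot>\<^bsub>HT\<^esub> lift i) j)"
    by (rule crd_finsum[OF s0]) (use c in auto)
  also have "\<dots> = (\<Sum>i<l. g i * mterm 0 (lvec i j))"
    by (simp add: crd_smult(2)[OF s0 lift_closed R0] crd_lift)
  finally show ?thesis .
qed

lemma ex_summands:
  assumes t: "t \<in> carrier HT"
  shows "\<exists>g. \<forall>i<l. \<phi> (chart {0}) t i = regular_of (chart {0}) (g i) \<odot>\<^bsub>HL i\<^esub> \<beta> i"
proof -
  have "\<exists>f. \<phi> (chart {0}) t i = regular_of (chart {0}) f \<odot>\<^bsub>HL i\<^esub> \<beta> i" if i: "i < l" for i
    using generator[OF i] iso_closed[OF t i] unfolding torus_generator_def bij_betw_def by auto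
  then show ?thesis by metis
qed

text \<open>A relation gives a section with vanishing coordinates, hence with vanishing components,
  and the generators are torsion-free. For spanning, the section with constant coordinates
  \<open>v\<close> is decomposed into the summands, and coefficients are compared at the exponent
  0.\<close>

lemma lvec_kbasis: "kbasis r l lvec"
  unfolding kbasis_def
proof (intro conjI allI impI ballI)
  show "lvec i \<in> kvec r" for i using crd_kvec[OF lift_closed, of i] by (simp add: lvec_def kvec_def)
  show "lc_free l lvec" unfolding lc_free_def
  proof (intro allI impI)
    fix c i assume c: "lc l c lvec = (\<lambda>_. 0)" and i: "i < l"
    have rg: "rg (chart {0}) (of_laurent f)" for f unfolding rg_def using of_laurent_in_loc_chart[OF s0 R0] by blast
    have cl: "regular_of (chart {0}) f \<odot>\<^bsub>HL k\<^esub> \<beta> k \<in> carrier (HL k)" if "k < l" for f k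
      unfolding regular_of_cf by (rule toric_bundle.H_smult_closed[OF summand_bundle[OF that] o0 rg generator_closed[OF that]])
    obtain t where t: "t \<in> carrier HT" "\<phi> (chart {0}) t = (\<lambda>k\<in>{..<l}. regular_of (chart {0}) (mterm 0 (c k)) \<odot>\<^bsub>HL k\<^esub> \<beta> k)"
      using iso_surj[OF o0, of "\<lambda>k. regular_of (chart {0}) (mterm 0 (c k)) \<odot>\<^bsub>HL k\<^esub> \<beta> k"] cl by blast
    have "crd {0} t j = mterm 0 (lc l c lvec j)" for j
      using crd_summands[OF t(1), of "\<lambda>k. mterm 0 (c k)" j] t(2) by (simp add: lc_def mterm_sum mult_single)
    then have "t = \<zero>\<^bsub>HT\<^esub>"
      by (intro crd_inj[OF s0 t(1) H_zero_closed[OF o0]]) (simp add: crd_zero[OF s0] c fun_eq_iff)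
    then have "regular_of (chart {0}) (mterm 0 (c i)) \<odot>\<^bsub>HL i\<^esub> \<beta> i = \<zero>\<^bsub>HL i\<^esub>"
      using fun_cong[OF iso_zero, of i] fun_cong[OF t(2), of i] i by simp
    also have "\<dots> = regular_of (chart {0}) 0 \<odot>\<^bsub>HL i\<^esub> \<beta> i"
      unfolding regular_of_cf using toric_bundle.H_smult_zero[OF summand_bundle[OF i] o0 generator_closed[OF i]] by simp
    finally have eq: "regular_of (chart {0}) (mterm 0 (c i)) \<odot>\<^bsub>HL i\<^esub> \<beta> i = regular_of (chart {0}) 0 \<odot>\<^bsub>HL i\<^esub> \<beta> i" .
    have "inj (\<lambda>f. regular_of (chart {0}) f \<odot>\<^bsub>HL i\<^esub> \<beta> i)"
      using generator[OF i] unfolding torus_generator_def bij_betw_def by simp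
    from injD[OF this eq] have "mterm (0 :: int ^ 'n) (c i) = 0" .
    then show "c i = 0" by (metis lookup_single_eq lookup_zero)
  qed
  fix v :: "nat \<Rightarrow> 'k" assume v: "v \<in> kvec r"
  then have "(\<lambda>j. mterm 0 (v j)) \<in> kvec r" by (simp add: kvec_def)
  then obtain t where t: "t \<in> carrier HT" "crd {0} t = (\<lambda>j. mterm 0 (v j))" using crd_torus_surj by blast
  obtain g where g: "\<forall>i<l. \<phi> (chart {0}) t i = regular_of (chart {0}) (g i) \<odot>\<^bsub>HL i\<^esub> \<beta> i" using ex_summands[OF t(1)] by blast
  have "v j = (\<Sum>i<l. coef (g i) 0 * lvec i j)" for j
  proof -
    have "mterm 0 (v j) = (\<Sum>i<l. mterm 0 (lvec i j) * g i)"
      using crd_summands[OF t(1), of g j] g t(2) by (simp add: mult.commute)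
    from arg_cong[OF this, of "\<lambda>x. coef x 0"] have "v j = (\<Sum>i<l. lvec i j * coef (g i) 0)"
      by (simp add: lookup_sum coef_mterm_mult)
    then show ?thesis by (simp add: mult.commute)
  qed
  then show "\<exists>c. v = lc l c lvec" by (auto simp: lc_def fun_eq_iff)
qed

text \<open>A section of \<open>F\<close> over the chart is a tuple of sections of the summands, and
  each of these restricts on the torus to a multiple \<open>f * mterm (- u i) (c i)\<close> of its
  generator. In coordinates these tuples form the module spanned by the rescaled lifts.\<close>

lemma split_chart:
  assumes s: "\<sigma> \<in> \<Sigma>"
  shows "\<exists>u d. (\<forall>i<l. d i \<noteq> 0) \<and> frame_at \<sigma> l u (\<lambda>i j. d i * lvec i j)"
proof -
  note o = zariski_open_chart[OF s]
  have z: "{0} \<subseteq> \<sigma>" using zero_in_cone[OF s] by simp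
  define Q where "Q i u c \<longleftrightarrow> c \<noteq> 0 \<and> restriction (L i) (chart \<sigma>) (chart {0}) ` carrier (sections (L i) (chart \<sigma>)) =
        {regular_of (chart {0}) (f * mterm (- u) c) \<odot>\<^bsub>HL i\<^esub> \<beta> i | f. f \<in> chart_ring \<sigma>}" for i u c
  have "\<exists>u c. Q i u c" if "i < l" for i
    using generator[OF that] s unfolding torus_generator_def Q_def by simp
  then obtain u c where Q: "\<And>i. i < l \<Longrightarrow> Q i (u i) (c i)" by metis
  note uc = Q[unfolded Q_def]
  have crd: "crd \<sigma> t = (\<lambda>j. \<Sum>i<l. f i * mterm (- u i) (c i * lvec i j))"
    if t: "t \<in> carrier (H (chart \<sigma>))" and f: "\<And>i. i < l \<Longrightarrow> restriction (L i) (chart \<sigma>) (chart {0}) (\<phi> (chart \<sigma>) t i) =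
      regular_of (chart {0}) (f i * mterm (- u i) (c i)) \<odot>\<^bsub>HL i\<^esub> \<beta> i" for t f
  proof
    fix j
    have "crd \<sigma> t j = crd {0} (res (chart \<sigma>) (chart {0}) t) j" using crd_res[OF s s0 z t] by simp
    also have "\<dots> = (\<Sum>i<l. (f i * mterm (- u i) (c i)) * mterm 0 (lvec i j))"
      by (rule crd_summands[OF res_closed[OF o o0 chart_mono[OF s s0 z] t]]) (simp add: iso_res[OF s t] f)
    also have "\<dots> = (\<Sum>i<l. f i * mterm (- u i) (c i * lvec i j))" by (simp add: mult.assoc mult_single)
    finally show "crd \<sigma> t j = (\<Sum>i<l. f i * mterm (- u i) (c i * lvec i j))" .
  qed
  have "PS \<sigma> = pspan \<sigma> l u (\<lambda>i j. c i * lvec i j)"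
  proof (intro Set.set_eqI iffI)
    fix v assume "v \<in> PS \<sigma>"
    then obtain t where t: "t \<in> carrier (H (chart \<sigma>))" "crd \<sigma> t = v" using crd_surj[OF s] by blast
    have "\<exists>f. f \<in> chart_ring \<sigma> \<and> restriction (L i) (chart \<sigma>) (chart {0}) (\<phi> (chart \<sigma>) t i) =
      regular_of (chart {0}) (f * mterm (- u i) (c i)) \<odot>\<^bsub>HL i\<^esub> \<beta> i" if i: "i < l" for i
    proof -
      have "\<phi> (chart \<sigma>) t i \<in> carrier (sections (L i) (chart \<sigma>))" using bij_betwE[OF iso_bij[OF o]] t(1) i by blast
      then have "restriction (L i) (chart \<sigma>) (chart {0}) (\<phi> (chart \<sigma>) t i) \<in>
        {regular_of (chart {0}) (f * mterm (- u i) (c i)) \<odot>\<^bsub>HL i\<^esub> \<beta> i | f. f \<in> chart_ring \<sigma>}"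
        unfolding conjunct2[OF uc[OF i], symmetric] by (rule imageI)
      then show ?thesis by blast
    qed
    then obtain f where f: "\<And>i. i < l \<Longrightarrow> f i \<in> chart_ring \<sigma> \<and> restriction (L i) (chart \<sigma>) (chart {0}) (\<phi> (chart \<sigma>) t i) =
      regular_of (chart {0}) (f i * mterm (- u i) (c i)) \<odot>\<^bsub>HL i\<^esub> \<beta> i" by metis
    show "v \<in> pspan \<sigma> l u (\<lambda>i j. c i * lvec i j)"
      unfolding pspan_def[OF s] mem_Collect_eq using crd[OF t(1), of f] f t(2) by (intro exI[of _ f]) simp
  next
    fix v assume "v \<in> pspan \<sigma> l u (\<lambda>i j. c i * lvec i j)"
    then obtain f where f: "v = (\<lambda>j. \<Sum>i<l. f i * mterm (- u i) (c i * lvec i j))" "\<forall>i<l. f i \<in> chart_ring \<sigma>"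
      unfolding pspan_def[OF s] by blast
    have "\<exists>y. y \<in> carrier (sections (L i) (chart \<sigma>)) \<and> restriction (L i) (chart \<sigma>) (chart {0}) y =
      regular_of (chart {0}) (f i * mterm (- u i) (c i)) \<odot>\<^bsub>HL i\<^esub> \<beta> i" if i: "i < l" for i
    proof -
      have "regular_of (chart {0}) (f i * mterm (- u i) (c i)) \<odot>\<^bsub>HL i\<^esub> \<beta> i \<in>
        restriction (L i) (chart \<sigma>) (chart {0}) ` carrier (sections (L i) (chart \<sigma>))"
        unfolding conjunct2[OF uc[OF i]] using f(2) i by blast
      then show ?thesis by (auto simp: image_iff)
    qed
    then obtain y where y: "\<And>i. i < l \<Longrightarrow> y i \<in> carrier (sections (L i) (chart \<sigma>)) \<and> restriction (L i) (chart \<sigma>) (chart {0}) (y i) =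
      regular_of (chart {0}) (f i * mterm (- u i) (c i)) \<odot>\<^bsub>HL i\<^esub> \<beta> i" by metis
    obtain t where t: "t \<in> carrier (H (chart \<sigma>))" "\<phi> (chart \<sigma>) t = (\<lambda>i\<in>{..<l}. y i)"
      using iso_surj[OF o, of y] y by blast
    have "crd \<sigma> t = v" unfolding f(1) by (rule crd[OF t(1)]) (simp add: t(2) y)
    then show "v \<in> PS \<sigma>" using crd_in_PS[OF s t(1)] by simp
  qed
  then have "frame_at \<sigma> l u (\<lambda>i j. c i * lvec i j)"
    unfolding frame_at_def using kbasis_rescale[OF _ lvec_kbasis, of c] uc by blast
  then show ?thesis using uc by blast
qed

lemma split_common_frame: "common_frame l lvec"
  unfolding common_frame_def using lvec_kbasis split_chart by blast

end

theorem splits_iff_common_frame: "splits_equivariantly F \<longleftrightarrow> (\<exists>n e. common_frame n e)"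
proof
  assume "splits_equivariantly F"
  then obtain l and L :: "nat \<Rightarrow> ('n, 'k, 'e) linearized_sheaf" and \<phi>
    where L: "\<And>i. i < l \<Longrightarrow> toric_line_bundle (L i)" and iso: "equivariant_isomorphism F (direct_sum l L) \<phi>"
    unfolding splits_equivariantly_def by blast
  have "\<exists>b. torus_generator (L i) b" if "i < l" for i by (rule ex_torus_generator[OF L[OF that]])
  then obtain \<beta> where "\<And>i. i < l \<Longrightarrow> torus_generator (L i) (\<beta> i)" by metis
  from split_common_frame[OF L iso this] show "\<exists>n e. common_frame n e" by blast
qed (use common_frame_splits in blast)

end

theorem theorem5p2:
  fixes val :: "'k::field \<Rightarrow> ereal"
    and \<pi> :: 'k
    and \<Sigma> :: "((real ^ 'n::finite) \<times> real) set set"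
    and \<E> :: "('n, 'k, 'e) linearized_sheaf"
    and r :: nat
  assumes "discrete_valuation val"
    and "val \<pi> = 1"
    and "fan \<Sigma>"
    and "toric_data.toric_vector_bundle val \<pi> \<Sigma> r \<E>"
  shows "(toric_data.splits_equivariantly val \<pi> \<Sigma> \<E> \<longleftrightarrow>
            in_one_extended_apartment val (toric_data.fiber val \<pi> \<Sigma> \<E>)
              (toric_data.Phi val \<pi> \<Sigma> \<E> ` support \<Sigma>)) \<and>
         (complete_fan \<Sigma> \<longrightarrow>
            (toric_data.splits_equivariantly val \<pi> \<Sigma> \<E> \<longleftrightarrow>
               in_one_affine_extended_apartment val (toric_data.fiber val \<pi> \<Sigma> \<E>)
                 (toric_data.Phi_affine val \<pi> \<Sigma> \<E> ` support (height_one_complex \<Sigma>))))"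
proof -
  interpret toric_bundle val \<pi> \<Sigma> r \<E> by unfold_locales (rule assms)+
  obtain t where t: "frame (chart {0}) t"
    "\<And>i u. i < r \<Longrightarrow> coaction \<E> {0} (t i) u = (if u = 0 then t i else \<zero>\<^bsub>H (chart {0})\<^esub>)"
    by (rule ex_torus_frame) blast
  interpret torus_framed_bundle val \<pi> \<Sigma> r \<E> t by unfold_locales (use t in auto)
  \<comment> \<open>All three conditions have been shown equivalent to the existence of a common
    frame, the last one for complete fans.\<close>
  show ?thesis using splits_iff_common_frame extended_apartment_iff affine_apartment_iff by blast
qed

end
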